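(* Let $n\ge 3$. The map $\beta\mapsto g(\beta)$, sending a pure braid in general position, viewed as a motion of $n$ points inside the unit circle, to the product $g(\beta)$ of the generators $a''_{i_l j_l k_l}$ corresponding to the successive moments when three points lie on a circle tangent to the unit circle, is a (well-defined) homomorphism from the pure braid group $PB_n$ to ${}''G_n^3$.
   Context: Definition of ${}''G_n^3$: the group with $n(n-1)(n-2)$ generators $a''_{ijk}$, indexed by all ordered triples of pairwise distinct $i,j,k\in\{1,\dots,n\}$, and relations: (4) $(a''_{ijk})^2=1$ for all pairwise distinct $i,j,k$; (5) $a''_{ijk}a''_{pqr}=a''_{pqr}a''_{ijk}$ if none of the ordered pairs $(i,j),(i,k),(j,k)$ coincides with any of the ordered pairs $(p,q),(p,r),(q,r)$; (6) $(a''_{ijk}a''_{ijl}a''_{ikl}a''_{jkl})^2=1$ for all pairwise distinct $i,j,k,l$. Pure braids inside the disc: let $D=\{z\in\mathbb{C}:|z|<1\}$; the circle $|z|=1$ is called the absolute. Fix a base configuration of $n$ distinct points in $D$, no three of which lie on a circle tangent to the absolute. A pure braid is represented by a motion $\beta(t)=(z_1(t),\dots,z_n(t))$, $t\in[0,1]$, given by smooth functions $z_j(t)\in D$, pairwise distinct for each $t$, with $\beta(0)=\beta(1)$ (pointwise, $z_j(0)=z_j(1)$) equal to the base configuration; $PB_n$ is the group of isotopy classes (homotopy classes with fixed endpoints, through such motions) with product given by concatenation in time (first factor first). Critical moments: a value $t$ is critical if some three of the points $z_i(t),z_j(t),z_k(t)$ (distinct indices) lie on a circle tangent to the absolute. General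 position means: finitely many critical moments; at each of them exactly one triple of points lies on a circle tangent to the absolute; and the number of critical moments does not change under sufficiently small ($C^1$-small) perturbations. Points on a circle tangent to the absolute are enumerated starting from the tangency point and going counterclockwise along the circle. Definition of $g(\beta)$: for $\beta$ in general position with critical moments $t_1<\dots<t_m$, let $(i_l,j_l,k_l)$ be the indices of the three points on the tangent circle at $t_l$, enumerated in the counterclockwise direction starting from the tangency point. Set $g(\beta)=a''_{i_1j_1k_1}\cdots a''_{i_mj_mk_m}\in{}''G_n^3$. The value of $g$ on an element of $PB_n$ is its value on any representative in general position. *)

theory Defs
  imports "HOL-Analysis.Analysis" "HOL-Algebra.Group"
begin

section \<open>Groups given by generators and relations\<close>

text \<open>
  A word is a list of signed letters; \<open>(x, True)\<close> stands for the generator \<open>x\<close> and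
  \<open>(x, False)\<close> for its formal inverse.
\<close>

type_synonym 'g word = "('g \<times> bool) list"

abbreviation words :: "'g set \<Rightarrow> 'g word set" where
  "words S \<equiv> lists (S \<times> UNIV)"

inductive word_eq :: "'g set \<Rightarrow> ('g word \<times> 'g word) set \<Rightarrow> 'g word \<Rightarrow> 'g word \<Rightarrow> bool"
  for S :: "'g set" and R :: "('g word \<times> 'g word) set"
where
  refl: "w \<in> words S \<Longrightarrow> word_eq S R w w"
| sym: "word_eq S R v w \<Longrightarrow> word_eq S R w v"
| trans: "word_eq S R u v \<Longrightarrow> word_eq S R v w \<Longrightarrow> word_eq S R u w"
| cancel: "u \<in> words S \<Longrightarrow> v \<in> words S \<Longrightarrow> x \<in> S \<Longrightarrow>
    word_eq S R (u @ [(x, b), (x, \<not> b)] @ v) (u @ v)"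
| relation: "u \<in> words S \<Longrightarrow> v \<in> words S \<Longrightarrow> (l, r) \<in> R \<Longrightarrow>
    l \<in> words S \<Longrightarrow> r \<in> words S \<Longrightarrow> word_eq S R (u @ l @ v) (u @ r @ v)"

definition word_class :: "'g set \<Rightarrow> ('g word \<times> 'g word) set \<Rightarrow> 'g word \<Rightarrow> 'g word set" where
  "word_class S R w = {v. word_eq S R w v}"

definition presented_group :: "'g set \<Rightarrow> ('g word \<times> 'g word) set \<Rightarrow> 'g word set monoid" where
  "presented_group S R =
    \<lparr>carrier = word_class S R ` words S,
     mult = (\<lambda>A B. \<Union>a\<in>A. \<Union>b\<in>B. word_class S R (a @ b)),
     one = word_class S R []\<rparr>"


section \<open>The group on ordered triples\<close>

text \<open>
  Throughout, a finite type \<open>'n\<close> with \<open>n\<close> elements plays the role of the index set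
  \<open>{1,\<dots>,n}\<close>.
\<close>

definition triples :: "('n \<times> 'n \<times> 'n) set" where
  "triples = {(i, j, k). distinct [i, j, k]}"

definition pairs_of :: "'n \<times> 'n \<times> 'n \<Rightarrow> ('n \<times> 'n) set" where
  "pairs_of = (\<lambda>(i, j, k). {(i, j), (i, k), (j, k)})"

abbreviation letter :: "'g \<Rightarrow> 'g \<times> bool" where
  "letter x \<equiv> (x, True)"

definition G3_relations :: "(('n \<times> 'n \<times> 'n) word \<times> ('n \<times> 'n \<times> 'n) word) set" where
  "G3_relations =
     {([letter a, letter a], []) | a. a \<in> triples} \<union>
     {([letter a, letter b], [letter b, letter a]) | a b.
        a \<in> triples \<and> b \<in> triples \<and> pairs_of a \<inter> pairs_of b = {}} \<union>
     {(w @ w, []) | w i j k l. distinct [i, j, k, l] \<and>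
        w = [letter (i, j, k), letter (i, j, l), letter (i, k, l), letter (j, k, l)]}"

definition G3 :: "('n \<times> 'n \<times> 'n) word set monoid" where
  "G3 = presented_group triples G3_relations"

definition G3_gen :: "'n \<times> 'n \<times> 'n \<Rightarrow> ('n \<times> 'n \<times> 'n) word set" where
  "G3_gen a = word_class triples G3_relations [letter a]"


section \<open>The pure braid group of the disc\<close>

definition config_space :: "(complex ^ 'n) set" where
  "config_space = {z. (\<forall>i. z $ i \<in> ball 0 1) \<and> inj (($) z)}"

text \<open>Infinite differentiability on \<open>[0,1]\<close>, with one-sided derivatives at the end points.\<close>

definition smooth_path :: "(real \<Rightarrow> 'a::real_normed_vector) \<Rightarrow> bool" where
  "smooth_path f \<longleftrightarrow> (\<exists>D :: nat \<Rightarrow> real \<Rightarrow> 'a. D 0 = f \<and>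
     (\<forall>k. \<forall>t\<in>{0..1}. (D k has_vector_derivative D (Suc k) t) (at t within {0..1})))"

definition motion :: "complex ^ 'n \<Rightarrow> (real \<Rightarrow> complex ^ 'n) \<Rightarrow> bool" where
  "motion b \<beta> \<longleftrightarrow> smooth_path \<beta> \<and> \<beta> ` {0..1} \<subseteq> config_space \<and> \<beta> 0 = b \<and> \<beta> 1 = b"

definition isotopic :: "complex ^ 'n \<Rightarrow> (real \<Rightarrow> complex ^ 'n) \<Rightarrow> (real \<Rightarrow> complex ^ 'n) \<Rightarrow> bool" where
  "isotopic b \<beta> \<gamma> \<longleftrightarrow> homotopic_with_canon (motion b) {0..1} config_space \<beta> \<gamma>"

text \<open>
  The concatenation of two smooth motions need not be smooth at the junction.  The product of two
  classes is therefore represented by the concatenations of those of their members which do fit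
  together smoothly (for instance members which are stationary near the end points).
\<close>

definition PB :: "complex ^ 'n \<Rightarrow> (real \<Rightarrow> complex ^ 'n) set monoid" where
  "PB b =
    \<lparr>carrier = {\<beta>. motion b \<beta>} // {(\<beta>, \<gamma>). isotopic b \<beta> \<gamma>},
     mult = (\<lambda>A B. {\<gamma>. \<exists>\<alpha>\<in>A. \<exists>\<beta>\<in>B. motion b (\<alpha> +++ \<beta>) \<and> isotopic b (\<alpha> +++ \<beta>) \<gamma>}),
     one = {\<gamma>. isotopic b (\<lambda>_. b) \<gamma>}\<rparr>"


section \<open>Critical moments\<close>

text \<open>
  Two distinct circles are tangent iff they have exactly one common point.  The absolute
  \<open>sphere 0 1\<close> is not tangent to itself in this sense, but it contains no point of the disc anyway.
\<close>

definition tangent_at :: "complex \<Rightarrow> real \<Rightarrow> complex \<Rightarrow> bool" where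
  "tangent_at c r p \<longleftrightarrow> r > 0 \<and> sphere c r \<inter> sphere 0 1 = {p}"

definition on_tangent_circle :: "complex set \<Rightarrow> bool" where
  "on_tangent_circle X \<longleftrightarrow> (\<exists>c r p. tangent_at c r p \<and> X \<subseteq> sphere c r)"

text \<open>
  The points \<open>x\<close>, \<open>y\<close>, \<open>z\<close> lie on a tangent circle and are met in this order when one travels
  counterclockwise along it, starting from the tangency point \<open>p\<close>.
\<close>

definition ccw_on_tangent_circle :: "complex \<Rightarrow> complex \<Rightarrow> complex \<Rightarrow> bool" where
  "ccw_on_tangent_circle x y z \<longleftrightarrow> (\<exists>c r p \<theta> \<phi> \<psi>. tangent_at c r p \<and>
     0 < \<theta> \<and> \<theta> < \<phi> \<and> \<phi> < \<psi> \<and> \<psi> < 2 * pi \<and>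
     x = c + (p - c) * cis \<theta> \<and> y = c + (p - c) * cis \<phi> \<and> z = c + (p - c) * cis \<psi>)"

definition critical_triples :: "complex ^ 'n \<Rightarrow> 'n set set" where
  "critical_triples z = {T. card T = 3 \<and> on_tangent_circle (($) z ` T)}"

definition critical_moments :: "(real \<Rightarrow> complex ^ 'n) \<Rightarrow> real set" where
  "critical_moments \<beta> = {t \<in> {0..1}. critical_triples (\<beta> t) \<noteq> {}}"

definition C1_close :: "real \<Rightarrow> (real \<Rightarrow> 'a::real_normed_vector) \<Rightarrow> (real \<Rightarrow> 'a) \<Rightarrow> bool" where
  "C1_close \<epsilon> \<beta> \<gamma> \<longleftrightarrow> (\<forall>t\<in>{0..1}. norm (\<gamma> t - \<beta> t) < \<epsilon> \<and>
     norm (vector_derivative \<gamma> (at t within {0..1}) - vector_derivative \<beta> (at t within {0..1})) < \<epsilon>)"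

definition general_position :: "complex ^ 'n \<Rightarrow> (real \<Rightarrow> complex ^ 'n) \<Rightarrow> bool" where
  "general_position b \<beta> \<longleftrightarrow> motion b \<beta> \<and>
     finite (critical_moments \<beta>) \<and>
     (\<forall>t\<in>critical_moments \<beta>. \<exists>!T. T \<in> critical_triples (\<beta> t)) \<and>
     (\<exists>\<epsilon>>0. \<forall>\<gamma>. motion b \<gamma> \<and> C1_close \<epsilon> \<beta> \<gamma> \<longrightarrow>
        finite (critical_moments \<gamma>) \<and> card (critical_moments \<gamma>) = card (critical_moments \<beta>))"


section \<open>The map \<open>g\<close>\<close>

definition ordered_triple :: "complex ^ 'n \<Rightarrow> 'n \<times> 'n \<times> 'n" where
  "ordered_triple z =
     (THE a. a \<in> triples \<and> (case a of (i, j, k) \<Rightarrow> ccw_on_tangent_circle (z $ i) (z $ j) (z $ k)))"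

definition g_motion :: "(real \<Rightarrow> complex ^ 'n) \<Rightarrow> ('n \<times> 'n \<times> 'n) word set" where
  "g_motion \<beta> = foldr (\<otimes>\<^bsub>G3\<^esub>)
     (map (\<lambda>t. G3_gen (ordered_triple (\<beta> t))) (sorted_list_of_set (critical_moments \<beta>))) \<one>\<^bsub>G3\<^esub>"

text \<open>The value on an isotopy class is the common value on its members in general position.\<close>

definition g_class :: "complex ^ 'n \<Rightarrow> (real \<Rightarrow> complex ^ 'n) set \<Rightarrow> ('n \<times> 'n \<times> 'n) word set" where
  "g_class b A = (THE x. \<exists>\<beta>\<in>A. general_position b \<beta> \<and> x = g_motion \<beta>)"

end

theory Submission
  imports Defs
begin

text \<open>
  A circle tangent to the absolute at \<open>p\<close> is a level set of \<open>x \<mapsto> |p - x|\<^sup>2 / (1 - |x|\<^sup>2)\<close>, and going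
  counterclockwise along it the derivative of this function with respect to the argument of \<open>p\<close>
  increases.  A triple of points is therefore critical when the graphs of three functions on the circle
  have a common point, the letter of the triple lists them by slope, and a braid is a motion of such an
  arrangement of graphs.

  Being critical is also the vanishing of a rational function \<open>walls\<close> of the coordinates, and a motion in
  general position changes the sign of \<open>walls\<close> at its critical moments.  Near every configuration,
  however degenerate, there is a function \<open>\<Phi>\<close> to the group on the regular configurations which is
  multiplied on the right by the letter of a triple when a simple wall of that triple is crossed:  it is
  a product of the letters of those triples whose three crossings have been inverted, and the relation of
  length eight says that passing a triple point is compatible with the triples that contain two of the
  three graphs.  So the product of the letters along a path inside a small box depends only on its ends.
  Cutting a homotopy into small squares shows that \<open>g\<close> is a homotopy invariant; that homotopies can be
  replaced by isotopies through smooth motions follows by smoothing polygons.  Polygons whose edges move one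
  point at a time cross the walls transversely after a small displacement of the vertices; this gives
  representatives in general position, and concatenating them shows multiplicativity.
\<close>

section \<open>Groups given by presentations\<close>

text \<open>Invariance could be proved by putting the homotopy itself in general position and
  checking its degenerations of codimension two. Here homotopies are only continuous, and a
  configuration may have any number of critical triples at once. A primitive of \<open>g\<close>
  around an arbitrary configuration replaces that case distinction, and primitives on different
  domains agree up to a factor on a common box, because its regular points are joined by chains of
  tame segments. The geometry rests on two facts about the hyperboloid model: two points lie on
  exactly two horocycles, one for each order of the points, and three points lie on at most one,
  because a line with spacelike direction meets the hyperboloid at most twice. Hence a critical
  triple has a single letter, and the two factors of its Gram determinant never vanish together.
  Another obstacle is that general position says about the crossing itself only that the number of
  critical moments is stable; that \<open>walls\<close> changes sign has to be extracted from this
  by pushing the motion through the wall.\<close>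

lemma word_eq_words: "word_eq S R u v \<Longrightarrow> u \<in> words S \<and> v \<in> words S"
  by (induction rule: word_eq.induct) (auto simp: lists_eq_set)

lemma word_eq_context:
  assumes "word_eq S R u v" "a \<in> words S" "c \<in> words S"
  shows "word_eq S R (a @ u @ c) (a @ v @ c)"
  using assms
proof (induction rule: word_eq.induct)
  case (refl w)
  then show ?case by (intro word_eq.refl) auto
next
  case (sym v w)
  then show ?case by (blast intro: word_eq.sym)
next
  case (trans u v w)
  then show ?case by (blast intro: word_eq.trans)
next
  case (cancel u v x b)
  have "word_eq S R ((a @ u) @ [(x, b), (x, \<not> b)] @ (v @ c)) ((a @ u) @ (v @ c))"
    by (rule word_eq.cancel) (use cancel in auto)
  then show ?case by simp
next
  case (relation u v l r)
  have "word_eq S R ((a @ u) @ l @ (v @ c)) ((a @ u) @ r @ (v @ c))"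
    by (rule word_eq.relation) (use relation in auto)
  then show ?case by simp
qed

lemma word_eq_append:
  assumes "word_eq S R u u'" "word_eq S R v v'"
  shows "word_eq S R (u @ v) (u' @ v')"
proof -
  note w = word_eq_words[OF assms(1)] word_eq_words[OF assms(2)]
  have "word_eq S R ([] @ u @ v) ([] @ u' @ v)" "word_eq S R (u' @ v @ []) (u' @ v' @ [])"
    by (rule word_eq_context; use assms w in auto)+
  then show ?thesis by (auto intro: word_eq.trans)
qed

lemma word_class_eq_iff:
  assumes "u \<in> words S"
  shows "word_class S R u = word_class S R v \<longleftrightarrow> word_eq S R u v"
proof
  assume "word_class S R u = word_class S R v"
  moreover have "u \<in> word_class S R u" using assms by (simp add: word_class_def word_eq.refl)
  ultimately show "word_eq S R u v" by (auto simp: word_class_def intro: word_eq.sym)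
next
  assume "word_eq S R u v"
  then show "word_class S R u = word_class S R v"
    unfolding word_class_def by (blast intro: word_eq.sym word_eq.trans)
qed

text \<open>The product is a union over all representatives; since concatenation respects
  \<open>word_eq\<close>, the members of this union are one and the same class.\<close>

lemma mult_word_class:
  assumes "u \<in> words S" "v \<in> words S"
  shows "word_class S R u \<otimes>\<^bsub>presented_group S R\<^esub> word_class S R v = word_class S R (u @ v)"
proof -
  have "word_class S R (a @ b) = word_class S R (u @ v)"
    if "a \<in> word_class S R u" "b \<in> word_class S R v" for a b
  proof -
    have "word_eq S R (u @ v) (a @ b)"
      using that by (intro word_eq_append) (auto simp: word_class_def)
    then show ?thesis using word_class_eq_iff[of "u @ v" S R "a @ b"] assms by simp
  qed
  moreover have "u \<in> word_class S R u" "v \<in> word_class S R v"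
    using assms by (auto simp: word_class_def word_eq.refl)
  ultimately have "(\<Union>a\<in>word_class S R u. \<Union>b\<in>word_class S R v. word_class S R (a @ b)) = word_class S R (u @ v)"
    by blast
  then show ?thesis by (simp add: presented_group_def)
qed

definition inverse_word :: "'g word \<Rightarrow> 'g word" where
  "inverse_word w = rev (map (\<lambda>(x, b). (x, \<not> b)) w)"

lemma inverse_word_in: "w \<in> words S \<Longrightarrow> inverse_word w \<in> words S"
  unfolding inverse_word_def in_lists_conv_set set_rev set_map by fast

lemma inverse_word_cancel: "w \<in> words S \<Longrightarrow> word_eq S R (inverse_word w @ w) []"
proof (induction w)
  case Nil
  show ?case unfolding inverse_word_def list.map rev.simps append_Nil by (rule word_eq.refl) (rule lists.Nil)
next
  case (Cons a w)
  obtain x b where a: "a = (x, b)" by force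
  have w: "w \<in> words S" "x \<in> S" using Cons.prems a by auto
  have "word_eq S R (inverse_word w @ [(x, \<not> b), (x, \<not> \<not> b)] @ w) (inverse_word w @ w)"
    using w inverse_word_in[OF w(1)] by (intro word_eq.cancel)
  with Cons.IH[OF w(1)] have "word_eq S R (inverse_word w @ [(x, \<not> b), (x, \<not> \<not> b)] @ w) []"
    by (blast intro: word_eq.trans)
  then show ?case by (simp add: a inverse_word_def)
qed

lemma group_presented_group: "group (presented_group S R)"
proof (rule groupI)
  let ?G = "presented_group S R"
  have car: "A \<in> carrier ?G \<longleftrightarrow> (\<exists>u\<in>words S. A = word_class S R u)" for A
    by (auto simp: presented_group_def)
  have one: "\<one>\<^bsub>?G\<^esub> = word_class S R []" by (simp add: presented_group_def)
  show "\<one>\<^bsub>?G\<^esub> \<in> carrier ?G" by (auto simp: presented_group_def)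
  fix A assume "A \<in> carrier ?G"
  then obtain u where u: "u \<in> words S" "A = word_class S R u" by (auto simp: car)
  show "\<one>\<^bsub>?G\<^esub> \<otimes>\<^bsub>?G\<^esub> A = A" using mult_word_class[of "[]" S u R] u by (simp add: one)
  show "\<exists>B\<in>carrier ?G. B \<otimes>\<^bsub>?G\<^esub> A = \<one>\<^bsub>?G\<^esub>"
  proof
    show "word_class S R (inverse_word u) \<in> carrier ?G" using inverse_word_in[OF u(1)] car by blast
    have "word_class S R (inverse_word u @ u) = word_class S R []"
      using u inverse_word_in[OF u(1)] inverse_word_cancel[OF u(1), of R]
      by (subst word_class_eq_iff) auto
    then show "word_class S R (inverse_word u) \<otimes>\<^bsub>?G\<^esub> A = \<one>\<^bsub>?G\<^esub>"
      using u inverse_word_in[OF u(1)] by (simp add: mult_word_class one)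
  qed
  fix B assume "B \<in> carrier ?G"
  then obtain v where v: "v \<in> words S" "B = word_class S R v" by (auto simp: car)
  have "u @ v \<in> words S" using u v by (simp only: append_in_lists_conv)
  then show "A \<otimes>\<^bsub>?G\<^esub> B \<in> carrier ?G"
    unfolding car u(2) v(2) mult_word_class[OF u(1) v(1)] by blast
  fix C assume "C \<in> carrier ?G"
  then obtain w where w: "w \<in> words S" "C = word_class S R w" by (auto simp: car)
  show "A \<otimes>\<^bsub>?G\<^esub> B \<otimes>\<^bsub>?G\<^esub> C = A \<otimes>\<^bsub>?G\<^esub> (B \<otimes>\<^bsub>?G\<^esub> C)"
    using u v w by (simp add: mult_word_class)
qed

interpretation G3: group G3
  unfolding G3_def by (rule group_presented_group)

lemma G3_relation:
  assumes "(l, r) \<in> G3_relations" "l \<in> words triples" "r \<in> words triples"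
  shows "word_class triples G3_relations l = word_class triples G3_relations r"
  using word_eq.relation[of "[]" triples "[]" l r G3_relations] assms
  by (subst word_class_eq_iff) auto

lemma G3_gen_closed [simp]: "a \<in> triples \<Longrightarrow> G3_gen a \<in> carrier G3"
  by (auto simp: G3_gen_def G3_def presented_group_def)

definition lprod :: "('n \<times> 'n \<times> 'n) list \<Rightarrow> ('n \<times> 'n \<times> 'n) word set" where
  "lprod as = foldr (\<otimes>\<^bsub>G3\<^esub>) (map G3_gen as) \<one>\<^bsub>G3\<^esub>"

lemma lprod_Nil [simp]: "lprod [] = \<one>\<^bsub>G3\<^esub>"
  and lprod_Cons [simp]: "lprod (a # as) = G3_gen a \<otimes>\<^bsub>G3\<^esub> lprod as"
  by (simp_all add: lprod_def)

lemma lprod_closed [simp]: "set as \<subseteq> triples \<Longrightarrow> lprod as \<in> carrier G3"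
  by (induction as) auto

lemma lprod_append:
  "set as \<subseteq> triples \<Longrightarrow> set bs \<subseteq> triples \<Longrightarrow> lprod (as @ bs) = lprod as \<otimes>\<^bsub>G3\<^esub> lprod bs"
  by (induction as) (auto simp: G3.m_assoc)

lemma letters_in_words: "set as \<subseteq> triples \<Longrightarrow> map letter as \<in> words triples"
  by (induction as) auto

lemma lprod_conv: "set as \<subseteq> triples \<Longrightarrow> lprod as = word_class triples G3_relations (map letter as)"
proof (induction as)
  case Nil
  then show ?case by (simp add: G3_def presented_group_def)
next
  case (Cons a as)
  have 1: "[letter a] \<in> words triples" "map letter as \<in> words triples"
    using letters_in_words[of "[a]"] letters_in_words[of as] Cons.prems by auto
  have "lprod as = word_class triples G3_relations (map letter as)"
    using Cons by simp
  then have "lprod (a # as) = word_class triples G3_relations ([letter a] @ map letter as)"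
    unfolding lprod_Cons G3_gen_def G3_def using mult_word_class[OF 1, of G3_relations] by metis
  then show ?case by simp
qed

lemma lprod_relation:
  assumes "(map letter as, map letter bs) \<in> G3_relations" "set as \<subseteq> triples" "set bs \<subseteq> triples"
  shows "lprod as = lprod bs"
  unfolding lprod_conv[OF assms(2)] lprod_conv[OF assms(3)]
  by (rule G3_relation[OF assms(1)]) (use assms letters_in_words in blast)+

lemma G3_gen_square:
  assumes "a \<in> triples"
  shows "G3_gen a \<otimes>\<^bsub>G3\<^esub> G3_gen a = \<one>\<^bsub>G3\<^esub>"
proof -
  have "(map letter [a, a], map letter []) \<in> G3_relations"
    unfolding G3_relations_def using assms by fastforce
  from lprod_relation[OF this] show ?thesis using assms by simp
qed

lemma G3_gen_commute:
  assumes "a \<in> triples" "b \<in> triples" "pairs_of a \<inter> pairs_of b = {}"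
  shows "G3_gen a \<otimes>\<^bsub>G3\<^esub> G3_gen b = G3_gen b \<otimes>\<^bsub>G3\<^esub> G3_gen a"
proof -
  have "(map letter [a, b], map letter [b, a]) \<in> G3_relations"
    unfolding G3_relations_def list.map using assms by blast
  from lprod_relation[OF this] show ?thesis using assms by simp
qed

text \<open>The four letters are involutions, so the inverse of their product \<open>abcd\<close> is
  \<open>dcba\<close>; the relation of length eight makes \<open>abcd\<close> an involution as well,
  hence \<open>abcd = dcba\<close>. Read as an exchange, \<open>a\<close> passes to the other side
  of \<open>bcd\<close> and reverses it.\<close>

lemma G3_exchange:
  assumes "distinct [i, j, k, l]"
  shows "G3_gen (i, j, k) \<otimes>\<^bsub>G3\<^esub> lprod [(i, j, l), (i, k, l), (j, k, l)] =
    lprod [(j, k, l), (i, k, l), (i, j, l)] \<otimes>\<^bsub>G3\<^esub> G3_gen (i, j, k)"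
proof -
  let ?as = "[(i, j, k), (i, j, l), (i, k, l), (j, k, l)]"
  define a b c d where abcd: "a = G3_gen (i, j, k)" "b = G3_gen (i, j, l)"
    "c = G3_gen (i, k, l)" "d = G3_gen (j, k, l)"
  have tr: "set ?as \<subseteq> triples" using assms by (auto simp: triples_def)
  then have cl [simp]: "a \<in> carrier G3" "b \<in> carrier G3" "c \<in> carrier G3" "d \<in> carrier G3"
    unfolding abcd by auto
  have sq: "b \<otimes>\<^bsub>G3\<^esub> b = \<one>\<^bsub>G3\<^esub>" "c \<otimes>\<^bsub>G3\<^esub> c = \<one>\<^bsub>G3\<^esub>" "d \<otimes>\<^bsub>G3\<^esub> d = \<one>\<^bsub>G3\<^esub>" "a \<otimes>\<^bsub>G3\<^esub> a = \<one>\<^bsub>G3\<^esub>"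
    unfolding abcd using tr by (simp_all add: G3_gen_square)
  then have sq': "b \<otimes>\<^bsub>G3\<^esub> (b \<otimes>\<^bsub>G3\<^esub> x) = x" "c \<otimes>\<^bsub>G3\<^esub> (c \<otimes>\<^bsub>G3\<^esub> x) = x" "d \<otimes>\<^bsub>G3\<^esub> (d \<otimes>\<^bsub>G3\<^esub> x) = x"
    "a \<otimes>\<^bsub>G3\<^esub> (a \<otimes>\<^bsub>G3\<^esub> x) = x" if "x \<in> carrier G3" for x
    using that by (simp_all flip: G3.m_assoc)
  have "(map letter (?as @ ?as), map letter []) \<in> G3_relations"
    unfolding G3_relations_def using assms by (auto intro!: exI[of _ "map letter ?as"])
  from lprod_relation[OF this] tr have "lprod (?as @ ?as) = \<one>\<^bsub>G3\<^esub>" by auto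
  then have one: "(a \<otimes>\<^bsub>G3\<^esub> (b \<otimes>\<^bsub>G3\<^esub> (c \<otimes>\<^bsub>G3\<^esub> d))) \<otimes>\<^bsub>G3\<^esub> (a \<otimes>\<^bsub>G3\<^esub> (b \<otimes>\<^bsub>G3\<^esub> (c \<otimes>\<^bsub>G3\<^esub> d))) = \<one>\<^bsub>G3\<^esub>"
    by (simp add: abcd[symmetric] G3.m_assoc)
  have "(d \<otimes>\<^bsub>G3\<^esub> (c \<otimes>\<^bsub>G3\<^esub> (b \<otimes>\<^bsub>G3\<^esub> a))) \<otimes>\<^bsub>G3\<^esub> (a \<otimes>\<^bsub>G3\<^esub> (b \<otimes>\<^bsub>G3\<^esub> (c \<otimes>\<^bsub>G3\<^esub> d))) = \<one>\<^bsub>G3\<^esub>"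
    by (simp add: G3.m_assoc sq sq')
  then have "a \<otimes>\<^bsub>G3\<^esub> (b \<otimes>\<^bsub>G3\<^esub> (c \<otimes>\<^bsub>G3\<^esub> d)) = d \<otimes>\<^bsub>G3\<^esub> (c \<otimes>\<^bsub>G3\<^esub> (b \<otimes>\<^bsub>G3\<^esub> a))"
    using one by (metis cl G3.m_closed G3.inv_equality)
  then show ?thesis by (simp add: abcd[symmetric] G3.m_assoc)
qed

section \<open>Products that depend on the order of non-commuting letters only\<close>

abbreviation independent :: "'n \<times> 'n \<times> 'n \<Rightarrow> 'n \<times> 'n \<times> 'n \<Rightarrow> bool" where
  "independent a b \<equiv> pairs_of a \<inter> pairs_of b = {}"

lemma lprod_move_front:
  assumes "set as \<subseteq> triples" "x \<in> triples" "\<And>a. a \<in> set as \<Longrightarrow> independent a x"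
  shows "lprod as \<otimes>\<^bsub>G3\<^esub> G3_gen x = G3_gen x \<otimes>\<^bsub>G3\<^esub> lprod as"
  using assms
proof (induction as)
  case (Cons a as)
  have c: "G3_gen a \<in> carrier G3" "G3_gen x \<in> carrier G3" "lprod as \<in> carrier G3"
    using Cons.prems by auto
  have "lprod (a # as) \<otimes>\<^bsub>G3\<^esub> G3_gen x = G3_gen a \<otimes>\<^bsub>G3\<^esub> (G3_gen x \<otimes>\<^bsub>G3\<^esub> lprod as)"
    using Cons c by (simp add: G3.m_assoc)
  also have "\<dots> = G3_gen x \<otimes>\<^bsub>G3\<^esub> (G3_gen a \<otimes>\<^bsub>G3\<^esub> lprod as)"
    using c G3_gen_commute[of a x] Cons.prems by (simp flip: G3.m_assoc)
  finally show ?case by simp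
qed auto

text \<open>Representatives of a trace: only the relative order of dependent letters is prescribed,
  by \<open>r\<close>, while independent letters may stand in either order.\<close>

definition listing :: "('n \<times> 'n \<times> 'n \<Rightarrow> 'n \<times> 'n \<times> 'n \<Rightarrow> bool) \<Rightarrow> ('n \<times> 'n \<times> 'n) set
    \<Rightarrow> ('n \<times> 'n \<times> 'n) list \<Rightarrow> bool" where
  "listing r A as \<longleftrightarrow> set as = A \<and> distinct as \<and> sorted_wrt (\<lambda>a b. independent a b \<or> r a b) as"

text \<open>The head \<open>a\<close> of the first list occurs in the second. Whatever precedes it
  there is independent of it, since a dependent letter would be both before and after
  \<open>a\<close> in the asymmetric order \<open>r\<close>. So \<open>a\<close> can be moved to the
  front and the tails compared.\<close>

lemma lprod_listing_unique:
  assumes "listing r A as" "listing r A bs" "A \<subseteq> triples"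
    and "asymp r"
  shows "lprod as = lprod bs"
  using assms(1-3)
proof (induction as arbitrary: A bs)
  case Nil
  then show ?case by (auto simp: listing_def)
next
  case (Cons a as)
  from Cons.prems(1,2) have "a \<in> set bs" by (auto simp: listing_def)
  then obtain us vs where bs: "bs = us @ a # vs" by (auto dest: split_list)
  have A: "A = insert a (set as)" "a \<notin> set as" and s1: "\<And>b. b \<in> set as \<Longrightarrow> independent a b \<or> r a b"
    using Cons.prems(1) by (auto simp: listing_def)
  have A': "A = insert a (set (us @ vs))" "a \<notin> set (us @ vs)"
    and s2: "\<And>b. b \<in> set us \<Longrightarrow> independent b a \<or> r b a"
    using Cons.prems(2) by (auto simp: listing_def bs sorted_wrt_append)
  have same: "set (us @ vs) = set as"
  proof -
    have "set (us @ vs) = A - {a}" "set as = A - {a}" using A A' by auto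
    then show ?thesis by simp
  qed
  have ind: "independent b a" if "b \<in> set us" for b
  proof -
    have "b \<in> set as" using that same by auto
    then have "independent a b \<or> r a b" "b \<in> A" "a \<in> A" using s1 A(1) by auto
    moreover have "independent b a \<or> r b a" using s2[OF that] .
    ultimately show ?thesis using asympD[OF assms(4)] by blast
  qed
  have "lprod as = lprod (us @ vs)"
  proof (rule Cons.IH)
    show "listing r (set as) as" using Cons.prems(1) by (auto simp: listing_def)
    show "listing r (set as) (us @ vs)"
      using Cons.prems(2) same by (auto simp: listing_def bs sorted_wrt_append)
    show "set as \<subseteq> triples" using Cons.prems(3) A(1) by blast
  qed
  moreover have sub: "set us \<subseteq> triples" "set vs \<subseteq> triples" "a \<in> triples"
    using Cons.prems(3) unfolding A'(1) by simp_all
  moreover have "lprod us \<otimes>\<^bsub>G3\<^esub> (G3_gen a \<otimes>\<^bsub>G3\<^esub> lprod vs) = G3_gen a \<otimes>\<^bsub>G3\<^esub> (lprod us \<otimes>\<^bsub>G3\<^esub> lprod vs)"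
  proof -
    have c: "lprod us \<in> carrier G3" "lprod vs \<in> carrier G3" "G3_gen a \<in> carrier G3" using sub by auto
    have "lprod us \<otimes>\<^bsub>G3\<^esub> G3_gen a = G3_gen a \<otimes>\<^bsub>G3\<^esub> lprod us"
      by (rule lprod_move_front[OF sub(1,3) ind])
    then show ?thesis unfolding G3.m_assoc[OF c(1,3,2), symmetric] G3.m_assoc[OF c(3,1,2), symmetric]
      by (rule arg_cong)
  qed
  ultimately show ?case using sub by (simp add: bs lprod_append)
qed

text \<open>A topological sort: repeatedly split off a minimal element.\<close>

lemma ex_linear_extension:
  assumes "finite A" "asymp r" "transp r"
  shows "\<exists>as. set as = A \<and> distinct as \<and> sorted_wrt (\<lambda>a b. \<not> r b a) as"
  using assms(1)
proof (induction "card A" arbitrary: A)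
  case 0
  then show ?case by simp
next
  case (Suc n)
  have "A \<noteq> {}" using Suc by auto
  then obtain m where m: "m \<in> A" "\<forall>x\<in>A. \<not> r x m"
    using Finite_Set.bex_min_element[OF Suc.prems, of r] assms(2,3)
    by (metis asympD asymp_on_subset transp_on_subset subset_UNIV)
  have "n = card (A - {m})" "finite (A - {m})"
    using Suc.hyps(2) m(1) Suc.prems by simp_all
  from Suc.hyps(1)[OF this]
  obtain bs where "set bs = A - {m}" "distinct bs" "sorted_wrt (\<lambda>a b. \<not> r b a) bs" by blast
  with m have "set (m # bs) = A \<and> distinct (m # bs) \<and> sorted_wrt (\<lambda>a b. \<not> r b a) (m # bs)"
    by auto
  then show ?case by blast
qed

text \<open>In a linear extension two dependent letters can only stand in the order of
  \<open>r\<close>, as they are comparable by assumption.\<close>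

lemma ex_listing:
  assumes "finite A" "asymp r" "transp r"
    "\<And>a b. a \<in> A \<Longrightarrow> b \<in> A \<Longrightarrow> a \<noteq> b \<Longrightarrow> \<not> independent a b \<Longrightarrow> r a b \<or> r b a"
  shows "\<exists>as. listing r A as"
proof -
  obtain bs where bs: "set bs = A" "distinct bs" "sorted_wrt (\<lambda>a b. \<not> r b a) bs"
    using ex_linear_extension[OF assms(1-3)] by blast
  have "sorted_wrt (\<lambda>a b. a \<noteq> b \<and> \<not> r b a) bs"
    using bs(2,3) by (induction bs) auto
  moreover have "independent a b \<or> r a b" if "a \<in> set bs" "b \<in> set bs" "a \<noteq> b \<and> \<not> r b a" for a b
    using assms(4)[of a b] that bs(1) by blast
  ultimately have "sorted_wrt (\<lambda>a b. independent a b \<or> r a b) bs"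
    by (rule sorted_wrt_mono_rel[rotated])
  with bs show ?thesis unfolding listing_def by blast
qed

section \<open>Horocycles\<close>

text \<open>
  A circle inside the disc that is tangent to the absolute at \<open>p\<close> is a level set of
  \<open>x \<mapsto> |p - x|\<^sup>2 / (1 - |x|\<^sup>2)\<close>, which for \<open>|p| = 1\<close> is the function \<open>level x p\<close> below.  It depends
  affinely on the point \<open>(height x, foot x)\<close> of the hyperboloid model of the hyperbolic plane, and
  \<open>slope x p\<close> is its derivative along the absolute.
\<close>

definition height :: "complex \<Rightarrow> real" where
  "height x = (1 + (cmod x)\<^sup>2) / (1 - (cmod x)\<^sup>2)"

definition foot :: "complex \<Rightarrow> complex" where
  "foot x = x / of_real (1 - (cmod x)\<^sup>2)"

definition level :: "complex \<Rightarrow> complex \<Rightarrow> real" where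
  "level x p = height x - 2 * Re (foot x * cnj p)"

definition slope :: "complex \<Rightarrow> complex \<Rightarrow> real" where
  "slope x p = - 2 * Im (foot x * cnj p)"

text \<open>The Minkowski square of the difference of the points \<open>(height, 2 * foot)\<close>
  of the hyperboloid; in terms of the hyperbolic distance \<open>d\<close> it is
  \<open>4 * sinh(d / 2)^2\<close>.\<close>

definition sep :: "complex \<Rightarrow> complex \<Rightarrow> real" where
  "sep x y = 4 * (cmod (foot x - foot y))\<^sup>2 - (height x - height y)\<^sup>2"

lemma sep_commute: "sep x y = sep y x"
  by (simp add: sep_def norm_minus_commute power2_commute)

lemma cmod_less_1: "cmod x < 1 \<Longrightarrow> (cmod x)\<^sup>2 < 1"
  by (simp add: power_less_one_iff abs_square_less_1)

lemma hyperboloid: "cmod x < 1 \<Longrightarrow> (height x)\<^sup>2 - 4 * (cmod (foot x))\<^sup>2 = 1"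
proof -
  assume "cmod x < 1"
  then have e: "1 - (cmod x)\<^sup>2 > 0" using cmod_less_1 by simp
  have "(cmod (foot x))\<^sup>2 = (cmod x)\<^sup>2 / (1 - (cmod x)\<^sup>2)\<^sup>2"
    unfolding foot_def norm_divide norm_of_real power_divide power2_abs ..
  then have "(height x)\<^sup>2 - 4 * (cmod (foot x))\<^sup>2 = ((1 + (cmod x)\<^sup>2)\<^sup>2 - 4 * (cmod x)\<^sup>2) / (1 - (cmod x)\<^sup>2)\<^sup>2"
    by (simp add: height_def power_divide diff_divide_distrib)
  also have "(1 + (cmod x)\<^sup>2)\<^sup>2 - 4 * (cmod x)\<^sup>2 = (1 - (cmod x)\<^sup>2)\<^sup>2"
    by (simp add: power2_eq_square algebra_simps)
  finally show ?thesis using e by simp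
qed

text \<open>The point is the positivity that can be read off: distinct points of the hyperboloid
  differ by a spacelike vector.\<close>

lemma sep_eq:
  assumes "cmod x < 1" "cmod y < 1"
  shows "sep x y = 4 * (cmod (x - y))\<^sup>2 / ((1 - (cmod x)\<^sup>2) * (1 - (cmod y)\<^sup>2))"
proof -
  define a b c d where abcd: "a = Re x" "b = Im x" "c = Re y" "d = Im y"
  define e f where ef: "e = 1 - (cmod x)\<^sup>2" "f = 1 - (cmod y)\<^sup>2"
  have pos: "e > 0" "f > 0" using assms cmod_less_1 by (simp_all add: ef)
  have ef': "e = 1 - a\<^sup>2 - b\<^sup>2" "f = 1 - c\<^sup>2 - d\<^sup>2" by (simp_all add: ef cmod_power2 abcd)
  have h: "height x = 2 / e - 1" "height y = 2 / f - 1"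
    using pos by (simp_all add: height_def ef[symmetric] field_simps) (simp_all add: ef)
  have z: "Re (foot x - foot y) = a / e - c / f" "Im (foot x - foot y) = b / e - d / f"
    by (simp_all add: foot_def ef[symmetric] abcd)
  have "sep x y = 4 * ((a / e - c / f)\<^sup>2 + (b / e - d / f)\<^sup>2 - (1 / e - 1 / f)\<^sup>2)"
    unfolding sep_def cmod_power2 z h by (simp add: power2_eq_square algebra_simps)
  also have "(a / e - c / f)\<^sup>2 + (b / e - d / f)\<^sup>2 - (1 / e - 1 / f)\<^sup>2 =
      ((a * f - c * e)\<^sup>2 + (b * f - d * e)\<^sup>2 - (f - e)\<^sup>2) / (e * f)\<^sup>2"
    using pos by (simp add: field_simps power2_eq_square)
  also have "(a * f - c * e)\<^sup>2 + (b * f - d * e)\<^sup>2 - (f - e)\<^sup>2 =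
      f\<^sup>2 * (a\<^sup>2 + b\<^sup>2 - 1) + e\<^sup>2 * (c\<^sup>2 + d\<^sup>2 - 1) + 2 * e * f * (1 - a * c - b * d)"
    by (simp add: power2_eq_square algebra_simps)
  also have "\<dots> = - f\<^sup>2 * e - e\<^sup>2 * f + 2 * e * f * (1 - a * c - b * d)"
  proof -
    have "a\<^sup>2 + b\<^sup>2 - 1 = - e" "c\<^sup>2 + d\<^sup>2 - 1 = - f" by (simp_all add: ef')
    then show ?thesis by simp
  qed
  also have "\<dots> = e * f * (2 - e - f - 2 * a * c - 2 * b * d)"
    by (simp add: power2_eq_square algebra_simps)
  also have "2 - e - f - 2 * a * c - 2 * b * d = (a - c)\<^sup>2 + (b - d)\<^sup>2"
    by (simp add: ef' power2_eq_square algebra_simps)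
  also have "\<dots> = (cmod (x - y))\<^sup>2" by (simp add: cmod_power2 abcd)
  finally have "sep x y = 4 * (e * f * (cmod (x - y))\<^sup>2 / (e * f)\<^sup>2)" .
  also have "e * f * (cmod (x - y))\<^sup>2 / (e * f)\<^sup>2 = (cmod (x - y))\<^sup>2 / (e * f)"
    using pos by (simp add: power2_eq_square)
  finally show ?thesis unfolding ef by simp
qed

lemma sep_pos: "cmod x < 1 \<Longrightarrow> cmod y < 1 \<Longrightarrow> x \<noteq> y \<Longrightarrow> sep x y > 0"
  unfolding sep_eq using cmod_less_1 by (simp add: zero_less_divide_iff)

lemma foot_inj: "cmod x < 1 \<Longrightarrow> cmod y < 1 \<Longrightarrow> x \<noteq> y \<Longrightarrow> foot x \<noteq> foot y"
proof
  assume "cmod x < 1" "cmod y < 1" "x \<noteq> y" "foot x = foot y"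
  moreover from \<open>foot x = foot y\<close> have "sep x y \<le> 0" by (simp add: sep_def)
  ultimately show False using sep_pos[of x y] by simp
qed

text \<open>
  Two points lie on exactly two horocycles; \<open>contact x y\<close> is the tangency point of the one along
  which \<open>x\<close> precedes \<open>y\<close>.
\<close>

definition contact :: "complex \<Rightarrow> complex \<Rightarrow> complex" where
  "contact x y = Complex ((height y - height x) / 2) (sqrt (sep x y) / 2) / cnj (foot y - foot x)"

lemma level_slope_diff:
  "level y p - level x p = height y - height x - 2 * Re (cnj (foot y - foot x) * p)"
  "slope y p - slope x p = 2 * Im (cnj (foot y - foot x) * p)"
  by (simp_all add: level_def slope_def algebra_simps)

text \<open>Rotate \<open>p\<close> to \<open>w = cnj d * p\<close>, where \<open>d\<close> is the
  difference of the feet. The three conditions become \<open>|w| = |d|\<close>, a prescribed real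
  part and a positive imaginary part, which leaves one candidate; it exists because
  \<open>sep x y\<close> is positive.\<close>

lemma contact_unique:
  assumes "cmod x < 1" "cmod y < 1" "x \<noteq> y"
  shows "cmod p = 1 \<and> level x p = level y p \<and> slope x p < slope y p \<longleftrightarrow> p = contact x y"
proof -
  define d where "d = foot y - foot x"
  define w where "w = cnj d * p"
  define c where "c = Complex ((height y - height x) / 2) (sqrt (sep x y) / 2)"
  have d: "d \<noteq> 0" using foot_inj[OF assms] by (simp add: d_def)
  have s: "sep x y > 0" by (rule sep_pos[OF assms])
  \<comment> \<open>The square root in \<open>contact\<close> is chosen so that the numerator has
    the modulus of \<open>d\<close>.\<close>
  have c2: "(cmod c)\<^sup>2 = (cmod d)\<^sup>2"
    using s by (simp add: c_def cmod_power2 power_divide d_def) (simp add: sep_def norm_minus_commute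
      power2_commute cmod_power2 field_simps)
  have "p = contact x y \<longleftrightarrow> w = c"
    using d by (auto simp: contact_def w_def c_def d_def field_simps)
  moreover have "cmod p = 1 \<longleftrightarrow> (cmod w)\<^sup>2 = (cmod d)\<^sup>2"
    using d by (auto simp: w_def norm_mult power_mult_distrib power2_eq_1_iff)
      (smt (verit) norm_ge_zero)
  moreover have "level x p = level y p \<longleftrightarrow> Re w = Re c"
    using level_slope_diff(1)[of y p x] by (auto simp: w_def c_def d_def)
  moreover have "slope x p < slope y p \<longleftrightarrow> Im w > 0"
    using level_slope_diff(2)[of y p x] by (auto simp: w_def d_def)
  moreover have "w = c \<longleftrightarrow> (cmod w)\<^sup>2 = (cmod d)\<^sup>2 \<and> Re w = Re c \<and> Im w > 0"
  proof
    assume "w = c"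
    then show "(cmod w)\<^sup>2 = (cmod d)\<^sup>2 \<and> Re w = Re c \<and> Im w > 0" using c2 s by (simp add: c_def)
  next
    assume *: "(cmod w)\<^sup>2 = (cmod d)\<^sup>2 \<and> Re w = Re c \<and> Im w > 0"
    then have "(Re w)\<^sup>2 = (Re c)\<^sup>2" by simp
    then have "(Im w)\<^sup>2 = (Im c)\<^sup>2" using c2 * unfolding cmod_power2 by linarith
    moreover have "Im c > 0" using s by (simp add: c_def)
    ultimately have "Im w = Im c" using * by (simp add: power2_eq_iff)
    then show "w = c" using * by (simp add: complex_eq_iff)
  qed
  ultimately show ?thesis by blast
qed

lemma contact_props:
  assumes "cmod x < 1" "cmod y < 1" "x \<noteq> y"
  shows "cmod (contact x y) = 1" "level x (contact x y) = level y (contact x y)"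
    "slope x (contact x y) < slope y (contact x y)"
  using contact_unique[OF assms, of "contact x y"] by auto

text \<open>With equal levels and equal slopes \<open>w\<close> would be real and
  \<open>4 * |w|^2\<close> would be the square of the height difference, which means
  \<open>sep x y = 0\<close>.\<close>

lemma slope_neq:
  assumes "cmod x < 1" "cmod y < 1" "x \<noteq> y" "cmod p = 1" "level x p = level y p"
  shows "slope x p \<noteq> slope y p"
proof
  assume s: "slope x p = slope y p"
  define w where "w = cnj (foot y - foot x) * p"
  have "2 * Re w = height y - height x" "Im w = 0"
    using level_slope_diff[of y p x] assms(5) s by (simp_all add: w_def)
  then have "4 * (cmod w)\<^sup>2 = (height y - height x)\<^sup>2"
    unfolding cmod_power2 by (simp flip: \<open>2 * Re w = height y - height x\<close> add: power_mult_distrib)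
  moreover have "cmod w = cmod (foot x - foot y)"
    using assms(4) by (simp add: w_def norm_mult norm_minus_commute flip: complex_cnj_diff)
  ultimately have "sep x y = 0" by (simp add: sep_def power2_commute)
  with sep_pos[OF assms(1-3)] show False by simp
qed

lemma contact_cases:
  assumes "cmod x < 1" "cmod y < 1" "x \<noteq> y" "cmod p = 1" "level x p = level y p"
  shows "slope x p < slope y p \<and> p = contact x y \<or> slope y p < slope x p \<and> p = contact y x"
  using slope_neq[OF assms] contact_unique[OF assms(1-3), of p]
    contact_unique[OF assms(2,1), of p] assms(3-5) by fastforce

lemma contact_swap_neq:
  assumes "cmod x < 1" "cmod y < 1" "x \<noteq> y"
  shows "contact x y \<noteq> contact y x"
  using contact_props(3)[OF assms] contact_props(3)[OF assms(2,1)] assms(3) by auto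

text \<open>Two distinct solutions \<open>p\<close> and \<open>q\<close> would force the three
  points of the hyperboloid onto one line of the ambient Minkowski space. Its direction is
  spacelike, and such a line meets the hyperboloid in at most two points.\<close>

lemma collinear_hyperboloid:
  assumes "cmod x < 1" "cmod y < 1" "cmod z < 1" "x \<noteq> y" "x \<noteq> z" "y \<noteq> z"
    and "cmod p = 1" "level x p = level y p" "level x p = level z p"
    and "cmod q = 1" "level x q = level y q" "level x q = level z q"
  shows "p = q"
proof (rule ccontr)
  assume pq: "p \<noteq> q"
  define d e where de: "d = foot y - foot x" "e = foot z - foot x"
  define al be where ab: "al = height y - height x" "be = height z - height x"
  have d: "d \<noteq> 0" using foot_inj[of x y] assms by (auto simp: de)
  have p: "al = 2 * Re (d * cnj p)" "be = 2 * Re (e * cnj p)"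
    and q: "al = 2 * Re (d * cnj q)" "be = 2 * Re (e * cnj q)"
    using assms by (simp_all add: level_def de ab algebra_simps)
  then have "Re (d * cnj (p - q)) = 0" "Re (e * cnj (p - q)) = 0" by (simp_all add: algebra_simps)
  \<comment> \<open>\<open>d\<close> and \<open>e\<close> are both perpendicular to
    \<open>p - q\<close>, hence parallel.\<close>
  then have "Im (e * cnj d) * (cmod (p - q))\<^sup>2 = 0"
    unfolding cmod_power2 by (simp add: algebra_simps power2_eq_square) algebra
  then have im: "Im (e * cnj d) = 0" using pq by simp
  define m where "m = Re (e * cnj d) / (cmod d)\<^sup>2"
  have "e * cnj d = of_real (m * (cmod d)\<^sup>2)"
    using im d by (simp add: m_def complex_eq_iff)
  then have "e * cnj d = (of_real m * d) * cnj d"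
    by (simp only: of_real_mult complex_norm_square mult.assoc)
  then have e: "e = of_real m * d" using d by simp
  then have be: "be = m * al" using p by (simp add: algebra_simps)
  define D where "D = (cmod d)\<^sup>2"
  have de2: "d - e = of_real (1 - m) * d" by (simp add: e algebra_simps)
  have A: "(cmod (d - e))\<^sup>2 = (1 - m)\<^sup>2 * D" "(cmod e)\<^sup>2 = m\<^sup>2 * D"
    unfolding de2 unfolding e norm_mult norm_of_real power_mult_distrib power2_abs D_def by simp_all
  have B: "(al - be)\<^sup>2 = (1 - m)\<^sup>2 * al\<^sup>2" "be\<^sup>2 = m\<^sup>2 * al\<^sup>2"
    unfolding be by (simp_all add: power2_eq_square algebra_simps)
  have sxy: "sep x y = 4 * D - al\<^sup>2" "sep x z = 4 * (cmod e)\<^sup>2 - be\<^sup>2"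
    "sep y z = 4 * (cmod (d - e))\<^sup>2 - (al - be)\<^sup>2"

  proof -
    have "d - e = foot y - foot z" "al - be = height y - height z" by (simp_all add: de ab)
    then show "sep x y = 4 * D - al\<^sup>2" "sep x z = 4 * (cmod e)\<^sup>2 - be\<^sup>2"
      "sep y z = 4 * (cmod (d - e))\<^sup>2 - (al - be)\<^sup>2"
      unfolding D_def de ab sep_commute[of x y] sep_commute[of x z] by (simp_all add: sep_def)
  qed
  have s: "sep x z = m\<^sup>2 * sep x y" "sep y z = (1 - m)\<^sup>2 * sep x y"
    unfolding sxy A B by (simp_all add: algebra_simps)
  define k where "k = 2 * height x * al - 8 * (Re (foot x) * Re d + Im (foot x) * Im d)"
  \<comment> \<open>The equation of the hyperboloid along the line from \<open>x\<close> through
    \<open>y\<close>, minus its instance at \<open>t = 0\<close>. It applies at \<open>t = 1\<close>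
    and \<open>t = m\<close>, the parameters of \<open>y\<close> and \<open>z\<close>, which leaves
    \<open>m = 0\<close> or \<open>m = 1\<close>.\<close>
  have key: "t * k = t\<^sup>2 * (4 * D - al\<^sup>2)"
    if "(height x + t * al)\<^sup>2 - 4 * (cmod (foot x + of_real t * d))\<^sup>2 = 1" for t
  proof -
    have "(height x + t * al)\<^sup>2 - 4 * (cmod (foot x + of_real t * d))\<^sup>2 =
      ((height x)\<^sup>2 - 4 * (cmod (foot x))\<^sup>2) + (t * k - t\<^sup>2 * (4 * D - al\<^sup>2))"
      unfolding k_def D_def cmod_power2 by (simp add: power2_eq_square algebra_simps)
    then show ?thesis using that hyperboloid[OF assms(1)] by linarith
  qed
  have "1 * k = 1\<^sup>2 * (4 * D - al\<^sup>2)"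
  proof (rule key)
    show "(height x + 1 * al)\<^sup>2 - 4 * (cmod (foot x + of_real 1 * d))\<^sup>2 = 1"
      using hyperboloid[OF assms(2)] by (simp add: de ab)
  qed
  moreover have "m * k = m\<^sup>2 * (4 * D - al\<^sup>2)"
  proof (rule key)
    have "foot z = foot x + e" "height z = height x + be" by (simp_all add: de ab)
    then have eqs: "foot z = foot x + of_real m * d" "height z = height x + m * al" unfolding e be .
    show "(height x + m * al)\<^sup>2 - 4 * (cmod (foot x + of_real m * d))\<^sup>2 = 1"
      using hyperboloid[OF assms(3)] unfolding eqs .
  qed
  moreover have pos: "sep x y > 0" "sep x z > 0" "sep y z > 0"
    by (intro sep_pos assms(1-6))+
  ultimately have "m * sep x y = m\<^sup>2 * sep x y" unfolding sxy(1) by simp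
  then have "m = m\<^sup>2" using pos by simp
  then have "m * (1 - m) = 0" by (simp add: power2_eq_square algebra_simps)
  then have "m = 0 \<or> m = 1" by simp
  with s pos show False by auto
qed

text \<open>Four times the Gram determinant of the three points, a form of Heron's formula.\<close>

definition gram :: "complex \<Rightarrow> complex \<Rightarrow> complex \<Rightarrow> real" where
  "gram x y z = 4 * sep x y * sep x z - (sep x y + sep x z - sep y z)\<^sup>2"

text \<open>For points of the disc: zero exactly when \<open>z\<close> is on the horocycle of
  \<open>x\<close> and \<open>y\<close> with tangency point \<open>contact x y\<close>, and negative
  inside that circle.\<close>

definition side :: "complex \<Rightarrow> complex \<Rightarrow> complex \<Rightarrow> real" where
  "side x y z = level z (contact x y) - level x (contact x y)"

text \<open>One factor for each of the two horocycles through \<open>x\<close> and \<open>y\<close>.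
  After multiplication by \<open>D\<close> the two values of \<open>side\<close> have the form
  \<open>A - B\<close> and \<open>A + B\<close>, where only \<open>B\<close> contains the square
  root \<open>s\<close>, so that their product is free of roots.\<close>

lemma gram_factor:
  assumes "cmod x < 1" "cmod y < 1" "x \<noteq> y"
  shows "gram x y z = - 16 * (cmod (foot y - foot x))\<^sup>2 * side x y z * side y x z"
proof -
  define d e where de: "d = foot y - foot x" "e = foot z - foot x"
  define al be where ab: "al = height y - height x" "be = height z - height x"
  define s where "s = sqrt (sep x y) / 2"
  define D where "D = (cmod d)\<^sup>2"
  define u v where uv: "u = Re (e * cnj d)" "v = Im (e * cnj d)"
  have d0: "d \<noteq> 0" using foot_inj[OF assms] by (simp add: de)
  then have D: "D > 0" by (simp add: D_def)
  have sepxy: "sep x y = 4 * D - al\<^sup>2" "sep x z = 4 * (cmod e)\<^sup>2 - be\<^sup>2"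
    "sep y z = 4 * (cmod (d - e))\<^sup>2 - (al - be)\<^sup>2"

  proof -
    have "d - e = foot y - foot z" "al - be = height y - height z" by (simp_all add: de ab)
    then show "sep x y = 4 * D - al\<^sup>2" "sep x z = 4 * (cmod e)\<^sup>2 - be\<^sup>2"
      "sep y z = 4 * (cmod (d - e))\<^sup>2 - (al - be)\<^sup>2"
      unfolding D_def de ab sep_commute[of x y] sep_commute[of x z] by (simp_all add: sep_def)
  qed
  have s2: "4 * s\<^sup>2 = 4 * D - al\<^sup>2"
    using sep_pos[OF assms] sepxy(1) by (simp add: s_def power_divide)
  have P: "contact x y = Complex (al / 2) s / cnj d"
    by (simp add: contact_def de ab s_def)
  have "Complex ((height x - height y) / 2) (sqrt (sep y x) / 2) = - Complex (al / 2) (- s)"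
    by (simp add: ab s_def sep_commute complex_eq_iff field_simps)
  moreover have "cnj (foot x - foot y) = - cnj d" by (simp add: de)
  ultimately have P': "contact y x = Complex (al / 2) (- s) / cnj d"
    by (simp add: contact_def del: complex_cnj_diff)
  have key: "D * (be - 2 * Re (e * cnj (Complex (al / 2) t / cnj d))) = D * be - u * al - 2 * v * t" for t
  proof -
    have "e * cnj (Complex (al / 2) t / cnj d) = e * cnj d * Complex (al / 2) (- t) / of_real D"
    proof -
      have D': "complex_of_real D = d * cnj d" unfolding D_def by (rule complex_norm_square)
      have "cnj (Complex (al / 2) t / cnj d) = Complex (al / 2) (- t) / d" by (simp add: complex_cnj)
      then show ?thesis unfolding D' using d0 by simp
    qed
    then have "Re (e * cnj (Complex (al / 2) t / cnj d)) = (u * al / 2 + v * t) / D"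
      by (simp add: uv)
    then show ?thesis using D by (simp add: field_simps)
  qed
  have lx: "level z p - level x p = be - 2 * Re (e * cnj p)" for p
    by (simp add: level_def de ab algebra_simps)
  have ly: "level z (contact y x) - level y (contact y x) = level z (contact y x) - level x (contact y x)"
    using contact_props(2)[of y x] assms by auto
  have s1: "D * side x y z = D * be - u * al - 2 * v * s"
    unfolding side_def lx P key ..
  have s2': "D * side y x z = D * be - u * al + 2 * v * s"
    unfolding side_def ly lx unfolding P' key by simp
  have uvD: "u\<^sup>2 + v\<^sup>2 = (cmod e)\<^sup>2 * D"
  proof -
    have "u\<^sup>2 + v\<^sup>2 = (cmod (e * cnj d))\<^sup>2" unfolding uv cmod_power2 ..
    then show ?thesis by (simp only: norm_mult complex_mod_cnj power_mult_distrib D_def)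
  qed
  have cde: "(cmod (d - e))\<^sup>2 = D + (cmod e)\<^sup>2 - 2 * u"
    unfolding uv D_def cmod_power2 by (simp add: power2_eq_square algebra_simps)
  have g: "gram x y z = 4 * ((4 * D - al\<^sup>2) * (4 * (cmod e)\<^sup>2 - be\<^sup>2) - (4 * u - al * be)\<^sup>2)"
    unfolding gram_def sepxy cde by (simp add: power2_eq_square algebra_simps)
  have "D * ((4 * D - al\<^sup>2) * (4 * (cmod e)\<^sup>2 - be\<^sup>2) - (4 * u - al * be)\<^sup>2)
      = (4 * D - al\<^sup>2) * (4 * (u\<^sup>2 + v\<^sup>2) - D * be\<^sup>2) - D * (4 * u - al * be)\<^sup>2"
    unfolding uvD by (simp add: algebra_simps)
  also have "\<dots> = 4 * v\<^sup>2 * (4 * D - al\<^sup>2) - 4 * (D * be - u * al)\<^sup>2"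
    by (simp add: power2_eq_square algebra_simps)
  also have "\<dots> = - 4 * ((D * be - u * al - 2 * v * s) * (D * be - u * al + 2 * v * s))"
    unfolding s2[symmetric] by (simp add: power2_eq_square algebra_simps)
  also have "\<dots> = - 4 * (D * side x y z) * (D * side y x z)" by (simp only: s1 s2' mult.assoc)
  finally have F: "D * ((4 * D - al\<^sup>2) * (4 * (cmod e)\<^sup>2 - be\<^sup>2) - (4 * u - al * be)\<^sup>2)
      = - 4 * (D * side x y z) * (D * side y x z)" .
  have "D * gram x y z = 4 * (D * ((4 * D - al\<^sup>2) * (4 * (cmod e)\<^sup>2 - be\<^sup>2) - (4 * u - al * be)\<^sup>2))"
    unfolding g by (rule mult.left_commute)
  then have "D * gram x y z = D * (- 16 * D * side x y z * side y x z)" unfolding F by simp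
  then have "gram x y z = - 16 * D * side x y z * side y x z"
    using D mult_left_cancel[of D "gram x y z" "- 16 * D * side x y z * side y x z"] by blast
  then show ?thesis by (simp add: D_def de)
qed

section \<open>Tangent circles as level sets, counterclockwise order as order of slopes\<close>

lemma level_eq:
  assumes "cmod p = 1" "cmod x < 1"
  shows "level x p = (cmod (p - x))\<^sup>2 / (1 - (cmod x)\<^sup>2)"
proof -
  have e: "1 - (cmod x)\<^sup>2 > 0" using cmod_less_1[OF assms(2)] by simp
  have "level x p = (1 + (cmod x)\<^sup>2 - 2 * Re (x * cnj p)) / (1 - (cmod x)\<^sup>2)"
    unfolding level_def height_def foot_def by (simp add: diff_divide_distrib)
  also have "1 + (cmod x)\<^sup>2 - 2 * Re (x * cnj p) = (cmod (p - x))\<^sup>2"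
  proof -
    have "(cmod p)\<^sup>2 = 1" using assms by simp
    then show ?thesis unfolding cmod_power2 by (simp add: power2_eq_square algebra_simps)
  qed
  finally show ?thesis .
qed

lemma level_pos: "cmod p = 1 \<Longrightarrow> cmod x < 1 \<Longrightarrow> level x p > 0"
  using cmod_less_1[of x] by (auto simp: level_eq intro!: divide_pos_pos)

text \<open>The mirror image of \<open>p\<close> in the line through the two centres lies on both
  circles, so it is \<open>p\<close> itself and the centre is a real multiple of \<open>p\<close>.
  Circles that touch the absolute from outside or enclose it are excluded because this one contains
  a point of the disc.\<close>

lemma tangent_at_inside:
  assumes "tangent_at c r p" "x \<in> sphere c r" "cmod x < 1"
  shows "cmod p = 1" "0 < r" "r < 1" "c = of_real (1 - r) * p"
proof -
  have r: "r > 0" and int: "sphere c r \<inter> sphere 0 1 = {p}"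
    using assms(1) by (auto simp: tangent_at_def)
  then have "p \<in> sphere c r \<inter> sphere 0 1" by blast
  then have p: "cmod p = 1" "cmod (p - c) = r" by (auto simp: dist_norm norm_minus_commute)
  have x: "cmod (x - c) = r" using assms(2) by (simp add: dist_norm norm_minus_commute)
  have c0: "c \<noteq> 0"
  proof
    assume "c = 0"
    then have "- p \<in> sphere c r \<inter> sphere 0 1" using p by simp
    then have "- p = p" using int by blast
    then have "p = 0" by (simp add: complex_eq_iff)
    then show False using p(1) by simp
  qed
  define q where "q = c / cnj c * cnj p"
  have u: "cmod (c / cnj c) = 1" using c0 by (simp add: norm_divide)
  have "q - c = c / cnj c * cnj (p - c)" using c0 by (simp add: q_def field_simps)
  then have "cmod (q - c) = r" "cmod q = 1"
    using u p by (simp_all only: q_def norm_mult complex_mod_cnj)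
  then have "q \<in> sphere c r \<inter> sphere 0 1" by (simp add: dist_norm norm_minus_commute)
  then have "q = p" using int by blast
  then have "c * cnj p = cnj (c * cnj p)" using c0 by (simp add: q_def field_simps)
  then have "Im (c * cnj p) = 0" by (simp add: complex_eq_iff)
  define l where "l = Re (c * cnj p)"
  have l: "c * cnj p = of_real l" using \<open>Im (c * cnj p) = 0\<close> by (simp add: l_def complex_eq_iff)
  have pp: "p * cnj p = 1" using p(1) by (simp add: complex_norm_square[symmetric])
  have "c = c * cnj p * p" using pp by (simp add: mult.assoc mult.commute)
  then have c: "c = of_real l * p" by (simp add: l)
  have "p - c = of_real (1 - l) * p" by (simp add: c algebra_simps)
  then have "cmod (p - c) = cmod (of_real (1 - l) * p)" by (rule arg_cong)
  also have "\<dots> = \<bar>1 - l\<bar>" using p unfolding norm_mult norm_of_real by simp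
  finally have "r = \<bar>1 - l\<bar>" using p by simp
  moreover have "cmod c = \<bar>l\<bar>" using p by (simp add: c norm_mult)
  moreover have "cmod c - r \<le> cmod x" "r - cmod c \<le> cmod x"
    using norm_triangle_ineq2[of c "c - x"] norm_triangle_ineq4[of x c] x by (simp_all add: norm_minus_commute)
  ultimately have "l = 1 - r" "r < 1" using assms(3) r by (auto simp: abs_if split: if_splits)
  then show "cmod p = 1" "0 < r" "r < 1" "c = of_real (1 - r) * p" using p r c by simp_all
qed

lemma dist_center:
  assumes "cmod p = 1"
  shows "(cmod (x - of_real (1 - r) * p))\<^sup>2 = (cmod x)\<^sup>2 - 2 * (1 - r) * Re (x * cnj p) + (1 - r)\<^sup>2"
proof -
  have "(cmod p)\<^sup>2 = 1" using assms by simp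
  then have "(1 - r)\<^sup>2 * ((Re p)\<^sup>2 + (Im p)\<^sup>2) = (1 - r)\<^sup>2" unfolding cmod_power2 by simp
  then show ?thesis unfolding cmod_power2 by (simp add: power2_eq_square algebra_simps)
qed

lemma tangent_atI:
  assumes "cmod p = 1" "0 < r" "r < 1"
  shows "tangent_at (of_real (1 - r) * p) r p"
proof -
  have "q = p" if "cmod (q - of_real (1 - r) * p) = r" "cmod q = 1" for q
  proof -
    have "(1 - r) * Re (q * cnj p) = 1 - r"
      using dist_center[OF assms(1), of q r] that by (simp add: power2_eq_square algebra_simps)
    then have 1: "Re (q * cnj p) = 1" using assms by simp
    have "(cmod (q - p))\<^sup>2 = 0"
      using dist_center[OF assms(1), of q 0] that 1 by simp
    then show ?thesis by simp
  qed
  moreover have "cmod (p - of_real (1 - r) * p) = r"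
  proof -
    have "p - of_real (1 - r) * p = of_real r * p" by (simp add: algebra_simps)
    then have "cmod (p - of_real (1 - r) * p) = cmod (of_real r * p)" by (rule arg_cong)
    also have "\<dots> = r" using assms by (simp add: norm_mult)
    finally show ?thesis .
  qed
  ultimately show ?thesis
    using assms by (auto simp: tangent_at_def dist_norm norm_minus_commute)
qed

lemma sphere_iff_level:
  assumes "cmod p = 1" "0 < r" "r < 1" "cmod x < 1"
  shows "x \<in> sphere (of_real (1 - r) * p) r \<longleftrightarrow> level x p = r / (1 - r)"
proof -
  define e where "e = 1 - (cmod x)\<^sup>2"
  define R where "R = Re (x * cnj p)"
  have e: "e > 0" using cmod_less_1[OF assms(4)] by (simp add: e_def)
  have "x \<in> sphere (of_real (1 - r) * p) r \<longleftrightarrow> cmod (x - of_real (1 - r) * p) = r"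
    by (simp add: dist_norm norm_minus_commute)
  also have "\<dots> \<longleftrightarrow> (cmod (x - of_real (1 - r) * p))\<^sup>2 = r\<^sup>2"
    using assms by (simp add: power2_eq_iff_nonneg)
  also have "\<dots> \<longleftrightarrow> (1 - e) - 2 * (1 - r) * R + (1 - r)\<^sup>2 = r\<^sup>2"
    unfolding dist_center[OF assms(1)] by (simp add: e_def R_def)
  also have "\<dots> \<longleftrightarrow> (2 - e - 2 * R) * (1 - r) = r * e"
    by (auto simp: power2_eq_square algebra_simps)
  also have "\<dots> \<longleftrightarrow> (2 - e - 2 * R) / e = r / (1 - r)"
    using e assms by (simp add: frac_eq_eq)
  also have "(2 - e - 2 * R) / e = level x p"
  proof -
    have "height x = (2 - e) / e" "Re (foot x * cnj p) = R / e"
      by (simp_all add: height_def foot_def e_def R_def)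
    then show ?thesis by (simp add: level_def diff_divide_distrib)
  qed
  finally show ?thesis .
qed

lemma on_tangent_circle_iff:
  assumes "x \<in> X" "\<And>y. y \<in> X \<Longrightarrow> cmod y < 1"
  shows "on_tangent_circle X \<longleftrightarrow> (\<exists>p. cmod p = 1 \<and> (\<forall>y\<in>X. level y p = level x p))"
proof
  assume "on_tangent_circle X"
  then obtain c r p where t: "tangent_at c r p" "X \<subseteq> sphere c r" by (auto simp: on_tangent_circle_def)
  note i = tangent_at_inside[OF t(1) subsetD[OF t(2) assms(1)] assms(2)[OF assms(1)]]
  have "level y p = r / (1 - r)" if "y \<in> X" for y
    using sphere_iff_level[OF i(1-3) assms(2)[OF that]] t(2) i(4) that by auto
  then show "\<exists>p. cmod p = 1 \<and> (\<forall>y\<in>X. level y p = level x p)" using i(1) assms(1) by auto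
next
  assume "\<exists>p. cmod p = 1 \<and> (\<forall>y\<in>X. level y p = level x p)"
  then obtain p where p: "cmod p = 1" "\<And>y. y \<in> X \<Longrightarrow> level y p = level x p" by blast
  \<comment> \<open>The solution of \<open>r / (1 - r) = level x p\<close>.\<close>
  define r where "r = level x p / (1 + level x p)"
  have L: "level x p > 0" using level_pos p assms by blast
  then have r: "0 < r" "r < 1" "r / (1 - r) = level x p" by (simp_all add: r_def field_simps)
  have "y \<in> sphere (of_real (1 - r) * p) r" if "y \<in> X" for y
    unfolding sphere_iff_level[OF p(1) r(1,2) assms(2)[OF that]] using r(3) p(2)[OF that] by simp
  then show "on_tangent_circle X"
    using tangent_atI[OF p(1) r(1,2)] unfolding on_tangent_circle_def by blast
qed

text \<open>In terms of the half angle,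
  \<open>1 - |x|^2 = 4 * r * (1 - r) * sin(\<theta> / 2)^2\<close>, and the slope becomes a positive
  multiple of \<open>- cot (\<theta> / 2)\<close>. This increases over a full turn, so that
  counterclockwise order is the order of slopes.\<close>

lemma slope_on_circle:
  assumes "cmod p = 1" "0 < r" "r < 1" "0 < \<theta>" "\<theta> < 2 * pi" "cmod x < 1"
    and x: "x = of_real (1 - r) * p + (p - of_real (1 - r) * p) * cis \<theta>"
  shows "slope x p = - (cos (\<theta> / 2) / sin (\<theta> / 2)) / (1 - r)"
proof -
  have pp: "p * cnj p = 1" using assms(1) by (simp add: complex_norm_square[symmetric])
  have s: "sin (\<theta> / 2) > 0" using assms by (intro sin_gt_zero) auto
  have "x * cnj p = (of_real (1 - r) + of_real r * cis \<theta>) * (p * cnj p)" unfolding x by (simp add: algebra_simps)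
  then have xp: "x * cnj p = of_real (1 - r) + of_real r * cis \<theta>" using pp by simp
  have sc: "sin \<theta> = 2 * sin (\<theta> / 2) * cos (\<theta> / 2)" "cos \<theta> = 1 - 2 * (sin (\<theta> / 2))\<^sup>2"
    using sin_double[of "\<theta> / 2"] cos_double_sin[of "\<theta> / 2"] by simp_all
  have "(cmod x)\<^sup>2 = (cmod (x * cnj p))\<^sup>2" using assms(1) by (simp add: norm_mult)
  also have "\<dots> = (1 - r + r * cos \<theta>)\<^sup>2 + (r * sin \<theta>)\<^sup>2" unfolding xp cmod_power2 by simp
  also have "\<dots> = (1 - r)\<^sup>2 + 2 * r * (1 - r) * cos \<theta> + r\<^sup>2 * ((sin \<theta>)\<^sup>2 + (cos \<theta>)\<^sup>2)"
    by (simp only: power2_eq_square algebra_simps)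
  also have "\<dots> = (1 - r)\<^sup>2 + 2 * r * (1 - r) * cos \<theta> + r\<^sup>2" by simp
  also have "\<dots> = 1 - 4 * r * (1 - r) * (sin (\<theta> / 2))\<^sup>2"
    unfolding sc(2) by (simp add: power2_eq_square algebra_simps)
  finally have e: "1 - (cmod x)\<^sup>2 = 4 * r * (1 - r) * (sin (\<theta> / 2))\<^sup>2" by simp
  have "slope x p = - 2 * (Im (x * cnj p) / (1 - (cmod x)\<^sup>2))"
    unfolding slope_def foot_def by simp
  also have "Im (x * cnj p) = 2 * r * sin (\<theta> / 2) * cos (\<theta> / 2)" unfolding xp by (simp add: sc(1))
  also have "- 2 * (2 * r * sin (\<theta> / 2) * cos (\<theta> / 2) / (1 - (cmod x)\<^sup>2)) =
      - (cos (\<theta> / 2) / sin (\<theta> / 2)) / (1 - r)"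
    unfolding e using assms(2,3) s by (simp add: field_simps power2_eq_square)
  finally show ?thesis .
qed

lemma slope_on_circle_mono:
  assumes "0 < (\<theta>::real)" "\<theta> < \<phi>" "\<phi> < 2 * pi" "r < (1::real)"
  shows "- (cos (\<theta> / 2) / sin (\<theta> / 2)) / (1 - r) < - (cos (\<phi> / 2) / sin (\<phi> / 2)) / (1 - r)"
proof -
  have s: "sin (\<theta> / 2) > 0" "sin (\<phi> / 2) > 0" using assms by (auto intro!: sin_gt_zero)
  have "sin (\<phi> / 2 - \<theta> / 2) > 0" using assms by (intro sin_gt_zero) auto
  then have "cos (\<phi> / 2) * sin (\<theta> / 2) < cos (\<theta> / 2) * sin (\<phi> / 2)" by (simp add: sin_diff algebra_simps)
  then have "cos (\<phi> / 2) / sin (\<phi> / 2) < cos (\<theta> / 2) / sin (\<theta> / 2)" using s by (simp add: field_simps)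
  then show ?thesis using assms by (intro divide_strict_right_mono) auto
qed

lemma ccw_on_tangent_circle_iff:
  assumes "cmod x < 1" "cmod y < 1" "cmod z < 1"
  shows "ccw_on_tangent_circle x y z \<longleftrightarrow> (\<exists>p. cmod p = 1 \<and> level x p = level y p \<and>
    level x p = level z p \<and> slope x p < slope y p \<and> slope y p < slope z p)"
proof
  assume "ccw_on_tangent_circle x y z"
  then obtain c r p \<theta> \<phi> \<psi> where t: "tangent_at c r p" and o: "0 < \<theta>" "\<theta> < \<phi>" "\<phi> < \<psi>" "\<psi> < 2 * pi"
    and e: "x = c + (p - c) * cis \<theta>" "y = c + (p - c) * cis \<phi>" "z = c + (p - c) * cis \<psi>"
    unfolding ccw_on_tangent_circle_def by blast
  have "p \<in> sphere c r" using t by (auto simp: tangent_at_def)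
  then have r: "cmod (p - c) = r" by (simp add: dist_norm norm_minus_commute)
  have s: "x \<in> sphere c r" "y \<in> sphere c r" "z \<in> sphere c r"
    unfolding e by (simp_all add: dist_norm norm_mult r)
  note i = tangent_at_inside[OF t s(1) assms(1)]
  have l: "level x p = r / (1 - r)" "level y p = r / (1 - r)" "level z p = r / (1 - r)"
    using s sphere_iff_level[OF i(1-3)] assms i(4) by blast+
  have "slope x p = - (cos (\<theta> / 2) / sin (\<theta> / 2)) / (1 - r)"
    by (rule slope_on_circle[OF i(1-3)]) (use o assms e i(4) in auto)
  moreover have "slope y p = - (cos (\<phi> / 2) / sin (\<phi> / 2)) / (1 - r)"
    by (rule slope_on_circle[OF i(1-3)]) (use o assms e i(4) in auto)
  moreover have "slope z p = - (cos (\<psi> / 2) / sin (\<psi> / 2)) / (1 - r)"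
    by (rule slope_on_circle[OF i(1-3)]) (use o assms e i(4) in auto)
  ultimately have "slope x p < slope y p" "slope y p < slope z p"
    using slope_on_circle_mono[of \<theta> \<phi> r] slope_on_circle_mono[of \<phi> \<psi> r] o i(3) by simp_all
  with i(1) l show "\<exists>p. cmod p = 1 \<and> level x p = level y p \<and>
    level x p = level z p \<and> slope x p < slope y p \<and> slope y p < slope z p" by (intro exI[of _ p]) simp
next
  assume "\<exists>p. cmod p = 1 \<and> level x p = level y p \<and>
    level x p = level z p \<and> slope x p < slope y p \<and> slope y p < slope z p"
  then obtain p where p: "cmod p = 1" "level x p = level y p" "level x p = level z p"
    "slope x p < slope y p" "slope y p < slope z p" by blast
  define r where "r = level x p / (1 + level x p)"
  define c where "c = of_real (1 - r) * p"
  have L: "level x p > 0" using level_pos p assms by blast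
  then have r: "0 < r" "r < 1" "r / (1 - r) = level x p" by (simp_all add: r_def field_simps)
  have pc: "p - c = of_real r * p" by (simp add: c_def algebra_simps)
  have p0: "p - c \<noteq> 0" "cmod (p - c) = r" using p(1) r unfolding pc by (auto simp: norm_mult)
  \<comment> \<open>\<open>Arg2pi\<close> recovers the angle; it is not zero because the tangency
    point is not inside the disc.\<close>
  have ex: "\<exists>\<theta>. 0 < \<theta> \<and> \<theta> < 2 * pi \<and> w = c + (p - c) * cis \<theta> \<and>
      slope w p = - (cos (\<theta> / 2) / sin (\<theta> / 2)) / (1 - r)" if w: "cmod w < 1" "level w p = level x p" for w
  proof -
    define q where "q = (w - c) / (p - c)"
    define \<theta> where "\<theta> = Arg2pi q"
    have "w \<in> sphere c r" unfolding c_def sphere_iff_level[OF p(1) r(1,2) w(1)] using r(3) w(2) by simp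
    then have "cmod (w - c) = r" by (simp add: dist_norm norm_minus_commute)
    then have "cmod q = 1" using p0 r(1) by (simp add: q_def norm_divide)
    then have q: "q = cis \<theta>" unfolding \<theta>_def using Arg2pi_eq[of q] by (simp add: cis_conv_exp)
    have wq: "w = c + (p - c) * cis \<theta>" using p0 unfolding q[symmetric] by (simp add: q_def)
    have "\<theta> \<noteq> 0"
    proof
      assume "\<theta> = 0"
      then have "w = p" using wq by simp
      then show False using w(1) p(1) by simp
    qed
    then have "0 < \<theta>" "\<theta> < 2 * pi" using Arg2pi_ge_0[of q] Arg2pi_lt_2pi[of q] by (simp_all add: \<theta>_def)
    moreover from this have "slope w p = - (cos (\<theta> / 2) / sin (\<theta> / 2)) / (1 - r)"
      by (intro slope_on_circle[OF p(1) r(1,2)]) (use w wq c_def in auto)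
    ultimately show ?thesis using wq by blast
  qed
  obtain \<theta> where 1: "0 < \<theta>" "\<theta> < 2 * pi" "x = c + (p - c) * cis \<theta>"
    "slope x p = - (cos (\<theta> / 2) / sin (\<theta> / 2)) / (1 - r)" using ex[of x] assms by blast
  obtain \<phi> where 2: "0 < \<phi>" "\<phi> < 2 * pi" "y = c + (p - c) * cis \<phi>"
    "slope y p = - (cos (\<phi> / 2) / sin (\<phi> / 2)) / (1 - r)" using ex[of y] assms p by metis
  obtain \<psi> where 3: "0 < \<psi>" "\<psi> < 2 * pi" "z = c + (p - c) * cis \<psi>"
    "slope z p = - (cos (\<psi> / 2) / sin (\<psi> / 2)) / (1 - r)" using ex[of z] assms p by metis
  have "\<theta> < \<phi>"
    using slope_on_circle_mono[of \<phi> \<theta> r] 1 2 p r(2) by (cases \<theta> \<phi> rule: linorder_cases) auto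
  moreover have "\<phi> < \<psi>"
    using slope_on_circle_mono[of \<psi> \<phi> r] 2 3 p r(2) by (cases \<phi> \<psi> rule: linorder_cases) auto
  moreover have "tangent_at c r p" unfolding c_def by (rule tangent_atI[OF p(1) r(1,2)])
  ultimately show "ccw_on_tangent_circle x y z"
    unfolding ccw_on_tangent_circle_def using 1 2 3 by blast
qed

section \<open>Configurations\<close>

lemma config_spaceD:
  assumes "z \<in> config_space"
  shows "cmod (z $ i) < 1" "i \<noteq> j \<Longrightarrow> z $ i \<noteq> z $ j"
  using assms by (auto simp: config_space_def inj_def)

definition pt :: "complex ^ 'n \<Rightarrow> 'n \<Rightarrow> 'n \<Rightarrow> complex" where
  "pt z i j = contact (z $ i) (z $ j)"

text \<open>Equality of the two contact points says everything: there the levels of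
  \<open>i\<close>, \<open>j\<close>, \<open>k\<close> agree and their slopes increase, so the
  points follow each other counterclockwise on one horocycle.\<close>

definition aligned :: "complex ^ 'n \<Rightarrow> 'n \<times> 'n \<times> 'n \<Rightarrow> bool" where
  "aligned z = (\<lambda>(i, j, k). distinct [i, j, k] \<and> pt z i j = pt z j k)"

definition tset :: "'n \<times> 'n \<times> 'n \<Rightarrow> 'n set" where
  "tset = (\<lambda>(i, j, k). {i, j, k})"

lemma aligned_triples: "aligned z a \<Longrightarrow> a \<in> triples"
  by (auto simp: aligned_def triples_def)

lemma pt_unique:
  assumes "z \<in> config_space" "i \<noteq> j"
  shows "cmod p = 1 \<and> level (z $ i) p = level (z $ j) p \<and> slope (z $ i) p < slope (z $ j) p \<longleftrightarrow> p = pt z i j"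
  unfolding pt_def using assms config_spaceD[OF assms(1)] by (intro contact_unique) auto

lemma pt_props:
  assumes "z \<in> config_space" "i \<noteq> j"
  shows "cmod (pt z i j) = 1" "level (z $ i) (pt z i j) = level (z $ j) (pt z i j)"
    "slope (z $ i) (pt z i j) < slope (z $ j) (pt z i j)"
  using pt_unique[OF assms, of "pt z i j"] by auto

lemma alignedI:
  assumes "z \<in> config_space" "cmod p = 1" "level (z $ i) p = level (z $ j) p" "level (z $ i) p = level (z $ k) p"
    "slope (z $ i) p < slope (z $ j) p" "slope (z $ j) p < slope (z $ k) p"
  shows "aligned z (i, j, k)" "pt z i j = p" "pt z i k = p" "pt z j k = p"
proof -
  have d: "i \<noteq> j" "i \<noteq> k" "j \<noteq> k" using assms(5,6) by auto
  show "pt z i j = p" "pt z i k = p" "pt z j k = p"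
    using pt_unique[OF assms(1) d(1), of p] pt_unique[OF assms(1) d(2), of p]
      pt_unique[OF assms(1) d(3), of p] assms(2-6) by auto
  then show "aligned z (i, j, k)" using d by (simp add: aligned_def)
qed

lemma alignedD:
  assumes "z \<in> config_space" "aligned z (i, j, k)"
  defines "p \<equiv> pt z i j"
  shows "distinct [i, j, k]" "cmod p = 1" "level (z $ i) p = level (z $ j) p" "level (z $ i) p = level (z $ k) p"
    "slope (z $ i) p < slope (z $ j) p" "slope (z $ j) p < slope (z $ k) p" "pt z i k = p" "pt z j k = p"
proof -
  show d: "distinct [i, j, k]" and jk: "pt z j k = p" using assms(2) by (auto simp: aligned_def p_def)
  have d': "i \<noteq> j" "j \<noteq> k" using d by auto
  show 1: "cmod p = 1" "level (z $ i) p = level (z $ j) p" "slope (z $ i) p < slope (z $ j) p"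
    using pt_props[OF assms(1) d'(1)] by (simp_all add: p_def)
  show 2: "level (z $ i) p = level (z $ k) p" "slope (z $ j) p < slope (z $ k) p"
    using 1 pt_props[OF assms(1) d'(2)] unfolding jk by simp_all
  show "pt z i k = p" by (rule alignedI(3)[OF assms(1) 1(1,2) 2(1) 1(3) 2(2)])
qed

lemma slope_neq_config:
  assumes "z \<in> config_space" "i \<noteq> j" "cmod p = 1" "level (z $ i) p = level (z $ j) p"
  shows "slope (z $ i) p \<noteq> slope (z $ j) p"
  using assms config_spaceD[OF assms(1)] by (intro slope_neq) auto

text \<open>The slopes at \<open>p\<close> are pairwise different, and sorting the indices by slope
  gives the aligned triple.\<close>

lemma ex_aligned:
  assumes "z \<in> config_space" "distinct [i, j, k]" "cmod p = 1"
    "level (z $ i) p = level (z $ j) p" "level (z $ i) p = level (z $ k) p"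
  shows "\<exists>u v w. {u, v, w} = {i, j, k} \<and> aligned z (u, v, w) \<and> pt z u v = p"
proof -
  have C: ?thesis if uvw: "{u, v, w} = {i, j, k}" "slope (z $ u) p < slope (z $ v) p"
    "slope (z $ v) p < slope (z $ w) p" for u v w
  proof -
    have l: "level (z $ x) p = level (z $ i) p" if "x \<in> {u, v, w}" for x
      using that assms(4,5) unfolding uvw(1) by auto
    have "level (z $ u) p = level (z $ v) p" "level (z $ u) p = level (z $ w) p"
      using l[of u] l[of v] l[of w] by simp_all
    from alignedI(1,2)[OF assms(1,3) this uvw(2,3)] uvw(1) show ?thesis by blast
  qed
  have "slope (z $ i) p \<noteq> slope (z $ j) p" "slope (z $ i) p \<noteq> slope (z $ k) p" "slope (z $ j) p \<noteq> slope (z $ k) p"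
    using slope_neq_config[OF assms(1) _ assms(3)] assms(2,4,5) by auto
  then consider "slope (z $ i) p < slope (z $ j) p" "slope (z $ j) p < slope (z $ k) p"
    | "slope (z $ i) p < slope (z $ k) p" "slope (z $ k) p < slope (z $ j) p"
    | "slope (z $ j) p < slope (z $ i) p" "slope (z $ i) p < slope (z $ k) p"
    | "slope (z $ j) p < slope (z $ k) p" "slope (z $ k) p < slope (z $ i) p"
    | "slope (z $ k) p < slope (z $ i) p" "slope (z $ i) p < slope (z $ j) p"
    | "slope (z $ k) p < slope (z $ j) p" "slope (z $ j) p < slope (z $ i) p"
    by linarith
  then show ?thesis by cases (rule C; fast?; assumption)+
qed

lemma critical_iff_level:
  assumes "z \<in> config_space" "distinct [i, j, k]"
  shows "{i, j, k} \<in> critical_triples z \<longleftrightarrow>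
    (\<exists>p. cmod p = 1 \<and> level (z $ i) p = level (z $ j) p \<and> level (z $ i) p = level (z $ k) p)"
proof -
  have c: "card {i, j, k} = 3" using assms(2) by simp
  have "on_tangent_circle (($) z ` {i, j, k}) \<longleftrightarrow>
      (\<exists>p. cmod p = 1 \<and> (\<forall>y\<in>($) z ` {i, j, k}. level y p = level (z $ i) p))"
    by (rule on_tangent_circle_iff) (use config_spaceD[OF assms(1)] in auto)
  with c show ?thesis unfolding critical_triples_def by (auto intro: sym)
qed

lemma aligned_critical:
  assumes "z \<in> config_space" "aligned z a"
  shows "tset a \<in> critical_triples z"
proof -
  obtain i j k where a: "a = (i, j, k)" by (cases a)
  note A = alignedD[OF assms(1) assms(2)[unfolded a]]
  show ?thesis unfolding a tset_def using critical_iff_level[OF assms(1) A(1)] A by auto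
qed

lemma critical_aligned:
  assumes "z \<in> config_space" "T \<in> critical_triples z"
  shows "\<exists>a. aligned z a \<and> tset a = T"
proof -
  have "card T = 3" using assms(2) by (simp add: critical_triples_def)
  then obtain i j k where T: "T = {i, j, k}" "distinct [i, j, k]"
    by (auto simp: card_3_iff)
  then obtain p where "cmod p = 1" "level (z $ i) p = level (z $ j) p" "level (z $ i) p = level (z $ k) p"
    using assms critical_iff_level by blast
  from ex_aligned[OF assms(1) T(2) this] T(1) show ?thesis by (auto simp: tset_def)
qed

lemma horocycle_unique:
  assumes "z \<in> config_space" "distinct [i, j, k]" "cmod p = 1" "cmod q = 1"
    "level (z $ i) p = level (z $ j) p" "level (z $ i) p = level (z $ k) p"
    "level (z $ i) q = level (z $ j) q" "level (z $ i) q = level (z $ k) q"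
  shows "p = q"
  by (rule collinear_hyperboloid[of "z $ i" "z $ j" "z $ k"])
    (use assms config_spaceD[OF assms(1)] in auto)

lemma aligned_levels:
  assumes "z \<in> config_space" "aligned z (i, j, k)" "u \<in> {i, j, k}" "v \<in> {i, j, k}"
  shows "level (z $ u) (pt z i j) = level (z $ v) (pt z i j)"
  using alignedD[OF assms(1,2)] assms(3,4) by auto

text \<open>Three points have only one horocycle, and on it the slopes determine the order.\<close>

lemma aligned_unique:
  assumes "z \<in> config_space" "aligned z a" "aligned z b" "tset a = tset b"
  shows "a = b"
proof -
  obtain i j k i' j' k' where ab: "a = (i, j, k)" "b = (i', j', k')" by (cases a, cases b)
  note A = alignedD[OF assms(1) assms(2)[unfolded ab]] and B = alignedD[OF assms(1) assms(3)[unfolded ab]]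
  have t: "{i, j, k} = {i', j', k'}" using assms(4) by (simp add: ab tset_def)
  have "pt z i j = pt z i' j'"
  proof (rule horocycle_unique[OF assms(1) A(1)])
    have m: "i \<in> {i', j', k'}" "j \<in> {i', j', k'}" "k \<in> {i', j', k'}" using t by auto
    note L = aligned_levels[OF assms(1) assms(3)[unfolded ab]]
    show "level (z $ i) (pt z i' j') = level (z $ j) (pt z i' j')" by (rule L[OF m(1,2)])
    show "level (z $ i) (pt z i' j') = level (z $ k) (pt z i' j')" by (rule L[OF m(1,3)])
  qed (use A B in auto)
  then have s: "slope (z $ i) (pt z i j) < slope (z $ j) (pt z i j)"
    "slope (z $ j) (pt z i j) < slope (z $ k) (pt z i j)"
    "slope (z $ i') (pt z i j) < slope (z $ j') (pt z i j)"
    "slope (z $ j') (pt z i j) < slope (z $ k') (pt z i j)"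
    using A B by auto
  have "i' \<in> {i, j, k}" "j' \<in> {i, j, k}" "k' \<in> {i, j, k}" using t by auto
  then have "i' = i \<and> j' = j \<and> k' = k" using s by auto
  then show ?thesis by (simp add: ab)
qed

text \<open>Makes the description in \<open>ordered_triple\<close> definite: its condition is
  \<open>aligned\<close>, and a single critical set of indices has a single aligned
  ordering.\<close>

lemma ordered_triple_eq:
  assumes "z \<in> config_space" "critical_triples z \<subseteq> {T}" "aligned z a"
  shows "ordered_triple z = a"
proof -
  have iff: "b \<in> triples \<and> (case b of (i, j, k) \<Rightarrow> ccw_on_tangent_circle (z $ i) (z $ j) (z $ k)) \<longleftrightarrow> aligned z b" for b
  proof -
    obtain i j k where b: "b = (i, j, k)" by (cases b)
    have "ccw_on_tangent_circle (z $ i) (z $ j) (z $ k) \<longleftrightarrow> aligned z (i, j, k)"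
    proof
      assume "ccw_on_tangent_circle (z $ i) (z $ j) (z $ k)"
      then show "aligned z (i, j, k)"
        unfolding ccw_on_tangent_circle_iff[OF config_spaceD(1)[OF assms(1)] config_spaceD(1)[OF assms(1)] config_spaceD(1)[OF assms(1)]]
        using alignedI(1)[OF assms(1)] by blast
    next
      assume "aligned z (i, j, k)"
      from alignedD[OF assms(1) this] show "ccw_on_tangent_circle (z $ i) (z $ j) (z $ k)"
        unfolding ccw_on_tangent_circle_iff[OF config_spaceD(1)[OF assms(1)] config_spaceD(1)[OF assms(1)] config_spaceD(1)[OF assms(1)]]
        by blast
    qed
    then show ?thesis using aligned_triples b by auto
  qed
  show ?thesis unfolding ordered_triple_def iff
  proof (rule the_equality)
    show "aligned z a" by (rule assms)
    fix b assume b: "aligned z b"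
    show "b = a"
      using aligned_unique[OF assms(1) b assms(3)] aligned_critical[OF assms(1) b]
        aligned_critical[OF assms(1,3)] assms(2) by auto
  qed
qed

lemma open_config_space: "open (config_space :: (complex ^ 'n) set)"
proof -
  have "(config_space :: (complex ^ 'n) set) =
      (\<Inter>i. {z. z $ i \<in> ball 0 1}) \<inter> (\<Inter>i. \<Inter>j\<in>UNIV - {i}. {z. z $ i \<noteq> z $ j})"
    by (auto simp: config_space_def inj_def)
  moreover have "open {z :: complex ^ 'n. z $ i \<in> ball 0 1}" for i
    unfolding mem_ball_0 by (intro open_Collect_less continuous_intros)
  moreover have "open {z :: complex ^ 'n. z $ i \<noteq> z $ j}" for i j
    by (intro open_Collect_neq continuous_intros)
  ultimately show ?thesis
    by (metis (no_types, lifting) open_Int open_INT finite_UNIV finite_Diff finite)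
qed

lemma continuous_foot_height:
  assumes "continuous_on S f" "\<And>x. x \<in> S \<Longrightarrow> cmod (f x) < 1"
  shows "continuous_on S (\<lambda>x. foot (f x))" "continuous_on S (\<lambda>x. height (f x))"
proof -
  have e: "\<forall>x\<in>S. complex_of_real (1 - (cmod (f x))\<^sup>2) \<noteq> 0" "\<forall>x\<in>S. 1 - (cmod (f x))\<^sup>2 \<noteq> 0"
  proof -
    have "1 - (cmod (f x))\<^sup>2 > 0" if "x \<in> S" for x
      using cmod_less_1[OF assms(2)[OF that]] by simp
    then show "\<forall>x\<in>S. complex_of_real (1 - (cmod (f x))\<^sup>2) \<noteq> 0" "\<forall>x\<in>S. 1 - (cmod (f x))\<^sup>2 \<noteq> 0"
      unfolding of_real_eq_0_iff by force+
  qed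
  show "continuous_on S (\<lambda>x. foot (f x))"
    unfolding foot_def by (intro continuous_intros assms e(1))
  show "continuous_on S (\<lambda>x. height (f x))"
    unfolding height_def by (intro continuous_intros assms e(2))
qed

lemma continuous_on_coord: "continuous_on S (\<lambda>z :: complex ^ 'n. z $ i)"
  by (intro continuous_intros)

lemma continuous_sep:
  "continuous_on (config_space :: (complex ^ 'n) set) (\<lambda>z. sep (z $ i) (z $ j))"
  unfolding sep_def using config_spaceD(1)
  by (intro continuous_intros continuous_foot_height continuous_on_coord) blast+

lemma continuous_pt:
  assumes "i \<noteq> j"
  shows "continuous_on (config_space :: (complex ^ 'n) set) (\<lambda>z. pt z i j)"
proof -
  have "\<forall>z\<in>config_space. cnj (foot (z $ j) - foot (z $ i)) \<noteq> 0"
    using foot_inj config_spaceD assms by fastforce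
  moreover have "Complex a b = of_real a + \<i> * of_real b" for a b
    by (simp add: complex_eq_iff)
  ultimately show ?thesis
    unfolding pt_def contact_def using config_spaceD(1)
    by (auto intro!: continuous_intros continuous_foot_height continuous_on_coord continuous_sep)
qed

section \<open>The wall function\<close>

text \<open>Heron's polynomial \<open>2ab + 2bc + 2ca - a^2 - b^2 - c^2\<close> in the three values
  of \<open>sep\<close>, written with sums over ordered pairs so that it depends on the set
  \<open>T\<close> alone; every pair is counted twice and the diagonal vanishes.\<close>

definition wall :: "complex ^ 'n \<Rightarrow> 'n set \<Rightarrow> real" where
  "wall z T = (\<Sum>i\<in>T. \<Sum>j\<in>T. sep (z $ i) (z $ j))\<^sup>2 / 4 - (\<Sum>i\<in>T. \<Sum>j\<in>T. (sep (z $ i) (z $ j))\<^sup>2)"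

text \<open>Being a product, it can have a simple zero along a path only where exactly one wall is
  crossed, and crossed transversely.\<close>

definition walls :: "complex ^ 'n \<Rightarrow> real" where
  "walls z = (\<Prod>T | card T = 3. wall z T)"

lemma wall_gram:
  assumes "distinct [i, j, k]"
  shows "wall z {i, j, k} = gram (z $ i) (z $ j) (z $ k)"
proof -
  have "sep x x = 0" for x by (simp add: sep_def)
  then show ?thesis using assms
    by (simp add: wall_def gram_def sep_commute[of "z $ j" "z $ i"] sep_commute[of "z $ k" "z $ i"]
        sep_commute[of "z $ k" "z $ j"] power2_eq_square algebra_simps)
qed

lemma wall_side:
  assumes "z \<in> config_space" "distinct [i, j, k]"
  shows "wall z {i, j, k} = - 16 * (cmod (foot (z $ j) - foot (z $ i)))\<^sup>2 *
    side (z $ i) (z $ j) (z $ k) * side (z $ j) (z $ i) (z $ k)"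
  unfolding wall_gram[OF assms(2)] using assms(2) config_spaceD[OF assms(1)]
  by (intro gram_factor) auto

lemma wall_eq_0_iff:
  assumes "z \<in> config_space" "distinct [i, j, k]"
  shows "wall z {i, j, k} = 0 \<longleftrightarrow> side (z $ i) (z $ j) (z $ k) = 0 \<or> side (z $ j) (z $ i) (z $ k) = 0"
  using wall_side[OF assms] foot_inj[of "z $ i" "z $ j"] config_spaceD[OF assms(1)] assms(2) by auto

text \<open>By \<open>contact_cases\<close> a horocycle through the first two points touches the
  absolute at one of their two contact points; the two factors of \<open>wall\<close> test
  these.\<close>

lemma wall_critical:
  assumes "z \<in> config_space" "card T = 3"
  shows "wall z T = 0 \<longleftrightarrow> T \<in> critical_triples z"
proof -
  obtain i j k where T: "T = {i, j, k}" and d: "distinct [i, j, k]"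
    using assms(2) by (auto simp: card_3_iff)
  have ij: "i \<noteq> j" "j \<noteq> i" using d by auto
  have c: "cmod (z $ i) < 1" "cmod (z $ j) < 1" "z $ i \<noteq> z $ j" using config_spaceD[OF assms(1)] d by auto
  have s: "side (z $ i) (z $ j) (z $ k) = 0 \<longleftrightarrow> level (z $ i) (pt z i j) = level (z $ k) (pt z i j)"
    "side (z $ j) (z $ i) (z $ k) = 0 \<longleftrightarrow> level (z $ i) (pt z j i) = level (z $ k) (pt z j i)"
    using pt_props(2)[OF assms(1) ij(2)] by (auto simp: side_def pt_def)
  have "(\<exists>p. cmod p = 1 \<and> level (z $ i) p = level (z $ j) p \<and> level (z $ i) p = level (z $ k) p) \<longleftrightarrow>
     level (z $ i) (pt z i j) = level (z $ k) (pt z i j) \<or> level (z $ i) (pt z j i) = level (z $ k) (pt z j i)"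
    using contact_cases[OF c] pt_props[OF assms(1) ij(1)] pt_props[OF assms(1) ij(2)] unfolding pt_def by metis
  then show ?thesis
    unfolding T wall_eq_0_iff[OF assms(1) d] critical_iff_level[OF assms(1) d] s by simp
qed

lemma walls_eq_0_iff:
  fixes z :: "complex ^ 'n"
  assumes "z \<in> config_space"
  shows "walls z = 0 \<longleftrightarrow> critical_triples z \<noteq> {}"
proof -
  have "finite {T :: 'n set. card T = 3}" by (rule finite_subset[OF subset_UNIV]) simp
  then have "walls z = 0 \<longleftrightarrow> (\<exists>T. card T = 3 \<and> wall z T = 0)" unfolding walls_def by auto
  then show ?thesis using wall_critical[OF assms] by (auto simp: critical_triples_def)
qed

lemma continuous_wall: "continuous_on (config_space :: (complex ^ 'n) set) (\<lambda>z. wall z T)"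
  unfolding wall_def by (intro continuous_intros continuous_sep) auto

section \<open>The local arrangement of levels\<close>

lemma level_deriv:
  "((\<lambda>t. level x (p * cis t)) has_real_derivative slope x (p * cis t)) (at t)"
proof -
  define q where "q = foot x * cnj p"
  have eqs: "level x (p * cis t) = height x - 2 * (Re q * cos t + Im q * sin t)"
    "slope x (p * cis t) = - 2 * (Im q * cos t - Re q * sin t)" for t
    by (simp_all add: level_def slope_def q_def algebra_simps)
  show ?thesis unfolding eqs by (auto intro!: derivative_eq_intros simp: algebra_simps)
qed

text \<open>The angle by which a contact point has moved between \<open>z\<close> and
  \<open>y\<close>; it serves as a coordinate while it stays away from the branch cut of
  \<open>Arg\<close>.\<close>

definition ang :: "complex ^ 'n \<Rightarrow> complex ^ 'n \<Rightarrow> 'n \<Rightarrow> 'n \<Rightarrow> real" where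
  "ang z y i j = Arg (pt y i j * cnj (pt z i j))"

text \<open>\<open>steep\<close> makes the difference of two levels strictly monotone on the arc of
  half-width \<open>e\<close> about a contact point of \<open>z\<close>, so that it has a single
  crossing there. \<open>apart\<close> keeps different contact points of \<open>z\<close> from
  merging, so that only triples aligned at \<open>z\<close> can be aligned somewhere in
  \<open>N\<close>.\<close>

locale chart =
  fixes z :: "complex ^ 'n" and N :: "(complex ^ 'n) set" and e :: real
  assumes z: "z \<in> config_space"
    and N: "open N" "z \<in> N" "N \<subseteq> config_space"
    and e: "0 < e" "e < pi"
    and small: "\<And>y i j. y \<in> N \<Longrightarrow> i \<noteq> j \<Longrightarrow> \<bar>ang z y i j\<bar> < e"
    and apart: "\<And>y i j k l. y \<in> N \<Longrightarrow> i \<noteq> j \<Longrightarrow> k \<noteq> l \<Longrightarrow> pt z i j \<noteq> pt z k l \<Longrightarrow> pt y i j \<noteq> pt y k l"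
    and steep: "\<And>y i j t. y \<in> N \<Longrightarrow> i \<noteq> j \<Longrightarrow> \<bar>t\<bar> \<le> e \<Longrightarrow>
      slope (y $ i) (pt z i j * cis t) < slope (y $ j) (pt z i j * cis t)"
begin

lemma in_config: "y \<in> N \<Longrightarrow> y \<in> config_space"
  using N by blast

lemma pt_cis:
  assumes "y \<in> N" "i \<noteq> j"
  shows "pt y i j = pt z i j * cis (ang z y i j)"
proof -
  have 1: "cmod (pt z i j) = 1" "cmod (pt y i j) = 1"
    using pt_props(1) z in_config assms by blast+
  then have "pt y i j * cnj (pt z i j) \<noteq> 0" by auto
  then have "cis (ang z y i j) = pt y i j * cnj (pt z i j)"
    unfolding ang_def using cis_Arg[of "pt y i j * cnj (pt z i j)"] 1 by (simp add: sgn_div_norm norm_mult)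
  moreover have "pt z i j * cnj (pt z i j) = 1"
    using 1 by (simp add: complex_norm_square[symmetric])
  ultimately show ?thesis by (simp add: mult.left_commute)
qed

lemma ang_eq_iff:
  assumes "y \<in> N" "i \<noteq> j" "k \<noteq> l" "pt z i j = pt z k l"
  shows "ang z y i j = ang z y k l \<longleftrightarrow> pt y i j = pt y k l"
proof
  assume "pt y i j = pt y k l"
  then show "ang z y i j = ang z y k l" using assms(4) by (simp add: ang_def)
next
  assume "ang z y i j = ang z y k l"
  then show "pt y i j = pt y k l" using pt_cis assms by metis
qed

text \<open>The difference of the levels increases by \<open>steep\<close> and vanishes at
  \<open>ang z y i j\<close>.\<close>

lemma level_order:
  assumes "y \<in> N" "i \<noteq> j" "\<bar>t\<bar> < e"
  defines "q \<equiv> pt z i j * cis t"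
  shows "level (y $ i) q < level (y $ j) q \<longleftrightarrow> ang z y i j < t"
    "level (y $ i) q = level (y $ j) q \<longleftrightarrow> ang z y i j = t"
    "level (y $ i) q > level (y $ j) q \<longleftrightarrow> ang z y i j > t"
proof -
  define f where "f = (\<lambda>t. level (y $ j) (pt z i j * cis t) - level (y $ i) (pt z i j * cis t))"
  have mono: "f a < f b" if "a < b" "\<bar>a\<bar> < e" "\<bar>b\<bar> < e" for a b
  proof (rule DERIV_pos_imp_increasing[OF that(1)])
    fix t assume t: "a \<le> t" "t \<le> b"
    have "(f has_real_derivative slope (y $ j) (pt z i j * cis t) - slope (y $ i) (pt z i j * cis t)) (at t)"
      unfolding f_def by (intro DERIV_diff level_deriv)
    moreover have "slope (y $ i) (pt z i j * cis t) < slope (y $ j) (pt z i j * cis t)"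
      by (rule steep[OF assms(1,2)]) (use t that in auto)
    ultimately show "\<exists>D. (f has_real_derivative D) (at t) \<and> 0 < D" by (intro exI conjI) auto
  qed
  have a: "\<bar>ang z y i j\<bar> < e" by (rule small[OF assms(1,2)])
  have "level (y $ i) (pt y i j) = level (y $ j) (pt y i j)"
    by (rule pt_props(2)[OF in_config[OF assms(1)] assms(2)])
  then have 0: "f (ang z y i j) = 0" unfolding f_def pt_cis[OF assms(1,2), symmetric] by simp
  have "f t > 0 \<longleftrightarrow> ang z y i j < t" "f t = 0 \<longleftrightarrow> ang z y i j = t" "f t < 0 \<longleftrightarrow> ang z y i j > t"
    using mono[OF _ a assms(3)] mono[OF _ assms(3) a] 0 by (cases "ang z y i j" t rule: linorder_cases; force)+
  then show "level (y $ i) q < level (y $ j) q \<longleftrightarrow> ang z y i j < t"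
    "level (y $ i) q = level (y $ j) q \<longleftrightarrow> ang z y i j = t"
    "level (y $ i) q > level (y $ j) q \<longleftrightarrow> ang z y i j > t"
    by (auto simp: f_def q_def)
qed

text \<open>Evaluate the three levels at the crossing of \<open>i\<close> and \<open>k\<close>:
  there \<open>i\<close> and \<open>k\<close> agree, so comparing \<open>j\<close> with
  \<open>i\<close> is the same as comparing it with \<open>k\<close>, which relates the crossing
  \<open>ij\<close> to the crossing \<open>jk\<close>.\<close>

lemma triple_trichotomy:
  assumes "aligned z (i, j, k)" "y \<in> N"
  defines "a \<equiv> ang z y i j" and "b \<equiv> ang z y i k" and "c \<equiv> ang z y j k"
  shows "a < b \<and> b < c \<or> a = b \<and> b = c \<or> a > b \<and> b > c"
proof -
  note A = alignedD[OF z assms(1)]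
  have d: "i \<noteq> j" "i \<noteq> k" "j \<noteq> k" using A(1) by auto
  define p where "p = pt z i j"
  have p: "pt z i k = p" "pt z j k = p" "pt z i j = p" using A by (simp_all add: p_def)
  have s: "\<bar>a\<bar> < e" "\<bar>b\<bar> < e" "\<bar>c\<bar> < e" unfolding a_def b_def c_def using small[OF assms(2)] d by auto
  have 2: "level (y $ i) (p * cis b) = level (y $ k) (p * cis b)"
    using level_order(2)[OF assms(2) d(2) s(2)] by (simp add: b_def p)
  note ij = level_order[OF assms(2) d(1) s(2), unfolded p, folded a_def]
  note jk = level_order[OF assms(2) d(3) s(2), unfolded p, folded c_def]
  have "a < b \<longleftrightarrow> b < c" using ij(1) jk(3) unfolding 2 by blast
  moreover have "a = b \<longleftrightarrow> b = c" using ij(2) jk(2) unfolding 2 by auto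
  ultimately show ?thesis by linarith
qed

text \<open>At the crossing of \<open>i\<close> and \<open>j\<close> the level of \<open>k\<close>
  is the lower one exactly when its crossing with \<open>i\<close> comes later; by the trichotomy
  this is also the order of \<open>ij\<close> and \<open>jk\<close>.\<close>

lemma side_sign:
  assumes "aligned z (i, j, k)" "y \<in> N"
  shows "side (y $ i) (y $ j) (y $ k) < 0 \<longleftrightarrow> ang z y i j < ang z y j k"
    "side (y $ i) (y $ j) (y $ k) = 0 \<longleftrightarrow> ang z y i j = ang z y j k"
proof -
  note A = alignedD[OF z assms(1)]
  have d: "i \<noteq> j" "i \<noteq> k" "j \<noteq> k" using A(1) by auto
  note s = small[OF assms(2) d(1)]
  have "side (y $ i) (y $ j) (y $ k) = level (y $ k) (pt y i j) - level (y $ i) (pt y i j)"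
    by (simp add: side_def pt_def)
  also have "pt y i j = pt z i k * cis (ang z y i j)" using pt_cis[OF assms(2) d(1)] A(7) by simp
  finally have "side (y $ i) (y $ j) (y $ k) < 0 \<longleftrightarrow> ang z y i j < ang z y i k"
    "side (y $ i) (y $ j) (y $ k) = 0 \<longleftrightarrow> ang z y i j = ang z y i k"
    using level_order[OF assms(2) d(2) s] by linarith+
  with triple_trichotomy[OF assms] show "side (y $ i) (y $ j) (y $ k) < 0 \<longleftrightarrow> ang z y i j < ang z y j k"
    "side (y $ i) (y $ j) (y $ k) = 0 \<longleftrightarrow> ang z y i j = ang z y j k" by linarith+
qed

lemma aligned_iff_ang:
  assumes "aligned z (i, j, k)" "y \<in> N"
  shows "aligned y (i, j, k) \<longleftrightarrow> ang z y i j = ang z y j k"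
  using ang_eq_iff[OF assms(2), of i j j k] alignedD[OF z assms(1)] by (auto simp: aligned_def)

lemma aligned_base:
  assumes "y \<in> N" "aligned y a"
  shows "aligned z a"
  using assms apart[OF assms(1)] by (auto simp: aligned_def)

lemma continuous_ang:
  assumes "i \<noteq> j"
  shows "continuous_on N (\<lambda>y. ang z y i j)"
proof (unfold ang_def, rule continuous_on_compose2[of "- \<real>\<^sub>\<le>\<^sub>0" Arg])
  show "continuous_on (- \<real>\<^sub>\<le>\<^sub>0) Arg" by (intro continuous_at_imp_continuous_on ballI continuous_at_Arg) auto
  show "continuous_on N (\<lambda>y. pt y i j * cnj (pt z i j))"
    by (intro continuous_intros continuous_on_subset[OF continuous_pt[OF assms] N(3)])
  show "(\<lambda>y. pt y i j * cnj (pt z i j)) ` N \<subseteq> - \<real>\<^sub>\<le>\<^sub>0"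
  proof clarify
    fix y assume y: "y \<in> N" "pt y i j * cnj (pt z i j) \<in> \<real>\<^sub>\<le>\<^sub>0"
    have "cmod (pt y i j * cnj (pt z i j)) = 1"
      using pt_props(1)[OF z assms] pt_props(1)[OF in_config[OF y(1)] assms] by (simp add: norm_mult)
    \<comment> \<open>The only point of the unit circle on the branch cut; the angle there is
      \<open>pi\<close>, which exceeds \<open>e\<close>.\<close>
    then have "pt y i j * cnj (pt z i j) = - 1"
      using y(2) by (elim nonpos_Reals_cases) auto
    then have "ang z y i j = pi" using Arg_eq_pi[of "- 1"] by (simp add: ang_def)
    then show False using small[OF y(1) assms] e by simp
  qed
qed

end

text \<open>All conditions are open and concern finitely many pairs. Only \<open>steep\<close>
  quantifies over an interval; continuity in \<open>(y, t)\<close> together and a product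
  neighbourhood give it with a uniform width.\<close>

lemma ex_chart:
  fixes z :: "complex ^ 'n"
  assumes "z \<in> config_space"
  shows "\<exists>N e. chart z N e"
proof -
  have ev_config: "eventually (\<lambda>y. y \<in> config_space) (nhds z)"
    using open_config_space assms by (rule eventually_nhds_in_open)
  have pt_lim: "((\<lambda>y. pt y i j) \<longlongrightarrow> pt z i j) (nhds z)" if "i \<noteq> j" for i j
  proof -
    have "isCont (\<lambda>y. pt y i j) z"
      using continuous_pt[OF that] open_config_space assms continuous_on_eq_continuous_at by blast
    then show ?thesis using tendsto_at_iff_tendsto_nhds[of "\<lambda>y. pt y i j" z] by (simp add: isCont_def)
  qed
  have steep_lim: "\<exists>d>0. eventually (\<lambda>y. \<forall>t. \<bar>t\<bar> \<le> d \<longrightarrow>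
      slope (y $ i) (pt z i j * cis t) < slope (y $ j) (pt z i j * cis t)) (nhds z)" if ij: "i \<noteq> j" for i j
  proof -
    define g where "g = (\<lambda>(y :: complex ^ 'n, t). slope (y $ j) (pt z i j * cis t) - slope (y $ i) (pt z i j * cis t))"
    have "continuous_on (config_space \<times> UNIV) (\<lambda>y :: (complex ^ 'n) \<times> real. foot (fst y $ l))" for l
      by (rule continuous_foot_height(1)) (auto intro!: continuous_intros simp: config_spaceD(1))
    then have "continuous_on (config_space \<times> UNIV) g"
      unfolding g_def slope_def split_beta by (intro continuous_intros)
    moreover have "open ((config_space :: (complex ^ 'n) set) \<times> (UNIV :: real set))"
      by (intro open_Times open_config_space open_UNIV)
    moreover have "g (z, 0) > 0" using pt_props(3)[OF assms ij] by (simp add: g_def)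
    ultimately have "open ((config_space \<times> UNIV) \<inter> g -` {0<..})" "(z, 0) \<in> (config_space \<times> UNIV) \<inter> g -` {0<..}"
      using assms by (auto intro: continuous_open_preimage)
    then obtain A B where AB: "open A" "open B" "z \<in> A" "0 \<in> B" "A \<times> B \<subseteq> (config_space \<times> UNIV) \<inter> g -` {0<..}"
      by (rule open_prod_elim) (auto simp: mem_Times_iff)
    obtain d where d: "d > 0" "cball 0 d \<subseteq> B" using AB(2,4) open_contains_cball by blast
    have "eventually (\<lambda>y. y \<in> A) (nhds z)" using AB by (intro eventually_nhds_in_open)
    then have "eventually (\<lambda>y. \<forall>t. \<bar>t\<bar> \<le> d \<longrightarrow>
      slope (y $ i) (pt z i j * cis t) < slope (y $ j) (pt z i j * cis t)) (nhds z)"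
    proof (rule eventually_mono, intro allI impI)
      fix y t assume "y \<in> A" "\<bar>t\<bar> \<le> d"
      then have "t \<in> B" using subsetD[OF d(2), of t] by simp
      then have "(y, t) \<in> (config_space \<times> UNIV) \<inter> g -` {0<..}" using AB(5) \<open>y \<in> A\<close> by blast
      then show "slope (y $ i) (pt z i j * cis t) < slope (y $ j) (pt z i j * cis t)" by (simp add: g_def)
    qed
    with d(1) show ?thesis by blast
  qed
  define P where "P = {(i :: 'n, j). i \<noteq> j}"
  have finP: "finite P" by (rule finite_subset[OF subset_UNIV]) simp
  have "\<forall>x. \<exists>d. x \<in> P \<longrightarrow> d > 0 \<and> eventually (\<lambda>y. \<forall>t. \<bar>t\<bar> \<le> d \<longrightarrow>
      slope (y $ fst x) (pt z (fst x) (snd x) * cis t) < slope (y $ snd x) (pt z (fst x) (snd x) * cis t)) (nhds z)"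
  proof
    fix x :: "'n \<times> 'n"
    show "\<exists>d. x \<in> P \<longrightarrow> d > 0 \<and> eventually (\<lambda>y. \<forall>t. \<bar>t\<bar> \<le> d \<longrightarrow>
      slope (y $ fst x) (pt z (fst x) (snd x) * cis t) < slope (y $ snd x) (pt z (fst x) (snd x) * cis t)) (nhds z)"
    proof (cases "x \<in> P")
      case True
      then have "fst x \<noteq> snd x" by (auto simp: P_def)
      from steep_lim[OF this] show ?thesis by blast
    qed simp
  qed
  from choice[OF this] obtain d where d0: "\<forall>x. x \<in> P \<longrightarrow> d x > 0 \<and> eventually (\<lambda>y. \<forall>t. \<bar>t\<bar> \<le> d x \<longrightarrow>
      slope (y $ fst x) (pt z (fst x) (snd x) * cis t) < slope (y $ snd x) (pt z (fst x) (snd x) * cis t)) (nhds z)"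
    by (rule exE)
  have d: "d x > 0" "eventually (\<lambda>y. \<forall>t. \<bar>t\<bar> \<le> d x \<longrightarrow>
      slope (y $ fst x) (pt z (fst x) (snd x) * cis t) < slope (y $ snd x) (pt z (fst x) (snd x) * cis t)) (nhds z)"
    if "x \<in> P" for x using conjunct1[OF mp[OF spec[OF d0] that]] conjunct2[OF mp[OF spec[OF d0] that]] .
  \<comment> \<open>The 1 keeps \<open>e\<close> below \<open>pi\<close>.\<close>
  define e where "e = Min (insert 1 (d ` P))"
  have e: "e > 0" "e \<le> 1" "\<And>x. x \<in> P \<Longrightarrow> e \<le> d x"
    using finP d(1) by (auto simp: e_def)
  have "eventually (\<lambda>y. \<forall>x\<in>P. \<forall>t. \<bar>t\<bar> \<le> d x \<longrightarrow>
      slope (y $ fst x) (pt z (fst x) (snd x) * cis t) < slope (y $ snd x) (pt z (fst x) (snd x) * cis t)) (nhds z)"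
    using d(2) finP by (simp add: eventually_ball_finite_distrib)
  moreover have "eventually (\<lambda>y. \<forall>x\<in>P. \<bar>ang z y (fst x) (snd x)\<bar> < e) (nhds z)"
    unfolding eventually_ball_finite_distrib[OF finP]
  proof
    fix x assume "x \<in> P"
    then have ij: "fst x \<noteq> snd x" by (auto simp: P_def)
    have u: "pt z (fst x) (snd x) * cnj (pt z (fst x) (snd x)) = 1"
      using pt_props(1)[OF assms ij] by (simp add: complex_norm_square[symmetric])
    have "((\<lambda>y. pt y (fst x) (snd x) * cnj (pt z (fst x) (snd x))) \<longlongrightarrow> 1) (nhds z)"
      using tendsto_mult[OF pt_lim[OF ij] tendsto_const[of "cnj (pt z (fst x) (snd x))"]] unfolding u .
    moreover have "isCont Arg 1" by (rule continuous_at_Arg) (simp add: complex_nonpos_Reals_iff)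
    ultimately have "((\<lambda>y. ang z y (fst x) (snd x)) \<longlongrightarrow> Arg 1) (nhds z)"
      unfolding ang_def by (rule isCont_tendsto_compose[rotated])
    then have "((\<lambda>y. ang z y (fst x) (snd x)) \<longlongrightarrow> 0) (nhds z)" by simp
    then show "eventually (\<lambda>y. \<bar>ang z y (fst x) (snd x)\<bar> < e) (nhds z)"
      using e(1) by (auto dest!: tendstoD simp: dist_real_def)
  qed
  moreover have "eventually (\<lambda>y. \<forall>x\<in>P. \<forall>x'\<in>P. pt z (fst x) (snd x) \<noteq> pt z (fst x') (snd x') \<longrightarrow>
      pt y (fst x) (snd x) \<noteq> pt y (fst x') (snd x')) (nhds z)"
    unfolding eventually_ball_finite_distrib[OF finP]
  proof (intro ballI)
    fix x x' assume "x \<in> P" "x' \<in> P"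
    then have ij: "fst x \<noteq> snd x" "fst x' \<noteq> snd x'" by (auto simp: P_def)
    show "eventually (\<lambda>y. pt z (fst x) (snd x) \<noteq> pt z (fst x') (snd x') \<longrightarrow>
      pt y (fst x) (snd x) \<noteq> pt y (fst x') (snd x')) (nhds z)"
    proof (cases "pt z (fst x) (snd x) = pt z (fst x') (snd x')")
      case False
      have "((\<lambda>y. pt y (fst x) (snd x) - pt y (fst x') (snd x')) \<longlongrightarrow>
          pt z (fst x) (snd x) - pt z (fst x') (snd x')) (nhds z)"
        by (intro tendsto_diff pt_lim ij)
      from tendsto_imp_eventually_ne[OF this, of 0] False show ?thesis
        by (auto elim: eventually_mono)
    qed auto
  qed
  ultimately have "eventually (\<lambda>y. y \<in> config_space \<and> (\<forall>x\<in>P. \<forall>t. \<bar>t\<bar> \<le> d x \<longrightarrow>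
      slope (y $ fst x) (pt z (fst x) (snd x) * cis t) < slope (y $ snd x) (pt z (fst x) (snd x) * cis t)) \<and>
      (\<forall>x\<in>P. \<bar>ang z y (fst x) (snd x)\<bar> < e) \<and>
      (\<forall>x\<in>P. \<forall>x'\<in>P. pt z (fst x) (snd x) \<noteq> pt z (fst x') (snd x') \<longrightarrow>
      pt y (fst x) (snd x) \<noteq> pt y (fst x') (snd x'))) (nhds z)"
    (is "eventually ?Q _")
    using ev_config by (simp only: eventually_conj_iff)
  from iffD1[OF eventually_nhds this] obtain N where "open N \<and> z \<in> N \<and> (\<forall>y\<in>N. ?Q y)"
    by (rule exE)
  note QN = this
  have N: "open N" "z \<in> N" using conjunct1[OF QN] conjunct1[OF conjunct2[OF QN]] .
  have NP: "?Q y" if "y \<in> N" for y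
    by (rule bspec[OF conjunct2[OF conjunct2[OF QN]] that])
  have "chart z N e"
  proof unfold_locales
    show "e < pi" using e(2) pi_gt3 by simp
    show "N \<subseteq> config_space" using NP by blast
    fix y i j assume y: "y \<in> N" and ij: "i \<noteq> (j :: 'n)"
    have P: "(i, j) \<in> P" using ij by (simp add: P_def)
    show "\<bar>ang z y i j\<bar> < e"
      using bspec[OF conjunct1[OF conjunct2[OF conjunct2[OF NP[OF y]]]] P] by simp
    show "slope (y $ i) (pt z i j * cis t) < slope (y $ j) (pt z i j * cis t)" if "\<bar>t\<bar> \<le> e" for t
    proof -
      have "\<bar>t\<bar> \<le> d (i, j)" using that e(3)[OF P] by simp
      then show ?thesis using spec[OF bspec[OF conjunct1[OF conjunct2[OF NP[OF y]]] P], of t] by simp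
    qed
    show "pt y i j \<noteq> pt y k l" if "k \<noteq> l" "pt z i j \<noteq> pt z k l" for k l
    proof -
      have "(k, l) \<in> P" using that by (simp add: P_def)
      from bspec[OF bspec[OF conjunct2[OF conjunct2[OF conjunct2[OF NP[OF y]]]] P] this] that(2)
      show ?thesis by simp
    qed
  qed (use assms N e in auto)
  then show ?thesis by blast
qed

section \<open>Local potentials\<close>

lemma sorted_wrt_concat_map:
  assumes "sorted_wrt (\<lambda>b c. \<forall>x\<in>set (f b). \<forall>y\<in>set (f c). Q x y) bs" "\<forall>b\<in>set bs. sorted_wrt Q (f b)"
  shows "sorted_wrt Q (concat (map f bs))"
  using assms by (induction bs) (auto simp: sorted_wrt_append)

lemma listingI:
  assumes "set as = A" "sorted_wrt (\<lambda>a b. a \<noteq> b \<and> (independent a b \<or> r a b)) as"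
  shows "listing r A as"
proof -
  have "distinct as" using assms(2) by (induction as) auto
  moreover have "sorted_wrt (\<lambda>a b. independent a b \<or> r a b) as"
    by (rule sorted_wrt_mono_rel[OF _ assms(2)]) simp
  ultimately show ?thesis using assms(1) by (simp add: listing_def)
qed

text \<open>The letter \<open>(i, j, k)\<close> moves through the word block by block:
  \<open>G3_exchange\<close> reverses a block that belongs to an index \<open>l\<close>, and an
  independent letter commutes. Membership in \<open>triples\<close> is carried along for the
  induction.\<close>

lemma block_exchange:
  assumes "distinct [i, j, k]"
    and "\<forall>b\<in>set bs. (\<exists>l. f b = [(i, j, l), (i, k, l), (j, k, l)] \<and> distinct [i, j, k, l]) \<or>
      (f b = [b] \<and> independent b (i, j, k) \<and> b \<in> triples)"
  shows "G3_gen (i, j, k) \<otimes>\<^bsub>G3\<^esub> lprod (concat (map f bs)) =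
      lprod (concat (map (\<lambda>b. rev (f b)) bs)) \<otimes>\<^bsub>G3\<^esub> G3_gen (i, j, k) \<and>
    set (concat (map f bs)) \<subseteq> triples"
  using assms(2)
proof (induction bs)
  case Nil
  then show ?case using assms(1) by (simp add: triples_def)
next
  case (Cons b bs)
  let ?a = "G3_gen (i, j, k)" and ?X = "lprod (concat (map f bs))"
  let ?Y = "lprod (concat (map (\<lambda>b. rev (f b)) bs))"
  have IH: "?a \<otimes>\<^bsub>G3\<^esub> ?X = ?Y \<otimes>\<^bsub>G3\<^esub> ?a" "set (concat (map f bs)) \<subseteq> triples" using Cons by simp_all
  have sub: "set (concat (map (\<lambda>b. rev (f b)) bs)) \<subseteq> triples" using IH(2) by simp
  have a: "(i, j, k) \<in> triples" "?a \<in> carrier G3" using assms(1) by (simp_all add: triples_def)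
  have fb: "set (f b) \<subseteq> triples" using Cons.prems by (auto simp: triples_def)
  have ex: "?a \<otimes>\<^bsub>G3\<^esub> lprod (f b) = lprod (rev (f b)) \<otimes>\<^bsub>G3\<^esub> ?a"
  proof (cases "\<exists>l. f b = [(i, j, l), (i, k, l), (j, k, l)] \<and> distinct [i, j, k, l]")
    case True
    then obtain l where l: "f b = [(i, j, l), (i, k, l), (j, k, l)]" "distinct [i, j, k, l]" by blast
    have "rev (f b) = [(j, k, l), (i, k, l), (i, j, l)]" by (simp add: l(1))
    with G3_exchange[OF l(2)] show ?thesis unfolding l(1) by (simp only:)
  next
    case False
    then have b: "f b = [b]" "independent b (i, j, k)" "b \<in> triples" using Cons.prems by auto
    have "lprod [b] \<otimes>\<^bsub>G3\<^esub> ?a = ?a \<otimes>\<^bsub>G3\<^esub> lprod [b]"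
      by (rule lprod_move_front) (use a b in auto)
    then show ?thesis by (simp add: b(1))
  qed
  have c: "lprod (f b) \<in> carrier G3" "lprod (rev (f b)) \<in> carrier G3" "?X \<in> carrier G3" "?Y \<in> carrier G3"
    using fb IH(2) sub by (auto intro!: lprod_closed)
  have "?a \<otimes>\<^bsub>G3\<^esub> lprod (concat (map f (b # bs))) = (?a \<otimes>\<^bsub>G3\<^esub> lprod (f b)) \<otimes>\<^bsub>G3\<^esub> ?X"
    using fb IH(2) a c by (simp add: lprod_append G3.m_assoc)
  also have "\<dots> = lprod (rev (f b)) \<otimes>\<^bsub>G3\<^esub> (?a \<otimes>\<^bsub>G3\<^esub> ?X)"
    unfolding ex using a c by (simp add: G3.m_assoc)
  also have "\<dots> = (lprod (rev (f b)) \<otimes>\<^bsub>G3\<^esub> ?Y) \<otimes>\<^bsub>G3\<^esub> ?a"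
    unfolding IH(1) using a c by (simp add: G3.m_assoc)
  also have "lprod (rev (f b)) \<otimes>\<^bsub>G3\<^esub> ?Y = lprod (concat (map (\<lambda>b. rev (f b)) (b # bs)))"
    using fb sub by (simp add: lprod_append)
  finally show ?case using fb IH(2) by simp
qed

text \<open>
  On the horocycle shared by a cluster of points of \<open>z\<close>, the points are ordered by their slopes.  Near \<open>z\<close>
  the levels of two of them agree at the angle \<open>ang z y i j\<close>, so that \<open>y\<close> determines an arrangement of
  graphs, and a triple \<open>i, j, k\<close> is inverted when its three crossings occur in the order \<open>ij, ik, jk\<close>.
  The potential multiplies the inverted triples in the order of the slope of the last index, and for the
  same last index in the order of the crossings \<open>ij\<close>.
\<close>

context chart
begin

definition rank :: "'n \<times> 'n \<times> 'n \<Rightarrow> real" where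
  "rank = (\<lambda>(i, j, k). slope (z $ k) (pt z i j))"

definition key :: "complex ^ 'n \<Rightarrow> 'n \<times> 'n \<times> 'n \<Rightarrow> real" where
  "key y = (\<lambda>(i, j, k). ang z y i j)"

definition ord :: "complex ^ 'n \<Rightarrow> 'n \<times> 'n \<times> 'n \<Rightarrow> 'n \<times> 'n \<times> 'n \<Rightarrow> bool" where
  "ord y a b \<longleftrightarrow> rank a < rank b \<or> rank a = rank b \<and> key y a < key y b"

definition inverted :: "complex ^ 'n \<Rightarrow> ('n \<times> 'n \<times> 'n) set" where
  "inverted y = {(i, j, k). aligned z (i, j, k) \<and> ang z y i j < ang z y j k}"

text \<open>The choice of the listing does not affect the product. Where dependent letters tie there
  may be no listing and the value is arbitrary; \<open>tie\<close> excludes this at regular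
  configurations.\<close>

definition potential :: "complex ^ 'n \<Rightarrow> ('n \<times> 'n \<times> 'n) word set" where
  "potential y = lprod (SOME as. listing (ord y) (inverted y) as)"

lemma ord_asymp: "asymp (ord y)"
  by (auto simp: asymp_on_def ord_def)

lemma ord_transp: "transp (ord y)"
  by (auto simp: transp_on_def ord_def)

lemma inverted_aligned: "a \<in> inverted y \<Longrightarrow> aligned z a"
  unfolding inverted_def by fastforce

lemma inverted_triples: "inverted y \<subseteq> triples"
  by (rule subsetI, erule aligned_triples[OF inverted_aligned])

lemma potential_eq: "listing (ord y) (inverted y) as \<Longrightarrow> potential y = lprod as"
  unfolding potential_def
  by (rule lprod_listing_unique[OF someI _ inverted_triples ord_asymp])

lemma potential_closed:
  assumes "listing (ord y) (inverted y) as"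
  shows "potential y \<in> carrier G3"
proof -
  have "set as \<subseteq> triples" using assms inverted_triples by (simp add: listing_def)
  then show ?thesis unfolding potential_eq[OF assms] by (rule lprod_closed)
qed

lemma shared_base:
  assumes "aligned z (p, q, r)" "aligned z (p', q', r')" "\<not> independent (p, q, r) (p', q', r')"
  shows "pt z p q = pt z p' q'"
  using alignedD(7,8)[OF z assms(1)] alignedD(7,8)[OF z assms(2)] assms(3) by (auto simp: pairs_of_def)

text \<open>Dependent letters share a contact point of \<open>z\<close>, and on its horocycle
  different indices have different slopes.\<close>

lemma same_rank:
  assumes "aligned z (p, q, r)" "aligned z (p', q', r')" "\<not> independent (p, q, r) (p', q', r')"
    "rank (p, q, r) = rank (p', q', r')"
  shows "r = r'"
proof (rule ccontr)
  assume "r \<noteq> r'"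
  note b = shared_base[OF assms(1-3)]
  have "{p, q, r} \<inter> {p', q', r'} \<noteq> {}" using assms(3) by (auto simp: pairs_of_def)
  then obtain u where u: "u \<in> {p, q, r}" "u \<in> {p', q', r'}" by blast
  have "level (z $ r) (pt z p q) = level (z $ u) (pt z p q)"
    using aligned_levels[OF z assms(1) _ u(1)] by simp
  moreover have "level (z $ u) (pt z p q) = level (z $ r') (pt z p q)"
    unfolding b using aligned_levels[OF z assms(2) u(2)] by simp
  ultimately have "slope (z $ r) (pt z p q) \<noteq> slope (z $ r') (pt z p q)"
    using slope_neq_config[OF z \<open>r \<noteq> r'\<close>] alignedD(2)[OF z assms(1)] by simp
  then show False using assms(4) by (simp add: rank_def b)
qed

text \<open>Equal keys mean that the crossings \<open>pq\<close> and \<open>p'q'\<close> coincide at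
  \<open>y\<close>. Having the same last index, the two dependent letters also share one of the
  other indices, so three graphs meet at that point and some triple is aligned.\<close>

lemma tie:
  assumes y: "y \<in> N" and a: "aligned z (p, q, r)" "aligned z (p', q', r')"
    and ni: "\<not> independent (p, q, r) (p', q', r')" and ne: "(p, q, r) \<noteq> (p', q', r')"
    and rk: "rank (p, q, r) = rank (p', q', r')" and ky: "key y (p, q, r) = key y (p', q', r')"
  shows "r = r'" "\<exists>u v w. aligned y (u, v, w) \<and> {u, v, w} = {p, q, p', q'} \<and> pt y u v = pt y p q \<and> pt y p' q' = pt y p q"
proof -
  show r: "r = r'" by (rule same_rank[OF a ni rk])
  note b = shared_base[OF a ni] and yc = in_config[OF y]
  have d: "p \<noteq> q" "p' \<noteq> q'" "r \<notin> {p, q}" "r' \<notin> {p', q'}" using alignedD(1)[OF z a(1)] alignedD(1)[OF z a(2)] by auto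
  have pq: "pt y p q = pt y p' q'"
    using ang_eq_iff[OF y d(1,2) b] ky by (simp add: key_def)
  \<comment> \<open>The two contact points of a pair differ, so \<open>{p, q, p', q'}\<close> really
    contains a third index.\<close>
  have "(p', q') \<noteq> (q, p)"
  proof
    assume "(p', q') = (q, p)"
    then show False using pq contact_swap_neq[of "y $ p" "y $ q"] config_spaceD[OF yc] d by (auto simp: pt_def)
  qed
  moreover have "(p, q) \<noteq> (p', q')" using ne r by auto
  moreover have "{p, q} \<inter> {p', q'} \<noteq> {}" using ni r d by (auto simp: pairs_of_def)
  ultimately obtain s where s: "s \<notin> {p, q}" "{p, q, p', q'} = {p, q, s}" "s \<in> {p', q'}"
    using d by fastforce
  note P = pt_props[OF yc d(1)] and P' = pt_props[OF yc d(2)]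
  have "{p', q'} \<inter> {p, q} \<noteq> {}" using \<open>{p, q} \<inter> {p', q'} \<noteq> {}\<close> by blast
  then have "level (y $ p) (pt y p q) = level (y $ s) (pt y p q)"
    using P(2) P'(2) s(3) unfolding pq by auto
  then have "\<exists>u v w. {u, v, w} = {p, q, s} \<and> aligned y (u, v, w) \<and> pt y u v = pt y p q"
    using P s(1) d by (intro ex_aligned[OF yc]) auto
  then show "\<exists>u v w. aligned y (u, v, w) \<and> {u, v, w} = {p, q, p', q'} \<and> pt y u v = pt y p q \<and> pt y p' q' = pt y p q"
    using s(2) pq by metis
qed

text \<open>Only strict inequalities survive a small change. Crossings that coincide at
  \<open>w\<close> may separate either way at \<open>y\<close>, and this freedom is what a wall
  consists of.\<close>

definition near :: "complex ^ 'n \<Rightarrow> complex ^ 'n \<Rightarrow> bool" where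
  "near w y \<longleftrightarrow> y \<in> N \<and> (\<forall>i j k l. i \<noteq> j \<longrightarrow> k \<noteq> l \<longrightarrow> ang z w i j < ang z w k l \<longrightarrow> ang z y i j < ang z y k l)"

lemma nearD: "near w y \<Longrightarrow> i \<noteq> j \<Longrightarrow> k \<noteq> l \<Longrightarrow> ang z w i j < ang z w k l \<Longrightarrow> ang z y i j < ang z y k l"
  by (simp add: near_def)

lemma eventually_near:
  assumes "w \<in> N"
  shows "eventually (near w) (nhds w)"
proof -
  define P where "P = {x :: ('n \<times> 'n) \<times> ('n \<times> 'n). fst (fst x) \<noteq> snd (fst x) \<and> fst (snd x) \<noteq> snd (snd x)}"
  have finP: "finite P" by (rule finite_subset[OF subset_UNIV]) simp
  let ?R = "\<lambda>x y. ang z w (fst (fst x)) (snd (fst x)) < ang z w (fst (snd x)) (snd (snd x)) \<longrightarrow>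
    ang z y (fst (fst x)) (snd (fst x)) < ang z y (fst (snd x)) (snd (snd x))"
  have "eventually (\<lambda>y. \<forall>x\<in>P. ?R x y) (nhds w)"
    unfolding eventually_ball_finite_distrib[OF finP]
  proof
    fix x assume x: "x \<in> P"
    have lim: "((\<lambda>y. ang z y i j) \<longlongrightarrow> ang z w i j) (nhds w)" if "i \<noteq> j" for i j
    proof -
      have "isCont (\<lambda>y. ang z y i j) w"
        using continuous_ang[OF that] N(1) assms continuous_on_eq_continuous_at by blast
      then show ?thesis using tendsto_at_iff_tendsto_nhds[of "\<lambda>y. ang z y i j" w] by (simp add: isCont_def)
    qed
    show "eventually (?R x) (nhds w)"
    proof (cases "ang z w (fst (fst x)) (snd (fst x)) < ang z w (fst (snd x)) (snd (snd x))")
      case True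
      have "((\<lambda>y. ang z y (fst (snd x)) (snd (snd x)) - ang z y (fst (fst x)) (snd (fst x))) \<longlongrightarrow>
          ang z w (fst (snd x)) (snd (snd x)) - ang z w (fst (fst x)) (snd (fst x))) (nhds w)"
        using x by (intro tendsto_diff lim) (auto simp: P_def)
      from order_tendstoD(1)[OF this, of 0] True show ?thesis by (auto elim: eventually_mono)
    qed simp
  qed
  moreover have "eventually (\<lambda>y. y \<in> N) (nhds w)" using N(1) assms by (rule eventually_nhds_in_open)
  ultimately show ?thesis
  proof eventually_elim
    case (elim y)
    show ?case unfolding near_def
    proof (intro conjI allI impI)
      fix i j k l :: 'n assume "i \<noteq> j" "k \<noteq> l" "ang z w i j < ang z w k l"
      then show "ang z y i j < ang z y k l" using bspec[OF elim(1), of "((i, j), (k, l))"] by (simp add: P_def)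
    qed (rule elim)
  qed
qed

lemma ord_near:
  assumes "near w y" "aligned z a" "aligned z b" "ord w a b"
  shows "ord y a b"
proof -
  obtain p q r p' q' r' where ab: "a = (p, q, r)" "b = (p', q', r')" by (cases a, cases b)
  have "p \<noteq> q" "p' \<noteq> q'" using alignedD(1)[OF z] assms(2,3) unfolding ab by fastforce+
  then show ?thesis using assms(4) nearD[OF assms(1)] by (auto simp: ord_def key_def ab)
qed

text \<open>Without aligned triples no comparison that decides \<open>inverted\<close> or the order
  of dependent letters is an equality, so all of them persist nearby.\<close>

lemma potential_regular:
  assumes w: "w \<in> N" and reg: "critical_triples w = {}"
  shows "potential w \<in> carrier G3" "near w y \<Longrightarrow> potential y = potential w"
proof -
  have nal: "\<not> aligned w a" for a using aligned_critical[OF in_config[OF w], of a] reg by auto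
  have "\<exists>as. listing (ord w) (inverted w) as"
  proof (rule ex_listing[OF _ ord_asymp ord_transp])
    show "finite (inverted w)" by (rule finite_subset[OF subset_UNIV]) simp
    fix a b assume ab: "a \<in> inverted w" "b \<in> inverted w" "a \<noteq> b" "\<not> independent a b"
    obtain p q r p' q' r' where ab': "a = (p, q, r)" "b = (p', q', r')" by (cases a, cases b)
    have "rank a \<noteq> rank b \<or> key w a \<noteq> key w b"
      using tie(2)[OF w inverted_aligned[OF ab(1)[unfolded ab']] inverted_aligned[OF ab(2)[unfolded ab']]]
        ab nal unfolding ab' by blast
    then show "ord w a b \<or> ord w b a" unfolding ord_def by linarith
  qed
  then obtain as where as: "listing (ord w) (inverted w) as" ..
  then show "potential w \<in> carrier G3" by (rule potential_closed)
  assume y: "near w y"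
  have "inverted y = inverted w"
  proof -
    have "ang z y i j < ang z y j k \<longleftrightarrow> ang z w i j < ang z w j k" if A: "aligned z (i, j, k)" for i j k
    proof -
      have d: "i \<noteq> j" "j \<noteq> k" using alignedD(1)[OF z A] by auto
      have "ang z w i j \<noteq> ang z w j k" using aligned_iff_ang[OF A w] nal by simp
      then show ?thesis using nearD[OF y d] nearD[OF y d(2,1)] by (meson linorder_neqE less_asym)
    qed
    then show ?thesis by (auto simp: inverted_def)
  qed
  moreover have "listing (ord y) (inverted w) as"
    unfolding listing_def
  proof (intro conjI)
    have "sorted_wrt (\<lambda>a b. independent a b \<or> ord w a b) as" "set as = inverted w"
      using as by (auto simp: listing_def)
    then show "sorted_wrt (\<lambda>a b. independent a b \<or> ord y a b) as"
      by (elim sorted_wrt_mono_rel[rotated]) (use ord_near[OF y] inverted_aligned in metis)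
  qed (use as in \<open>auto simp: listing_def\<close>)
  ultimately have "listing (ord y) (inverted y) as" by simp
  with as show "potential y = potential w" using potential_eq by metis
qed

text \<open>The only triple coincidence at \<open>w\<close> is that of \<open>ij\<close>,
  \<open>ik\<close> and \<open>jk\<close>. Dependent letters can therefore tie only if they extend
  two of these pairs by a common last index, whose slope exceeds that of \<open>k\<close>.\<close>

lemma tie_at_wall:
  assumes w: "w \<in> N" and al: "aligned w (i, j, k)" and cr: "critical_triples w \<subseteq> {T}"
    and a: "aligned z (p, q, r)" "aligned z (p', q', r')"
    and ni: "\<not> independent (p, q, r) (p', q', r')" and ne: "(p, q, r) \<noteq> (p', q', r')"
    and rk: "rank (p, q, r) = rank (p', q', r')" and ky: "key w (p, q, r) = key w (p', q', r')"
  shows "r' = r" "r \<notin> {i, j, k}" "(p, q) \<in> {(i, j), (i, k), (j, k)}" "(p', q') \<in> {(i, j), (i, k), (j, k)}"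
    "rank (i, j, k) < rank (p, q, r)"
proof -
  note wc = in_config[OF w]
  show r: "r' = r" using tie(1)[OF w a ni ne rk ky] by simp
  obtain u v x where uvx: "aligned w (u, v, x)" "{u, v, x} = {p, q, p', q'}" "pt w u v = pt w p q" "pt w p' q' = pt w p q"
    using tie(2)[OF w a ni ne rk ky] by blast
  have "tset (u, v, x) = tset (i, j, k)"
    using aligned_critical[OF wc uvx(1)] aligned_critical[OF wc al] cr by auto
  then have uvx2: "(u, v, x) = (i, j, k)" by (rule aligned_unique[OF wc uvx(1) al])
  then have set: "{p, q, p', q'} = {i, j, k}" and P: "pt w p q = pt w i j" "pt w p' q' = pt w i j" using uvx by auto
  have d: "p \<noteq> q" "p' \<noteq> q'" "r \<notin> {p, q}" "r' \<notin> {p', q'}" using alignedD(1)[OF z a(1)] alignedD(1)[OF z a(2)] by auto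
  show "r \<notin> {i, j, k}" using set d r by auto
  note A = alignedD[OF wc al]
  have mem: "(s, t) \<in> {(i, j), (i, k), (j, k)}" if "s \<in> {i, j, k}" "t \<in> {i, j, k}" "s \<noteq> t" "pt w s t = pt w i j" for s t
    using pt_props(3)[OF wc that(3)] A(5,6) that unfolding that(4) by auto
  show pq: "(p, q) \<in> {(i, j), (i, k), (j, k)}" by (rule mem) (use set P d in auto)
  show pq': "(p', q') \<in> {(i, j), (i, k), (j, k)}" by (rule mem) (use set P d in auto)
  note Z = alignedD[OF z aligned_base[OF w al]]
  have b: "pt z p q = pt z i j" "pt z p' q' = pt z i j" using pq pq' Z(7,8) by auto
  have "slope (z $ q) (pt z i j) < slope (z $ r) (pt z i j)" "slope (z $ q') (pt z i j) < slope (z $ r) (pt z i j)"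
    using alignedD(6)[OF z a(1)] alignedD(6)[OF z a(2)] b r by auto
  moreover have "k = q \<or> k = q'" using pq pq' set Z(1) by auto
  ultimately show "rank (i, j, k) < rank (p, q, r)" by (auto simp: rank_def b)
qed

text \<open>At \<open>w\<close> the letter \<open>a = (i, j, k)\<close> is on the verge of
  inversion. For an index \<open>l\<close> of larger slope on the same horocycle, the letters
  \<open>(i, j, l)\<close>, \<open>(i, k, l)\<close>, \<open>(j, k, l)\<close> are inverted together
  or not at all, and their keys tie at \<open>w\<close>; next to the wall they separate in one order
  or its reverse, according to whether \<open>a\<close> is inverted. Other dependent letters keep
  their order. So the potential is \<open>pre L0\<close> on one side and \<open>pre a L1\<close> on
  the other, where \<open>L0\<close> has the blocks of \<open>L1\<close> reversed, and
  \<open>block_exchange\<close> turns \<open>a L1\<close> into \<open>L0 a\<close>.\<close>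

lemma potential_flip:
  assumes w: "w \<in> N" and al: "aligned w (i, j, k)" and cr: "critical_triples w \<subseteq> {T}"
  obtains g where "g \<in> carrier G3"
    "\<And>y. near w y \<Longrightarrow> ang z y i j > ang z y j k \<Longrightarrow> potential y = g"
    "\<And>y. near w y \<Longrightarrow> ang z y i j < ang z y j k \<Longrightarrow> potential y = g \<otimes>\<^bsub>G3\<^esub> G3_gen (i, j, k)"
proof -
  let ?a = "(i, j, k)"
  note wc = in_config[OF w]
  have alz: "aligned z ?a" by (rule aligned_base[OF w al])
  note Z = alignedD[OF z alz]
  have d: "i \<noteq> j" "i \<noteq> k" "j \<noteq> k" using Z(1) by auto
  have eq: "ang z w i j = ang z w j k" using aligned_iff_ang[OF alz w] al by simp
  then have eq': "ang z w i k = ang z w i j" using triple_trichotomy[OF alz w] by linarith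
  define S where "S = inverted w"
  have SA: "aligned z b" if "b \<in> S" for b using that inverted_aligned by (simp add: S_def)
  have aS: "?a \<notin> S" using eq by (simp add: S_def inverted_def)

  have above: "aligned z (i, j, l) \<and> aligned z (i, k, l) \<and> aligned z (j, k, l) \<and>
      rank (i, j, l) = rank (i, k, l) \<and> rank (i, j, l) = rank (j, k, l) \<and> rank ?a < rank (i, j, l) \<and>
      ((i, j, l) \<in> S \<longleftrightarrow> (i, k, l) \<in> S) \<and> ((i, j, l) \<in> S \<longleftrightarrow> (j, k, l) \<in> S) \<and> distinct [i, j, k, l]"
    if l: "slope (z $ k) (pt z i j) < slope (z $ l) (pt z i j)" "level (z $ i) (pt z i j) = level (z $ l) (pt z i j)" for l
  proof -
    have dl: "distinct [i, j, k, l]" using Z(5,6) l(1) d by auto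
    have A: "aligned z (i, j, l)" "aligned z (i, k, l)" "aligned z (j, k, l)"
      using alignedI(1)[OF z Z(2)] Z(3-6) l by auto
    have rk: "rank (i, j, l) = rank (i, k, l)" "rank (i, j, l) = rank (j, k, l)" "rank ?a < rank (i, j, l)"
      using Z(7,8) l(1) by (simp_all add: rank_def)
    have "(i, j, l) \<in> S \<longleftrightarrow> ang z w i j < ang z w j l" "(i, k, l) \<in> S \<longleftrightarrow> ang z w i k < ang z w k l"
      "(j, k, l) \<in> S \<longleftrightarrow> ang z w j k < ang z w k l"
      using A by (simp_all add: S_def inverted_def)
    with triple_trichotomy[OF A(1) w] triple_trichotomy[OF A(2) w] triple_trichotomy[OF A(3) w] eq eq'
    have "(i, j, l) \<in> S \<longleftrightarrow> (i, k, l) \<in> S" "(i, j, l) \<in> S \<longleftrightarrow> (j, k, l) \<in> S" by linarith+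
    with A rk dl show ?thesis by blast
  qed
  have aboveI: "slope (z $ k) (pt z i j) < slope (z $ l) (pt z i j) \<and> level (z $ i) (pt z i j) = level (z $ l) (pt z i j)"
    if "aligned z (i, j, l) \<and> rank ?a < rank (i, j, l) \<or> aligned z (i, k, l) \<or> aligned z (j, k, l)" for l
    using that alignedD[OF z, of i j l] alignedD[OF z, of i k l] alignedD[OF z, of j k l] Z
    by (auto simp: rank_def)

  define blk where "blk = (\<lambda>b :: 'n \<times> 'n \<times> 'n. case b of (p, q, l) \<Rightarrow>
    if p = i \<and> q = j then [(i, j, l), (i, k, l), (j, k, l)] else [b])"
  \<comment> \<open>The letters after \<open>a\<close>, each block being represented by its member
    \<open>(i, j, l)\<close> alone; \<open>blk\<close> expands it again.\<close>
  define R where "R = {b \<in> S. ord w ?a b \<and> (\<forall>l. b \<noteq> (i, k, l) \<and> b \<noteq> (j, k, l))}"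
  define Pre where "Pre = {b \<in> S. \<not> ord w ?a b}"
  have blk_ij: "blk (i, j, l) = [(i, j, l), (i, k, l), (j, k, l)]" for l by (simp add: blk_def)
  have R_ij: "slope (z $ k) (pt z i j) < slope (z $ l) (pt z i j) \<and> level (z $ i) (pt z i j) = level (z $ l) (pt z i j)"
    if "(i, j, l) \<in> R" for l
  proof (rule aboveI, rule disjI1)
    have "(i, j, l) \<in> S" "ord w ?a (i, j, l)" using that by (simp_all add: R_def)
    then show "aligned z (i, j, l) \<and> rank ?a < rank (i, j, l)" using SA by (auto simp: ord_def key_def)
  qed
  have R_cases: "(\<exists>l. b = (i, j, l)) \<or> blk b = [b]" for b
    by (cases b) (auto simp: blk_def)

  have blk_props: "b \<in> S \<and> ord w ?a b \<and> rank b = rank c \<and> key w b = key w c"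
    if "c \<in> R" "b \<in> set (blk c)" for b c
  proof (cases "\<exists>l. c = (i, j, l)")
    case True
    then obtain l where c: "c = (i, j, l)" by blast
    note ab = above[OF conjunct1[OF R_ij] conjunct2[OF R_ij], OF that(1)[unfolded c] that(1)[unfolded c]]
    have cS: "(i, j, l) \<in> S" using that(1) by (simp add: R_def c)
    have "b = (i, j, l) \<or> b = (i, k, l) \<or> b = (j, k, l)" using that(2) by (auto simp: c blk_ij)
    then have "b \<in> S \<and> rank b = rank c \<and> rank ?a < rank b \<and> key w b = key w c"
      using ab cS eq eq' by (auto simp: c key_def)
    then show ?thesis by (auto simp: ord_def)
  next
    case False
    then have "b = c" using R_cases[of c] that(2) by auto
    then show ?thesis using that(1) by (simp add: R_def)
  qed
  have cover: "b \<in> Pre \<or> (\<exists>c\<in>R. b \<in> set (blk c))" if "b \<in> S" for b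
  proof (cases "ord w ?a b \<and> (\<exists>l. b = (i, k, l) \<or> b = (j, k, l))")
    case True
    then obtain l where b: "b = (i, k, l) \<or> b = (j, k, l)" by blast
    then have "slope (z $ k) (pt z i j) < slope (z $ l) (pt z i j) \<and> level (z $ i) (pt z i j) = level (z $ l) (pt z i j)"
      using SA[OF that] by (intro aboveI) auto
    note ab = above[OF conjunct1[OF this] conjunct2[OF this]]
    have "(i, j, l) \<in> R" using ab that b by (auto simp: R_def ord_def)
    moreover have "b \<in> set (blk (i, j, l))" using b by (auto simp: blk_ij)
    ultimately show ?thesis by blast
  next
    case False
    have "b \<in> set (blk b)" by (cases b) (auto simp: blk_def)
    moreover have "b \<in> Pre \<or> b \<in> R" unfolding R_def Pre_def using False that by blast
    ultimately show ?thesis by blast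
  qed

  \<comment> \<open>If the rank of \<open>c\<close> is higher, the shared pair would be its first
    two indices, which are excluded. If the rank is equal, its last index is \<open>k\<close> and
    all its crossings come strictly after \<open>ij\<close>, whereas a shared crossing
    \<open>ik\<close> or \<open>jk\<close> coincides with \<open>ij\<close> at
    \<open>w\<close>.\<close>
  have indep: "independent c ?a" if c: "c \<in> R" and nij: "\<forall>l. c \<noteq> (i, j, l)" for c
  proof (rule ccontr)
    assume ni: "\<not> independent c ?a"
    obtain p q r where cpq: "c = (p, q, r)" by (cases c)
    have cS: "(p, q, r) \<in> S" "ord w ?a (p, q, r)" "(p, q) \<noteq> (i, j)" "(p, q) \<noteq> (i, k)" "(p, q) \<noteq> (j, k)"
      using c nij by (auto simp: R_def cpq)
    have A: "aligned z (p, q, r)" by (rule SA[OF cS(1)])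
    note C = alignedD[OF z A]
    have b: "pt z p q = pt z i j" by (rule shared_base[OF A alz ni[unfolded cpq]])
    show False
    proof (cases "rank ?a < rank (p, q, r)")
      case True
      have "r \<noteq> k" "r \<noteq> j" using True Z(6) by (auto simp: rank_def b)
      then show False using ni cS(3-5) by (auto simp: cpq pairs_of_def)
    next
      case False
      then have rk: "rank (p, q, r) = rank ?a" and ky: "ang z w i j < ang z w p q"
        using cS(2) by (auto simp: ord_def key_def)
      have r: "r = k" by (rule same_rank[OF A alz ni[unfolded cpq] rk])
      have "ang z w p q < ang z w q r" using cS(1) by (simp add: S_def inverted_def)
      with triple_trichotomy[OF A w] have tr: "ang z w p q < ang z w p k" "ang z w p k < ang z w q k"
        unfolding r by linarith+
      have "p \<in> {i, j} \<or> q \<in> {i, j}" using ni r C(1) d by (auto simp: cpq pairs_of_def)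
      then show False using tr ky eq eq' by auto
    qed
  qed

  \<comment> \<open>Dependent letters are either strictly ordered at \<open>w\<close>, which
    persists, or tie there and then belong to one block.\<close>
  have cmp: "ord y b c \<or> (\<exists>l. b \<in> {(i, j, l), (i, k, l), (j, k, l)} \<and> c \<in> {(i, j, l), (i, k, l), (j, k, l)} \<and>
      rank ?a < rank b \<and> l \<notin> {i, j, k})"
    if bc: "aligned z b" "aligned z c" "b \<noteq> c" "\<not> independent b c" "\<not> ord w c b" and y: "near w y" for b c y
  proof (cases "ord w b c")
    case True
    then show ?thesis using ord_near[OF y bc(1,2)] by blast
  next
    case False
    obtain p q r p' q' r' where e: "b = (p, q, r)" "c = (p', q', r')" by (cases b, cases c)
    have rk: "rank (p, q, r) = rank (p', q', r')" "key w (p, q, r) = key w (p', q', r')"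
      using False bc(5) by (auto simp: ord_def e)
    note t = tie_at_wall[OF w al cr bc(1,2,4,3)[unfolded e] rk]
    show ?thesis using t by (intro disjI2 exI[of _ r]) (auto simp: e)
  qed

  have "finite Pre" by (rule finite_subset[OF subset_UNIV]) simp
  from ex_linear_extension[OF this ord_asymp[of w] ord_transp[of w]]
  obtain pre where pre: "set pre = Pre" "distinct pre" "sorted_wrt (\<lambda>b c. \<not> ord w c b) pre" by blast
  have "finite R" by (rule finite_subset[OF subset_UNIV]) simp
  from ex_linear_extension[OF this ord_asymp[of w] ord_transp[of w]]
  obtain rs where rs: "set rs = R" "distinct rs" "sorted_wrt (\<lambda>b c. \<not> ord w c b) rs" by blast
  define L1 where "L1 = concat (map blk rs)"
  define L0 where "L0 = concat (map (\<lambda>b. rev (blk b)) rs)"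
  have "G3_gen ?a \<otimes>\<^bsub>G3\<^esub> lprod L1 = lprod L0 \<otimes>\<^bsub>G3\<^esub> G3_gen ?a \<and> set L1 \<subseteq> triples"
    unfolding L1_def L0_def
  proof (rule block_exchange[OF Z(1)], rule ballI)
    fix c assume "c \<in> set rs"
    then have cR: "c \<in> R" using rs by simp
    show "(\<exists>l. blk c = [(i, j, l), (i, k, l), (j, k, l)] \<and> distinct [i, j, k, l]) \<or>
      blk c = [c] \<and> independent c ?a \<and> c \<in> triples"
    proof (cases "\<exists>l. c = (i, j, l)")
      case True
      then obtain l where c: "c = (i, j, l)" by blast
      note ab = above[OF conjunct1[OF R_ij] conjunct2[OF R_ij], OF cR[unfolded c] cR[unfolded c]]
      then show ?thesis using blk_ij[of l] c by blast
    next
      case False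
      have "c \<in> S" using cR by (simp add: R_def)
      then have "c \<in> triples" by (rule aligned_triples[OF SA])
      then show ?thesis using False R_cases[of c] indep[OF cR] by blast
    qed
  qed
  then have ex: "G3_gen ?a \<otimes>\<^bsub>G3\<^esub> lprod L1 = lprod L0 \<otimes>\<^bsub>G3\<^esub> G3_gen ?a" and L1t: "set L1 \<subseteq> triples" by simp_all
  have setL: "set L0 = set L1" by (simp add: L0_def L1_def)
  have setL1: "set L1 = {b. \<exists>c\<in>R. b \<in> set (blk c)}" using rs(1) by (auto simp: L1_def)
  have L1S: "c \<in> S \<and> ord w ?a c" if "c \<in> set L1" for c
  proof -
    have "\<exists>x\<in>R. c \<in> set (blk x)" using that unfolding setL1 by (rule CollectD)
    then obtain x where x: "x \<in> R" "c \<in> set (blk x)" by (rule bexE)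
    from blk_props[OF x] show ?thesis by blast
  qed
  have Sset: "Pre \<union> set L1 = S"
  proof (rule equalityI; rule subsetI)
    fix b assume "b \<in> Pre \<union> set L1"
    then show "b \<in> S" using L1S[of b] by (auto simp: Pre_def)
  next
    fix b assume "b \<in> S"
    then show "b \<in> Pre \<union> set L1" unfolding setL1 Un_iff mem_Collect_eq by (rule cover)
  qed

  let ?Q = "\<lambda>y b c. b \<noteq> c \<and> (independent b c \<or> ord y b c)"
  have sort_pre: "sorted_wrt (?Q y) pre" if y: "near w y" for y
  proof -
    have "sorted_wrt (\<lambda>b c. b \<noteq> c \<and> \<not> ord w c b) pre"
      using pre(2,3) by (induction pre) auto
    moreover have "?Q y b c" if bc: "b \<in> set pre" "c \<in> set pre" "b \<noteq> c \<and> \<not> ord w c b" for b c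
    proof -
      have b: "b \<in> S" "c \<in> S" "\<not> ord w ?a b" using bc(1,2) pre(1) by (simp_all add: Pre_def)
      then have "\<not> rank ?a < rank b" by (simp add: ord_def)
      with cmp[OF SA[OF b(1)] SA[OF b(2)] _ _ _ y] bc(3) show ?thesis by blast
    qed
    ultimately show ?thesis by (rule sorted_wrt_mono_rel[rotated])
  qed
  have pre_post: "?Q y b c" if y: "near w y" and b: "b \<in> Pre" and c: "c \<in> set L1" for y b c
  proof -
    have c': "c \<in> S" "ord w ?a c" using L1S[OF c] by blast+
    have b': "b \<in> S" "\<not> ord w ?a b" using b by (simp_all add: Pre_def)
    have "\<not> ord w c b" using c'(2) b'(2) transpD[OF ord_transp, of w ?a c b] by blast
    moreover have "b \<noteq> c" using c' b' by auto
    moreover have "\<not> rank ?a < rank b" using b'(2) by (simp add: ord_def)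
    ultimately show ?thesis using cmp[OF SA[OF b'(1)] SA[OF c'(1)] _ _ _ y] by blast
  qed
  \<comment> \<open>Stated for any arrangement \<open>f\<close> of the blocks, to serve both for
    \<open>L1\<close> and for the reversed \<open>L0\<close>.\<close>
  have sort_post: "sorted_wrt (?Q y) (concat (map f rs))"
    if y: "near w y" and f: "\<And>c. set (f c) = set (blk c)" "\<And>c. c \<in> R \<Longrightarrow> sorted_wrt (?Q y) (f c)" for y f
  proof (rule sorted_wrt_concat_map)
    show "\<forall>c\<in>set rs. sorted_wrt (?Q y) (f c)" using f(2) rs(1) by simp
    have "sorted_wrt (\<lambda>b c. b \<noteq> c \<and> \<not> ord w c b) rs"
      using rs(2,3) by (induction rs) auto
    moreover have "\<forall>b'\<in>set (f b). \<forall>c'\<in>set (f c). ?Q y b' c'"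
      if bc: "b \<in> set rs" "c \<in> set rs" "b \<noteq> c \<and> \<not> ord w c b" for b c
    proof (intro ballI)
      fix b' c' assume "b' \<in> set (f b)" "c' \<in> set (f c)"
      then have m: "b' \<in> set (blk b)" "c' \<in> set (blk c)" using f(1) by auto
      have R: "b \<in> R" "c \<in> R" using bc rs(1) by auto
      note B = blk_props[OF R(1) m(1)] and C = blk_props[OF R(2) m(2)]
      have no: "\<not> ord w c' b'" using B C bc(3) by (simp add: ord_def)
      have nl: "\<not> (b' \<in> {(i, j, l), (i, k, l), (j, k, l)} \<and> c' \<in> {(i, j, l), (i, k, l), (j, k, l)})" for l
      proof
        assume A: "b' \<in> {(i, j, l), (i, k, l), (j, k, l)} \<and> c' \<in> {(i, j, l), (i, k, l), (j, k, l)}"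
        \<comment> \<open>An element of \<open>R\<close> whose expansion meets the block of
          \<open>l\<close> is the representative of that block, so two different elements never
          share one.\<close>
        have "x = (i, j, l)" if "x \<in> R" "x' \<in> set (blk x)" "x' \<in> {(i, j, l), (i, k, l), (j, k, l)}" for x x'
        proof (cases "\<exists>m. x = (i, j, m)")
          case True
          then show ?thesis using that d by (auto simp: blk_ij)
        next
          case False
          then have "x' = x" using R_cases[of x] that(2) by auto
          then show ?thesis using that(1,3) by (auto simp: R_def)
        qed
        from this[OF R(1) m(1)] this[OF R(2) m(2)] A bc(3) show False by blast
      qed
      have "b' \<noteq> c'"
      proof
        assume "b' = c'"
        show False
        proof (cases "(\<exists>m. b = (i, j, m)) \<or> (\<exists>m. c = (i, j, m))")
          case True
          then obtain m where "b' \<in> {(i, j, m), (i, k, m), (j, k, m)}"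
            using m \<open>b' = c'\<close> by (auto simp: blk_ij)
          then show False using nl[of m] \<open>b' = c'\<close> by blast
        next
          case False
          then have "b' = b" "c' = c" using R_cases[of b] R_cases[of c] m by auto
          then show False using \<open>b' = c'\<close> bc(3) by blast
        qed
      qed
      then show "?Q y b' c'"
        using cmp[OF SA[OF conjunct1[OF B]] SA[OF conjunct1[OF C]] _ _ no y] nl by blast
    qed
    ultimately show "sorted_wrt (\<lambda>b c. \<forall>b'\<in>set (f b). \<forall>c'\<in>set (f c). ?Q y b' c') rs"
      by (rule sorted_wrt_mono_rel[rotated])
  qed
  have inv: "b \<in> inverted y \<longleftrightarrow> b \<in> S" if y: "near w y" and b: "b \<noteq> ?a" for y b
  proof -
    obtain p q r where e: "b = (p, q, r)" by (cases b)
    show ?thesis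
    proof (cases "aligned z (p, q, r)")
      case True
      have dp: "p \<noteq> q" "q \<noteq> r" using alignedD(1)[OF z True] by auto
      have "\<not> aligned w (p, q, r)"
      proof
        assume A: "aligned w (p, q, r)"
        have "tset (p, q, r) = tset ?a"
          using aligned_critical[OF wc A] aligned_critical[OF wc al] cr by auto
        then show False using aligned_unique[OF wc A al] b e by simp
      qed
      then have "ang z w p q \<noteq> ang z w q r" using aligned_iff_ang[OF True w] by simp
      then have "ang z y p q < ang z y q r \<longleftrightarrow> ang z w p q < ang z w q r"
        using nearD[OF y dp] nearD[OF y dp(2,1)] by (meson linorder_neqE less_asym)
      then show ?thesis by (simp add: e S_def inverted_def)
    next
      case False
      then show ?thesis by (simp add: e S_def inverted_def)
    qed
  qed
  have tri: "ang z y i j < ang z y i k \<and> ang z y i k < ang z y j k \<longleftrightarrow> ang z y i j < ang z y j k"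
    "ang z y i j > ang z y i k \<and> ang z y i k > ang z y j k \<longleftrightarrow> ang z y i j > ang z y j k" if "near w y" for y
    using triple_trichotomy[OF alz, of y] that by (auto simp: near_def)
  have "S \<subseteq> triples" unfolding S_def by (rule inverted_triples)
  then have Pt: "set pre \<subseteq> triples" using pre(1) by (auto simp: Pre_def)
  have at: "?a \<in> triples" using d by (simp add: triples_def)
  have c: "lprod pre \<in> carrier G3" "lprod L0 \<in> carrier G3" "lprod L1 \<in> carrier G3" "G3_gen ?a \<in> carrier G3"
    using Pt L1t setL at by (simp_all add: lprod_closed)

  show thesis
  proof (rule that)
    show "lprod (pre @ L0) \<in> carrier G3" using Pt L1t setL by (intro lprod_closed) auto
    fix y assume y: "near w y"
    show "potential y = lprod (pre @ L0)" if gt: "ang z y i j > ang z y j k"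
    proof (rule potential_eq, rule listingI)
      have "?a \<notin> inverted y" using gt by (simp add: inverted_def)
      then have "b \<in> inverted y \<longleftrightarrow> b \<in> S" for b
        using inv[OF y, of b] aS by (cases "b = ?a") blast+
      then have "inverted y = S" by (rule Set.set_eqI)
      then show "set (pre @ L0) = inverted y" using Sset pre(1) setL by simp
      have "sorted_wrt (?Q y) L0" unfolding L0_def
      proof (rule sort_post[OF y])
        fix c assume cR: "c \<in> R"
        show "sorted_wrt (?Q y) (rev (blk c))"
        proof (cases "\<exists>l. c = (i, j, l)")
          case True
          then obtain l where cl: "c = (i, j, l)" by blast
          note ab = above[OF conjunct1[OF R_ij] conjunct2[OF R_ij], OF cR[unfolded cl] cR[unfolded cl]]
          have "sorted_wrt (?Q y) [(j, k, l), (i, k, l), (i, j, l)]"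
            using ab tri(2)[OF y] gt d by (auto simp: ord_def key_def)
          moreover have "rev (blk c) = [(j, k, l), (i, k, l), (i, j, l)]" by (simp add: cl blk_ij)
          ultimately show ?thesis by (simp only:)
        next
          case False
          then show ?thesis using R_cases[of c] by auto
        qed
      qed simp
      then show "sorted_wrt (?Q y) (pre @ L0)"
        using sort_pre[OF y] pre_post[OF y] pre(1) setL by (simp add: sorted_wrt_append)
    qed
    show "potential y = lprod (pre @ L0) \<otimes>\<^bsub>G3\<^esub> G3_gen ?a" if lt: "ang z y i j < ang z y j k"
    proof -
      have "potential y = lprod (pre @ [?a] @ L1)"
      proof (rule potential_eq, rule listingI)
        have "?a \<in> inverted y" using lt alz by (simp add: inverted_def)
        then have "b \<in> inverted y \<longleftrightarrow> b \<in> insert ?a S" for b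
          using inv[OF y, of b] by (cases "b = ?a") blast+
        then have "inverted y = insert ?a S" by (rule Set.set_eqI)
        then show "set (pre @ [?a] @ L1) = inverted y" using Sset pre(1) by auto
        have "sorted_wrt (?Q y) L1" unfolding L1_def
        proof (rule sort_post[OF y])
          fix c assume cR: "c \<in> R"
          show "sorted_wrt (?Q y) (blk c)"
          proof (cases "\<exists>l. c = (i, j, l)")
            case True
            then obtain l where cl: "c = (i, j, l)" by blast
            note ab = above[OF conjunct1[OF R_ij] conjunct2[OF R_ij], OF cR[unfolded cl] cR[unfolded cl]]
            have "sorted_wrt (?Q y) [(i, j, l), (i, k, l), (j, k, l)]"
              using ab tri(1)[OF y] lt d by (auto simp: ord_def key_def)
            then show ?thesis by (simp only: cl blk_ij)
          next
            case False
            then show ?thesis using R_cases[of c] by auto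
          qed
        qed simp
        moreover have "?Q y ?a c" if "c \<in> set L1" for c
        proof -
          have c': "c \<in> S" "ord w ?a c" using L1S[OF that] by blast+
          then show ?thesis using ord_near[OF y alz SA[OF c'(1)] c'(2)] aS by blast
        qed
        moreover have "?Q y b ?a" if b: "b \<in> Pre" for b
        proof -
          have b': "b \<in> S" "\<not> ord w ?a b" using b by (simp_all add: Pre_def)
          have "b \<noteq> ?a" using b'(1) aS by blast
          moreover have "\<not> (\<exists>l. ?a \<in> {(i, j, l), (i, k, l), (j, k, l)} \<and> l \<notin> {i, j, k})" by auto
          ultimately show ?thesis using cmp[OF SA[OF b'(1)] alz _ _ b'(2) y] by blast
        qed
        ultimately show "sorted_wrt (?Q y) (pre @ [?a] @ L1)"
          using sort_pre[OF y] pre_post[OF y] pre(1) by (simp add: sorted_wrt_append)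
      qed
      also have "\<dots> = lprod pre \<otimes>\<^bsub>G3\<^esub> (G3_gen ?a \<otimes>\<^bsub>G3\<^esub> lprod L1)"
        using Pt L1t at by (simp add: lprod_append)
      also have "\<dots> = lprod (pre @ L0) \<otimes>\<^bsub>G3\<^esub> G3_gen ?a"
        unfolding ex using Pt L1t setL c by (simp add: lprod_append G3.m_assoc)
      finally show ?thesis .
    qed
  qed
qed

end

text \<open>
  A primitive of the map \<open>g\<close>: along a path in \<open>N\<close> from \<open>x\<close> to \<open>y\<close>, the product of the letters met is
  the quotient of \<open>\<Phi> y\<close> by \<open>\<Phi> x\<close>.  Nothing is required where several triples are critical at once.
\<close>

definition local_potential :: "(complex ^ 'n) set \<Rightarrow> (complex ^ 'n \<Rightarrow> ('n \<times> 'n \<times> 'n) word set) \<Rightarrow> bool" where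
  "local_potential N \<Phi> \<longleftrightarrow> N \<subseteq> config_space \<and> (\<forall>y\<in>N. walls y \<noteq> 0 \<longrightarrow> \<Phi> y \<in> carrier G3) \<and>
    (\<forall>w\<in>N. \<forall>T. critical_triples w \<subseteq> {T} \<longrightarrow> (\<exists>U. open U \<and> w \<in> U \<and>
      (\<forall>y\<in>U \<inter> N. \<forall>y'\<in>U \<inter> N. walls y \<noteq> 0 \<longrightarrow> walls y' \<noteq> 0 \<longrightarrow>
        \<Phi> y' = (if walls y * walls y' > 0 then \<Phi> y else \<Phi> y \<otimes>\<^bsub>G3\<^esub> G3_gen (ordered_triple w)))))"

section \<open>The sign of \<open>walls\<close> near a simple wall\<close>

lemma continuous_side:
  assumes "i \<noteq> j"
  shows "continuous_on (config_space :: (complex ^ 'n) set) (\<lambda>y. side (y $ i) (y $ j) (y $ k))"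
proof -
  have eq: "(\<lambda>y :: complex ^ 'n. side (y $ i) (y $ j) (y $ k)) =
    (\<lambda>y. (height (y $ k) - 2 * Re (foot (y $ k) * cnj (pt y i j))) -
      (height (y $ i) - 2 * Re (foot (y $ i) * cnj (pt y i j))))"
    by (simp add: fun_eq_iff side_def level_def pt_def)
  show ?thesis unfolding eq
    using config_spaceD(1)
    by (intro continuous_intros continuous_foot_height continuous_on_coord continuous_pt assms) blast+
qed

lemma continuous_walls: "continuous_on (config_space :: (complex ^ 'n) set) walls"
proof -
  have eq: "walls = (\<lambda>z :: complex ^ 'n. \<Prod>T | card T = 3. wall z T)" by (simp add: fun_eq_iff walls_def)
  show ?thesis by (subst eq) (intro continuous_intros continuous_wall)
qed

lemma eventually_sign:
  fixes f :: "complex ^ 'n \<Rightarrow> real"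
  assumes "continuous_on config_space f" "w \<in> config_space" "f w \<noteq> 0"
  shows "eventually (\<lambda>y. f y * f w > 0) (nhds w)"
proof -
  have "isCont f w" using assms open_config_space continuous_on_eq_continuous_at by blast
  then have "(f \<longlongrightarrow> f w) (nhds w)" using tendsto_at_iff_tendsto_nhds[of f w] by (simp add: isCont_def)
  then have "((\<lambda>y. f y * f w) \<longlongrightarrow> f w * f w) (nhds w)" by (intro tendsto_intros)
  moreover have "f w * f w > 0" using assms(3) by (auto simp: zero_less_mult_iff)
  ultimately show ?thesis by (rule order_tendstoD(1))
qed

text \<open>Of the two factors of the critical wall only one vanishes, since the points lie on a
  single horocycle, and the walls of the other triples do not vanish at \<open>w\<close>; what
  remains is \<open>H\<close>.\<close>

lemma walls_factor:
  fixes w :: "complex ^ 'n"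
  assumes w: "w \<in> config_space" and cr: "critical_triples w \<subseteq> {T}" and dist: "distinct [i, j, k]"
    and s: "side (w $ i) (w $ j) (w $ k) = 0"
  obtains H where "continuous_on config_space H" "H w \<noteq> 0"
    "\<And>y. y \<in> config_space \<Longrightarrow> walls y = side (y $ i) (y $ j) (y $ k) * H y"
proof -
  have d: "i \<noteq> j" "j \<noteq> i" using dist by auto
  define M :: "'n set set" where "M = {S. card S = 3} - {{i, j, k}}"
  have fin: "finite {S :: 'n set. card S = 3}" by (rule finite_subset[OF subset_UNIV]) simp
  have c3: "card {i, j, k} = 3" using dist by simp
  define H where "H = (\<lambda>y :: complex ^ 'n. - 16 * (cmod (foot (y $ j) - foot (y $ i)))\<^sup>2 *
      side (y $ j) (y $ i) (y $ k) * (\<Prod>S\<in>M. wall y S))"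
  have "continuous_on config_space H"
    unfolding H_def using config_spaceD(1)
    by (intro continuous_intros continuous_foot_height continuous_on_coord continuous_side d continuous_wall) blast+
  moreover have wl: "walls y = side (y $ i) (y $ j) (y $ k) * H y" if y: "y \<in> config_space" for y
  proof -
    have "walls y = wall y {i, j, k} * (\<Prod>S\<in>M. wall y S)"
      unfolding walls_def M_def using fin c3 by (intro prod.remove) auto
    then show ?thesis unfolding wall_side[OF y dist] H_def by (simp add: mult_ac)
  qed
  have f0: "foot (w $ j) \<noteq> foot (w $ i)"
    by (rule foot_inj) (use config_spaceD[OF w] d in auto)
  have s0: "side (w $ j) (w $ i) (w $ k) \<noteq> 0"
  proof
    assume 0: "side (w $ j) (w $ i) (w $ k) = 0"
    have "pt w i j = pt w j i"
      by (rule horocycle_unique[OF w dist])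
        (use 0 s pt_props[OF w d(1)] pt_props[OF w d(2)] in \<open>auto simp: side_def pt_def\<close>)
    then show False using contact_swap_neq[of "w $ i" "w $ j"] config_spaceD[OF w] d by (auto simp: pt_def)
  qed
  have nz: "wall w S \<noteq> 0" if "S \<in> M" for S
  proof -
    have "{i, j, k} \<in> critical_triples w"
      using wall_critical[OF w c3] wall_eq_0_iff[OF w dist] s by simp
    then have "S \<notin> critical_triples w" using that cr by (auto simp: M_def)
    then show ?thesis using wall_critical[OF w, of S] that by (simp add: M_def)
  qed
  moreover have "H w \<noteq> 0"
    using f0 s0 nz finite_Diff[OF fin, of "{{i, j, k}}"] unfolding H_def by (auto simp: M_def)
  ultimately show thesis using wl by (intro that[of H])
qed

text \<open>At a simple wall the sign of \<open>walls\<close> is that of \<open>side\<close> up to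
  the constant sign of \<open>H\<close>, and the sign of \<open>side\<close> is the order of
  crossings that \<open>potential_flip\<close> refers to.\<close>

theorem ex_local_potential:
  fixes z :: "complex ^ 'n"
  assumes "z \<in> config_space"
  obtains N \<Phi> where "open N" "z \<in> N" "local_potential N \<Phi>"
proof -
  obtain N e where "chart z N e" using ex_chart[OF assms] by blast
  then interpret chart z N e .
  have "local_potential N potential"
    unfolding local_potential_def
  proof (intro conjI ballI allI impI)
    show "N \<subseteq> config_space" by (rule N(3))
    fix y assume "y \<in> N" "walls y \<noteq> 0"
    then show "potential y \<in> carrier G3" using potential_regular(1) walls_eq_0_iff in_config by blast
  next
    fix w T assume w: "w \<in> N" and cr: "critical_triples w \<subseteq> {T}"
    note wc = in_config[OF w]
    show "\<exists>U. open U \<and> w \<in> U \<and> (\<forall>y\<in>U \<inter> N. \<forall>y'\<in>U \<inter> N. walls y \<noteq> 0 \<longrightarrow> walls y' \<noteq> 0 \<longrightarrow>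
        potential y' = (if walls y * walls y' > 0 then potential y
          else potential y \<otimes>\<^bsub>G3\<^esub> G3_gen (ordered_triple w)))"
    proof (cases "critical_triples w = {}")
      case True
      then have "walls w \<noteq> 0" using walls_eq_0_iff[OF wc] by simp
      then have "eventually (\<lambda>y. near w y \<and> walls y * walls w > 0) (nhds w)"
        by (intro eventually_conj eventually_near[OF w] eventually_sign[OF continuous_walls wc])
      then obtain U where U: "open U" "w \<in> U" and nw: "\<forall>y\<in>U. near w y \<and> walls y * walls w > 0"
        unfolding eventually_nhds by auto
      have "potential y' = (if walls y * walls y' > 0 then potential y
          else potential y \<otimes>\<^bsub>G3\<^esub> G3_gen (ordered_triple w))" if "y \<in> U" "y' \<in> U" for y y'
      proof -
        have n: "near w y" "near w y'" "walls y * walls w > 0" "walls y' * walls w > 0" using nw that by auto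
        then have "walls y * walls y' > 0" by (auto simp: zero_less_mult_iff)
        then show ?thesis using potential_regular(2)[OF w True] n by simp
      qed
      then show ?thesis using U by blast
    next
      case False
      then have "T \<in> critical_triples w" using cr by auto
      then obtain a where al0: "aligned w a" using critical_aligned[OF wc] by blast
      obtain i j k where a: "a = (i, j, k)" by (cases a)
      have al: "aligned w (i, j, k)" using al0 a by simp
      have ot: "ordered_triple w = (i, j, k)" by (rule ordered_triple_eq[OF wc cr al])
      have alz: "aligned z (i, j, k)" by (rule aligned_base[OF w al])
      obtain g where g: "g \<in> carrier G3"
        and gt: "\<And>y. near w y \<Longrightarrow> ang z y i j > ang z y j k \<Longrightarrow> potential y = g"
        and lt: "\<And>y. near w y \<Longrightarrow> ang z y i j < ang z y j k \<Longrightarrow> potential y = g \<otimes>\<^bsub>G3\<^esub> G3_gen (i, j, k)"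
        using potential_flip[OF w al cr] by blast
      have s0: "side (w $ i) (w $ j) (w $ k) = 0" using alignedD(4)[OF wc al] by (simp add: side_def pt_def)
      obtain H where H: "continuous_on config_space H" "H w \<noteq> 0"
        "\<And>y. y \<in> config_space \<Longrightarrow> walls y = side (y $ i) (y $ j) (y $ k) * H y"
        using walls_factor[OF wc cr alignedD(1)[OF wc al] s0] by blast
      have tr: "(i, j, k) \<in> triples" by (rule aligned_triples[OF al])
      \<comment> \<open>Letters are involutions, so crossing the wall in either direction multiplies
        by the same letter.\<close>
      have gg: "g \<otimes>\<^bsub>G3\<^esub> G3_gen (i, j, k) \<otimes>\<^bsub>G3\<^esub> G3_gen (i, j, k) = g"
        using g tr by (simp add: G3.m_assoc G3_gen_square)
      have "eventually (\<lambda>y. near w y \<and> H y * H w > 0) (nhds w)"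
        by (intro eventually_conj eventually_near[OF w] eventually_sign[OF H(1) wc H(2)])
      then obtain U where U: "open U" "w \<in> U" and nw: "\<forall>y\<in>U. near w y \<and> H y * H w > 0"
        unfolding eventually_nhds by auto
      have "potential y' = (if walls y * walls y' > 0 then potential y
          else potential y \<otimes>\<^bsub>G3\<^esub> G3_gen (ordered_triple w))"
        if y: "y \<in> U" "y' \<in> U" "y \<in> N" "y' \<in> N" "walls y \<noteq> 0" "walls y' \<noteq> 0" for y y'
      proof -
        let ?s = "\<lambda>y. side (y $ i) (y $ j) (y $ k)"
        have n: "near w y" "near w y'" "H y * H w > 0" "H y' * H w > 0" using nw y by auto
        have wl: "walls y = ?s y * H y" "walls y' = ?s y' * H y'" using H(3) in_config y by auto
        have s0: "?s y \<noteq> 0" "?s y' \<noteq> 0" using wl y by auto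
        have "H y * H y' > 0" using n(3,4) by (auto simp: zero_less_mult_iff)
        moreover have "walls y * walls y' = (?s y * ?s y') * (H y * H y')" unfolding wl by simp
        ultimately have sg: "walls y * walls y' > 0 \<longleftrightarrow> ?s y * ?s y' > 0"
          by (metis mult_pos_pos zero_less_mult_pos2)
        have pot: "potential x = (if ?s x < 0 then g \<otimes>\<^bsub>G3\<^esub> G3_gen (i, j, k) else g)"
          if px: "near w x" "x \<in> N" "?s x \<noteq> 0" for x
          using side_sign[OF alz px(2)] px(3) gt[OF px(1)] lt[OF px(1)] by auto
        have p: "potential y = (if ?s y < 0 then g \<otimes>\<^bsub>G3\<^esub> G3_gen (i, j, k) else g)"
          "potential y' = (if ?s y' < 0 then g \<otimes>\<^bsub>G3\<^esub> G3_gen (i, j, k) else g)"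
          using pot n y s0 by auto
        show ?thesis unfolding p sg ot using s0 gg by (auto simp: zero_less_mult_iff)
      qed
      then show ?thesis using U by blast
    qed
  qed
  then show thesis by (rule that[OF N(1,2)])
qed

section \<open>Continuously differentiable functions of a configuration\<close>

text \<open>Continuous differentiability expressed by the chain rule along curves, one-sided
  derivatives included, with a derivative \<open>F z v\<close> continuous in position and velocity
  together. In this form it passes to sums, products and inverses.\<close>

definition C1_with :: "(complex ^ 'n \<Rightarrow> real) \<Rightarrow> (complex ^ 'n \<Rightarrow> complex ^ 'n \<Rightarrow> real) \<Rightarrow> bool" where
  "C1_with f F \<longleftrightarrow> continuous_on config_space f \<and>
    continuous_on (config_space \<times> UNIV) (\<lambda>x. F (fst x) (snd x)) \<and>
    (\<forall>\<gamma> v t S. \<gamma> t \<in> config_space \<longrightarrow> (\<gamma> has_vector_derivative v) (at t within S) \<longrightarrow>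
      ((\<lambda>t. f (\<gamma> t)) has_real_derivative F (\<gamma> t) v) (at t within S))"

definition C1_config :: "(complex ^ 'n \<Rightarrow> real) \<Rightarrow> bool" where
  "C1_config f \<longleftrightarrow> (\<exists>F. C1_with f F)"

lemma C1_with_deriv:
  "C1_with f F \<Longrightarrow> \<gamma> t \<in> config_space \<Longrightarrow> (\<gamma> has_vector_derivative v) (at t within S) \<Longrightarrow>
    ((\<lambda>t. f (\<gamma> t)) has_real_derivative F (\<gamma> t) v) (at t within S)"
  unfolding C1_with_def by blast

lemma C1_with_continuous:
  assumes "C1_with f F"
  shows "continuous_on config_space f" "continuous_on (config_space \<times> UNIV) (\<lambda>x. F (fst x) (snd x))"
    "continuous_on (config_space \<times> UNIV) (\<lambda>x. f (fst x))"
proof -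
  show 1: "continuous_on config_space f" and "continuous_on (config_space \<times> UNIV) (\<lambda>x. F (fst x) (snd x))"
    using assms by (simp_all add: C1_with_def)
  show "continuous_on (config_space \<times> UNIV) (\<lambda>x. f (fst x))"
    by (rule continuous_on_compose2[OF 1]) (auto intro: continuous_intros)
qed

lemma C1_withI:
  assumes "continuous_on config_space f" "continuous_on (config_space \<times> UNIV) (\<lambda>x. F (fst x) (snd x))"
    "\<And>\<gamma> v t S. \<gamma> t \<in> config_space \<Longrightarrow> (\<gamma> has_vector_derivative v) (at t within S) \<Longrightarrow>
      ((\<lambda>t. f (\<gamma> t)) has_real_derivative F (\<gamma> t) v) (at t within S)"
  shows "C1_with f F"
  unfolding C1_with_def using assms by blast

lemma C1_config_const: "C1_config (\<lambda>z. c)"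
  unfolding C1_config_def
  by (intro exI[of _ "\<lambda>x v. 0"] C1_withI) (auto intro!: derivative_eq_intros)

lemma C1_config_Re: "C1_config (\<lambda>z :: complex ^ 'n. Re (z $ i))"
  unfolding C1_config_def
proof (intro exI C1_withI)
  fix \<gamma> :: "real \<Rightarrow> complex ^ 'n" and v t S
  assume "(\<gamma> has_vector_derivative v) (at t within S)"
  then have "((\<lambda>t. Re (\<gamma> t $ i)) has_vector_derivative Re (v $ i)) (at t within S)"
    by (intro bounded_linear.has_vector_derivative[OF bounded_linear_compose[OF bounded_linear_Re bounded_linear_vec_nth]])
  then show "((\<lambda>t. Re (\<gamma> t $ i)) has_real_derivative Re (v $ i)) (at t within S)"
    by (simp add: has_real_derivative_iff_has_vector_derivative)
qed (intro continuous_intros)+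

lemma C1_config_Im: "C1_config (\<lambda>z :: complex ^ 'n. Im (z $ i))"
  unfolding C1_config_def
proof (intro exI C1_withI)
  fix \<gamma> :: "real \<Rightarrow> complex ^ 'n" and v t S
  assume "(\<gamma> has_vector_derivative v) (at t within S)"
  then have "((\<lambda>t. Im (\<gamma> t $ i)) has_vector_derivative Im (v $ i)) (at t within S)"
    by (intro bounded_linear.has_vector_derivative[OF bounded_linear_compose[OF bounded_linear_Im bounded_linear_vec_nth]])
  then show "((\<lambda>t. Im (\<gamma> t $ i)) has_real_derivative Im (v $ i)) (at t within S)"
    by (simp add: has_real_derivative_iff_has_vector_derivative)
qed (intro continuous_intros)+

lemma C1_config_add:
  fixes f g :: "complex ^ 'n \<Rightarrow> real"
  assumes "C1_config f" "C1_config g"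
  shows "C1_config (\<lambda>z. f z + g z)"
proof -
  obtain F G where FG: "C1_with f F" "C1_with g G" using assms by (auto simp: C1_config_def)
  note c = C1_with_continuous[OF FG(1)] C1_with_continuous[OF FG(2)]
  show ?thesis unfolding C1_config_def
  proof (intro exI[of _ "\<lambda>x v. F x v + G x v"] C1_withI)
    fix \<gamma> :: "real \<Rightarrow> complex ^ 'n" and v t S
    assume "\<gamma> t \<in> config_space" "(\<gamma> has_vector_derivative v) (at t within S)"
    from C1_with_deriv[OF FG(1) this] C1_with_deriv[OF FG(2) this]
    show "((\<lambda>t. f (\<gamma> t) + g (\<gamma> t)) has_real_derivative F (\<gamma> t) v + G (\<gamma> t) v) (at t within S)"
      by (rule DERIV_add)
  qed (intro continuous_intros c)+
qed

lemma C1_config_mult: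
  fixes f g :: "complex ^ 'n \<Rightarrow> real"
  assumes "C1_config f" "C1_config g"
  shows "C1_config (\<lambda>z. f z * g z)"
proof -
  obtain F G where FG: "C1_with f F" "C1_with g G" using assms by (auto simp: C1_config_def)
  note c = C1_with_continuous[OF FG(1)] C1_with_continuous[OF FG(2)]
  show ?thesis unfolding C1_config_def
  proof (intro exI[of _ "\<lambda>x v. F x v * g x + G x v * f x"] C1_withI)
    fix \<gamma> :: "real \<Rightarrow> complex ^ 'n" and v t S
    assume "\<gamma> t \<in> config_space" "(\<gamma> has_vector_derivative v) (at t within S)"
    from C1_with_deriv[OF FG(1) this] C1_with_deriv[OF FG(2) this]
    show "((\<lambda>t. f (\<gamma> t) * g (\<gamma> t)) has_real_derivative F (\<gamma> t) v * g (\<gamma> t) + G (\<gamma> t) v * f (\<gamma> t)) (at t within S)"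
      by (rule DERIV_mult)
  qed (intro continuous_intros c)+
qed

lemma C1_config_inverse:
  fixes f :: "complex ^ 'n \<Rightarrow> real"
  assumes "C1_config f" "\<And>z. z \<in> config_space \<Longrightarrow> f z \<noteq> 0"
  shows "C1_config (\<lambda>z. inverse (f z))"
proof -
  obtain F where F: "C1_with f F" using assms by (auto simp: C1_config_def)
  note c = C1_with_continuous[OF F]
  have ne: "\<forall>z\<in>config_space. f z \<noteq> 0" "\<forall>x\<in>config_space \<times> UNIV. f (fst x) \<noteq> 0" using assms(2) by auto
  show ?thesis unfolding C1_config_def
  proof (intro exI[of _ "\<lambda>x v. - (inverse (f x) * F x v * inverse (f x))"] C1_withI)
    fix \<gamma> :: "real \<Rightarrow> complex ^ 'n" and v t S
    assume a: "\<gamma> t \<in> config_space" "(\<gamma> has_vector_derivative v) (at t within S)"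
    from C1_with_deriv[OF F a] assms(2)[OF a(1)]
    show "((\<lambda>t. inverse (f (\<gamma> t))) has_real_derivative
        - (inverse (f (\<gamma> t)) * F (\<gamma> t) v * inverse (f (\<gamma> t)))) (at t within S)"
      by (auto intro!: derivative_eq_intros)
  qed (intro continuous_intros c ne)+
qed

lemma C1_config_diff: "C1_config f \<Longrightarrow> C1_config g \<Longrightarrow> C1_config (\<lambda>z. f z - g z)"
  using C1_config_add[of f "\<lambda>z. - 1 * g z"] C1_config_mult[OF C1_config_const[of "- 1"], of g] by simp

lemma C1_config_power2: "C1_config f \<Longrightarrow> C1_config (\<lambda>z. (f z)\<^sup>2)"
  unfolding power2_eq_square by (rule C1_config_mult)

lemma C1_config_sum: "finite A \<Longrightarrow> (\<And>a. a \<in> A \<Longrightarrow> C1_config (f a)) \<Longrightarrow> C1_config (\<lambda>z. \<Sum>a\<in>A. f a z)"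
  by (induction rule: finite_induct) (auto intro: C1_config_const C1_config_add)

lemma C1_config_prod: "finite A \<Longrightarrow> (\<And>a. a \<in> A \<Longrightarrow> C1_config (f a)) \<Longrightarrow> C1_config (\<lambda>z. \<Prod>a\<in>A. f a z)"
  by (induction rule: finite_induct) (auto intro: C1_config_const C1_config_mult)

lemma C1_sep: "C1_config (\<lambda>z :: complex ^ 'n. sep (z $ i) (z $ j))"
proof -
  define E where "E = (\<lambda>i (z :: complex ^ 'n). 1 - ((Re (z $ i))\<^sup>2 + (Im (z $ i))\<^sup>2))"
  have E: "C1_config (\<lambda>z. inverse (E i z))" for i
  proof (rule C1_config_inverse)
    show "C1_config (E i)" unfolding E_def
      by (intro C1_config_diff C1_config_add C1_config_power2 C1_config_const C1_config_Re C1_config_Im)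
    show "E i z \<noteq> 0" if "z \<in> config_space" for z
      using cmod_less_1[OF config_spaceD(1)[OF that, of i]] by (simp add: E_def cmod_power2)
  qed
  have eq: "(\<lambda>z :: complex ^ 'n. sep (z $ i) (z $ j)) = (\<lambda>z.
     4 * ((Re (z $ i) * inverse (E i z) - Re (z $ j) * inverse (E j z))\<^sup>2 +
      (Im (z $ i) * inverse (E i z) - Im (z $ j) * inverse (E j z))\<^sup>2) -
     ((2 - E i z) * inverse (E i z) - (2 - E j z) * inverse (E j z))\<^sup>2)"
  proof -
    have "Re (foot w) = Re w * inverse (1 - (cmod w)\<^sup>2)" "Im (foot w) = Im w * inverse (1 - (cmod w)\<^sup>2)"
      "height w = (2 - (1 - (cmod w)\<^sup>2)) * inverse (1 - (cmod w)\<^sup>2)" for w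
      by (simp_all only: foot_def height_def Re_divide_of_real Im_divide_of_real) (simp_all add: divide_inverse)
    then show ?thesis
      unfolding sep_def cmod_power2[of "foot _ - foot _"] minus_complex.sel E_def cmod_power2[symmetric] by metis
  qed
  have E': "C1_config (E i)" for i
    unfolding E_def by (intro C1_config_diff C1_config_add C1_config_power2 C1_config_const C1_config_Re C1_config_Im)
  show ?thesis unfolding eq
    by (intro C1_config_diff C1_config_add C1_config_power2 C1_config_mult C1_config_const C1_config_Re C1_config_Im E E')
qed

lemma C1_wall: "C1_config (\<lambda>z :: complex ^ 'n. wall z T)"
  unfolding wall_def divide_inverse
  by (intro C1_config_diff C1_config_mult C1_config_power2 C1_config_sum C1_config_const C1_sep) auto

lemma C1_walls: "C1_config (walls :: complex ^ 'n \<Rightarrow> real)"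
proof -
  have eq: "walls = (\<lambda>z :: complex ^ 'n. \<Prod>T | card T = 3. wall z T)" by (simp add: fun_eq_iff walls_def)
  show ?thesis by (subst eq) (intro C1_config_prod C1_wall, simp)
qed

lemma real_derivative_unique:
  fixes f :: "real \<Rightarrow> real"
  assumes "(f has_real_derivative D) (at t within S)" "(f has_real_derivative E) (at t within S)" "at t within S \<noteq> bot"
  shows "D = E"
  using vector_derivative_unique_within[OF assms(3)] assms(1,2)
  by (simp add: has_real_derivative_iff_has_vector_derivative)

text \<open>Where two walls meet, the derivative of their product vanishes.\<close>

lemma simple_zero_one_wall:
  fixes \<gamma> :: "real \<Rightarrow> complex ^ 'n"
  assumes g: "\<gamma> t \<in> config_space" "(\<gamma> has_vector_derivative v) (at t within S)" "at t within S \<noteq> bot"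
    and D: "((\<lambda>t. walls (\<gamma> t)) has_real_derivative D) (at t within S)" "D \<noteq> 0"
  shows "\<exists>T. critical_triples (\<gamma> t) \<subseteq> {T}"
proof (rule ccontr)
  assume "\<nexists>T. critical_triples (\<gamma> t) \<subseteq> {T}"
  then obtain T T' where T: "T \<in> critical_triples (\<gamma> t)" "T' \<in> critical_triples (\<gamma> t)" "T \<noteq> T'"
    by (metis insertI1 subsetI singleton_iff)
  have c: "card T = 3" "card T' = 3" using T by (simp_all add: critical_triples_def)
  have fin: "finite {S :: 'n set. card S = 3}" by (rule finite_subset[OF subset_UNIV]) simp
  define R where "R = (\<lambda>z. wall z T' * (\<Prod>S\<in>{S. card S = 3} - {T} - {T'}. wall z S))"
  have eq: "walls z = wall z T * R z" for z
  proof -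
    have "walls z = wall z T * (\<Prod>S\<in>{S. card S = 3} - {T}. wall z S)"
      unfolding walls_def by (rule prod.remove) (use fin c in auto)
    also have "(\<Prod>S\<in>{S. card S = 3} - {T}. wall z S) = R z"
      unfolding R_def by (rule prod.remove) (use fin c T in auto)
    finally show ?thesis .
  qed
  have "C1_config R" unfolding R_def
    by (intro C1_config_mult C1_wall C1_config_prod) (use fin in auto)
  then obtain F G where F: "C1_with (\<lambda>z. wall z T) F" "C1_with R G"
    using C1_wall[of T] by (metis C1_config_def)
  have "wall (\<gamma> t) T = 0" "R (\<gamma> t) = 0"
    using wall_critical[OF g(1)] T c by (auto simp: R_def)
  with DERIV_mult[OF C1_with_deriv[OF F(1) g(1,2)] C1_with_deriv[OF F(2) g(1,2)]]
  have "((\<lambda>t. walls (\<gamma> t)) has_real_derivative 0) (at t within S)" unfolding eq by simp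
  with D g(3) show False using real_derivative_unique by blast
qed

section \<open>Segments transverse to the walls\<close>

text \<open>Regular end points allow such segments to be chained; simple zeros of
  \<open>walls\<close> on the way are transverse crossings of single walls.\<close>

definition tame :: "complex ^ 'n \<Rightarrow> complex ^ 'n \<Rightarrow> bool" where
  "tame x y \<longleftrightarrow> closed_segment x y \<subseteq> config_space \<and> walls x \<noteq> 0 \<and> walls y \<noteq> 0 \<and>
    (\<forall>t\<in>{0..1}. walls (x + t *\<^sub>R (y - x)) = 0 \<longrightarrow>
      (\<exists>D. D \<noteq> 0 \<and> ((\<lambda>t. walls (x + t *\<^sub>R (y - x))) has_real_derivative D) (at t)))"

definition upd :: "complex ^ 'n \<Rightarrow> 'n \<Rightarrow> complex \<Rightarrow> complex ^ 'n" where
  "upd x m v = (\<chi> i. if i = m then v else x $ i)"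

lemma upd_nth [simp]: "upd x m v $ i = (if i = m then v else x $ i)"
  by (simp add: upd_def)

lemma upd_segment: "x + t *\<^sub>R (upd x m v - x) = upd x m (x $ m + t *\<^sub>R (v - x $ m))"
  by (simp add: vec_eq_iff)

section \<open>Intersections and tangents of horocycles\<close>

lemma finite_quadratic:
  fixes A B C :: real
  assumes "A \<noteq> 0"
  shows "finite {t. A * t\<^sup>2 + B * t + C = 0}"
proof -
  have "finite {t. poly [:C, B, A:] t = 0}" by (rule poly_roots_finite) (use assms in simp)
  then show ?thesis by (simp add: power2_eq_square algebra_simps)
qed

text \<open>The line is parametrised by \<open>t = Im (w * cnj q)\<close>, and the circle becomes a
  quadratic equation in \<open>t\<close>.\<close>

lemma finite_circle_line:
  assumes "q \<noteq> 0" "a \<noteq> 0"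
  shows "finite {w. a * (cmod w)\<^sup>2 + Re (w * cnj r) + k = 0 \<and> Re (w * cnj q) = l}"
proof -
  define s where "s = (cmod q)\<^sup>2"
  have s: "s > 0" using assms by (simp add: s_def)
  define f where "f = (\<lambda>t. (of_real l + \<i> * of_real t) * q / of_real s)"
  define Q where "Q = {t. (a / s) * t\<^sup>2 + (- Im (q * cnj r) / s) * t + (a * l\<^sup>2 / s + l * Re (q * cnj r) / s + k) = 0}"
  have "finite Q" unfolding Q_def by (rule finite_quadratic) (use assms s in simp)
  moreover have "w \<in> f ` Q" if w: "a * (cmod w)\<^sup>2 + Re (w * cnj r) + k = 0" "Re (w * cnj q) = l" for w
  proof
    define t where "t = Im (w * cnj q)"
    have wq: "w * cnj q = of_real l + \<i> * of_real t" using w(2) by (simp add: complex_eq_iff t_def)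
    have "w * of_real s = (w * cnj q) * q" by (simp add: s_def complex_norm_square del: of_real_power)
    then show wf: "w = f t" using s unfolding wq by (simp add: f_def field_simps)
    have "(cmod w)\<^sup>2 * s = (cmod (w * cnj q))\<^sup>2" by (simp add: s_def norm_mult power_mult_distrib)
    also have "\<dots> = l\<^sup>2 + t\<^sup>2" unfolding wq cmod_power2 by simp
    finally have "(cmod w)\<^sup>2 = (l\<^sup>2 + t\<^sup>2) / s" using s by (simp add: field_simps)
    moreover have "Re (w * cnj r) = (l * Re (q * cnj r) - t * Im (q * cnj r)) / s"
    proof -
      have "w * cnj r = ((of_real l + \<i> * of_real t) * (q * cnj r)) / of_real s" by (simp add: wf f_def)
      then show ?thesis by (simp only: Re_divide_of_real) simp
    qed
    ultimately show "t \<in> Q" using w(1) by (simp add: Q_def diff_divide_distrib add_divide_distrib algebra_simps)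
  qed
  ultimately show ?thesis by (elim finite_surj) blast
qed

text \<open>The numerator of \<open>level w p - c\<close>. For \<open>|p| = 1\<close> and
  \<open>c > 0\<close> it is a quadratic polynomial on the whole plane that vanishes on the circle
  with centre \<open>p / (1 + c)\<close> and radius \<open>c / (1 + c)\<close>.\<close>

definition circ :: "complex \<Rightarrow> real \<Rightarrow> complex \<Rightarrow> real" where
  "circ p c w = (1 + c) * (cmod w)\<^sup>2 + Re (w * cnj (- 2 * p)) + (1 - c)"

lemma level_circ:
  assumes "cmod w < 1"
  shows "level w p - c = circ p c w / (1 - (cmod w)\<^sup>2)"
proof -
  define e where "e = 1 - (cmod w)\<^sup>2"
  have e: "e > 0" using cmod_less_1[OF assms] by (simp add: e_def)
  have "foot w * cnj p = w * cnj p / of_real e" by (simp add: foot_def e_def)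
  then have "level w p - c = (1 + (cmod w)\<^sup>2) / e - 2 * (Re (w * cnj p) / e) - c"
    unfolding level_def height_def by (simp only: Re_divide_of_real e_def)
  also have "\<dots> = (1 + (cmod w)\<^sup>2 - 2 * Re (w * cnj p) - c * e) / e"
    using e by (simp add: diff_divide_distrib)
  also have "1 + (cmod w)\<^sup>2 - 2 * Re (w * cnj p) - c * e = circ p c w"
    by (simp add: circ_def e_def algebra_simps)
  finally show ?thesis by (simp add: e_def)
qed

text \<open>Eliminating \<open>|w|^2\<close> leaves the radical axis, a line with normal
  \<open>q\<close>, which could vanish only if the two circles coincided.\<close>

lemma finite_circ_inter:
  assumes "cmod p = 1" "cmod p' = 1" "c > 0" "c' > 0" "(p, c) \<noteq> (p', c')"
  shows "finite {w. circ p c w = 0 \<and> circ p' c' w = 0}"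
proof -
  define q where "q = of_real (1 + c') * p - of_real (1 + c) * p'"
  have "q \<noteq> 0"
  proof
    assume "q = 0"
    then have eq: "of_real (1 + c') * p = of_real (1 + c) * p'" by (simp add: q_def)
    then have "cmod (of_real (1 + c') * p) = cmod (of_real (1 + c) * p')" by (rule arg_cong)
    then have "c' = c" using assms unfolding norm_mult norm_of_real by simp
    moreover have "complex_of_real (1 + c) \<noteq> 0" using assms(3) by (simp only: of_real_eq_0_iff)
    ultimately show False using eq assms(5) by (simp del: of_real_add)
  qed
  then have "finite {w. (1 + c) * (cmod w)\<^sup>2 + Re (w * cnj (- 2 * p)) + (1 - c) = 0 \<and>
      Re (w * cnj q) = ((1 + c') * (1 - c) - (1 + c) * (1 - c')) / 2}"
    by (rule finite_circle_line) (use assms in simp)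
  moreover have "Re (w * cnj q) = ((1 + c') * (1 - c) - (1 + c) * (1 - c')) / 2"
    if "circ p c w = 0" "circ p' c' w = 0" for w
  proof -
    have "(1 + c') * circ p c w - (1 + c) * circ p' c' w = 0" using that by simp
    then show ?thesis by (simp add: circ_def q_def algebra_simps)
  qed
  ultimately show ?thesis by (elim finite_subset[rotated]) (auto simp: circ_def)
qed

text \<open>The points where a line through \<open>u\<close> touches the circle lie on the polar of
  \<open>u\<close>. If \<open>u\<close> is the centre, then \<open>q = 0\<close> and there are none,
  since \<open>l\<close> is not zero.\<close>

lemma finite_circ_tangent:
  assumes "cmod p = 1" "c > 0"
  shows "finite {w. circ p c w = 0 \<and> 2 * (1 + c) * Re (w * cnj (w - u)) - 2 * Re ((w - u) * cnj p) = 0}"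
proof -
  define q where "q = of_real (1 + c) * u - p"
  define l where "l = Re (u * cnj p) - (1 - c)"
  have lin: "Re (w * cnj q) = l"
    if "circ p c w = 0" "2 * (1 + c) * Re (w * cnj (w - u)) - 2 * Re ((w - u) * cnj p) = 0" for w
  proof -
    have "(cmod w)\<^sup>2 = Re w * Re w + Im w * Im w" using cmod_power2[of w] by (simp only: power2_eq_square)
    with that show ?thesis unfolding circ_def q_def l_def by (simp add: algebra_simps)
  qed
  show ?thesis
  proof (cases "q = 0")
    case False
    then have "finite {w. (1 + c) * (cmod w)\<^sup>2 + Re (w * cnj (- 2 * p)) + (1 - c) = 0 \<and> Re (w * cnj q) = l}"
      by (rule finite_circle_line) (use assms in simp)
    then show ?thesis by (rule finite_subset[rotated]) (use lin in \<open>auto simp: circ_def\<close>)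
  next
    case True
    then have p: "p = of_real (1 + c) * u" by (simp add: q_def)
    have "(1 + c) * Re (u * cnj p) = Re (p * cnj p)" unfolding p by (simp add: algebra_simps)
    also have "p * cnj p = of_real 1" using assms(1) by (simp add: complex_norm_square[symmetric])
    finally have "(1 + c) * Re (u * cnj p) = 1" by simp
    then have "(1 + c) * l = c * c" unfolding l_def by (simp add: algebra_simps)
    then have "l \<noteq> 0" using assms(2) by auto
    then have "{w. circ p c w = 0 \<and> 2 * (1 + c) * Re (w * cnj (w - u)) - 2 * Re ((w - u) * cnj p) = 0} = {}"
      using lin True by fastforce
    then show ?thesis by (simp only: finite.emptyI)
  qed
qed

lemma circ_deriv:
  "((\<lambda>t. circ p c (u + t *\<^sub>R d)) has_real_derivative
     2 * (1 + c) * Re ((u + t *\<^sub>R d) * cnj d) - 2 * Re (d * cnj p)) (at t)"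
  unfolding circ_def cmod_power2
  by (auto intro!: derivative_eq_intros simp: algebra_simps power2_eq_square)

lemma negligible_circ:
  assumes "c > 0"
  shows "negligible {w. circ p c w = 0}"
proof -
  define m where "m = p / of_real (1 + c)"
  define R where "R = (cmod m)\<^sup>2 - (1 - c) / (1 + c)"
  have "w \<in> sphere m (sqrt R)" if "circ p c w = 0" for w
  proof -
    have "(cmod (w - m))\<^sup>2 = (cmod w)\<^sup>2 - 2 * Re (w * cnj m) + (cmod m)\<^sup>2"
      unfolding cmod_power2 by (simp add: power2_eq_square algebra_simps)
    also have "Re (w * cnj m) = Re (w * cnj p) / (1 + c)"
    proof -
      have "w * cnj m = w * cnj p / of_real (1 + c)" by (simp add: m_def)
      then show ?thesis by (simp only: Re_divide_of_real)
    qed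
    also have "(cmod w)\<^sup>2 - 2 * (Re (w * cnj p) / (1 + c)) = - (1 - c) / (1 + c)"
      using that assms by (simp add: circ_def field_simps)
    finally have "(cmod (w - m))\<^sup>2 = R" by (simp add: R_def diff_divide_distrib)
    moreover have "cmod (w - m) = sqrt ((cmod (w - m))\<^sup>2)" by simp
    ultimately have "cmod (w - m) = sqrt R" by simp
    then show ?thesis by (simp add: dist_norm norm_minus_commute)
  qed
  then show ?thesis by (intro negligible_subset[OF negligible_sphere]) auto
qed

lemma negligible_line:
  assumes "q \<noteq> u"
  shows "negligible {v. Im ((v - u) * cnj (q - u)) = 0}"
proof -
  define a where "a = Complex (- Im (q - u)) (Re (q - u))"
  have "a \<noteq> 0" using assms by (auto simp: a_def complex_eq_iff)
  then have "negligible {v. a \<bullet> v = a \<bullet> u}" by (intro negligible_hyperplane) simp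
  moreover have "{v. Im ((v - u) * cnj (q - u)) = 0} = {v. a \<bullet> v = a \<bullet> u}"
    by (auto simp: a_def inner_complex_def algebra_simps)
  ultimately show ?thesis by simp
qed

text \<open>A product rule for a \<open>g\<close> that is merely continuous: at a zero of
  \<open>f\<close> the difference quotient of the product is that of \<open>f\<close> times
  \<open>g\<close>.\<close>

lemma DERIV_mult_at_zero:
  fixes f g :: "real \<Rightarrow> real"
  assumes "(f has_real_derivative D) (at t)" "f t = 0" "isCont g t"
  shows "((\<lambda>s. f s * g s) has_real_derivative D * g t) (at t)"
proof -
  have "(\<lambda>s. (f s - f t) / (s - t)) \<midarrow>t\<rightarrow> D" "g \<midarrow>t\<rightarrow> g t"
    using assms(1,3) by (simp_all add: has_field_derivative_iff isCont_def)
  from tendsto_mult[OF this] show ?thesis using assms(2) by (simp add: has_field_derivative_iff)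
qed

lemma isCont_config:
  "continuous_on config_space f \<Longrightarrow> z \<in> config_space \<Longrightarrow> isCont f z"
  using continuous_on_eq_continuous_at[OF open_config_space] by blast

lemma side_upd:
  assumes "i \<noteq> m" "j \<noteq> m" "cmod w < 1"
  shows "side (upd x m w $ i) (upd x m w $ j) (upd x m w $ m) =
    circ (pt x i j) (level (x $ i) (pt x i j)) w / (1 - (cmod w)\<^sup>2)"
  using assms level_circ[OF assms(3)] by (simp add: side_def pt_def)

lemma wall_upd:
  assumes "m \<notin> T"
  shows "wall (upd x m w) T = wall x T"
proof -
  have "upd x m w $ i = x $ i" if "i \<in> T" for i using that assms by auto
  then show ?thesis unfolding wall_def by (simp cong: sum.cong)
qed

text \<open>When only the point \<open>m\<close> moves, the walls it can meet are the circles
  \<open>C a\<close> of the pairs of other points. A straight move from \<open>u\<close> is bad if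
  it passes through an intersection of two circles or touches one, which happens at the finitely
  many points \<open>Q\<close>, or if it ends on a circle. The bad end points form a null set and
  cannot fill \<open>V\<close>.\<close>

lemma ex_tame_coordinate:
  fixes x :: "complex ^ 'n"
  assumes x: "x \<in> config_space" "walls x \<noteq> 0" and V: "open V" "V \<noteq> {}"
    and in_config: "\<And>v t. v \<in> V \<Longrightarrow> t \<in> {0..1} \<Longrightarrow> upd x m (x $ m + t *\<^sub>R (v - x $ m)) \<in> config_space"
  shows "\<exists>v\<in>V. tame x (upd x m v)"
proof -
  define u where "u = x $ m"
  define I where "I = {(i, j). i \<noteq> j \<and> i \<noteq> m \<and> j \<noteq> m}"
  define p where "p = (\<lambda>a. pt x (fst a) (snd a))"
  define c where "c = (\<lambda>a. level (x $ fst a) (p a))"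
  define C where "C = (\<lambda>a. circ (p a) (c a))"
  have finI: "finite I" by (rule finite_subset[OF subset_UNIV]) simp
  have no_crit: "T \<notin> critical_triples x" for T using walls_eq_0_iff[OF x(1)] x(2) by simp
  have pI: "cmod (p a) = 1" "c a > 0" "level (x $ snd a) (p a) = c a" if "a \<in> I" for a
  proof -
    have d: "fst a \<noteq> snd a" using that by (auto simp: I_def)
    show 1: "cmod (p a) = 1" "level (x $ snd a) (p a) = c a" using pt_props[OF x(1) d] by (simp_all add: p_def c_def)
    show "c a > 0" unfolding c_def by (rule level_pos[OF 1(1) config_spaceD(1)[OF x(1)]])
  qed
  \<comment> \<open>Two pairs with the same circle would contain three indices on one horocycle, or
    be \<open>(i, j)\<close> and \<open>(j, i)\<close>, whose contact points differ.\<close>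
  have distinct_circles: "(p a, c a) \<noteq> (p b, c b)" if ab: "a \<in> I" "b \<in> I" "a \<noteq> b" for a b
  proof
    assume eq: "(p a, c a) = (p b, c b)"
    obtain i j k l where e: "a = (i, j)" "b = (k, l)" by (cases a, cases b)
    have d: "i \<noteq> j" "k \<noteq> l" "(i, j) \<noteq> (k, l)" using ab by (auto simp: I_def e)
    have lv: "level (x $ s) (p a) = c a" if "s \<in> {i, j, k, l}" for s
      using that pI(3)[OF ab(1)] pI(3)[OF ab(2)] eq by (auto simp: e c_def)
    show False
    proof (cases "k \<in> {i, j} \<and> l \<in> {i, j}")
      case True
      then have "k = j \<and> l = i" using d by auto
      then have "pt x i j = pt x j i" using eq by (simp add: p_def e)
      then show False using contact_swap_neq[of "x $ i" "x $ j"] config_spaceD[OF x(1)] d by (auto simp: pt_def)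
    next
      case False
      then obtain s where s: "s \<in> {i, j, k, l}" "s \<noteq> i" "s \<noteq> j" by auto
      have "{i, j, s} \<in> critical_triples x"
        using critical_iff_level[OF x(1), of i j s] d(1) s lv pI(1)[OF ab(1)] by auto
      then show False using no_crit by blast
    qed
  qed
  have curve: "\<exists>a\<in>I. C a w = 0 \<and> T = {fst a, snd a, m}"
    if w: "upd x m w \<in> config_space" "T \<in> critical_triples (upd x m w)" for w T
  proof -
    have c3: "card T = 3" using w(2) by (simp add: critical_triples_def)
    have z: "wall (upd x m w) T = 0" using wall_critical[OF w(1) c3] w(2) by simp
    have w1: "cmod w < 1" using config_spaceD(1)[OF w(1), of m] by simp
    have "m \<in> T"
    proof (rule ccontr)
      assume "m \<notin> T"
      then have "wall x T = 0" using z wall_upd by metis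
      then show False using wall_critical[OF x(1) c3] no_crit by blast
    qed
    then have "card (T - {m}) = 2" using c3 by simp
    then obtain i j where "T - {m} = {i, j}" "i \<noteq> j" by (auto simp: card_2_iff)
    then have T: "T = {i, j, m}" and d: "distinct [i, j, m]" using \<open>m \<in> T\<close> by auto
    have e: "1 - (cmod w)\<^sup>2 \<noteq> 0" using cmod_less_1[OF w1] by simp
    have "side (upd x m w $ i) (upd x m w $ j) (upd x m w $ m) = 0 \<or> side (upd x m w $ j) (upd x m w $ i) (upd x m w $ m) = 0"
      using z unfolding T wall_eq_0_iff[OF w(1) d] .
    then have "C (i, j) w = 0 \<or> C (j, i) w = 0"
      using side_upd[of i m j w x] side_upd[of j m i w x] d w1 e by (auto simp: C_def c_def p_def)
    moreover have "(i, j) \<in> I" "(j, i) \<in> I" using d by (auto simp: I_def)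
    ultimately show ?thesis using T by force
  qed
  \<comment> \<open>\<open>M a w\<close> is the derivative of \<open>C a\<close> at \<open>w\<close>
    in the direction \<open>w - u\<close>, that is, \<open>t\<close> times the derivative along the
    segment.\<close>
  define M where "M = (\<lambda>a w. 2 * (1 + c a) * Re (w * cnj (w - u)) - 2 * Re ((w - u) * cnj (p a)))"
  define Q where "Q = (\<Union>a\<in>I. \<Union>b\<in>I - {a}. {w. C a w = 0 \<and> C b w = 0}) \<union> (\<Union>a\<in>I. {w. C a w = 0 \<and> M a w = 0})"
  have "finite Q" unfolding Q_def
  proof (intro finite_UnI finite_UN_I finite_Diff finI)
    fix a b assume ab: "a \<in> I" "b \<in> I - {a}"
    show "finite {w. C a w = 0 \<and> C b w = 0}" unfolding C_def
      by (rule finite_circ_inter) (use pI ab distinct_circles[of a b] in auto)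
  next
    fix a assume "a \<in> I"
    then show "finite {w. C a w = 0 \<and> M a w = 0}" unfolding C_def M_def
      by (intro finite_circ_tangent pI)
  qed
  have Cu: "C a u \<noteq> 0" if a: "a \<in> I" for a
  proof
    assume Ca: "C a u = 0"
    have xu: "upd x m u = x" by (simp add: vec_eq_iff u_def)
    have d: "distinct [fst a, snd a, m]" using a by (auto simp: I_def)
    have "cmod u < 1" unfolding u_def by (rule config_spaceD(1)[OF x(1)])
    with d have "side (upd x m u $ fst a) (upd x m u $ snd a) (upd x m u $ m) = C a u / (1 - (cmod u)\<^sup>2)"
      unfolding C_def c_def p_def by (intro side_upd) auto
    then have "side (x $ fst a) (x $ snd a) (x $ m) = 0" unfolding xu Ca by simp
    then have "wall x {fst a, snd a, m} = 0" using wall_eq_0_iff[OF x(1) d] by simp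
    then have "{fst a, snd a, m} \<in> critical_triples x"
      using wall_critical[OF x(1), of "{fst a, snd a, m}"] d by simp
    then show False using no_crit by blast
  qed
  have uQ: "u \<notin> Q" using Cu by (auto simp: Q_def)
  define B where "B = (\<Union>q\<in>Q. {v. Im ((v - u) * cnj (q - u)) = 0}) \<union> (\<Union>a\<in>I. {v. C a v = 0})"
  have "negligible {v. Im ((v - u) * cnj (q - u)) = 0}" if "q \<in> Q" for q
  proof (rule negligible_line)
    show "q \<noteq> u" using that uQ by auto
  qed
  then have "negligible (\<Union>q\<in>Q. {v. Im ((v - u) * cnj (q - u)) = 0})"
    using \<open>finite Q\<close> by (intro negligible_Union) auto
  moreover have "negligible {v. C a v = 0}" if "a \<in> I" for a
    unfolding C_def by (rule negligible_circ[OF pI(2)[OF that]])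
  then have "negligible (\<Union>a\<in>I. {v. C a v = 0})"
    using finI by (intro negligible_Union) auto
  ultimately have "negligible B" unfolding B_def by (rule negligible_Un)
  then have "\<not> V \<subseteq> B" using open_not_negligible[OF V] negligible_subset by blast
  then obtain v where v: "v \<in> V" "v \<notin> B" by blast
  define d where "d = v - u"
  have line: "x + t *\<^sub>R (upd x m v - x) = upd x m (u + t *\<^sub>R d)" for t
    unfolding upd_segment u_def d_def ..
  have lc: "upd x m (u + t *\<^sub>R d) \<in> config_space" if "t \<in> {0..1}" for t
    unfolding u_def d_def using in_config[OF v(1) that] .
  have "tame x (upd x m v)"
    unfolding tame_def
  proof (intro conjI ballI impI)
    have "closed_segment x (upd x m v) = (\<lambda>t. x + t *\<^sub>R (upd x m v - x)) ` {0..1}"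
      by (auto simp: closed_segment_def algebra_simps)
    then show "closed_segment x (upd x m v) \<subseteq> config_space" using lc line by auto
    show "walls x \<noteq> 0" by (rule x(2))
    have vc: "upd x m v \<in> config_space" using lc[of 1] by (simp add: d_def)
    show "walls (upd x m v) \<noteq> 0"
    proof
      assume "walls (upd x m v) = 0"
      then obtain T where "T \<in> critical_triples (upd x m v)" using walls_eq_0_iff[OF vc] by auto
      from curve[OF vc this] v(2) show False by (auto simp: B_def)
    qed
    fix t :: real assume t: "t \<in> {0..1}" and 0: "walls (x + t *\<^sub>R (upd x m v - x)) = 0"
    define w where "w = u + t *\<^sub>R d"
    have wc: "upd x m w \<in> config_space" unfolding w_def by (rule lc[OF t])
    have w1: "cmod w < 1" using config_spaceD(1)[OF wc, of m] by simp
    have wQ: "w \<notin> Q"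
    proof
      assume q: "w \<in> Q"
      have "(v - u) * cnj (w - u) = of_real t * (d * cnj d)"
        by (simp add: w_def d_def scaleR_conv_of_real)
      also have "\<dots> = of_real (t * (cmod d)\<^sup>2)" unfolding complex_norm_square[symmetric] by simp
      finally have "Im ((v - u) * cnj (w - u)) = 0" by simp
      then show False using v(2) q by (auto simp: B_def)
    qed
    have "walls (upd x m w) = 0" using 0 unfolding line w_def .
    then obtain T where T: "T \<in> critical_triples (upd x m w)" using walls_eq_0_iff[OF wc] by auto
    obtain a where a: "a \<in> I" "C a w = 0" "T = {fst a, snd a, m}" using curve[OF wc T] by blast
    have cr: "critical_triples (upd x m w) \<subseteq> {T}"
    proof
      fix T' assume "T' \<in> critical_triples (upd x m w)"
      from curve[OF wc this] obtain b where b: "b \<in> I" "C b w = 0" "T' = {fst b, snd b, m}" by blast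
      have "b = a"
      proof (rule ccontr)
        assume "b \<noteq> a"
        then have "w \<in> Q" using a b unfolding Q_def by blast
        then show False using wQ by blast
      qed
      then show "T' \<in> {T}" using a b by simp
    qed
    have da: "distinct [fst a, snd a, m]" using a(1) by (auto simp: I_def)
    have s: "side (upd x m s $ fst a) (upd x m s $ snd a) (upd x m s $ m) = C a s / (1 - (cmod s)\<^sup>2)"
      if "cmod s < 1" for s
      using side_upd[of "fst a" m "snd a" s x] da that by (simp add: C_def c_def p_def)
    have s0: "side (upd x m w $ fst a) (upd x m w $ snd a) (upd x m w $ m) = 0" using s[OF w1] a(2) by simp
    obtain H where H: "continuous_on config_space H" "H (upd x m w) \<noteq> 0"
      "\<And>y. y \<in> config_space \<Longrightarrow> walls y = side (y $ fst a) (y $ snd a) (y $ m) * H y"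
      using walls_factor[OF wc cr da s0] by blast
    \<comment> \<open>The quotient of \<open>walls\<close> by \<open>C a\<close> along the segment;
      it is continuous at \<open>t\<close> and not zero there.\<close>
    define G where "G = (\<lambda>r. H (x + r *\<^sub>R (upd x m v - x)) / (1 - (cmod (u + r *\<^sub>R d))\<^sup>2))"
    have ev: "eventually (\<lambda>r. x + r *\<^sub>R (upd x m v - x) \<in> config_space) (nhds t)"
    proof -
      have "open ((\<lambda>r. x + r *\<^sub>R (upd x m v - x)) -` config_space)"
        by (intro open_vimage open_config_space continuous_intros)
      moreover have "t \<in> (\<lambda>r. x + r *\<^sub>R (upd x m v - x)) -` config_space" using wc by (simp add: line w_def)
      ultimately show ?thesis using eventually_nhds_in_open by fastforce
    qed
    have ev2: "eventually (\<lambda>r. walls (x + r *\<^sub>R (upd x m v - x)) = C a (u + r *\<^sub>R d) * G r) (nhds t)"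
      using ev
    proof eventually_elim
      case (elim r)
      then have rc: "upd x m (u + r *\<^sub>R d) \<in> config_space" by (simp only: line)
      have "cmod (u + r *\<^sub>R d) < 1" using config_spaceD(1)[OF rc, of m] by simp
      from H(3)[OF rc] s[OF this] show ?case by (simp add: line G_def)
    qed
    have contG: "isCont G t"
    proof -
      have "isCont H (x + t *\<^sub>R (upd x m v - x))"
        unfolding line by (rule isCont_config[OF H(1) wc[unfolded w_def]])
      moreover have "isCont (\<lambda>r. x + r *\<^sub>R (upd x m v - x)) t" by (intro continuous_intros)
      ultimately have "isCont (\<lambda>r. H (x + r *\<^sub>R (upd x m v - x))) t" by (rule isCont_o2[rotated])
      moreover have "1 - (cmod (u + t *\<^sub>R d))\<^sup>2 \<noteq> 0" using cmod_less_1[OF w1] by (simp add: w_def)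
      ultimately show ?thesis unfolding G_def by (intro continuous_intros) auto
    qed
    define E where "E = 2 * (1 + c a) * Re ((u + t *\<^sub>R d) * cnj d) - 2 * Re (d * cnj (p a))"
    have dC: "((\<lambda>r. C a (u + r *\<^sub>R d)) has_real_derivative E) (at t)"
      unfolding C_def E_def by (rule circ_deriv)
    have "t * E = M a w" unfolding E_def M_def w_def by (simp add: algebra_simps scaleR_conv_of_real)
    moreover have "M a w \<noteq> 0" using wQ a by (auto simp: Q_def)
    ultimately have "E \<noteq> 0" by auto
    moreover have "G t \<noteq> 0" using H(2) cmod_less_1[OF w1] unfolding G_def line w_def by simp
    moreover have "((\<lambda>r. C a (u + r *\<^sub>R d) * G r) has_real_derivative E * G t) (at t)"
      by (rule DERIV_mult_at_zero[OF dC _ contG]) (use a(2) in \<open>simp add: w_def\<close>)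
    then have "((\<lambda>r. walls (x + r *\<^sub>R (upd x m v - x))) has_real_derivative E * G t) (at t)"
      using DERIV_cong_ev[OF HOL.refl ev2 HOL.refl] by blast
    ultimately show "\<exists>D. D \<noteq> 0 \<and> ((\<lambda>t. walls (x + t *\<^sub>R (upd x m v - x))) has_real_derivative D) (at t)"
      by (intro exI[of _ "E * G t"]) simp
  qed
  with v(1) show ?thesis by blast
qed

section \<open>Good paths\<close>

lemma (in group) quotient_eq:
  assumes "x \<otimes> inv u = y \<otimes> inv v" "x \<in> carrier G" "y \<in> carrier G" "u \<in> carrier G" "v \<in> carrier G"
  shows "inv x \<otimes> y = inv u \<otimes> v"
proof -
  have "y = y \<otimes> inv v \<otimes> v" using assms(3,5) by (simp add: m_assoc)
  also have "\<dots> = x \<otimes> (inv u \<otimes> v)" using assms by (simp add: m_assoc flip: assms(1))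
  finally have "inv x \<otimes> y = inv x \<otimes> (x \<otimes> (inv u \<otimes> v))" by simp
  also have "\<dots> = (inv x \<otimes> x) \<otimes> (inv u \<otimes> v)" using assms by (subst m_assoc) auto
  finally show ?thesis using assms by simp
qed

text \<open>Multiplication by \<open>D\<close> turns the derivative into \<open>D * D > 0\<close>
  and treats both signs at once.\<close>

lemma simple_zero_sign:
  fixes f :: "real \<Rightarrow> real"
  assumes D: "(f has_real_derivative D) (at t within S)" "D \<noteq> 0" "f t = 0"
  shows "\<exists>\<epsilon>>0. \<forall>s\<in>S. \<bar>s - t\<bar> < \<epsilon> \<longrightarrow> (s < t \<longrightarrow> f s * D < 0) \<and> (t < s \<longrightarrow> f s * D > 0)"
proof -
  define g where "g = (\<lambda>s. f s * D)"
  have g: "(g has_real_derivative D * D) (at t within S)"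
    unfolding g_def using D(1) by (rule DERIV_cmult_right)
  have pos: "D * D > 0" using D(2) by (auto simp: zero_less_mult_iff)
  have g0: "g t = 0" using D(3) by (simp add: g_def)
  obtain d where d: "d > 0" "\<And>h. h > 0 \<Longrightarrow> t + h \<in> S \<Longrightarrow> h < d \<Longrightarrow> g t < g (t + h)"
    using has_real_derivative_pos_inc_right[OF g pos] by blast
  obtain e where e: "e > 0" "\<And>h. h > 0 \<Longrightarrow> t - h \<in> S \<Longrightarrow> h < e \<Longrightarrow> g (t - h) < g t"
    using has_real_derivative_pos_inc_left[OF g pos] by blast
  have "g s < 0" if "s \<in> S" "\<bar>s - t\<bar> < min d e" "s < t" for s
    using e(2)[of "t - s"] that g0 by auto
  moreover have "g s > 0" if "s \<in> S" "\<bar>s - t\<bar> < min d e" "t < s" for s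
    using d(2)[of "s - t"] that g0 by auto
  ultimately show ?thesis using d(1) e(1) unfolding g_def by (intro exI[of _ "min d e"]) auto
qed

text \<open>Infinitely many zeros in a compact interval would accumulate at a zero, contrary to
  isolation.\<close>

lemma finite_zeros:
  fixes f :: "real \<Rightarrow> real"
  assumes "continuous_on {a..b} f"
    and iso: "\<And>t. t \<in> {a..b} \<Longrightarrow> f t = 0 \<Longrightarrow> \<exists>\<epsilon>>0. \<forall>s\<in>{a..b}. \<bar>s - t\<bar> < \<epsilon> \<longrightarrow> s \<noteq> t \<longrightarrow> f s \<noteq> 0"
  shows "finite {t \<in> {a..b}. f t = 0}"
proof (rule ccontr)
  let ?Z = "{t \<in> {a..b}. f t = 0}"
  assume inf: "infinite ?Z"
  have cl: "closed ?Z" by (rule continuous_closed_preimage_constant[OF assms(1) closed_atLeastAtMost])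
  have "compact ({a..b} \<inter> ?Z)" by (rule compact_Int_closed[OF compact_Icc cl])
  moreover have "{a..b} \<inter> ?Z = ?Z" by blast
  ultimately have "compact ?Z" by (simp only:)
  then obtain t where t: "t \<in> ?Z" "t islimpt ?Z"
    using inf unfolding compact_eq_Bolzano_Weierstrass by blast
  obtain \<epsilon> where e: "\<epsilon> > 0" "\<forall>s\<in>{a..b}. \<bar>s - t\<bar> < \<epsilon> \<longrightarrow> s \<noteq> t \<longrightarrow> f s \<noteq> 0"
    using iso[of t] t(1) by auto
  obtain s where "s \<in> ?Z" "s \<noteq> t" "dist s t < \<epsilon>"
    using t(2) e(1) unfolding islimpt_approachable by blast
  then show False using e(2) by (auto simp: dist_real_def)
qed

text \<open>A connectedness argument for a function that is controlled only on a dense set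
  \<open>R\<close>. The bisection statement carries a margin \<open>e\<close> on both sides, so that
  adjacent pieces always share a point of \<open>R\<close>.\<close>

lemma locally_constant_dense:
  fixes q :: "real \<Rightarrow> 'b"
  assumes ab: "a \<le> b"
    and dense: "\<And>t \<epsilon>. t \<in> {a..b} \<Longrightarrow> \<epsilon> > 0 \<Longrightarrow> \<exists>s\<in>R. \<bar>s - t\<bar> < \<epsilon>"
    and loc: "\<And>t. t \<in> {a..b} \<Longrightarrow> \<exists>\<epsilon>>0. \<forall>s\<in>R. \<forall>s'\<in>R. \<bar>s - t\<bar> < \<epsilon> \<longrightarrow> \<bar>s' - t\<bar> < \<epsilon> \<longrightarrow> q s = q s'"
    and "a \<in> R" "b \<in> R"
  shows "q a = q b"
proof -
  define L where "L = (\<lambda>e u v. \<forall>s\<in>R. \<forall>s'\<in>R.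
    u - e < s \<longrightarrow> s < v + e \<longrightarrow> u - e < s' \<longrightarrow> s' < v + e \<longrightarrow> q s = q s')"
  have LD: "q s = q s'" if "L e u v" "s \<in> R" "s' \<in> R" "u - e < s" "s < v + e" "u - e < s'" "s' < v + e"
    for e u v s s' by (rule that(1)[unfolded L_def, rule_format, OF that(2-7)])
  define P where "P = (\<lambda>u v. a \<le> u \<longrightarrow> v \<le> b \<longrightarrow> (\<exists>e>0. L e u v))"
  have "P a b"
  proof (rule Bolzano[OF ab])
    fix u v w assume P: "P u v" "P v w" and o: "u \<le> v" "v \<le> w"
    show "P u w" unfolding P_def
    proof (intro impI)
      assume uw: "a \<le> u" "w \<le> b"
      obtain e where e: "e > 0" "L e u v" using P(1) uw o by (auto simp: P_def)
      obtain d where d: "d > 0" "L d v w" using P(2) uw o by (auto simp: P_def)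
      define m where "m = min e d"
      have m: "m > 0" "m \<le> e" "m \<le> d" using e(1) d(1) by (auto simp: m_def)
      obtain r where r: "r \<in> R" "\<bar>r - v\<bar> < m" using dense[of v m] uw o m by auto
      have rv: "q s = q r" if s: "s \<in> R" "u - m < s" "s < w + m" for s
      proof (cases "s < v + m")
        case True
        show ?thesis by (rule LD[OF e(2) s(1) r(1)]) (use True s r m o in auto)
      next
        case False
        show ?thesis by (rule LD[OF d(2) s(1) r(1)]) (use False s r m o in auto)
      qed
      have "L m u w" unfolding L_def
      proof (intro ballI impI)
        fix s s' assume "s \<in> R" "s' \<in> R" "u - m < s" "s < w + m" "u - m < s'" "s' < w + m"
        then show "q s = q s'" using rv[of s] rv[of s'] by simp
      qed
      with m(1) show "\<exists>e>0. L e u w" by blast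
    qed
  next
    fix x assume x: "a \<le> x" "x \<le> b"
    obtain e where e: "e > 0" "\<forall>s\<in>R. \<forall>s'\<in>R. \<bar>s - x\<bar> < e \<longrightarrow> \<bar>s' - x\<bar> < e \<longrightarrow> q s = q s'"
      using loc[of x] x by auto
    have "P u v" if uv: "u \<le> x" "x \<le> v" "v - u < e / 2" for u v
    proof -
      have "L (e / 2) u v" unfolding L_def
      proof (intro ballI impI)
        fix s s' assume s: "s \<in> R" "s' \<in> R" "u - e / 2 < s" "s < v + e / 2" "u - e / 2 < s'" "s' < v + e / 2"
        have "\<bar>s - x\<bar> < e" "\<bar>s' - x\<bar> < e" using s uv by linarith+
        then show "q s = q s'" by (rule e(2)[rule_format, OF s(1,2)])
      qed
      then show ?thesis unfolding P_def using e(1) half_gt_zero by blast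
    qed
    then show "\<exists>d>0. \<forall>u v. u \<le> x \<and> x \<le> v \<and> v - u < d \<longrightarrow> P u v"
      using e(1) by (intro exI[of _ "e / 2"]) simp
  qed
  then obtain e where e: "e > 0" "L e a b" by (auto simp: P_def)
  show ?thesis by (rule LD[OF e(2)]) (use e(1) assms(1,4,5) in auto)
qed

lemma path_stays:
  fixes \<gamma> :: "real \<Rightarrow> 'a::metric_space"
  assumes "continuous_on S \<gamma>" "t \<in> S" "open X" "\<gamma> t \<in> X"
  shows "\<exists>e>0. \<forall>s\<in>S. \<bar>s - t\<bar> < e \<longrightarrow> \<gamma> s \<in> X"
proof -
  obtain r where r: "r > 0" "ball (\<gamma> t) r \<subseteq> X" using assms(3,4) openE by blast
  have "\<exists>d>0. \<forall>x'\<in>S. dist x' t < d \<longrightarrow> dist (\<gamma> x') (\<gamma> t) < r"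
    using assms(1,2) r(1) unfolding continuous_on_iff by simp
  then obtain d where d: "d > 0" "\<forall>s\<in>S. dist s t < d \<longrightarrow> dist (\<gamma> s) (\<gamma> t) < r" by blast
  have "\<gamma> s \<in> X" if "s \<in> S" "\<bar>s - t\<bar> < d" for s
  proof -
    have "\<gamma> s \<in> ball (\<gamma> t) r" using d(2) that by (simp add: dist_real_def dist_commute)
    then show ?thesis by (rule subsetD[OF r(2)])
  qed
  with d(1) show ?thesis by blast
qed

definition sign_change :: "(real \<Rightarrow> complex ^ 'n) \<Rightarrow> real \<Rightarrow> bool" where
  "sign_change \<gamma> t \<longleftrightarrow> (\<exists>\<epsilon>>0. \<forall>s\<in>{0..1}. \<forall>s'\<in>{0..1}. t - \<epsilon> < s \<longrightarrow> s < t \<longrightarrow> t < s' \<longrightarrow> s' < t + \<epsilon> \<longrightarrow>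
    walls (\<gamma> s) * walls (\<gamma> s') < 0)"

text \<open>The common ground of tame segments, transverse motions and motions in general position;
  continuity and a change of sign take the place of smoothness and a derivative.\<close>

definition good_path :: "(real \<Rightarrow> complex ^ 'n) \<Rightarrow> bool" where
  "good_path \<gamma> \<longleftrightarrow> continuous_on {0..1} \<gamma> \<and> \<gamma> ` {0..1} \<subseteq> config_space \<and> walls (\<gamma> 0) \<noteq> 0 \<and> walls (\<gamma> 1) \<noteq> 0 \<and>
    finite (critical_moments \<gamma>) \<and>
    (\<forall>t\<in>critical_moments \<gamma>. (\<exists>T. critical_triples (\<gamma> t) \<subseteq> {T}) \<and> sign_change \<gamma> t)"

lemma critical_moments_walls:
  assumes "\<gamma> ` {0..1} \<subseteq> config_space"
  shows "critical_moments \<gamma> = {t \<in> {0..1}. walls (\<gamma> t) = 0}"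
  unfolding critical_moments_def using walls_eq_0_iff assms by blast

text \<open>The letters strictly before \<open>t\<close>; at regular times the quotient of two
  values is the product of the letters in between.\<close>

definition word_upto :: "(real \<Rightarrow> complex ^ 'n) \<Rightarrow> real \<Rightarrow> ('n \<times> 'n \<times> 'n) word set" where
  "word_upto \<gamma> t = lprod (map (\<lambda>s. ordered_triple (\<gamma> s)) (sorted_list_of_set {s \<in> critical_moments \<gamma>. s < t}))"

lemma ordered_triple_triples:
  assumes "z \<in> config_space" "critical_triples z \<noteq> {}" "critical_triples z \<subseteq> {T}"
  shows "ordered_triple z \<in> triples"
proof -
  obtain S where "S \<in> critical_triples z" using assms(2) by blast
  then obtain a where a: "aligned z a" using critical_aligned[OF assms(1)] by blast
  show ?thesis using ordered_triple_eq[OF assms(1,3) a] aligned_triples[OF a] by simp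
qed

lemma sorted_list_of_set_insert_Max:
  assumes "finite A" "\<And>a. a \<in> A \<Longrightarrow> a < t"
  shows "sorted_list_of_set (insert t A) = sorted_list_of_set A @ [t :: real]"
proof (rule sorted_distinct_set_unique)
  have "t \<notin> A" using assms(2) by blast
  then show "distinct (sorted_list_of_set A @ [t])" using assms(1) by simp
  show "sorted (sorted_list_of_set A @ [t])" using assms by (auto simp: sorted_append intro: less_imp_le)
qed (use assms in \<open>simp_all del: sorted_list_of_set_insert_remove\<close>)

lemma local_potential_step:
  assumes "local_potential N \<Phi>" "w \<in> N" "critical_triples w \<subseteq> {T}"
  shows "\<exists>U. open U \<and> w \<in> U \<and> (\<forall>y\<in>U \<inter> N. \<forall>y'\<in>U \<inter> N. walls y \<noteq> 0 \<longrightarrow> walls y' \<noteq> 0 \<longrightarrow>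
    \<Phi> y' = (if walls y * walls y' > 0 then \<Phi> y else \<Phi> y \<otimes>\<^bsub>G3\<^esub> G3_gen (ordered_triple w)))"
  by (rule mp[OF spec[OF bspec[OF conjunct2[OF conjunct2[OF assms(1)[unfolded local_potential_def]]] assms(2)]] assms(3)])

lemma local_potential_closed: "local_potential N \<Phi> \<Longrightarrow> y \<in> N \<Longrightarrow> walls y \<noteq> 0 \<Longrightarrow> \<Phi> y \<in> carrier G3"
  unfolding local_potential_def by blast

context
  fixes \<gamma> :: "real \<Rightarrow> complex ^ 'n"
  assumes good: "good_path \<gamma>"
begin

lemma good_config: "t \<in> {0..1} \<Longrightarrow> \<gamma> t \<in> config_space"
  using good by (auto simp: good_path_def)

lemma good_single: "t \<in> critical_moments \<gamma> \<Longrightarrow> \<exists>T. critical_triples (\<gamma> t) \<subseteq> {T}"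
  and good_sign: "t \<in> critical_moments \<gamma> \<Longrightarrow> sign_change \<gamma> t"
  using good unfolding good_path_def by blast+

lemma good_triples:
  assumes "t \<in> critical_moments \<gamma>"
  shows "ordered_triple (\<gamma> t) \<in> triples"
proof -
  obtain T where "critical_triples (\<gamma> t) \<subseteq> {T}" using good_single[OF assms] by blast
  then show ?thesis
    by (intro ordered_triple_triples) (use assms good_config in \<open>auto simp: critical_moments_def\<close>)
qed

lemma word_upto_closed: "word_upto \<gamma> t \<in> carrier G3"
proof -
  have "ordered_triple (\<gamma> s) \<in> triples" if s: "s \<in> critical_moments \<gamma>" for s
    by (rule good_triples[OF s])
  moreover have "finite {s \<in> critical_moments \<gamma>. s < t}" using good by (simp add: good_path_def)
  ultimately show ?thesis unfolding word_upto_def by (intro lprod_closed) auto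
qed

lemma word_upto_const:
  assumes "\<And>c. c \<in> critical_moments \<gamma> \<Longrightarrow> c < s \<longleftrightarrow> c < s'"
  shows "word_upto \<gamma> s = word_upto \<gamma> s'"
proof -
  have "{c \<in> critical_moments \<gamma>. c < s} = {c \<in> critical_moments \<gamma>. c < s'}" using assms by blast
  then show ?thesis by (simp only: word_upto_def)
qed

lemma word_upto_step:
  assumes "t \<in> critical_moments \<gamma>" "s < t" "t < s'"
    "\<And>c. c \<in> critical_moments \<gamma> \<Longrightarrow> c \<noteq> t \<Longrightarrow> (c < s \<longleftrightarrow> c < t) \<and> (c < s' \<longleftrightarrow> c < t)"
  shows "word_upto \<gamma> s' = word_upto \<gamma> s \<otimes>\<^bsub>G3\<^esub> G3_gen (ordered_triple (\<gamma> t))"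
proof -
  let ?A = "{c \<in> critical_moments \<gamma>. c < s}"
  have "{c \<in> critical_moments \<gamma>. c < s'} = insert t ?A"
  proof (rule Set.set_eqI)
    fix c
    show "c \<in> {c \<in> critical_moments \<gamma>. c < s'} \<longleftrightarrow> c \<in> insert t ?A"
      using assms(1-3) assms(4)[of c] by (cases "c = t") auto
  qed
  moreover have fin: "finite (critical_moments \<gamma>)" using good by (simp add: good_path_def)
  then have "sorted_list_of_set (insert t ?A) = sorted_list_of_set ?A @ [t]"
    using assms(2) by (intro sorted_list_of_set_insert_Max) auto
  moreover have tr: "ordered_triple (\<gamma> c) \<in> triples" if c: "c \<in> critical_moments \<gamma>" for c
    by (rule good_triples[OF c])
  ultimately show ?thesis
    unfolding word_upto_def using tr[OF assms(1)] fin tr by (simp add: lprod_append image_subset_iff)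
qed

text \<open>The quotient \<open>q\<close> of the potential by the word is locally constant on
  regular times: at a critical moment both are multiplied on the right by the same letter.\<close>

lemma potential_along_path:
  assumes pot: "local_potential N \<Phi>" and ab: "a \<le> b" "{a..b} \<subseteq> {0..1}" and im: "\<gamma> ` {a..b} \<subseteq> N"
    and reg: "walls (\<gamma> a) \<noteq> 0" "walls (\<gamma> b) \<noteq> 0"
  shows "inv\<^bsub>G3\<^esub> \<Phi> (\<gamma> a) \<otimes>\<^bsub>G3\<^esub> \<Phi> (\<gamma> b) = inv\<^bsub>G3\<^esub> word_upto \<gamma> a \<otimes>\<^bsub>G3\<^esub> word_upto \<gamma> b"
proof -
  define R where "R = {t \<in> {a..b}. walls (\<gamma> t) \<noteq> 0}"
  define q where "q = (\<lambda>t. \<Phi> (\<gamma> t) \<otimes>\<^bsub>G3\<^esub> inv\<^bsub>G3\<^esub> word_upto \<gamma> t)"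
  note W [simp] = word_upto_closed
  have fin: "finite (critical_moments \<gamma>)" using good by (simp add: good_path_def)
  have cm: "critical_moments \<gamma> = {t \<in> {0..1}. walls (\<gamma> t) = 0}"
    using good by (intro critical_moments_walls) (auto simp: good_path_def)
  have Phi: "\<Phi> (\<gamma> t) \<in> carrier G3" if "t \<in> R" for t
  proof (rule local_potential_closed[OF pot])
    show "\<gamma> t \<in> N" using im that unfolding R_def by blast
  qed (use that in \<open>simp add: R_def\<close>)
  have gap: "\<exists>\<epsilon>>0. \<forall>c\<in>critical_moments \<gamma>. c \<noteq> t \<longrightarrow> \<epsilon> \<le> \<bar>c - t\<bar>" for t
  proof -
    obtain d where d: "d > 0" "\<forall>c\<in>critical_moments \<gamma>. c \<noteq> t \<longrightarrow> d \<le> dist t c"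
      using finite_set_avoid[OF fin, of t] by blast
    then show ?thesis by (intro exI[of _ d]) (auto simp: dist_real_def abs_minus_commute)
  qed
  have "q a = q b" if "a < b"
  proof (rule locally_constant_dense[OF ab(1), of R])
    show "a \<in> R" "b \<in> R" using reg ab by (auto simp: R_def)
    fix t assume t: "t \<in> {a..b}"
    show "\<exists>s\<in>R. \<bar>s - t\<bar> < \<epsilon>" if eps: "\<epsilon> > 0" for \<epsilon>
    proof -
      obtain d where d: "d > 0" "\<forall>c\<in>critical_moments \<gamma>. c \<noteq> t \<longrightarrow> d \<le> \<bar>c - t\<bar>" using gap by blast
      \<comment> \<open>Less than the gap to the other critical moments, and so small that
        \<open>t + h\<close> or \<open>t - h\<close> stays in the interval.\<close>
      define h where "h = min (min \<epsilon> d) (b - a) / 2"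
      have h: "h > 0" "h < \<epsilon>" "h < d" "h \<le> (b - a) / 2" using eps d \<open>a < b\<close> by (auto simp: h_def)
      define s where "s = (if t + h \<le> b then t + h else t - h)"
      have s: "s \<in> {a..b}" "\<bar>s - t\<bar> = h" "s \<noteq> t" using h t by (auto simp: s_def)
      have "s \<notin> critical_moments \<gamma>" using d(2) s h by force
      then have "s \<in> R" using s(1) ab(2) unfolding cm R_def by auto
      then show ?thesis using s h by auto
    qed
    have t01: "t \<in> {0..1}" using t ab by auto
    have gN: "\<gamma> t \<in> N" using im t by blast
    obtain T where T: "critical_triples (\<gamma> t) \<subseteq> {T}"
    proof (cases "t \<in> critical_moments \<gamma>")
      case True
      from good_single[OF True] that show thesis by blast
    next
      case False
      then have "critical_triples (\<gamma> t) = {}" using t01 by (simp add: critical_moments_def)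
      then show thesis using that by blast
    qed
    obtain U where U: "open U" "\<gamma> t \<in> U" and P0: "\<forall>y\<in>U \<inter> N. \<forall>y'\<in>U \<inter> N. walls y \<noteq> 0 \<longrightarrow> walls y' \<noteq> 0 \<longrightarrow>
        \<Phi> y' = (if walls y * walls y' > 0 then \<Phi> y else \<Phi> y \<otimes>\<^bsub>G3\<^esub> G3_gen (ordered_triple (\<gamma> t)))"
      using local_potential_step[OF pot gN T] by (elim exE conjE)
    note P = P0[rule_format]
    have cont: "continuous_on {0..1} \<gamma>" using good by (simp add: good_path_def)
    note stay = path_stays[OF cont t01]
    obtain e1 where e1: "e1 > 0" "\<forall>s\<in>{0..1}. \<bar>s - t\<bar> < e1 \<longrightarrow> \<gamma> s \<in> U" using stay[OF U] by blast
    obtain d where d: "d > 0" "\<forall>c\<in>critical_moments \<gamma>. c \<noteq> t \<longrightarrow> d \<le> \<bar>c - t\<bar>" using gap by blast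
    let ?g = "G3_gen (ordered_triple (\<gamma> t))"
    have step: "\<Phi> (\<gamma> s') = (if walls (\<gamma> s) * walls (\<gamma> s') > 0 then \<Phi> (\<gamma> s) else \<Phi> (\<gamma> s) \<otimes>\<^bsub>G3\<^esub> ?g)"
      if "s \<in> R" "s' \<in> R" "\<bar>s - t\<bar> < e1" "\<bar>s' - t\<bar> < e1" for s s'
    proof (rule P)
      have "s \<in> {0..1}" "s' \<in> {0..1}" using that(1,2) ab(2) unfolding R_def by blast+
      then show "\<gamma> s \<in> U \<inter> N" "\<gamma> s' \<in> U \<inter> N"
        using that e1(2) im unfolding R_def by blast+
    qed (use that in \<open>simp_all add: R_def\<close>)
    show "\<exists>\<epsilon>>0. \<forall>s\<in>R. \<forall>s'\<in>R. \<bar>s - t\<bar> < \<epsilon> \<longrightarrow> \<bar>s' - t\<bar> < \<epsilon> \<longrightarrow> q s = q s'"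
    proof (cases "t \<in> critical_moments \<gamma>")
      case False
      then have wt: "walls (\<gamma> t) \<noteq> 0" using t01 by (simp add: cm)
      obtain X where X: "open X" "\<gamma> t \<in> X" "\<forall>y\<in>X. walls y * walls (\<gamma> t) > 0"
        using eventually_sign[OF continuous_walls good_config[OF t01] wt] unfolding eventually_nhds by blast
      obtain e2 where e2: "e2 > 0" "\<forall>s\<in>{0..1}. \<bar>s - t\<bar> < e2 \<longrightarrow> \<gamma> s \<in> X" using stay[OF X(1,2)] by blast
      have A: "q s = q s'" if s: "s \<in> R" "s' \<in> R" "\<bar>s - t\<bar> < min (min e1 e2) d" "\<bar>s' - t\<bar> < min (min e1 e2) d" for s s'
      proof -
        have "s \<in> {0..1}" "s' \<in> {0..1}" using s(1,2) ab(2) unfolding R_def by blast+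
        then have "walls (\<gamma> s) * walls (\<gamma> t) > 0" "walls (\<gamma> s') * walls (\<gamma> t) > 0" using s e2(2) X(3) by auto
        then have "walls (\<gamma> s) * walls (\<gamma> s') > 0" by (auto simp: zero_less_mult_iff)
        then have "\<Phi> (\<gamma> s') = \<Phi> (\<gamma> s)" using step[of s s'] s by simp
        moreover have "word_upto \<gamma> s = word_upto \<gamma> s'"
        proof (rule word_upto_const)
          fix c assume c: "c \<in> critical_moments \<gamma>"
          then have "d \<le> \<bar>c - t\<bar>" using d(2) False by auto
          then show "c < s \<longleftrightarrow> c < s'" using s(3,4) by linarith
        qed
        ultimately show ?thesis by (simp add: q_def)
      qed
      have pos: "min (min e1 e2) d > 0" using e1(1) e2(1) d(1) by simp
      show ?thesis
        by (rule exI[of _ "min (min e1 e2) d"], intro conjI pos ballI impI) (rule A)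
    next
      case True
      then have "sign_change \<gamma> t" by (rule good_sign)
      then obtain e2 where e2: "e2 > 0" "\<And>s s'. s \<in> {0..1} \<Longrightarrow> s' \<in> {0..1} \<Longrightarrow> t - e2 < s \<Longrightarrow> s < t \<Longrightarrow> t < s' \<Longrightarrow> s' < t + e2 \<Longrightarrow>
          walls (\<gamma> s) * walls (\<gamma> s') < 0" unfolding sign_change_def by blast
      define e where "e = min (min e1 e2) d"
      have e: "e > 0" "e \<le> e1" "e \<le> e2" "e \<le> d" using e1(1) e2(1) d(1) by (auto simp: e_def)
      have gt: "?g \<in> carrier G3" by (rule G3_gen_closed[OF good_triples[OF True]])
      have t1: "0 < t" "t < 1" using True good by (auto simp: cm good_path_def less_le)
      \<comment> \<open>\<open>\<sigma>\<close> is the value of \<open>walls\<close> shortly after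
        \<open>t\<close>, with which the values at all nearby regular times are compared.\<close>
      have "\<exists>\<sigma>::real. \<sigma> \<noteq> 0 \<and> (\<forall>s\<in>R. \<bar>s - t\<bar> < e \<longrightarrow> (s < t \<longrightarrow> walls (\<gamma> s) * \<sigma> < 0) \<and> (t < s \<longrightarrow> walls (\<gamma> s) * \<sigma> > 0))"
      proof -
        obtain h where h: "h > 0" "h < e" "h < 1 - t" "h < t"
          using dense[of 0 "min (min e (1 - t)) t"] e(1) t1 by auto
        define r where "r = t + h"
        define l where "l = t - h"
        have rl: "r \<in> {0..1}" "t < r" "r < t + e2" "r < t + e" "l \<in> {0..1}" "l < t" "t - e2 < l"
          using h e(3) t1 by (simp_all add: r_def l_def)
        note r = rl(1-3)
        note l = rl(5-7)
        have lr: "walls (\<gamma> l) * walls (\<gamma> r) < 0" by (rule e2(2)) (use l r in auto)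
        have "(s < t \<longrightarrow> walls (\<gamma> s) * walls (\<gamma> r) < 0) \<and> (t < s \<longrightarrow> walls (\<gamma> s) * walls (\<gamma> r) > 0)"
          if s: "s \<in> R" "\<bar>s - t\<bar> < e" for s
        proof (intro conjI impI)
          have s01: "s \<in> {0..1}" using s(1) ab(2) unfolding R_def by blast
          show "walls (\<gamma> s) * walls (\<gamma> r) < 0" if "s < t"
            by (rule e2(2)) (use s01 s r that e in auto)
          assume "t < s"
          then have "walls (\<gamma> l) * walls (\<gamma> s) < 0"
            by (intro e2(2)) (use s01 s l e in auto)
          then show "walls (\<gamma> s) * walls (\<gamma> r) > 0" using lr by (auto simp: mult_less_0_iff zero_less_mult_iff)
        qed
        moreover have "walls (\<gamma> r) \<noteq> 0" using lr by auto
        ultimately show ?thesis by blast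
      qed
      then obtain \<sigma> :: real where \<sigma>: "\<sigma> \<noteq> 0" "\<forall>s\<in>R. \<bar>s - t\<bar> < e \<longrightarrow>
        (s < t \<longrightarrow> walls (\<gamma> s) * \<sigma> < 0) \<and> (t < s \<longrightarrow> walls (\<gamma> s) * \<sigma> > 0)" by blast
      have Rt: "s \<noteq> t" if "s \<in> R" for s using True that by (auto simp: cm R_def)
      have far: "d \<le> \<bar>c - t\<bar>" if "c \<in> critical_moments \<gamma>" "c \<noteq> t" for c using d(2) that by blast
      have same: "q s = q s'" if s: "s \<in> R" "s' \<in> R" "\<bar>s - t\<bar> < e" "\<bar>s' - t\<bar> < e" "s < t \<longleftrightarrow> s' < t" for s s'
      proof -
        have "s \<noteq> t" "s' \<noteq> t" using Rt s by auto
        then have "walls (\<gamma> s) * walls (\<gamma> s') > 0"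
          using bspec[OF \<sigma>(2) s(1)] bspec[OF \<sigma>(2) s(2)] s(3-5)
          by (cases "s < t") (auto simp: mult_less_0_iff zero_less_mult_iff)
        then have "\<Phi> (\<gamma> s') = \<Phi> (\<gamma> s)" using step[of s s'] s e by simp
        moreover have "word_upto \<gamma> s = word_upto \<gamma> s'"
        proof (rule word_upto_const)
          fix c assume c: "c \<in> critical_moments \<gamma>"
          show "c < s \<longleftrightarrow> c < s'"
          proof (cases "c = t")
            case True
            then show ?thesis using s(5) \<open>s \<noteq> t\<close> \<open>s' \<noteq> t\<close> by linarith
          next
            case False
            then show ?thesis using far[OF c False] s(3,4) e by linarith
          qed
        qed
        ultimately show ?thesis by (simp add: q_def)
      qed
      have diff: "q s = q s'" if s: "s \<in> R" "s' \<in> R" "\<bar>s - t\<bar> < e" "\<bar>s' - t\<bar> < e" "s < t" "t < s'" for s s'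
      proof -
        have "\<not> walls (\<gamma> s) * walls (\<gamma> s') > 0"
          using bspec[OF \<sigma>(2) s(1)] bspec[OF \<sigma>(2) s(2)] s(3-6)
          by (auto simp: mult_less_0_iff zero_less_mult_iff)
        then have 1: "\<Phi> (\<gamma> s') = \<Phi> (\<gamma> s) \<otimes>\<^bsub>G3\<^esub> ?g" using step[of s s'] s e by simp
        have 2: "word_upto \<gamma> s' = word_upto \<gamma> s \<otimes>\<^bsub>G3\<^esub> ?g"
        proof (rule word_upto_step[OF True s(5,6)])
          fix c assume c: "c \<in> critical_moments \<gamma>" "c \<noteq> t"
          show "(c < s \<longleftrightarrow> c < t) \<and> (c < s' \<longleftrightarrow> c < t)" using far[OF c] s(3,4) e by linarith
        qed
        have "\<Phi> (\<gamma> s) \<otimes>\<^bsub>G3\<^esub> ?g \<otimes>\<^bsub>G3\<^esub> (inv\<^bsub>G3\<^esub> ?g \<otimes>\<^bsub>G3\<^esub> inv\<^bsub>G3\<^esub> word_upto \<gamma> s) =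
            \<Phi> (\<gamma> s) \<otimes>\<^bsub>G3\<^esub> inv\<^bsub>G3\<^esub> word_upto \<gamma> s"
        proof -
          have "?g \<otimes>\<^bsub>G3\<^esub> (inv\<^bsub>G3\<^esub> ?g \<otimes>\<^bsub>G3\<^esub> inv\<^bsub>G3\<^esub> word_upto \<gamma> s) = inv\<^bsub>G3\<^esub> word_upto \<gamma> s"
            using gt by (simp flip: G3.m_assoc)
          then show ?thesis using Phi[OF s(1)] gt by (simp add: G3.m_assoc)
        qed
        then show ?thesis unfolding q_def 1 2 using gt by (simp add: G3.inv_mult_group)
      qed
      have A: "q s = q s'" if s: "s \<in> R" "s' \<in> R" "\<bar>s - t\<bar> < e" "\<bar>s' - t\<bar> < e" for s s'
      proof -
        consider "s < t \<longleftrightarrow> s' < t" | "s < t" "t < s'" | "s' < t" "t < s"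
          using Rt[OF s(1)] Rt[OF s(2)] by linarith
        then show ?thesis
        proof cases
          case 1
          show ?thesis by (rule same[OF s 1])
        next
          case 2
          show ?thesis by (rule diff[OF s 2])
        next
          case 3
          show ?thesis by (rule diff[OF s(2,1,4,3) 3, symmetric])
        qed
      qed
      show ?thesis by (rule exI[of _ e], intro conjI e(1) ballI impI) (rule A)
    qed
  qed
  then have "q a = q b" using ab(1) by (cases "a = b") auto
  moreover have "\<Phi> (\<gamma> a) \<in> carrier G3" "\<Phi> (\<gamma> b) \<in> carrier G3" using Phi reg ab by (auto simp: R_def)
  ultimately show ?thesis
    unfolding q_def by (intro G3.quotient_eq W)
qed

end

section \<open>Polydiscs\<close>

text \<open>Products of discs rather than balls: a point can be moved one coordinate at a time, and
  the intersection of two polydiscs is again a product of convex sets.\<close>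

definition polydisc :: "complex ^ 'n \<Rightarrow> real \<Rightarrow> (complex ^ 'n) set" where
  "polydisc z r = {y. \<forall>i. y $ i \<in> ball (z $ i) r}"

definition box_of :: "('n \<Rightarrow> complex set) \<Rightarrow> (complex ^ 'n) set" where
  "box_of U = {y. \<forall>i. y $ i \<in> U i}"

lemma open_box_of:
  assumes "\<And>i. open (U i)"
  shows "open (box_of U :: (complex ^ 'n) set)"
proof -
  have "box_of U = (\<Inter>i. (\<lambda>y :: complex ^ 'n. y $ i) -` U i)" by (auto simp: box_of_def)
  moreover have "open ((\<lambda>y :: complex ^ 'n. y $ i) -` U i)" for i
    by (intro open_vimage assms continuous_intros)
  ultimately show ?thesis by auto
qed

lemma convex_box_of:
  assumes "\<And>i. convex (U i)"
  shows "convex (box_of U :: (complex ^ 'n) set)"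
  using assms unfolding convex_def box_of_def by simp

lemma polydisc_box: "polydisc z r = box_of (\<lambda>i. ball (z $ i) r)"
  by (simp add: polydisc_def box_of_def)

lemma ball_subset_polydisc: "ball z r \<subseteq> polydisc (z :: complex ^ 'n) r"
proof
  fix y assume "y \<in> ball z r"
  then have "dist (z $ i) (y $ i) < r" for i using dist_vec_nth_le[of z i y] by simp
  then show "y \<in> polydisc z r" by (simp add: polydisc_def)
qed

lemma polydisc_subset_ball:
  assumes "e > 0"
  shows "polydisc (z :: complex ^ 'n) (e / real CARD('n)) \<subseteq> ball z e"
proof
  fix y assume "y \<in> polydisc z (e / real CARD('n))"
  then have d: "dist (z $ i) (y $ i) < e / real CARD('n)" for i by (simp add: polydisc_def)
  have "dist z y \<le> (\<Sum>i\<in>UNIV. dist (z $ i) (y $ i))"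
    unfolding dist_vec_def by (rule L2_set_le_sum) simp
  also have "\<dots> < (\<Sum>i\<in>(UNIV :: 'n set). e / real CARD('n))"
    by (rule sum_strict_mono) (use d in auto)
  also have "\<dots> = e" by simp
  finally show "y \<in> ball z e" by simp
qed

lemma open_contains_polydisc:
  assumes "open S" "z \<in> S"
  shows "\<exists>r>0. polydisc (z :: complex ^ 'n) r \<subseteq> S"
proof -
  obtain e where "e > 0" "ball z e \<subseteq> S" using assms openE by blast
  then show ?thesis using polydisc_subset_ball[of e z] by (intro exI[of _ "e / real CARD('n)"]) auto
qed

lemma open_regular: "open {z \<in> config_space :: (complex ^ 'n) set. walls z \<noteq> 0}"
proof -
  have "open (config_space \<inter> walls -` (- {0}) :: (complex ^ 'n) set)"
    by (rule continuous_open_preimage[OF continuous_walls open_config_space]) auto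
  moreover have "config_space \<inter> walls -` (- {0}) = {z \<in> config_space :: (complex ^ 'n) set. walls z \<noteq> 0}" by auto
  ultimately show ?thesis by simp
qed

section \<open>Density of regular configurations and chains of tame segments\<close>

lemma ex_regular_wall:
  fixes z :: "complex ^ 'n"
  assumes "open X" "z \<in> X" "X \<subseteq> config_space" "card T = 3"
  shows "\<exists>y\<in>X. wall y T \<noteq> 0"
proof -
  have zc: "z \<in> config_space" using assms by blast
  obtain i j k where T: "T = {i, j, k}" and d: "distinct [i, j, k]"
    using assms(4) by (auto simp: card_3_iff)
  obtain r where r: "r > 0" "polydisc z r \<subseteq> X" using open_contains_polydisc assms by blast
  \<comment> \<open>The point \<open>k\<close> is moved off the two horocycles through the points
    \<open>i\<close> and \<open>j\<close>, which form a null set.\<close>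
  define B where "B = (\<Union>a\<in>{(i, j), (j, i)}. {w. circ (pt z (fst a) (snd a)) (level (z $ fst a) (pt z (fst a) (snd a))) w = 0})"
  have "negligible {w. circ (pt z a b) (level (z $ a) (pt z a b)) w = 0}" if "a \<noteq> b" for a b
    by (intro negligible_circ level_pos pt_props(1)[OF zc that] config_spaceD(1)[OF zc])
  then have "negligible B" unfolding B_def using d by auto
  moreover have "\<not> negligible (ball (z $ k) r)" by (rule open_not_negligible) (use r in auto)
  ultimately have "\<not> ball (z $ k) r \<subseteq> B" using negligible_subset by blast
  then obtain w where w: "w \<in> ball (z $ k) r" "w \<notin> B" by blast
  have yX: "upd z k w \<in> X" using w(1) r by (intro subsetD[OF r(2)]) (simp add: polydisc_def)
  then have yc: "upd z k w \<in> config_space" using assms(3) by blast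
  have w1: "cmod w < 1" using config_spaceD(1)[OF yc, of k] by simp
  have e: "1 - (cmod w)\<^sup>2 \<noteq> 0" using cmod_less_1[OF w1] by simp
  have "wall (upd z k w) {i, j, k} \<noteq> 0"
    unfolding wall_eq_0_iff[OF yc d]
    using side_upd[of i k j w z] side_upd[of j k i w z] d w1 w(2) e by (auto simp: B_def)
  then show ?thesis using yX T by blast
qed

text \<open>One wall at a time: the set where the walls treated so far do not vanish is open, and
  \<open>ex_regular_wall\<close> applies inside it.\<close>

lemma ex_regular:
  fixes z :: "complex ^ 'n"
  assumes "open X" "z \<in> X" "X \<subseteq> config_space"
  shows "\<exists>y\<in>X. walls y \<noteq> 0"
proof -
  have fin: "finite {T :: 'n set. card T = 3}" by (rule finite_subset[OF subset_UNIV]) simp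
  have "\<exists>y\<in>X. \<forall>T\<in>F. wall y T \<noteq> 0" if "finite F" "F \<subseteq> {T. card T = 3}" for F
    using that
  proof (induction F rule: finite_induct)
    case empty
    then show ?case using assms by blast
  next
    case (insert T F)
    then obtain y where y: "y \<in> X" "\<forall>T\<in>F. wall y T \<noteq> 0" by auto
    define f where "f = (\<lambda>y :: complex ^ 'n. \<Prod>T\<in>F. wall y T)"
    have "continuous_on X f" unfolding f_def
      by (intro continuous_intros continuous_on_subset[OF continuous_wall assms(3)])
    then have "open (X \<inter> f -` (- {0}))" by (rule continuous_open_preimage[OF _ assms(1)]) auto
    moreover have "y \<in> X \<inter> f -` (- {0})" using y insert.hyps(1) by (simp add: f_def)
    moreover have "X \<inter> f -` (- {0}) \<subseteq> config_space" using assms(3) by blast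
    ultimately obtain y' where "y' \<in> X \<inter> f -` (- {0})" "wall y' T \<noteq> 0"
      using ex_regular_wall[of "X \<inter> f -` (- {0})" y T] insert.prems by blast
    then show ?case using insert.hyps(1) by (auto simp: f_def)
  qed
  from this[OF fin] show ?thesis using fin unfolding walls_def by auto
qed

definition tame_in :: "(complex ^ 'n) set \<Rightarrow> complex ^ 'n \<Rightarrow> complex ^ 'n \<Rightarrow> bool" where
  "tame_in B x y \<longleftrightarrow> tame x y \<and> x \<in> B \<and> y \<in> B"

text \<open>The coordinates are moved one after the other by generic tame segments; convexity of
  \<open>U m\<close> keeps each move inside the box.\<close>

lemma tame_approach:
  fixes x :: "complex ^ 'n"
  assumes U: "\<And>i. open (U i)" "\<And>i. convex (U i)" "box_of U \<subseteq> config_space"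
    and W: "\<And>i. open (W i)" "\<And>i. W i \<inter> U i \<noteq> {}"
    and x: "x \<in> box_of U" "walls x \<noteq> 0"
  shows "\<exists>y. (tame_in (box_of U))\<^sup>*\<^sup>* x y \<and> y \<in> box_of U \<and> walls y \<noteq> 0 \<and> y \<in> box_of W"
proof -
  have "\<exists>y. (tame_in (box_of U))\<^sup>*\<^sup>* x y \<and> y \<in> box_of U \<and> walls y \<noteq> 0 \<and> (\<forall>i\<in>D. y $ i \<in> W i)"
    if "finite D" for D
    using that
  proof (induction D rule: finite_induct)
    case empty
    then show ?case using x by blast
  next
    case (insert m D)
    then obtain y where y: "(tame_in (box_of U))\<^sup>*\<^sup>* x y" "y \<in> box_of U" "walls y \<noteq> 0" "\<forall>i\<in>D. y $ i \<in> W i" by blast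
    have upd: "upd y m v \<in> box_of U" if "v \<in> U m" for v using that y(2) by (simp add: box_of_def)
    have "\<exists>v\<in>W m \<inter> U m. tame y (upd y m v)"
    proof (rule ex_tame_coordinate)
      show "y \<in> config_space" using y(2) U(3) by blast
      fix v and t :: real assume v: "v \<in> W m \<inter> U m" and t: "t \<in> {0..1}"
      have "y $ m \<in> U m" using y(2) by (simp add: box_of_def)
      then have "(1 - t) *\<^sub>R (y $ m) + t *\<^sub>R v \<in> U m" using U(2)[of m] v t by (intro convexD) auto
      moreover have "(1 - t) *\<^sub>R (y $ m) + t *\<^sub>R v = y $ m + t *\<^sub>R (v - y $ m)" by (simp add: algebra_simps)
      ultimately show "upd y m (y $ m + t *\<^sub>R (v - y $ m)) \<in> config_space" using upd U(3) by auto
    qed (use y W U(1) in auto)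
    then obtain v where v: "v \<in> W m" "v \<in> U m" "tame y (upd y m v)" by blast
    have "tame_in (box_of U) y (upd y m v)" using v y(2) upd by (simp add: tame_in_def)
    with y(1) have "(tame_in (box_of U))\<^sup>*\<^sup>* x (upd y m v)" by (rule rtranclp.rtrancl_into_rtrancl)
    moreover have "walls (upd y m v) \<noteq> 0" using v(3) by (simp add: tame_def)
    ultimately show ?case using upd[OF v(2)] v(1) y(4) by (intro exI[of _ "upd y m v"]) auto
  qed
  from this[of UNIV] show ?thesis by (auto simp: box_of_def)
qed

text \<open>The walls cut the regular set into pieces, so the chain has to cross them.
  \<open>tame_approach\<close> leads into a polydisc of regular configurations about
  \<open>y\<close>, in which the last segment meets no wall.\<close>

lemma regular_connected:
  fixes x y :: "complex ^ 'n"
  assumes U: "\<And>i. open (U i)" "\<And>i. convex (U i)" "box_of U \<subseteq> config_space"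
    and x: "x \<in> box_of U" "walls x \<noteq> 0" and y: "y \<in> box_of U" "walls y \<noteq> 0"
  shows "(tame_in (box_of U))\<^sup>*\<^sup>* x y"
proof -
  have "open (box_of U \<inter> {z \<in> config_space. walls z \<noteq> 0})"
    by (intro open_Int open_regular open_box_of U(1))
  then obtain r where r: "r > 0" "polydisc y r \<subseteq> box_of U \<inter> {z \<in> config_space. walls z \<noteq> 0}"
    using open_contains_polydisc[of _ y] y U(3) by blast
  have "\<exists>y'. (tame_in (box_of U))\<^sup>*\<^sup>* x y' \<and> y' \<in> box_of U \<and> walls y' \<noteq> 0 \<and> y' \<in> box_of (\<lambda>i. ball (y $ i) r)"
  proof (rule tame_approach[OF U _ _ x])
    fix i
    have "y $ i \<in> ball (y $ i) r \<inter> U i" using r(1) y(1) by (simp add: box_of_def)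
    then show "ball (y $ i) r \<inter> U i \<noteq> {}" by blast
  qed simp
  then obtain y' where y': "(tame_in (box_of U))\<^sup>*\<^sup>* x y'" "y' \<in> box_of U" "walls y' \<noteq> 0" "y' \<in> polydisc y r"
    unfolding polydisc_box[of y r, symmetric] by (elim exE conjE)
  have "convex (polydisc y r)" unfolding polydisc_box by (rule convex_box_of) simp
  moreover have "y \<in> polydisc y r" using r by (simp add: polydisc_def)
  ultimately have "closed_segment y' y \<subseteq> polydisc y r" using y'(4) by (intro closed_segment_subset) auto
  then have seg: "closed_segment y' y \<subseteq> {z \<in> config_space. walls z \<noteq> 0}" using r(2) by blast
  have "y' + t *\<^sub>R (y - y') \<in> closed_segment y' y" if "t \<in> {0..1}" for t
    using that unfolding closed_segment_def by (auto intro!: exI[of _ t] simp: algebra_simps)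
  then have nz: "walls (y' + t *\<^sub>R (y - y')) \<noteq> 0" if "t \<in> {0..1}" for t using seg that by blast
  have "tame y' y" unfolding tame_def
  proof (intro conjI ballI impI)
    fix t :: real assume "t \<in> {0..1}" "walls (y' + t *\<^sub>R (y - y')) = 0"
    then show "\<exists>D. D \<noteq> 0 \<and> ((\<lambda>t. walls (y' + t *\<^sub>R (y - y'))) has_real_derivative D) (at t)"
      using nz by blast
  qed (use seg y(2) y'(3) in blast)+
  then have "tame_in (box_of U) y' y" using y(1) y'(2) by (simp add: tame_in_def)
  with y'(1) show ?thesis by (rule rtranclp.rtrancl_into_rtrancl)
qed

lemma tame_good:
  fixes x y :: "complex ^ 'n"
  assumes "tame x y"
  shows "good_path (\<lambda>t. x + t *\<^sub>R (y - x))"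
proof -
  define \<gamma> where "\<gamma> = (\<lambda>t. x + t *\<^sub>R (y - x))"
  have im: "\<gamma> ` {0..1} = closed_segment x y"
    unfolding \<gamma>_def closed_segment_image_interval by (simp add: algebra_simps)
  then have cfg: "\<gamma> ` {0..1} \<subseteq> config_space" using assms by (simp add: tame_def)
  have cont: "continuous_on S \<gamma>" for S unfolding \<gamma>_def by (intro continuous_intros)
  have D: "\<exists>D. D \<noteq> 0 \<and> ((\<lambda>t. walls (\<gamma> t)) has_real_derivative D) (at t)" if "t \<in> {0..1}" "walls (\<gamma> t) = 0" for t
  proof -
    have "\<forall>t\<in>{0..1}. walls (\<gamma> t) = 0 \<longrightarrow> (\<exists>D. D \<noteq> 0 \<and> ((\<lambda>t. walls (\<gamma> t)) has_real_derivative D) (at t))"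
      using assms unfolding tame_def \<gamma>_def by (elim conjE)
    from mp[OF bspec[OF this that(1)] that(2)] show ?thesis .
  qed
  note cm = critical_moments_walls[OF cfg]
  have sg: "\<exists>\<epsilon>>0. \<exists>D. D \<noteq> 0 \<and> (\<forall>s. \<bar>s - t\<bar> < \<epsilon> \<longrightarrow> (s < t \<longrightarrow> walls (\<gamma> s) * D < 0) \<and> (t < s \<longrightarrow> walls (\<gamma> s) * D > 0))"
    if t: "t \<in> {0..1}" "walls (\<gamma> t) = 0" for t
  proof -
    obtain D where D': "D \<noteq> 0" "((\<lambda>t. walls (\<gamma> t)) has_real_derivative D) (at t)" using D[OF t] by blast
    have "\<exists>\<epsilon>>0. \<forall>s. \<bar>s - t\<bar> < \<epsilon> \<longrightarrow> (s < t \<longrightarrow> walls (\<gamma> s) * D < 0) \<and> (t < s \<longrightarrow> walls (\<gamma> s) * D > 0)"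
      using simple_zero_sign[OF D'(2,1) t(2)] by (simp only: ball_UNIV)
    then show ?thesis using D'(1) by blast
  qed
  have "good_path \<gamma>" unfolding good_path_def cm
  proof (intro conjI ballI)
    show "walls (\<gamma> 0) \<noteq> 0" "walls (\<gamma> 1) \<noteq> 0" using assms by (simp_all add: tame_def \<gamma>_def)
    have "continuous_on {0..1} (\<lambda>t. walls (\<gamma> t))"
      by (rule continuous_on_compose2[OF continuous_walls cont cfg])
    then show "finite {t \<in> {0..1}. walls (\<gamma> t) = 0}"
    proof (rule finite_zeros)
      fix t :: real assume t: "t \<in> {0..1}" "walls (\<gamma> t) = 0"
      obtain \<epsilon> D where e: "\<epsilon> > 0" "\<forall>s. \<bar>s - t\<bar> < \<epsilon> \<longrightarrow> (s < t \<longrightarrow> walls (\<gamma> s) * D < 0) \<and> (t < s \<longrightarrow> walls (\<gamma> s) * D > 0)"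
        using sg[OF t] by blast
      have "walls (\<gamma> s) \<noteq> 0" if "\<bar>s - t\<bar> < \<epsilon>" "s \<noteq> t" for s
        using spec[OF e(2), of s] that by (cases "s < t") auto
      then show "\<exists>\<epsilon>>0. \<forall>s\<in>{0..1}. \<bar>s - t\<bar> < \<epsilon> \<longrightarrow> s \<noteq> t \<longrightarrow> walls (\<gamma> s) \<noteq> 0" using e(1) by blast
    qed
    fix t assume "t \<in> {t \<in> {0..1}. walls (\<gamma> t) = 0}"
    then have t: "t \<in> {0..1}" "walls (\<gamma> t) = 0" by auto
    obtain D where D': "D \<noteq> 0" "((\<lambda>t. walls (\<gamma> t)) has_real_derivative D) (at t)" using D[OF t] by blast
    have "(\<gamma> has_vector_derivative (y - x)) (at t)"
      unfolding \<gamma>_def by (auto intro!: derivative_eq_intros)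
    moreover have "\<gamma> t \<in> config_space" using cfg t(1) by blast
    ultimately show "\<exists>T. critical_triples (\<gamma> t) \<subseteq> {T}"
      by (intro simple_zero_one_wall[OF _ _ _ D'(2,1)]) simp_all
    obtain \<epsilon> D where e: "\<epsilon> > 0" "D \<noteq> 0" "\<forall>s. \<bar>s - t\<bar> < \<epsilon> \<longrightarrow> (s < t \<longrightarrow> walls (\<gamma> s) * D < 0) \<and> (t < s \<longrightarrow> walls (\<gamma> s) * D > 0)"
      using sg[OF t] by blast
    show "sign_change \<gamma> t" unfolding sign_change_def
    proof (intro exI[of _ \<epsilon>] conjI ballI impI e(1))
      fix s s' assume "t - \<epsilon> < s" "s < t" "t < s'" "s' < t + \<epsilon>"
      then have "walls (\<gamma> s) * D < 0" "walls (\<gamma> s') * D > 0" using spec[OF e(3), of s] spec[OF e(3), of s'] by auto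
      then show "walls (\<gamma> s) * walls (\<gamma> s') < 0" by (auto simp: mult_less_0_iff zero_less_mult_iff)
    qed
  qed (use cont cfg in auto)
  then show ?thesis by (simp add: \<gamma>_def)
qed

section \<open>Homotopy invariance\<close>

lemma word_upto_0: "word_upto \<gamma> 0 = \<one>\<^bsub>G3\<^esub>"
proof -
  have "{s \<in> critical_moments \<gamma>. s < 0} = {}" by (auto simp: critical_moments_def)
  then show ?thesis by (simp only: word_upto_def) simp
qed

lemma word_upto_1:
  assumes "good_path \<gamma>"
  shows "word_upto \<gamma> 1 = g_motion \<gamma>"
proof -
  have "s < 1" if "s \<in> critical_moments \<gamma>" for s
  proof -
    have "\<gamma> 1 \<in> config_space" "walls (\<gamma> 1) \<noteq> 0" using assms by (auto simp: good_path_def)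
    then have "critical_triples (\<gamma> 1) = {}" using walls_eq_0_iff by blast
    then have "s \<noteq> 1" using that by (auto simp: critical_moments_def)
    then show ?thesis using that by (auto simp: critical_moments_def)
  qed
  then have "{s \<in> critical_moments \<gamma>. s < 1} = critical_moments \<gamma>" by blast
  then show ?thesis by (simp add: word_upto_def g_motion_def lprod_def comp_def)
qed

text \<open>
  Both sides are the product of the letters met along a chain of tame segments from \<open>x\<close> to \<open>y\<close>.
\<close>

lemma potential_quotient_unique:
  assumes U: "\<And>i. open (U i)" "\<And>i. convex (U i)"
    and sub: "box_of U \<subseteq> N" "box_of U \<subseteq> N'"
    and pot: "local_potential N \<Phi>" "local_potential N' \<Phi>'"
    and x: "x \<in> box_of U" "walls x \<noteq> 0" and y: "y \<in> box_of U" "walls y \<noteq> 0"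
  shows "inv\<^bsub>G3\<^esub> \<Phi> x \<otimes>\<^bsub>G3\<^esub> \<Phi> y = inv\<^bsub>G3\<^esub> \<Phi>' x \<otimes>\<^bsub>G3\<^esub> \<Phi>' y"
proof -
  have cfg: "box_of U \<subseteq> config_space" using sub(1) pot(1) by (auto simp: local_potential_def)
  have conv: "convex (box_of U)" by (rule convex_box_of[OF U(2)])
  have cl: "\<Phi> u \<in> carrier G3" "\<Phi>' u \<in> carrier G3" if "u \<in> box_of U" "walls u \<noteq> 0" for u
    using local_potential_closed pot sub that by blast+
  have one: "inv\<^bsub>G3\<^esub> \<Phi> u \<otimes>\<^bsub>G3\<^esub> \<Phi> v = inv\<^bsub>G3\<^esub> \<Phi>' u \<otimes>\<^bsub>G3\<^esub> \<Phi>' v" if uv: "tame_in (box_of U) u v" for u v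
  proof -
    let ?g = "\<lambda>t. u + t *\<^sub>R (v - u)"
    have t: "tame u v" "u \<in> box_of U" "v \<in> box_of U" using uv by (simp_all add: tame_in_def)
    have "?g ` {0..1} = closed_segment u v"
      unfolding closed_segment_image_interval by (simp add: algebra_simps)
    also have "\<dots> \<subseteq> box_of U" by (rule closed_segment_subset[OF t(2,3) conv])
    finally have im: "?g ` {0..1} \<subseteq> N" "?g ` {0..1} \<subseteq> N'" using sub by auto
    have w: "walls (?g 0) \<noteq> 0" "walls (?g 1) \<noteq> 0" using t(1) by (simp_all add: tame_def)
    note p = potential_along_path[OF tame_good[OF t(1)] _ zero_le_one order_refl _ w]
    from p[OF pot(1) im(1)] p[OF pot(2) im(2)] show ?thesis by simp
  qed
  have "(tame_in (box_of U))\<^sup>*\<^sup>* x y" by (rule regular_connected[OF U cfg x y])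
  then show ?thesis
  proof (induction rule: rtranclp_induct)
    case base
    then show ?case using cl[OF x] by simp
  next
    case (step v w)
    have v: "v \<in> box_of U" "walls v \<noteq> 0" "w \<in> box_of U" "walls w \<noteq> 0"
      using step.hyps(2) by (simp_all add: tame_in_def tame_def)
    have tr: "inv\<^bsub>G3\<^esub> a \<otimes>\<^bsub>G3\<^esub> c = (inv\<^bsub>G3\<^esub> a \<otimes>\<^bsub>G3\<^esub> b) \<otimes>\<^bsub>G3\<^esub> (inv\<^bsub>G3\<^esub> b \<otimes>\<^bsub>G3\<^esub> c)"
      if "a \<in> carrier G3" "b \<in> carrier G3" "c \<in> carrier G3" for a b c
    proof -
      have "b \<otimes>\<^bsub>G3\<^esub> (inv\<^bsub>G3\<^esub> b \<otimes>\<^bsub>G3\<^esub> c) = c" using that by (simp flip: G3.m_assoc)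
      then show ?thesis using that by (simp add: G3.m_assoc)
    qed
    show ?case
      unfolding tr[OF cl(1)[OF x] cl(1)[OF v(1,2)] cl(1)[OF v(3,4)]]
        tr[OF cl(2)[OF x] cl(2)[OF v(1,2)] cl(2)[OF v(3,4)]] step.IH one[OF step.hyps(2)] ..
  qed
qed

text \<open>A parallel transport: \<open>T x y\<close> is the product of the letters on any good
  path in \<open>B\<close> between the regular points \<open>x\<close> and \<open>y\<close>, with
  the composition law of a groupoid.\<close>

definition transport_on :: "(complex ^ 'n) set \<Rightarrow> (complex ^ 'n \<Rightarrow> complex ^ 'n \<Rightarrow> ('n \<times> 'n \<times> 'n) word set) \<Rightarrow> bool" where
  "transport_on B T \<longleftrightarrow>
    (\<forall>x\<in>B. \<forall>y\<in>B. walls x \<noteq> 0 \<longrightarrow> walls y \<noteq> 0 \<longrightarrow> T x y \<in> carrier G3 \<and> T x x = \<one>\<^bsub>G3\<^esub> \<and>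
      (\<forall>w\<in>B. walls w \<noteq> 0 \<longrightarrow> T x y \<otimes>\<^bsub>G3\<^esub> T y w = T x w)) \<and>
    (\<forall>\<gamma> a b. good_path \<gamma> \<longrightarrow> a \<le> b \<longrightarrow> {a..b} \<subseteq> {0..1} \<longrightarrow> \<gamma> ` {a..b} \<subseteq> B \<longrightarrow>
      walls (\<gamma> a) \<noteq> 0 \<longrightarrow> walls (\<gamma> b) \<noteq> 0 \<longrightarrow>
      T (\<gamma> a) (\<gamma> b) = inv\<^bsub>G3\<^esub> word_upto \<gamma> a \<otimes>\<^bsub>G3\<^esub> word_upto \<gamma> b)"

lemma transport_onD:
  assumes "transport_on B T" "x \<in> B" "y \<in> B" "walls x \<noteq> 0" "walls y \<noteq> 0"
  shows "T x y \<in> carrier G3" "T x x = \<one>\<^bsub>G3\<^esub>"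
    "w \<in> B \<Longrightarrow> walls w \<noteq> 0 \<Longrightarrow> T x y \<otimes>\<^bsub>G3\<^esub> T y w = T x w"
  using conjunct1[OF assms(1)[unfolded transport_on_def]] assms(2-5) by blast+

lemma transport_on_path:
  assumes "transport_on B T" "good_path \<gamma>" "a \<le> b" "{a..b} \<subseteq> {0..1}" "\<gamma> ` {a..b} \<subseteq> B"
    "walls (\<gamma> a) \<noteq> 0" "walls (\<gamma> b) \<noteq> 0"
  shows "T (\<gamma> a) (\<gamma> b) = inv\<^bsub>G3\<^esub> word_upto \<gamma> a \<otimes>\<^bsub>G3\<^esub> word_upto \<gamma> b"
  using conjunct2[OF assms(1)[unfolded transport_on_def]] assms(2-7) by blast

text \<open>A Lebesgue number puts every small polydisc into the domain of some potential. One
  \<open>T\<close> serves them all: it is computed in an arbitrarily chosen polydisc containing both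
  points, and \<open>potential_quotient_unique\<close> on the intersection of two polydiscs removes
  the dependence on the choice.\<close>

lemma ex_transport:
  fixes K :: "(complex ^ 'n) set"
  assumes "compact K" "K \<subseteq> config_space"
  shows "\<exists>\<delta>>0. \<exists>T. \<forall>z\<in>K. transport_on (polydisc z \<delta>) T"
proof -
  define G where "G = {N :: (complex ^ 'n) set. open N \<and> (\<exists>\<Phi>. local_potential N \<Phi>)}"
  have cover: "K \<subseteq> \<Union>G"
  proof
    fix z assume "z \<in> K"
    then obtain N \<Phi> where "open N" "z \<in> N" "local_potential N \<Phi>"
      using ex_local_potential[of z] assms(2) by blast
    then show "z \<in> \<Union>G" unfolding G_def by blast
  qed
  have "\<exists>e>0. \<forall>z\<in>K. \<exists>N\<in>G. ball z e \<subseteq> N"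
  proof (rule Heine_Borel_lemma[OF assms(1) cover])
    show "open N" if "N \<in> G" for N using that by (simp add: G_def)
    fix e :: real assume "0 < e" "\<And>x. x \<in> K \<Longrightarrow> \<exists>N\<in>G. ball x e \<subseteq> N"
    then show ?thesis by (intro exI conjI ballI)
  qed
  then obtain e where e0: "e > 0" "\<forall>z\<in>K. \<exists>N\<in>G. ball z e \<subseteq> N" by (elim exE conjE)
  note e = e0(1) bspec[OF e0(2)]
  define d where "d = e / real CARD('n)"
  have d: "d > 0" using e(1) by (simp add: d_def)
  have "\<forall>z. \<exists>\<Phi>. z \<in> K \<longrightarrow> (\<exists>N. polydisc z d \<subseteq> N \<and> local_potential N \<Phi>)"
  proof
    fix z show "\<exists>\<Phi>. z \<in> K \<longrightarrow> (\<exists>N. polydisc z d \<subseteq> N \<and> local_potential N \<Phi>)"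
    proof (cases "z \<in> K")
      case True
      then obtain N where N: "N \<in> G" "ball z e \<subseteq> N" using e(2) by blast
      then obtain \<Phi> where "local_potential N \<Phi>" unfolding G_def by blast
      moreover have "polydisc z d \<subseteq> N" using polydisc_subset_ball[OF e(1), of z] N(2) unfolding d_def by blast
      ultimately show ?thesis by blast
    qed blast
  qed
  from choice[OF this] obtain \<Phi> where Phi0: "\<forall>z. z \<in> K \<longrightarrow> (\<exists>N. polydisc z d \<subseteq> N \<and> local_potential N (\<Phi> z))"
    by (rule exE)
  have Phi: "\<exists>N. polydisc z d \<subseteq> N \<and> local_potential N (\<Phi> z)" if "z \<in> K" for z
    by (rule mp[OF spec[OF Phi0] that])
  define T where "T = (\<lambda>x y. let z = (SOME z. z \<in> K \<and> x \<in> polydisc z d \<and> y \<in> polydisc z d) in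
    inv\<^bsub>G3\<^esub> \<Phi> z x \<otimes>\<^bsub>G3\<^esub> \<Phi> z y)"
  have T: "T x y = inv\<^bsub>G3\<^esub> \<Phi> z x \<otimes>\<^bsub>G3\<^esub> \<Phi> z y"
    if z: "z \<in> K" "x \<in> polydisc z d" "y \<in> polydisc z d" and w: "walls x \<noteq> 0" "walls y \<noteq> 0" for x y z
  proof -
    define z' where "z' = (SOME z. z \<in> K \<and> x \<in> polydisc z d \<and> y \<in> polydisc z d)"
    have z': "z' \<in> K \<and> x \<in> polydisc z' d \<and> y \<in> polydisc z' d"
      unfolding z'_def by (rule someI[of _ z]) (use z in blast)
    obtain N where N: "polydisc z d \<subseteq> N" "local_potential N (\<Phi> z)" using Phi[OF z(1)] by blast
    obtain N' where N': "polydisc z' d \<subseteq> N'" "local_potential N' (\<Phi> z')" using Phi z' by blast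
    define U where "U = (\<lambda>i. ball (z $ i) d \<inter> ball (z' $ i) d)"
    have U: "box_of U = polydisc z d \<inter> polydisc z' d" by (auto simp: U_def box_of_def polydisc_def)
    have "inv\<^bsub>G3\<^esub> \<Phi> z' x \<otimes>\<^bsub>G3\<^esub> \<Phi> z' y = inv\<^bsub>G3\<^esub> \<Phi> z x \<otimes>\<^bsub>G3\<^esub> \<Phi> z y"
    proof (rule potential_quotient_unique[OF _ _ _ _ N'(2) N(2)])
      show "open (U i)" "convex (U i)" for i unfolding U_def by (auto intro: convex_Int)
      show "box_of U \<subseteq> N'" "box_of U \<subseteq> N" using N N' U by auto
      show "x \<in> box_of U" "y \<in> box_of U" using z z' U by auto
    qed (rule w)+
    then show ?thesis by (simp add: T_def Let_def z'_def)
  qed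
  show ?thesis
  proof (rule exI[of _ d], intro conjI d exI[of _ T] ballI, unfold transport_on_def, intro conjI ballI)
    fix z assume z: "z \<in> K"
    obtain N where N: "polydisc z d \<subseteq> N" "local_potential N (\<Phi> z)" using Phi[OF z] by blast
    have cl: "\<Phi> z x \<in> carrier G3" if "x \<in> polydisc z d" "walls x \<noteq> 0" for x
      using local_potential_closed[OF N(2)] N(1) that by blast
    show "walls x \<noteq> 0 \<longrightarrow> walls y \<noteq> 0 \<longrightarrow> T x y \<in> carrier G3 \<and> T x x = \<one>\<^bsub>G3\<^esub> \<and>
      (\<forall>w\<in>polydisc z d. walls w \<noteq> 0 \<longrightarrow> T x y \<otimes>\<^bsub>G3\<^esub> T y w = T x w)"
      if x: "x \<in> polydisc z d" and y: "y \<in> polydisc z d" for x y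
    proof (intro impI conjI ballI)
      assume w: "walls x \<noteq> 0" "walls y \<noteq> 0"
      note c = cl[OF x w(1)] cl[OF y w(2)]
      show "T x y \<in> carrier G3" "T x x = \<one>\<^bsub>G3\<^esub>"
        unfolding T[OF z x y w] T[OF z x x w(1,1)] using c by simp_all
      fix u assume u: "u \<in> polydisc z d" "walls u \<noteq> 0"
      have "\<Phi> z y \<otimes>\<^bsub>G3\<^esub> (inv\<^bsub>G3\<^esub> \<Phi> z y \<otimes>\<^bsub>G3\<^esub> \<Phi> z u) = \<Phi> z u" using c cl[OF u] by (simp flip: G3.m_assoc)
      then show "T x y \<otimes>\<^bsub>G3\<^esub> T y u = T x u"
        unfolding T[OF z x y w] T[OF z y u(1) w(2) u(2)] T[OF z x u(1) w(1) u(2)]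
        using c cl[OF u] by (simp add: G3.m_assoc)
    qed
    show "\<forall>\<gamma> a b. good_path \<gamma> \<longrightarrow> a \<le> b \<longrightarrow> {a..b} \<subseteq> {0..1} \<longrightarrow> \<gamma> ` {a..b} \<subseteq> polydisc z d \<longrightarrow>
      walls (\<gamma> a) \<noteq> 0 \<longrightarrow> walls (\<gamma> b) \<noteq> 0 \<longrightarrow> T (\<gamma> a) (\<gamma> b) = inv\<^bsub>G3\<^esub> word_upto \<gamma> a \<otimes>\<^bsub>G3\<^esub> word_upto \<gamma> b"
    proof (intro allI impI)
      fix \<gamma> :: "real \<Rightarrow> complex ^ 'n" and a b :: real
      assume g: "good_path \<gamma>" and ab: "a \<le> b" "{a..b} \<subseteq> {0..1}" and im: "\<gamma> ` {a..b} \<subseteq> polydisc z d"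
        and w: "walls (\<gamma> a) \<noteq> 0" "walls (\<gamma> b) \<noteq> 0"
      have ends: "\<gamma> a \<in> polydisc z d" "\<gamma> b \<in> polydisc z d" using im ab(1) by auto
      show "T (\<gamma> a) (\<gamma> b) = inv\<^bsub>G3\<^esub> word_upto \<gamma> a \<otimes>\<^bsub>G3\<^esub> word_upto \<gamma> b"
        unfolding T[OF z ends w]
        by (rule potential_along_path[OF g N(2) ab _ w]) (use im N(1) in blast)
    qed
  qed
qed

text \<open>A discrete homotopy: \<open>h\<close> and \<open>v\<close> are the values on horizontal
  and vertical edges, and \<open>R i j\<close> is the product of the first \<open>j\<close> edges of
  row \<open>i\<close>. Commuting cells carry a row to the next one, and the vertical sides of the
  square contribute nothing.\<close>

lemma grid_rows:
  fixes h v :: "nat \<Rightarrow> nat \<Rightarrow> _"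
  assumes cl: "\<And>i j. i \<le> M \<Longrightarrow> j < M \<Longrightarrow> h i j \<in> carrier G3" "\<And>i j. i < M \<Longrightarrow> j \<le> M \<Longrightarrow> v i j \<in> carrier G3"
    and cell: "\<And>i j. i < M \<Longrightarrow> j < M \<Longrightarrow> h i j \<otimes>\<^bsub>G3\<^esub> v i (Suc j) = v i j \<otimes>\<^bsub>G3\<^esub> h (Suc i) j"
    and ends: "\<And>i. i < M \<Longrightarrow> v i 0 = \<one>\<^bsub>G3\<^esub>" "\<And>i. i < M \<Longrightarrow> v i M = \<one>\<^bsub>G3\<^esub>"
  defines "R \<equiv> \<lambda>i. rec_nat \<one>\<^bsub>G3\<^esub> (\<lambda>j g. g \<otimes>\<^bsub>G3\<^esub> h i j)"
  shows "R 0 M = R M M"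
proof -
  have R: "R i 0 = \<one>\<^bsub>G3\<^esub>" "R i (Suc j) = R i j \<otimes>\<^bsub>G3\<^esub> h i j" for i j by (simp_all add: R_def)
  have Rc: "R i j \<in> carrier G3" if "i \<le> M" "j \<le> M" for i j
    using that(2) by (induction j) (use cl(1) that(1) R in auto)
  have "R i j \<otimes>\<^bsub>G3\<^esub> v i j = R (Suc i) j" if i: "i < M" and "j \<le> M" for i j
    using that(2)
  proof (induction j)
    case 0
    then show ?case using ends(1)[OF i] by (simp add: R)
  next
    case (Suc j)
    have j: "j < M" "j \<le> M" using Suc.prems by auto
    have "R i (Suc j) \<otimes>\<^bsub>G3\<^esub> v i (Suc j) = R i j \<otimes>\<^bsub>G3\<^esub> (v i j \<otimes>\<^bsub>G3\<^esub> h (Suc i) j)"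
      unfolding R(2) cell[OF i j(1), symmetric] using Rc[of i j] cl(1)[of i j] cl(2)[of i "Suc j"] i Suc.prems
      by (simp add: G3.m_assoc)
    also have "\<dots> = R (Suc i) (Suc j)"
      unfolding R(2) Suc.IH[OF j(2), symmetric] using Rc[of i j] cl(1)[of "Suc i" j] cl(2)[of i j] i j
      by (simp add: G3.m_assoc)
    finally show ?case .
  qed
  from this[of _ M] have step: "R i M = R (Suc i) M" if "i < M" for i
    using ends(2)[OF that] Rc[of i M] that by fastforce
  have "R 0 M = R i M" if "i \<le> M" for i
    using that by (induction i) (use step in auto)
  then show ?thesis by simp
qed

lemma ex_regular_time:
  assumes "good_path \<gamma>" "a < (b::real)" "0 \<le> a" "b \<le> 1"
  shows "\<exists>t\<in>{a<..<b}. walls (\<gamma> t) \<noteq> 0"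
proof (rule ccontr)
  assume n: "\<not> ?thesis"
  have "\<gamma> ` {0..1} \<subseteq> config_space" using assms(1) by (simp add: good_path_def)
  then have "{a<..<b} \<subseteq> critical_moments \<gamma>"
    unfolding critical_moments_walls[OF \<open>\<gamma> ` {0..1} \<subseteq> config_space\<close>] using n assms(3,4) by auto
  moreover have "finite (critical_moments \<gamma>)" using assms(1) by (simp add: good_path_def)
  ultimately show False using assms(2) finite_subset infinite_Ioo by blast
qed

text \<open>The factors telescope from \<open>word_upto\<close> at 0, which is the unit, to
  \<open>word_upto\<close> at 1.\<close>

lemma row_product:
  fixes \<tau> :: "nat \<Rightarrow> real"
  assumes g: "good_path \<gamma>" and t: "\<tau> 0 = 0" "\<tau> M = 1"
    and h: "\<And>j. j < M \<Longrightarrow> h j = inv\<^bsub>G3\<^esub> word_upto \<gamma> (\<tau> j) \<otimes>\<^bsub>G3\<^esub> word_upto \<gamma> (\<tau> (Suc j))"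
  shows "rec_nat \<one>\<^bsub>G3\<^esub> (\<lambda>j g. g \<otimes>\<^bsub>G3\<^esub> h j) M = g_motion \<gamma>"
proof -
  note W [simp] = word_upto_closed[OF g]
  have "rec_nat \<one>\<^bsub>G3\<^esub> (\<lambda>j g. g \<otimes>\<^bsub>G3\<^esub> h j) j = word_upto \<gamma> (\<tau> j)" if "j \<le> M" for j
    using that
  proof (induction j)
    case 0
    then show ?case by (simp add: t word_upto_0)
  next
    case (Suc j)
    have "word_upto \<gamma> (\<tau> j) \<otimes>\<^bsub>G3\<^esub> h j = word_upto \<gamma> (\<tau> (Suc j))"
      unfolding h[OF Suc_le_lessD[OF Suc.prems]] by (simp flip: G3.m_assoc)
    with Suc show ?case by simp
  qed
  then show ?thesis using word_upto_1[OF g] t(2) by simp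
qed

text \<open>A tolerance of half a mesh width keeps the chosen times in increasing order.\<close>

lemma ex_regular_times:
  assumes "good_path \<gamma>" "M \<ge> 2"
  shows "\<exists>\<tau>. \<tau> 0 = 0 \<and> \<tau> M = 1 \<and> (\<forall>j\<le>M. \<tau> j \<in> {0..1} \<and> \<bar>\<tau> j - real j / real M\<bar> < 1 / (2 * real M) \<and> walls (\<gamma> (\<tau> j)) \<noteq> 0)"
proof -
  have M: "real M > 0" using assms(2) by simp
  have "\<forall>j. \<exists>t. j \<le> M \<longrightarrow> t \<in> {0..1} \<and> \<bar>t - real j / real M\<bar> < 1 / (2 * real M) \<and> walls (\<gamma> t) \<noteq> 0 \<and>
     (j = 0 \<longrightarrow> t = 0) \<and> (j = M \<longrightarrow> t = 1)"
  proof
    fix j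
    have w: "walls (\<gamma> 0) \<noteq> 0" "walls (\<gamma> 1) \<noteq> 0" using assms(1) by (simp_all add: good_path_def)
    consider "j = 0" | "j = M" | "0 < j" "j < M" | "j > M" by linarith
    then show "\<exists>t. j \<le> M \<longrightarrow> t \<in> {0..1} \<and> \<bar>t - real j / real M\<bar> < 1 / (2 * real M) \<and> walls (\<gamma> t) \<noteq> 0 \<and>
     (j = 0 \<longrightarrow> t = 0) \<and> (j = M \<longrightarrow> t = 1)"
    proof cases
      case 1
      then show ?thesis using w M assms(2) by (intro exI[of _ 0]) auto
    next
      case 2
      then show ?thesis using w M assms(2) by (intro exI[of _ 1]) auto
    next
      case 3
      define c where "c = 1 / (2 * real M)"
      have c: "c > 0" using M by (simp add: c_def)
      have jM: "1 / real M = 2 * c" using M by (simp add: c_def)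
      have "real j / real M \<ge> 1 / real M" "real j / real M \<le> (real M - 1) / real M"
        using 3 M by (auto intro!: divide_right_mono)
      moreover have "(real M - 1) / real M = 1 - 2 * c" using M by (simp add: c_def field_simps)
      ultimately have b: "0 \<le> real j / real M - c" "real j / real M + c \<le> 1" using jM c by auto
      obtain t where "t \<in> {real j / real M - c<..<real j / real M + c}" "walls (\<gamma> t) \<noteq> 0"
        using ex_regular_time[OF assms(1) _ b] c by auto
      then show ?thesis using 3 b by (intro exI[of _ t]) (auto simp: c_def[symmetric] abs_if)
    qed auto
  qed
  from choice[OF this] obtain \<tau> where "\<forall>j. j \<le> M \<longrightarrow> \<tau> j \<in> {0..1} \<and> \<bar>\<tau> j - real j / real M\<bar> < 1 / (2 * real M) \<and>
     walls (\<gamma> (\<tau> j)) \<noteq> 0 \<and> (j = 0 \<longrightarrow> \<tau> j = 0) \<and> (j = M \<longrightarrow> \<tau> j = 1)" by (rule exE)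
  then show ?thesis by (intro exI[of _ \<tau>]) auto
qed

text \<open>The vertices of the grid are replaced by nearby regular configurations; on the first and
  last row these are taken on the two paths, so that the products along those rows are the two
  values of \<open>g_motion\<close>.\<close>

theorem g_motion_homotopic:
  fixes \<beta> \<gamma> :: "real \<Rightarrow> complex ^ 'n"
  assumes g: "good_path \<beta>" "good_path \<gamma>" and hom: "homotopic_paths config_space \<beta> \<gamma>"
  shows "g_motion \<beta> = g_motion \<gamma>"
proof -
  let ?Sq = "{0..1} \<times> {0..1} :: (real \<times> real) set"
  have "\<exists>H. continuous_on ?Sq H \<and> H \<in> ?Sq \<rightarrow> config_space \<and> (\<forall>t\<in>{0..1}. H (0, t) = \<beta> t) \<and>
    (\<forall>t\<in>{0..1}. H (1, t) = \<gamma> t) \<and>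
    (\<forall>s\<in>{0..1}. pathstart (H \<circ> Pair s) = pathstart \<beta> \<and> pathfinish (H \<circ> Pair s) = pathfinish \<beta>)"
    using hom unfolding homotopic_paths .
  then obtain H where H0: "continuous_on ?Sq H" "H \<in> ?Sq \<rightarrow> config_space" "\<forall>t\<in>{0..1}. H (0, t) = \<beta> t"
    "\<forall>t\<in>{0..1}. H (1, t) = \<gamma> t"
    "\<forall>s\<in>{0..1}. pathstart (H \<circ> Pair s) = pathstart \<beta> \<and> pathfinish (H \<circ> Pair s) = pathfinish \<beta>"
    by (elim exE conjE)
  have H: "continuous_on ?Sq H" "H ` ?Sq \<subseteq> config_space" "\<And>t. t \<in> {0..1} \<Longrightarrow> H (0, t) = \<beta> t"
    "\<And>t. t \<in> {0..1} \<Longrightarrow> H (1, t) = \<gamma> t" "\<And>s. s \<in> {0..1} \<Longrightarrow> H (s, 0) = \<beta> 0" "\<And>s. s \<in> {0..1} \<Longrightarrow> H (s, 1) = \<beta> 1"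
    using H0 by (simp_all add: pathstart_def pathfinish_def image_subset_iff_funcset)
  have sq: "compact ?Sq" by (intro compact_Times compact_Icc)
  have "compact (H ` ?Sq)" by (rule compact_continuous_image[OF H(1) sq])
  from ex_transport[OF this H(2)] obtain \<delta> T where d: "\<delta> > 0" and T: "\<forall>z\<in>H ` ?Sq. transport_on (polydisc z \<delta>) T" by (elim exE conjE)
  note T' = bspec[OF T imageI]
  note T1 = transport_onD[OF T'] and T3 = transport_on_path[OF T']
  have "uniformly_continuous_on ?Sq H" by (rule compact_uniformly_continuous[OF H(1) sq])
  then obtain \<eta> where eta: "\<eta> > 0" "\<forall>p\<in>?Sq. \<forall>p'\<in>?Sq. dist p' p < \<eta> \<longrightarrow> dist (H p') (H p) < \<delta> / 2"
    using half_gt_zero[OF d] unfolding uniformly_continuous_on_def by blast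
  \<comment> \<open>Both coordinates may vary by up to \<open>2 * c\<close> with
    \<open>c = 1 / M\<close>, hence the 4.\<close>
  obtain M0 :: nat where "4 / \<eta> < real M0" using reals_Archimedean2 by blast
  define M where "M = max 2 M0"
  have M: "M \<ge> 2" "real M > 0" "4 / real M < \<eta>"
  proof -
    have "4 / \<eta> < real M" using \<open>4 / \<eta> < real M0\<close> by (simp add: M_def)
    then show "4 / real M < \<eta>" using eta(1) by (simp add: M_def field_simps)
  qed (simp_all add: M_def)
  define c where "c = 1 / real M"
  have c: "c > 0" "4 * c < \<eta>" using M by (simp_all add: c_def)
  have close: "dist (H (s', t')) (H (s, t)) < \<delta> / 2"
    if "s \<in> {0..1}" "t \<in> {0..1}" "s' \<in> {0..1}" "t' \<in> {0..1}" "\<bar>s' - s\<bar> \<le> 2 * c" "\<bar>t' - t\<bar> < 2 * c" for s t s' t'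
  proof -
    have "dist (s', t') (s, t) \<le> \<bar>s' - s\<bar> + \<bar>t' - t\<bar>"
      unfolding dist_Pair_Pair dist_real_def by (rule sqrt_sum_squares_le_sum) auto
    also have "\<dots> < \<eta>" using that c by linarith
    finally show ?thesis using eta(2) that by simp
  qed
  define p where "p = (\<lambda>i j. (real i * c, real j * c))"
  have pSq: "p i j \<in> ?Sq" "real i * c \<in> {0..1}" "real j * c \<in> {0..1}" if "i \<le> M" "j \<le> M" for i j
    using that M by (auto simp: p_def c_def)
  obtain \<tau> where tau: "\<tau> 0 = 0" "\<tau> M = 1"
    "\<forall>j\<le>M. \<tau> j \<in> {0..1} \<and> \<bar>\<tau> j - real j / real M\<bar> < 1 / (2 * real M) \<and> walls (\<beta> (\<tau> j)) \<noteq> 0"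
    using ex_regular_times[OF g(1) M(1)] by blast
  obtain \<sigma> where sig: "\<sigma> 0 = 0" "\<sigma> M = 1"
    "\<forall>j\<le>M. \<sigma> j \<in> {0..1} \<and> \<bar>\<sigma> j - real j / real M\<bar> < 1 / (2 * real M) \<and> walls (\<gamma> (\<sigma> j)) \<noteq> 0"
    using ex_regular_times[OF g(2) M(1)] by blast
  have tau': "\<tau> j \<in> {0..1}" "\<bar>\<tau> j - real j * c\<bar> < c / 2" "walls (\<beta> (\<tau> j)) \<noteq> 0" if "j \<le> M" for j
    using tau(3) that by (auto simp: c_def)
  have sig': "\<sigma> j \<in> {0..1}" "\<bar>\<sigma> j - real j * c\<bar> < c / 2" "walls (\<gamma> (\<sigma> j)) \<noteq> 0" if "j \<le> M" for j
    using sig(3) that by (auto simp: c_def)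
  have "\<forall>q. \<exists>y. fst q \<le> M \<and> snd q \<le> M \<longrightarrow> dist (H (p (fst q) (snd q))) y < \<delta> / 2 \<and> walls y \<noteq> 0"
  proof
    fix q :: "nat \<times> nat"
    show "\<exists>y. fst q \<le> M \<and> snd q \<le> M \<longrightarrow> dist (H (p (fst q) (snd q))) y < \<delta> / 2 \<and> walls y \<noteq> 0"
    proof (cases "fst q \<le> M \<and> snd q \<le> M")
      case True
      then have P: "H (p (fst q) (snd q)) \<in> config_space" using H(2) pSq by blast
      have "\<exists>y\<in>ball (H (p (fst q) (snd q))) (\<delta> / 2) \<inter> config_space. walls y \<noteq> 0"
        by (rule ex_regular[of _ "H (p (fst q) (snd q))"]) (use P d open_config_space in auto)
      then show ?thesis by auto
    qed auto
  qed
  from choice[OF this] obtain y where y: "\<forall>q. fst q \<le> M \<and> snd q \<le> M \<longrightarrow>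
    dist (H (p (fst q) (snd q))) (y q) < \<delta> / 2 \<and> walls (y q) \<noteq> 0" by (rule exE)
  \<comment> \<open>The rows on the two paths come first and also supply the corners; the outer
    columns are constant, as the homotopy is there.\<close>
  define x where "x = (\<lambda>i j. if i = 0 then \<beta> (\<tau> j) else if i = M then \<gamma> (\<sigma> j) else
    if j = 0 then \<beta> 0 else if j = M then \<beta> 1 else y (i, j))"
  have x: "dist (H (p i j)) (x i j) < \<delta> / 2" "walls (x i j) \<noteq> 0" if ij: "i \<le> M" "j \<le> M" for i j
  proof -
    have M0: "M \<noteq> 0" using M by simp
    have Mc: "real M * c = 1" using M by (simp add: c_def)
    note P = pSq(2,3)[OF ij]
    have "dist (H (p i j)) (x i j) < \<delta> / 2 \<and> walls (x i j) \<noteq> 0"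
    proof (cases "i = 0 \<or> i = M \<or> j = 0 \<or> j = M")
      case True
      have w: "walls (\<beta> 0) \<noteq> 0" "walls (\<beta> 1) \<noteq> 0" using g(1) by (simp_all add: good_path_def)
      consider "i = 0" | "i = M" "i \<noteq> 0" | "i \<noteq> 0" "i \<noteq> M" "j = 0" | "i \<noteq> 0" "i \<noteq> M" "j \<noteq> 0" "j = M" using True by blast
      then show ?thesis
      proof cases
        case 1
        have "dist (H (0, real j * c)) (H (0, \<tau> j)) < \<delta> / 2"
          by (rule close) (use tau'[OF ij(2)] P c in \<open>auto simp: abs_minus_commute\<close>)
        then show ?thesis using 1 H(3)[OF tau'(1)[OF ij(2)]] tau'(3)[OF ij(2)] by (simp add: x_def p_def)
      next
        case 2
        have "dist (H (1, real j * c)) (H (1, \<sigma> j)) < \<delta> / 2"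
          by (rule close) (use sig'[OF ij(2)] P c in \<open>auto simp: abs_minus_commute\<close>)
        then show ?thesis using 2 M0 Mc H(4)[OF sig'(1)[OF ij(2)]] sig'(3)[OF ij(2)] by (simp add: x_def p_def)
      next
        case 3
        then show ?thesis using H(5)[OF P(1)] w d by (simp add: x_def p_def)
      next
        case 4
        then show ?thesis using H(6)[OF P(1)] w d Mc by (simp add: x_def p_def)
      qed
    next
      case False
      then have "x i j = y (i, j)" by (simp add: x_def)
      then show ?thesis using spec[OF y, of "(i, j)"] ij by simp
    qed
    then show "dist (H (p i j)) (x i j) < \<delta> / 2" "walls (x i j) \<noteq> 0" by simp_all
  qed
  have xin: "x i' j' \<in> polydisc (H (p i j)) \<delta>"
    if ij: "i \<le> M" "j \<le> M" "i' \<le> M" "j' \<le> M" "i' = i \<or> i' = Suc i" "j' = j \<or> j' = Suc j" for i j i' j'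
  proof -
    have "dist (H (p i' j')) (H (p i j)) < \<delta> / 2"
      unfolding p_def by (rule close) (use pSq(2,3)[OF ij(1,2)] pSq(2,3)[OF ij(3,4)] ij(5,6) c in \<open>auto simp: algebra_simps\<close>)
    moreover have "dist (H (p i' j')) (x i' j') < \<delta> / 2" by (rule x(1)[OF ij(3,4)])
    ultimately have "dist (H (p i j)) (x i' j') < \<delta>"
      using dist_triangle[of "H (p i j)" "x i' j'" "H (p i' j')"] by (simp add: dist_commute)
    then have "x i' j' \<in> ball (H (p i j)) \<delta>" by simp
    then show ?thesis by (rule subsetD[OF ball_subset_polydisc])
  qed
  define h where "h = (\<lambda>i j. T (x i j) (x i (Suc j)))"
  define v where "v = (\<lambda>i j. T (x i j) (x (Suc i) j))"
  have rows: "rec_nat \<one>\<^bsub>G3\<^esub> (\<lambda>j g. g \<otimes>\<^bsub>G3\<^esub> h 0 j) M = rec_nat \<one>\<^bsub>G3\<^esub> (\<lambda>j g. g \<otimes>\<^bsub>G3\<^esub> h M j) M"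
  proof (rule grid_rows[where v = v])
    show "h i j \<in> carrier G3" if "i \<le> M" "j < M" for i j
      unfolding h_def by (rule T1(1)[OF pSq(1)[of i j]]) (use that x xin in auto)
    show "v i j \<in> carrier G3" if "i < M" "j \<le> M" for i j
      unfolding v_def by (rule T1(1)[OF pSq(1)[of i j]]) (use that x xin in auto)
    fix i assume i: "i < M"
    show "h i j \<otimes>\<^bsub>G3\<^esub> v i (Suc j) = v i j \<otimes>\<^bsub>G3\<^esub> h (Suc i) j" if "j < M" for j
    proof -
      have le: "i \<le> M" "j \<le> M" "Suc i \<le> M" "Suc j \<le> M" using i that by auto
      note P = pSq(1)[OF le(1,2)]
      note X = xin[OF le(1,2) le(1,2)] xin[OF le(1,2) le(3,2)] xin[OF le(1,2) le(1,4)] xin[OF le(1,2) le(3,4)]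
      have "T (x i j) (x i (Suc j)) \<otimes>\<^bsub>G3\<^esub> T (x i (Suc j)) (x (Suc i) (Suc j)) = T (x i j) (x (Suc i) (Suc j))"
        by (rule T1(3)[OF P]) (use X x(2) le in auto)
      moreover have "T (x i j) (x (Suc i) j) \<otimes>\<^bsub>G3\<^esub> T (x (Suc i) j) (x (Suc i) (Suc j)) = T (x i j) (x (Suc i) (Suc j))"
        by (rule T1(3)[OF P]) (use X x(2) le in auto)
      ultimately show ?thesis by (simp add: h_def v_def)
    qed
    have bc: "\<gamma> 0 = \<beta> 0" "\<gamma> 1 = \<beta> 1" using H(4)[of 0] H(4)[of 1] H(5)[of 1] H(6)[of 1] by auto
    have xe: "x i 0 = x (Suc i) 0" "x i M = x (Suc i) M"
      using i M(1) bc tau(1,2) sig(1,2) by (auto simp: x_def)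
    have Tj: "T (x i j) (x i j) = \<one>\<^bsub>G3\<^esub>" if "j \<le> M" for j
    proof -
      have le: "i \<le> M" "j \<le> M" using i that by auto
      note X = xin[OF le le HOL.disjI1[OF HOL.refl] HOL.disjI1[OF HOL.refl]]
      show ?thesis by (rule T1(2)[OF pSq(1)[OF le] X X x(2)[OF le] x(2)[OF le]])
    qed
    show "v i 0 = \<one>\<^bsub>G3\<^esub>" "v i M = \<one>\<^bsub>G3\<^esub>"
      unfolding v_def xe[symmetric] by (rule Tj, simp)+
  qed
  have row: "rec_nat \<one>\<^bsub>G3\<^esub> (\<lambda>j g. g \<otimes>\<^bsub>G3\<^esub> h k j) M = g_motion \<alpha>"
    if a: "good_path \<alpha>" "\<And>t. t \<in> {0..1} \<Longrightarrow> H (s, t) = \<alpha> t" and s: "s \<in> {0..1}" "real k * c = s" "k \<le> M"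
      and t: "t 0 = 0" "t M = 1" "\<And>j. j \<le> M \<Longrightarrow> t j \<in> {0..1}" "\<And>j. j \<le> M \<Longrightarrow> \<bar>t j - real j * c\<bar> < c / 2"
        "\<And>j. j \<le> M \<Longrightarrow> walls (\<alpha> (t j)) \<noteq> 0" "\<And>j. j \<le> M \<Longrightarrow> x k j = \<alpha> (t j)"
    for \<alpha> s k t
  proof (rule row_product[OF a(1) t(1,2)])
    fix j assume j: "j < M"
    then have le: "j \<le> M" "Suc j \<le> M" by auto
    have sj: "real (Suc j) * c = real j * c + c" by (simp add: algebra_simps)
    have tj: "t j \<le> t (Suc j)" "\<bar>t j - real j * c\<bar> < c / 2" "\<bar>t (Suc j) - (real j * c + c)\<bar> < c / 2"
      using t(4)[OF le(1)] t(4)[OF le(2)] c(1) unfolding sj by linarith+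
    have P: "p k j \<in> ?Sq" by (rule pSq(1)[OF s(3) le(1)])
    show "h k j = inv\<^bsub>G3\<^esub> word_upto \<alpha> (t j) \<otimes>\<^bsub>G3\<^esub> word_upto \<alpha> (t (Suc j))"
      unfolding h_def t(6)[OF le(1)] t(6)[OF le(2)]
    proof (rule T3[OF P a(1) tj(1) _ _ t(5)[OF le(1)] t(5)[OF le(2)]])
      show sub: "{t j..t (Suc j)} \<subseteq> {0..1}" using t(3)[OF le(1)] t(3)[OF le(2)] by auto
      show "\<alpha> ` {t j..t (Suc j)} \<subseteq> polydisc (H (p k j)) \<delta>"
      proof clarify
        fix u assume u: "u \<in> {t j..t (Suc j)}"
        then have u01: "u \<in> {0..1}" using sub by blast
        have "t j \<le> u" "u \<le> t (Suc j)" using u by auto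
        then have "\<bar>u - real j * c\<bar> < 2 * c" using tj c(1) by linarith
        then have "dist (H (s, u)) (H (p k j)) < \<delta> / 2"
          unfolding p_def s(2) by (intro close) (use s(1) u01 pSq(3)[OF s(3) le(1)] c in auto)
        then have "\<alpha> u \<in> ball (H (p k j)) \<delta>" using a(2)[OF u01] d by (simp add: dist_commute)
        then show "\<alpha> u \<in> polydisc (H (p k j)) \<delta>" by (rule subsetD[OF ball_subset_polydisc])
      qed
    qed
  qed
  have Mc: "real M * c = 1" using M by (simp add: c_def)
  have "rec_nat \<one>\<^bsub>G3\<^esub> (\<lambda>j g. g \<otimes>\<^bsub>G3\<^esub> h 0 j) M = g_motion \<beta>"
    by (rule row[OF g(1) H(3) _ _ _ tau(1,2) tau']) (use c in \<open>auto simp: x_def\<close>)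
  moreover have "rec_nat \<one>\<^bsub>G3\<^esub> (\<lambda>j g. g \<otimes>\<^bsub>G3\<^esub> h M j) M = g_motion \<gamma>"
    by (rule row[OF g(2) H(4) _ _ _ sig(1,2) sig']) (use Mc M(1) in \<open>auto simp: x_def\<close>)
  ultimately show ?thesis using rows by simp
qed

section \<open>Smooth functions\<close>

text \<open>The derivative is supplied afresh at each order, unlike the single sequence in
  \<open>smooth_path\<close>; closure under products is then an induction on the order.\<close>

fun diff_times :: "nat \<Rightarrow> (real \<Rightarrow> 'a::real_normed_vector) \<Rightarrow> real set \<Rightarrow> bool" where
  "diff_times 0 f S = True"
| "diff_times (Suc k) f S = (\<exists>f'. (\<forall>t\<in>S. (f has_vector_derivative f' t) (at t within S)) \<and> diff_times k f' S)"

definition smooth_on :: "(real \<Rightarrow> 'a::real_normed_vector) \<Rightarrow> real set \<Rightarrow> bool" where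
  "smooth_on f S \<longleftrightarrow> (\<forall>k. diff_times k f S)"

lemma diff_times_SucI:
  "(\<And>t. t \<in> S \<Longrightarrow> (f has_vector_derivative f' t) (at t within S)) \<Longrightarrow> diff_times k f' S \<Longrightarrow> diff_times (Suc k) f S"
  by auto

lemma diff_times_mono: "diff_times (Suc k) f S \<Longrightarrow> diff_times k f S"
proof (induction k arbitrary: f)
  case (Suc k)
  then obtain f' where "\<forall>t\<in>S. (f has_vector_derivative f' t) (at t within S)" "diff_times (Suc k) f' S" by auto
  with Suc.IH[of f'] show ?case by auto
qed simp

lemma diff_times_cong:
  assumes "diff_times k f S" "\<And>t. t \<in> S \<Longrightarrow> f t = g t"
  shows "diff_times k g S"
proof (cases k)
  case (Suc m)
  then obtain f' where f': "\<forall>t\<in>S. (f has_vector_derivative f' t) (at t within S)" "diff_times m f' S" using assms(1) by auto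
  have "(g has_vector_derivative f' t) (at t within S)" if "t \<in> S" for t
    using has_vector_derivative_transform[OF that, of g f] f'(1) assms(2) that by metis
  with f'(2) show ?thesis unfolding Suc by (intro diff_times_SucI)
qed simp

lemma diff_times_const: "diff_times k (\<lambda>t. c) S"
proof (induction k arbitrary: c)
  case (Suc k)
  show ?case by (rule diff_times_SucI[where f' = "\<lambda>t. 0"]) (use Suc in auto)
qed simp

lemma diff_times_add: "diff_times k f S \<Longrightarrow> diff_times k g S \<Longrightarrow> diff_times k (\<lambda>t. f t + g t) S"
proof (induction k arbitrary: f g)
  case (Suc k)
  then obtain f' g' where "\<forall>t\<in>S. (f has_vector_derivative f' t) (at t within S)" "diff_times k f' S"
    "\<forall>t\<in>S. (g has_vector_derivative g' t) (at t within S)" "diff_times k g' S" by auto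
  then show ?case using Suc.IH[of f' g']
    by (intro diff_times_SucI[where f' = "\<lambda>t. f' t + g' t"] has_vector_derivative_add) auto
qed simp

lemma diff_times_scaleR:
  fixes f :: "real \<Rightarrow> real"
  shows "diff_times k f S \<Longrightarrow> diff_times k g S \<Longrightarrow> diff_times k (\<lambda>t. f t *\<^sub>R g t) S"
proof (induction k arbitrary: f g)
  case (Suc k)
  then obtain f' g' where fg: "\<forall>t\<in>S. (f has_vector_derivative f' t) (at t within S)" "diff_times k f' S"
    "\<forall>t\<in>S. (g has_vector_derivative g' t) (at t within S)" "diff_times k g' S" by auto
  note m = diff_times_mono[OF Suc.prems(1)] diff_times_mono[OF Suc.prems(2)]
  show ?case
  proof (rule diff_times_SucI[where f' = "\<lambda>t. f t *\<^sub>R g' t + f' t *\<^sub>R g t"])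
    show "((\<lambda>t. f t *\<^sub>R g t) has_vector_derivative f t *\<^sub>R g' t + f' t *\<^sub>R g t) (at t within S)" if "t \<in> S" for t
      using fg(1,3) that by (intro has_vector_derivative_scaleR) (auto simp: has_real_derivative_iff_has_vector_derivative)
    show "diff_times k (\<lambda>t. f t *\<^sub>R g' t + f' t *\<^sub>R g t) S"
      by (intro diff_times_add Suc.IH m fg)
  qed
qed simp

lemma diff_times_inverse:
  fixes f :: "real \<Rightarrow> real"
  assumes nz: "\<And>t. t \<in> S \<Longrightarrow> f t \<noteq> 0"
  shows "diff_times k f S \<Longrightarrow> diff_times k (\<lambda>t. inverse (f t)) S"
proof (induction k)
  case (Suc k)
  then obtain f' where f': "\<forall>t\<in>S. (f has_vector_derivative f' t) (at t within S)" "diff_times k f' S" by auto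
  have IH: "diff_times k (\<lambda>t. inverse (f t)) S" by (rule Suc.IH[OF diff_times_mono[OF Suc.prems]])
  show ?case
  proof (rule diff_times_SucI[where f' = "\<lambda>t. (- 1) *\<^sub>R (inverse (f t) *\<^sub>R (inverse (f t) *\<^sub>R f' t))"])
    fix t assume t: "t \<in> S"
    have "(f has_real_derivative f' t) (at t within S)"
      using f'(1) t by (simp add: has_real_derivative_iff_has_vector_derivative)
    from DERIV_inverse_fun[OF this nz[OF t]]
    show "((\<lambda>t. inverse (f t)) has_vector_derivative (- 1) *\<^sub>R (inverse (f t) *\<^sub>R (inverse (f t) *\<^sub>R f' t))) (at t within S)"
      by (simp add: has_real_derivative_iff_has_vector_derivative mult_ac)
  qed (intro diff_times_scaleR diff_times_const IH f'(2))
qed simp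

lemma diff_times_affine:
  "diff_times k f UNIV \<Longrightarrow> diff_times k (\<lambda>t. f (a * t + b)) S"
proof (induction k arbitrary: f)
  case (Suc k)
  then obtain f' where f': "\<forall>t. (f has_vector_derivative f' t) (at t)" "diff_times k f' UNIV" by auto
  show ?case
  proof (rule diff_times_SucI[where f' = "\<lambda>t. a *\<^sub>R f' (a * t + b)"])
    fix t
    have "((\<lambda>t. a * t + b) has_vector_derivative a) (at t within S)"
      by (auto intro!: derivative_eq_intros simp flip: has_real_derivative_iff_has_vector_derivative)
    from vector_diff_chain_within[OF this, of f "f' (a * t + b)"]
    show "((\<lambda>t. f (a * t + b)) has_vector_derivative a *\<^sub>R f' (a * t + b)) (at t within S)"
      using f'(1) by (auto simp: comp_def intro: has_vector_derivative_at_within)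
  qed (intro diff_times_scaleR diff_times_const Suc.IH f'(2))
qed simp

lemma smooth_const: "smooth_on (\<lambda>t. c) S"
  by (simp add: smooth_on_def diff_times_const)

lemma smooth_add: "smooth_on f S \<Longrightarrow> smooth_on g S \<Longrightarrow> smooth_on (\<lambda>t. f t + g t) S"
  by (simp add: smooth_on_def diff_times_add)

lemma smooth_scaleR: "smooth_on f S \<Longrightarrow> smooth_on g S \<Longrightarrow> smooth_on (\<lambda>t. (f t :: real) *\<^sub>R g t) S"
  by (simp add: smooth_on_def diff_times_scaleR)

lemma smooth_mult: "smooth_on f S \<Longrightarrow> smooth_on g S \<Longrightarrow> smooth_on (\<lambda>t. (f t :: real) * g t) S"
  using smooth_scaleR[of f S g] by simp

lemma smooth_inverse: "(\<And>t. t \<in> S \<Longrightarrow> f t \<noteq> 0) \<Longrightarrow> smooth_on f S \<Longrightarrow> smooth_on (\<lambda>t. inverse (f t :: real)) S"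
  by (simp add: smooth_on_def diff_times_inverse)

lemma smooth_affine: "smooth_on f UNIV \<Longrightarrow> smooth_on (\<lambda>t. f (a * t + b)) S"
  by (simp add: smooth_on_def diff_times_affine)

lemma smooth_cong: "smooth_on f S \<Longrightarrow> (\<And>t. t \<in> S \<Longrightarrow> f t = g t) \<Longrightarrow> smooth_on g S"
  unfolding smooth_on_def using diff_times_cong by metis

lemma smooth_sum: "finite A \<Longrightarrow> (\<And>a. a \<in> A \<Longrightarrow> smooth_on (f a) S) \<Longrightarrow> smooth_on (\<lambda>t. \<Sum>a\<in>A. f a t) S"
  by (induction rule: finite_induct) (auto intro: smooth_const smooth_add)

text \<open>Derivatives within \<open>{0..1}\<close> are unique, so those supplied order by order
  fit together into one sequence.\<close>

lemma smooth_path_iff: "smooth_path f \<longleftrightarrow> smooth_on f {0..1}"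
proof
  assume "smooth_path f"
  then obtain D :: "nat \<Rightarrow> real \<Rightarrow> 'a" where D: "D 0 = f"
    "\<forall>k. \<forall>t\<in>{0..1}. (D k has_vector_derivative D (Suc k) t) (at t within {0..1})"
    unfolding smooth_path_def by blast
  have "diff_times m (D k) {0..1}" for m k
  proof (induction m arbitrary: k)
    case (Suc m)
    show ?case by (rule diff_times_SucI[where f' = "D (Suc k)"]) (use D(2) Suc in auto)
  qed simp
  from this[of _ 0] show "smooth_on f {0..1}" by (simp add: smooth_on_def D(1))
next
  assume sm: "smooth_on f {0..1}"
  define d where "d = (\<lambda>(g :: real \<Rightarrow> 'a) t. vector_derivative g (at t within {0..1}))"
  have step: "smooth_on (d g) {0..1} \<and> (\<forall>t\<in>{0..1}. (g has_vector_derivative d g t) (at t within {0..1}))"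
    if g: "smooth_on g {0..1}" for g
  proof -
    have eq: "g' t = d g t" if "(g has_vector_derivative g' t) (at t within {0..1})" "t \<in> {0..1}" for g' t
      unfolding d_def using vector_derivative_within_cbox[of 0 1 t g "g' t"] that by simp
    have "diff_times k (d g) {0..1} \<and> (\<forall>t\<in>{0..1}. (g has_vector_derivative d g t) (at t within {0..1}))" for k
    proof -
      have "diff_times (Suc k) g {0..1}" using g by (simp add: smooth_on_def del: diff_times.simps)
      then obtain g' where g': "\<forall>t\<in>{0..1}. (g has_vector_derivative g' t) (at t within {0..1})" "diff_times k g' {0..1}"
        by auto
      then have e: "g' t = d g t" if "t \<in> {0..1}" for t using eq that by blast
      then show ?thesis using diff_times_cong[OF g'(2) e] g'(1) by auto
    qed
    then show ?thesis by (simp add: smooth_on_def)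
  qed
  have "smooth_on ((d ^^ k) f) {0..1}" for k
    by (induction k) (use sm step in auto)
  then show "smooth_path f"
    unfolding smooth_path_def using step by (intro exI[of _ "\<lambda>k. (d ^^ k) f"]) auto
qed

subsection \<open>A smooth step\<close>

text \<open>The powers of \<open>1 / x\<close> make the family closed under differentiation.\<close>

definition flat :: "nat \<Rightarrow> real \<Rightarrow> real" where
  "flat n x = (if x \<le> 0 then 0 else (1 / x) ^ n * exp (- (1 / x)))"

text \<open>The exponential beats every power; on the right of 0 substitute
  \<open>y = 1 / x\<close>.\<close>

lemma flat_tendsto: "(flat n \<longlongrightarrow> 0) (at 0)"
proof -
  have "((\<lambda>y :: real. y ^ n / exp y) \<longlongrightarrow> 0) at_top" by (rule tendsto_power_div_exp_0)
  then have "((\<lambda>x :: real. inverse x ^ n / exp (inverse x)) \<longlongrightarrow> 0) (at_right 0)"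
    by (rule filterlim_compose[OF _ filterlim_inverse_at_top_right])
  then have "(flat n \<longlongrightarrow> 0) (at_right 0)"
    by (rule Lim_transform_eventually)
      (auto simp: flat_def eventually_at_filter exp_minus divide_inverse intro!: always_eventually)
  moreover have "(flat n \<longlongrightarrow> 0) (at_left 0)"
    by (rule Lim_transform_eventually[OF tendsto_const])
      (auto simp: flat_def eventually_at_filter intro!: always_eventually)
  ultimately show ?thesis by (rule filterlim_split_at[rotated])
qed

lemma flat_deriv: "(flat n has_real_derivative (- real n * flat (n + 1) x + flat (n + 2) x)) (at x)"
proof (cases x "0 :: real" rule: linorder_cases)
  case less
  have "((\<lambda>x. 0) has_real_derivative 0) (at x)" by simp
  then have "(flat n has_real_derivative 0) (at x)"
    by (rule has_field_derivative_transform_within_open[of _ _ _ "{..<0}"]) (use less in \<open>auto simp: flat_def\<close>)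
  then show ?thesis using less by (simp add: flat_def)
next
  case equal
  \<comment> \<open>At 0 the difference quotient of \<open>flat n\<close> is
    \<open>flat (Suc n)\<close>.\<close>
  have "(\<lambda>y. (flat n y - flat n 0) / (y - 0)) \<midarrow>0\<rightarrow> 0"
    by (rule Lim_transform_eventually[OF flat_tendsto[of "Suc n"]])
      (auto simp: flat_def eventually_at_filter intro!: always_eventually)
  then show ?thesis using equal by (simp add: has_field_derivative_iff flat_def)
next
  case greater
  have "((\<lambda>x. (1 / x) ^ n * exp (- (1 / x))) has_real_derivative
      (- real n * (1 / x) ^ (n + 1) + (1 / x) ^ (n + 2)) * exp (- (1 / x))) (at x)"
  proof -
    have u: "((\<lambda>x. 1 / x) has_real_derivative - ((1 / x)\<^sup>2)) (at x)"
      using greater by (auto intro!: derivative_eq_intros simp: power2_eq_square)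
    have e: "((\<lambda>x. exp (- (1 / x))) has_real_derivative exp (- (1 / x)) * (- (- ((1 / x)\<^sup>2)))) (at x)"
      by (rule DERIV_chain2[OF DERIV_exp DERIV_minus[OF u]])
    have n: "real n * (- (q\<^sup>2) * q ^ (n - Suc 0)) = - real n * q ^ (n + 1)" for q :: real
      by (cases n) (simp_all add: power2_eq_square algebra_simps)
    have "((\<lambda>x. (1 / x) ^ n * exp (- (1 / x))) has_real_derivative
        (- real n * (1 / x) ^ (n + 1)) * exp (- (1 / x)) + exp (- (1 / x)) * (- (- ((1 / x)\<^sup>2))) * (1 / x) ^ n) (at x)"
      using DERIV_mult[OF DERIV_power[OF u, of n] e] unfolding n .
    moreover have "(- real n * (1 / x) ^ (n + 1)) * exp (- (1 / x)) + exp (- (1 / x)) * (- (- ((1 / x)\<^sup>2))) * (1 / x) ^ n =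
        (- real n * (1 / x) ^ (n + 1) + (1 / x) ^ (n + 2)) * exp (- (1 / x))"
      unfolding power_add by (simp only: algebra_simps minus_minus)
    ultimately show ?thesis by (simp only:)
  qed
  then have "(flat n has_real_derivative
      (- real n * (1 / x) ^ (n + 1) + (1 / x) ^ (n + 2)) * exp (- (1 / x))) (at x)"
    by (rule has_field_derivative_transform_within_open[of _ _ _ "{0<..}"]) (use greater in \<open>auto simp: flat_def\<close>)
  moreover have "(- real n * (1 / x) ^ (n + 1) + (1 / x) ^ (n + 2)) * exp (- (1 / x)) =
      - real n * flat (n + 1) x + flat (n + 2) x"
    using greater by (simp add: flat_def algebra_simps)
  ultimately show ?thesis by simp
qed

lemma smooth_flat: "smooth_on (flat n) UNIV"
proof -
  have "diff_times k (flat n) UNIV" for k n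
  proof (induction k arbitrary: n)
    case (Suc k)
    show ?case
    proof (rule diff_times_SucI[where f' = "\<lambda>x. (- real n) *\<^sub>R flat (n + 1) x + flat (n + 2) x"])
      show "(flat n has_vector_derivative (- real n) *\<^sub>R flat (n + 1) x + flat (n + 2) x) (at x within UNIV)" for x
        using flat_deriv[of n x] by (simp add: has_real_derivative_iff_has_vector_derivative)
    qed (intro diff_times_add diff_times_scaleR diff_times_const Suc)
  qed simp
  then show ?thesis by (simp add: smooth_on_def)
qed

lemma flat_pos: "x > 0 \<Longrightarrow> flat n x > 0"
  by (simp add: flat_def)

lemma flat_nonneg: "flat n x \<ge> 0"
  by (simp add: flat_def)

definition step :: "real \<Rightarrow> real" where
  "step x = flat 0 x * inverse (flat 0 x + flat 0 (1 - x))"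

lemma step_denominator: "flat 0 x + flat 0 (1 - x) > 0"
proof (cases "x > 0")
  case True
  then show ?thesis using flat_pos[of x 0] flat_nonneg[of 0 "1 - x"] by linarith
next
  case False
  then show ?thesis using flat_pos[of "1 - x" 0] flat_nonneg[of 0 x] by linarith
qed

lemma smooth_step: "smooth_on step UNIV"
proof -
  have "smooth_on (\<lambda>x. flat 0 (- 1 * x + 1)) UNIV" by (rule smooth_affine[OF smooth_flat])
  moreover have "- 1 * x + 1 = 1 - x" for x :: real by simp
  ultimately have "smooth_on (\<lambda>x. flat 0 (1 - x)) UNIV" by (simp only:)
  then have "smooth_on (\<lambda>x. flat 0 x + flat 0 (1 - x)) UNIV" by (rule smooth_add[OF smooth_flat])
  then have "smooth_on (\<lambda>x. inverse (flat 0 x + flat 0 (1 - x))) UNIV"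
    by (rule smooth_inverse[rotated]) (use step_denominator in \<open>auto simp: less_le\<close>)
  from smooth_mult[OF smooth_flat this] show ?thesis unfolding step_def[abs_def] .
qed

lemma step_0: "x \<le> 0 \<Longrightarrow> step x = 0"
  by (simp add: step_def flat_def)

lemma step_1: "x \<ge> 1 \<Longrightarrow> step x = 1"
  using step_denominator[of x] by (simp add: step_def flat_def)

lemma step_range: "0 \<le> step x" "step x \<le> 1"
  using step_denominator[of x] flat_nonneg[of 0 x] flat_nonneg[of 0 "1 - x"]
  by (simp_all add: step_def field_simps)

text \<open>A positive derivative keeps the zeros of \<open>walls\<close> simple when a segment is
  traversed with \<open>step\<close> as parameter.\<close>

lemma step_deriv_pos:
  assumes "0 < x" "x < 1"
  shows "\<exists>D>0. (step has_real_derivative D) (at x)"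
proof -
  have e: "(flat 0 has_real_derivative flat 2 x) (at x)" using flat_deriv[of 0 x] by (simp add: numeral_2_eq_2)
  have "(flat 0 has_real_derivative flat 2 (1 - x)) (at (1 - x))" using flat_deriv[of 0 "1 - x"] by (simp add: numeral_2_eq_2)
  then have "((\<lambda>x. flat 0 (1 - x)) has_real_derivative flat 2 (1 - x) * (- 1)) (at x)"
    by (rule DERIV_chain2) (auto intro!: derivative_eq_intros)
  from DERIV_divide[OF e DERIV_add[OF e this]] step_denominator[of x]
  have "(step has_real_derivative (flat 2 x * (flat 0 x + flat 0 (1 - x)) - flat 0 x * (flat 2 x + flat 2 (1 - x) * (- 1))) /
      ((flat 0 x + flat 0 (1 - x)) * (flat 0 x + flat 0 (1 - x)))) (at x)"
    unfolding step_def[abs_def] divide_inverse by simp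
  moreover have "flat 2 x * (flat 0 x + flat 0 (1 - x)) - flat 0 x * (flat 2 x + flat 2 (1 - x) * (- 1)) =
     flat 2 x * flat 0 (1 - x) + flat 0 x * flat 2 (1 - x)" by (simp add: algebra_simps)
  moreover have "flat 2 x * flat 0 (1 - x) + flat 0 x * flat 2 (1 - x) > 0"
    using assms by (intro add_pos_pos mult_pos_pos flat_pos) auto
  ultimately show ?thesis using step_denominator[of x] by (metis divide_pos_pos mult_pos_pos)
qed

section \<open>Smooth polygonal motions\<close>

text \<open>A polygon that comes to rest at every vertex to infinite order, so that corners and
  concatenations are smooth. Writing it as one sum makes smoothness immediate; at any time at most
  one summand is between its end values.\<close>

definition poly_path :: "nat \<Rightarrow> (nat \<Rightarrow> 'a::real_normed_vector) \<Rightarrow> real \<Rightarrow> 'a" where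
  "poly_path N v t = v 0 + (\<Sum>r<N. step (real N * t - real r) *\<^sub>R (v (Suc r) - v r))"

lemma smooth_poly_path: "smooth_on (poly_path N v) S"
proof -
  have "smooth_on (\<lambda>t. step (real N * t - real r) *\<^sub>R (v (Suc r) - v r)) S" for r
    using smooth_affine[OF smooth_step, of "real N" "- real r" S] by (intro smooth_scaleR smooth_const) simp
  then show ?thesis unfolding poly_path_def[abs_def] by (intro smooth_add smooth_const smooth_sum) auto
qed

lemma poly_path_eq:
  assumes "r < N" "real r \<le> real N * t" "real N * t \<le> real r + 1"
  shows "poly_path N v t = v r + step (real N * t - real r) *\<^sub>R (v (Suc r) - v r)"
proof -
  let ?f = "\<lambda>q. step (real N * t - real q) *\<^sub>R (v (Suc q) - v q)"
  have "(\<Sum>q<N. ?f q) = (\<Sum>q\<in>{..<r} \<union> {r}. ?f q)"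
  proof (rule sum.mono_neutral_right)
    show "\<forall>q\<in>{..<N} - ({..<r} \<union> {r}). ?f q = 0"
    proof
      fix q assume "q \<in> {..<N} - ({..<r} \<union> {r})"
      then have "r + 1 \<le> q" by auto
      then have "real r + 1 \<le> real q" by linarith
      then show "?f q = 0" using assms(3) by (simp add: step_0)
    qed
  qed (use assms in auto)
  also have "\<dots> = (\<Sum>q<r. ?f q) + ?f r" by (subst sum.union_disjoint) auto
  also have "(\<Sum>q<r. ?f q) = (\<Sum>q<r. v (Suc q) - v q)"
  proof (rule sum.cong[OF HOL.refl])
    fix q assume "q \<in> {..<r}"
    then have "q + 1 \<le> r" by auto
    then have "real q + 1 \<le> real r" by linarith
    then show "?f q = v (Suc q) - v q" using assms(2) by (simp add: step_1)
  qed
  also have "\<dots> = v r - v 0" by (rule sum_lessThan_telescope)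
  finally show ?thesis by (simp add: poly_path_def)
qed

lemma grid_index:
  assumes "0 < N" "t \<in> {0..1}"
  obtains r where "r < N" "real r \<le> real N * t" "real N * t \<le> real r + 1"
proof (cases "t = 1")
  case True
  show ?thesis by (rule that[of "N - 1"]) (use assms True in \<open>auto simp: of_nat_diff\<close>)
next
  case False
  then have t: "0 \<le> t" "t < 1" using assms by auto
  define r where "r = nat \<lfloor>real N * t\<rfloor>"
  have nn: "0 \<le> real N * t" using t by simp
  have lt: "real N * t < real N" using t assms by simp
  have le: "real r \<le> real N * t" unfolding r_def using nn by linarith
  have "real N * t \<le> real r + 1" unfolding r_def using nn by linarith
  moreover have "r < N" using le lt by linarith
  ultimately show ?thesis using le that by blast
qed

lemma poly_path_convex:
  assumes "0 < N" "t \<in> {0..1}" "convex C"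
    and v: "\<And>r. r < N \<Longrightarrow> real r \<le> real N * t \<Longrightarrow> real N * t \<le> real r + 1 \<Longrightarrow> v r \<in> C \<and> v (Suc r) \<in> C"
  shows "poly_path N v t \<in> C"
proof -
  obtain r where r: "r < N" "real r \<le> real N * t" "real N * t \<le> real r + 1" using grid_index assms(1,2) by blast
  have "v r + step (real N * t - real r) *\<^sub>R (v (Suc r) - v r) \<in> C"
    using convexD_alt[OF assms(3) conjunct1[OF v[OF r]] conjunct2[OF v[OF r]] step_range]
    by (simp add: algebra_simps)
  then show ?thesis by (simp add: poly_path_eq[OF r])
qed

lemma poly_path_0: "poly_path N v 0 = v 0"
  unfolding poly_path_def by (simp add: step_0)

lemma poly_path_1: "poly_path N v 1 = v N"
proof (cases N)
  case (Suc m)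
  then show ?thesis using poly_path_eq[of m N 1 v] by (simp add: step_1)
qed (simp add: poly_path_def)

text \<open>Equal numbers of edges in both halves make the parameter of the concatenation uniform
  again.\<close>

lemma poly_path_join:
  assumes "0 < N" "v N = w 0" "t \<in> {0..1}"
  shows "(poly_path N v +++ poly_path N w) t = poly_path (2 * N) (\<lambda>r. if r \<le> N then v r else w (r - N)) t"
proof (cases "t \<le> 1 / 2")
  case True
  then have "2 * t \<in> {0..1}" using assms by auto
  then obtain r where r: "r < N" "real r \<le> real N * (2 * t)" "real N * (2 * t) \<le> real r + 1" using grid_index assms(1) by blast
  have "poly_path (2 * N) (\<lambda>r. if r \<le> N then v r else w (r - N)) t = poly_path N v (2 * t)"
    using r by (subst poly_path_eq[of r "2 * N" t], simp, simp, simp, subst poly_path_eq[OF r]) (simp add: algebra_simps)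
  then show ?thesis using True by (simp add: joinpaths_def)
next
  case False
  then have "2 * t - 1 \<in> {0..1}" using assms by auto
  then obtain r where r: "r < N" "real r \<le> real N * (2 * t - 1)" "real N * (2 * t - 1) \<le> real r + 1" using grid_index assms(1) by blast
  have e: "real (2 * N) * t = real N * (2 * t - 1) + real N" by (simp add: algebra_simps)
  have "(if N + r \<le> N then v (N + r) else w (N + r - N)) = w r" using assms(2) by auto
  moreover have "(if Suc (N + r) \<le> N then v (Suc (N + r)) else w (Suc (N + r) - N)) = w (Suc r)"
    by (simp add: Suc_diff_le)
  moreover have "real (2 * N) * t - real (N + r) = real N * (2 * t - 1) - real r" unfolding e by simp
  moreover have "poly_path (2 * N) (\<lambda>r. if r \<le> N then v r else w (r - N)) t =
      (if N + r \<le> N then v (N + r) else w (N + r - N)) + step (real (2 * N) * t - real (N + r)) *\<^sub>R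
      ((if Suc (N + r) \<le> N then v (Suc (N + r)) else w (Suc (N + r) - N)) - (if N + r \<le> N then v (N + r) else w (N + r - N)))"
    by (rule poly_path_eq) (use r e in auto)
  ultimately have "poly_path (2 * N) (\<lambda>r. if r \<le> N then v r else w (r - N)) t = poly_path N w (2 * t - 1)"
    unfolding poly_path_eq[OF r] by (simp only:)
  then show ?thesis using False by (simp add: joinpaths_def)
qed

section \<open>Isotopy and homotopy\<close>

lemma smooth_path_cong: "(\<And>t. t \<in> {0..1} \<Longrightarrow> f t = g t) \<Longrightarrow> smooth_path f \<longleftrightarrow> smooth_path g"
  unfolding smooth_path_iff using smooth_cong[of f "{0..1}" g] smooth_cong[of g "{0..1}" f] by auto

lemma motion_cong: "(\<And>t. t \<in> {0..1} \<Longrightarrow> f t = g t) \<Longrightarrow> motion b f \<longleftrightarrow> motion b g"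
  unfolding motion_def using smooth_path_cong[of f g] by (auto simp: image_subset_iff)

lemma smooth_on_continuous:
  assumes "smooth_on f S"
  shows "continuous_on S f"
proof -
  have "diff_times (Suc 0) f S" using assms unfolding smooth_on_def by blast
  then obtain f' where "\<forall>t\<in>S. (f has_vector_derivative f' t) (at t within S)" by auto
  then show ?thesis by (meson continuous_on_eq_continuous_within has_vector_derivative_continuous)
qed

lemma smooth_path_continuous: "smooth_path f \<Longrightarrow> continuous_on {0..1} f"
  unfolding smooth_path_iff by (rule smooth_on_continuous)

lemma motion_path:
  assumes "motion b \<beta>"
  shows "path \<beta>" "path_image \<beta> \<subseteq> config_space" "pathstart \<beta> = b" "pathfinish \<beta> = b"
  using assms smooth_path_continuous by (auto simp: motion_def path_def path_image_def pathstart_def pathfinish_def)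

lemma isotopicI:
  fixes h :: "real \<times> real \<Rightarrow> complex ^ 'n"
  assumes "continuous_on ({0..1} \<times> {0..1}) h"
    and "\<And>s. s \<in> {0..1} \<Longrightarrow> motion b (\<lambda>t. h (s, t))"
    and "\<And>t. t \<in> {0..1} \<Longrightarrow> h (0, t) = \<beta> t" "\<And>t. t \<in> {0..1} \<Longrightarrow> h (1, t) = \<gamma> t"
  shows "isotopic b \<beta> \<gamma>"
proof -
  have im: "h \<in> {0..1} \<times> {0..1} \<rightarrow> config_space"
    using assms(2) unfolding motion_def by (auto simp: image_subset_iff)
  show ?thesis
    unfolding isotopic_def
  proof (subst homotopic_with)
    show "motion b f \<longleftrightarrow> motion b g" if eq: "\<And>x. x \<in> topspace (top_of_set {0..1}) \<Longrightarrow> f x = g x" for f g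
      by (rule motion_cong) (use eq in simp)
  next
    have cont: "continuous_map (prod_topology (top_of_set {0..1}) (top_of_set {0..1})) (top_of_set config_space) h"
      using assms(1) im by (simp add: continuous_map_iff_continuous2 image_subset_iff_funcset
        flip: subtopology_Times euclidean_product_topology)
    show "\<exists>h :: real \<times> real \<Rightarrow> _. continuous_map (prod_topology (top_of_set {0..1}) (top_of_set {0..1})) (top_of_set config_space) h \<and>
       (\<forall>x\<in>topspace (top_of_set {0..1}). h (0, x) = \<beta> x) \<and>
       (\<forall>x\<in>topspace (top_of_set {0..1}). h (1, x) = \<gamma> x) \<and>
       (\<forall>t\<in>{0..1}. motion b (\<lambda>x. h (t, x)))"
      by (intro exI[of _ h] conjI) (use cont assms(2-4) in simp_all)
  qed
qed

lemma isotopic_motion: "isotopic b \<beta> \<gamma> \<Longrightarrow> motion b \<beta>" "isotopic b \<beta> \<gamma> \<Longrightarrow> motion b \<gamma>"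
  using homotopic_with_imp_property unfolding isotopic_def by blast+

lemma isotopic_homotopic_paths:
  assumes "isotopic b \<beta> \<gamma>"
  shows "homotopic_paths config_space \<beta> \<gamma>"
  unfolding homotopic_paths_def
proof (rule homotopic_with_mono[OF assms[unfolded isotopic_def]])
  show "pathstart f = pathstart \<beta> \<and> pathfinish f = pathfinish \<beta>" if f: "motion b f" for f
    using motion_path(3,4)[OF f] motion_path(3,4)[OF isotopic_motion(1)[OF assms]] by simp
qed

lemma isotopic_refl: "motion b \<beta> \<Longrightarrow> isotopic b \<beta> \<beta>"
  unfolding isotopic_def
  by (subst homotopic_with_refl) (auto simp: motion_def smooth_path_continuous)

lemma isotopic_sym: "isotopic b \<beta> \<gamma> \<Longrightarrow> isotopic b \<gamma> \<beta>"
  unfolding isotopic_def by (rule homotopic_with_symD)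

lemma isotopic_trans: "isotopic b \<alpha> \<beta> \<Longrightarrow> isotopic b \<beta> \<gamma> \<Longrightarrow> isotopic b \<alpha> \<gamma>"
  unfolding isotopic_def by (rule homotopic_with_trans)

lemma isotopic_linear:
  assumes "motion b \<beta>" "motion b \<gamma>" and seg: "\<And>t. t \<in> {0..1} \<Longrightarrow> closed_segment (\<beta> t) (\<gamma> t) \<subseteq> config_space"
  shows "isotopic b \<beta> \<gamma>"
proof -
  have sm: "smooth_path \<beta>" "smooth_path \<gamma>" using assms(1,2) by (simp_all add: motion_def)
  note c = smooth_path_continuous[OF sm(1)] smooth_path_continuous[OF sm(2)]
  show ?thesis
  proof (rule isotopicI[where h = "\<lambda>(s, t). (1 - s) *\<^sub>R \<beta> t + s *\<^sub>R \<gamma> t"])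
  show "continuous_on ({0..1} \<times> {0..1}) (\<lambda>(s, t). (1 - s) *\<^sub>R \<beta> t + s *\<^sub>R \<gamma> t)"
    unfolding case_prod_beta
    by (intro continuous_intros continuous_on_compose2[OF c(1)] continuous_on_compose2[OF c(2)]) auto
next
  fix s :: real assume s: "s \<in> {0..1}"
  have "smooth_path (\<lambda>t. (1 - s) *\<^sub>R \<beta> t + s *\<^sub>R \<gamma> t)"
    using sm unfolding smooth_path_iff by (intro smooth_add smooth_scaleR smooth_const) auto
  moreover have "(1 - s) *\<^sub>R \<beta> t + s *\<^sub>R \<gamma> t \<in> config_space" if "t \<in> {0..1}" for t
    using seg[OF that] s unfolding closed_segment_def by auto
  ultimately have "motion b (\<lambda>t. (1 - s) *\<^sub>R \<beta> t + s *\<^sub>R \<gamma> t)"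
    using assms(1,2) unfolding motion_def by (auto simp: algebra_simps)
  then show "motion b (\<lambda>t. case (s, t) of (s, t) \<Rightarrow> (1 - s) *\<^sub>R \<beta> t + s *\<^sub>R \<gamma> t)" by simp
  qed auto
qed

lemma motion_poly_path:
  assumes "v 0 = b" "v N = b" "\<And>t. t \<in> {0..1} \<Longrightarrow> poly_path N v t \<in> config_space"
  shows "motion b (poly_path N v)"
  using assms smooth_poly_path[of N v] unfolding motion_def smooth_path_iff by (auto simp: poly_path_0 poly_path_1)

lemma ball_config_uniform:
  assumes "compact K" "K \<subseteq> config_space"
  obtains d where "d > 0" "\<And>x. x \<in> K \<Longrightarrow> ball x d \<subseteq> config_space"
proof -
  obtain d where d: "d > 0" "(\<Union>x\<in>K. ball x d) \<subseteq> config_space"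
    using compact_subset_open_imp_ball_epsilon_subset[OF assms(1) open_config_space assms(2)] by blast
  show ?thesis by (rule that[OF d(1)]) (use d(2) in blast)
qed

text \<open>At time \<open>t\<close> only the two ends of the current edge matter, and both belong
  to times within \<open>1 / N\<close> of \<open>t\<close>.\<close>

lemma poly_path_near:
  assumes "0 < N" "t \<in> {0..1}" and near: "\<And>t'. t' \<in> {0..1} \<Longrightarrow> \<bar>t' - t\<bar> \<le> 1 / real N \<Longrightarrow> f t' \<in> C" and "convex C"
  shows "poly_path N (\<lambda>k. f (real k / real N)) t \<in> C"
proof (rule poly_path_convex[OF assms(1,2,4)])
  fix r assume r: "r < N" "real r \<le> real N * t" "real N * t \<le> real r + 1"
  have N: "real N > 0" using assms(1) by simp
  have "real r / real N \<le> t" "t \<le> (real r + 1) / real N" using r N by (auto simp: field_simps)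
  moreover have "(real r + 1) / real N = real r / real N + 1 / real N" by (simp add: add_divide_distrib)
  ultimately have "\<bar>real r / real N - t\<bar> \<le> 1 / real N" "\<bar>real (Suc r) / real N - t\<bar> \<le> 1 / real N"
    by (auto simp: abs_le_iff add_divide_distrib)
  moreover have "real r / real N \<in> {0..1}" "real (Suc r) / real N \<in> {0..1}" using r N by (auto simp: field_simps)
  ultimately show "f (real r / real N) \<in> C \<and> f (real (Suc r) / real N) \<in> C" using near by blast
qed

text \<open>Uniform continuity. The bound holds for all finer grids as well, so that two motions can
  later share one.\<close>

lemma ex_grid:
  fixes F :: "'a::metric_space \<Rightarrow> real \<Rightarrow> 'b::metric_space"
  assumes "compact S" "continuous_on (S \<times> {0..1}) (\<lambda>(s, t). F s t)" "d > 0"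
  obtains N0 where "N0 > 0" "\<And>N s t t'. N0 \<le> N \<Longrightarrow> s \<in> S \<Longrightarrow> t \<in> {0..1} \<Longrightarrow> t' \<in> {0..1} \<Longrightarrow> \<bar>t' - t\<bar> \<le> 1 / real N \<Longrightarrow>
    dist (F s t) (F s t') < d"
proof -
  have "uniformly_continuous_on (S \<times> {0..1}) (\<lambda>(s, t). F s t)"
    using assms by (intro compact_uniformly_continuous compact_Times) auto
  then obtain e where e: "e > 0" "\<And>x x'. x \<in> S \<times> {0..1} \<Longrightarrow> x' \<in> S \<times> {0..1} \<Longrightarrow> dist x' x < e \<Longrightarrow>
      dist (case x' of (s, t) \<Rightarrow> F s t) (case x of (s, t) \<Rightarrow> F s t) < d"
    unfolding uniformly_continuous_on_def using assms(3) by metis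
  obtain N0 where N0: "N0 \<noteq> 0" "inverse (real N0) < e" using real_arch_inverse e(1) by blast
  show ?thesis
  proof (rule that)
    show "N0 > 0" using N0(1) by simp
    fix N s t t' assume h: "N0 \<le> N" "s \<in> S" "t \<in> {0..1}" "t' \<in> {0..1}" "\<bar>t' - t\<bar> \<le> 1 / real N"
    have "1 / real N \<le> 1 / real N0" using h(1) N0(1) by (intro divide_left_mono) auto
    then have "dist t t' < e" using h(5) N0(2) by (simp add: dist_real_def inverse_eq_divide abs_minus_commute)
    then have "dist (s, t) (s, t') < e" by (simp add: dist_Pair_Pair)
    then show "dist (F s t) (F s t') < d" using e(2)[of "(s, t')" "(s, t)"] h by simp
  qed
qed

text \<open>Every stage of the homotopy is replaced by the polygon through its points at the same
  \<open>N + 1\<close> times. The vertices depend continuously on \<open>s\<close>, so these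
  polygons form an isotopy, and linear isotopies connect its ends to \<beta> and \<gamma>.\<close>

lemma smooth_homotopy:
  fixes h :: "real \<times> real \<Rightarrow> complex ^ 'n"
  assumes h: "continuous_on ({0..1} \<times> {0..1}) h" "h ` ({0..1} \<times> {0..1}) \<subseteq> config_space"
    and ends: "\<And>s. s \<in> {0..1} \<Longrightarrow> h (s, 0) = b" "\<And>s. s \<in> {0..1} \<Longrightarrow> h (s, 1) = b"
    and \<beta>: "motion b \<beta>" "\<And>t. t \<in> {0..1} \<Longrightarrow> h (0, t) = \<beta> t"
    and \<gamma>: "motion b \<gamma>" "\<And>t. t \<in> {0..1} \<Longrightarrow> h (1, t) = \<gamma> t"
  shows "isotopic b \<beta> \<gamma>"
proof -
  have "compact (h ` ({0..1} \<times> {0..1}))" by (intro compact_continuous_image h compact_Times) auto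
  then obtain d where d: "d > 0" "\<And>x. x \<in> h ` ({0..1} \<times> {0..1}) \<Longrightarrow> ball x d \<subseteq> config_space"
    using ball_config_uniform h(2) by metis
  have hc: "continuous_on ({0..1} \<times> {0..1}) (\<lambda>(s, t). h (s, t))" using h(1) by (simp add: case_prod_beta')
  obtain N where N: "N > 0" "\<And>s t t'. s \<in> {0..1} \<Longrightarrow> t \<in> {0..1} \<Longrightarrow> t' \<in> {0..1} \<Longrightarrow> \<bar>t' - t\<bar> \<le> 1 / real N \<Longrightarrow>
    dist (h (s, t)) (h (s, t')) < d"
  proof -
    obtain N0 where "N0 > 0" "\<And>N s t t'. N0 \<le> N \<Longrightarrow> s \<in> {0..1} \<Longrightarrow> t \<in> {0..1} \<Longrightarrow> t' \<in> {0..1} \<Longrightarrow> \<bar>t' - t\<bar> \<le> 1 / real N \<Longrightarrow>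
      dist (h (s, t)) (h (s, t')) < d"
      using ex_grid[OF _ hc d(1)] compact_Icc by blast
    then show ?thesis using that[of N0] by blast
  qed
  define K where "K = (\<lambda>s. poly_path N (\<lambda>k. h (s, real k / real N)))"
  have near: "K s t \<in> ball (h (s, t)) d" if "s \<in> {0..1}" "t \<in> {0..1}" for s t
    unfolding K_def by (rule poly_path_near[OF N(1) that(2)]) (use N(2)[OF that] in auto)
  have mem: "h (s, t) \<in> h ` ({0..1} \<times> {0..1})" if "s \<in> {0..1}" "t \<in> {0..1}" for s t using that by blast
  have Kc: "K s t \<in> config_space" if "s \<in> {0..1}" "t \<in> {0..1}" for s t
    using near[OF that] d(2)[OF mem[OF that]] by blast
  have mot: "motion b (K s)" if s: "s \<in> {0..1}" for s
    unfolding K_def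
  proof (rule motion_poly_path)
    show "h (s, real 0 / real N) = b" using ends(1)[OF s] by simp
    show "h (s, real N / real N) = b" using ends(2)[OF s] N(1) by simp
  qed (rule Kc[OF s, unfolded K_def])
  have lin: "isotopic b \<alpha> (K s)" if s: "s \<in> {0..1}" and \<alpha>: "motion b \<alpha>" "\<And>t. t \<in> {0..1} \<Longrightarrow> h (s, t) = \<alpha> t" for s \<alpha>
  proof (rule isotopic_linear[OF \<alpha>(1) mot[OF s]])
    fix t :: real assume t: "t \<in> {0..1}"
    have "closed_segment (h (s, t)) (K s t) \<subseteq> ball (h (s, t)) d"
      using near[OF s t] d(1) by (intro closed_segment_subset) auto
    then show "closed_segment (\<alpha> t) (K s t) \<subseteq> config_space" using d(2)[OF mem[OF s t]] \<alpha>(2)[OF t] by auto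
  qed
  have "isotopic b (K 0) (K 1)"
  proof (rule isotopicI[where h = "\<lambda>(s, t). K s t"])
    note st = smooth_on_continuous[OF smooth_step]
    have v: "continuous_on ({0..1} \<times> {0..1}) (\<lambda>x :: real \<times> real. h (fst x, real k / real N))" if "k \<le> N" for k
      by (rule continuous_on_compose2[OF h(1)]) (use that N(1) in \<open>auto intro!: continuous_intros\<close>)
    show "continuous_on ({0..1} \<times> {0..1}) (\<lambda>(s, t). K s t)"
      unfolding K_def poly_path_def case_prod_beta
      by (intro continuous_intros v continuous_on_compose2[OF st]) auto
    show "motion b (\<lambda>t. case (s, t) of (s, t) \<Rightarrow> K s t)" if "s \<in> {0..1}" for s using mot[OF that] by simp
  qed simp_all
  moreover have "isotopic b \<beta> (K 0)" by (rule lin[OF _ \<beta>]) simp_all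
  moreover have "isotopic b \<gamma> (K 1)" by (rule lin[OF _ \<gamma>]) simp_all
  ultimately show ?thesis by (meson isotopic_sym isotopic_trans)
qed

text \<open>Reduces isotopy to homotopy of paths in \<open>config_space\<close>, from which the
  unit, inverses and associativity of the braid group are taken.\<close>

lemma isotopic_iff:
  fixes \<beta> :: "real \<Rightarrow> complex ^ 'n"
  shows "isotopic b \<beta> \<gamma> \<longleftrightarrow> motion b \<beta> \<and> motion b \<gamma> \<and> homotopic_paths config_space \<beta> \<gamma>"
proof
  assume "motion b \<beta> \<and> motion b \<gamma> \<and> homotopic_paths config_space \<beta> \<gamma>"
  then have m: "motion b \<beta>" "motion b \<gamma>" and hp: "homotopic_paths config_space \<beta> \<gamma>" by auto
  from hp[unfolded homotopic_paths] obtain h :: "real \<times> real \<Rightarrow> complex ^ 'n" where "continuous_on ({0..1} \<times> {0..1}) h \<and> h \<in> {0..1} \<times> {0..1} \<rightarrow> config_space \<and>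
    (\<forall>x\<in>{0..1}. h (0, x) = \<beta> x) \<and> (\<forall>x\<in>{0..1}. h (1, x) = \<gamma> x) \<and>
    (\<forall>t\<in>{0..1}. pathstart (h \<circ> Pair t) = pathstart \<beta> \<and> pathfinish (h \<circ> Pair t) = pathfinish \<beta>)" ..
  then have h: "continuous_on ({0..1} \<times> {0..1}) h" "h \<in> {0..1} \<times> {0..1} \<rightarrow> config_space"
    "\<forall>x\<in>{0..1}. h (0, x) = \<beta> x" "\<forall>x\<in>{0..1}. h (1, x) = \<gamma> x"
    "\<forall>t\<in>{0..1}. pathstart (h \<circ> Pair t) = pathstart \<beta> \<and> pathfinish (h \<circ> Pair t) = pathfinish \<beta>"
    by blast+
  show "isotopic b \<beta> \<gamma>"
    by (rule smooth_homotopy[OF h(1) h(2)[folded image_subset_iff_funcset] _ _ m(1) _ m(2)])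
      (use h(3-5) motion_path[OF m(1)] in \<open>auto simp: pathstart_def pathfinish_def\<close>)
qed (use isotopic_motion isotopic_homotopic_paths in blast)

lemma ex_poly_path:
  assumes "motion b \<beta>"
  obtains N0 where "N0 > 0" "\<forall>N\<ge>N0. isotopic b \<beta> (poly_path N (\<lambda>k. \<beta> (real k / real N)))"
proof -
  note m = motion_path[OF assms]
  have c: "continuous_on {0..1} \<beta>" using m(1) by (simp add: path_def)
  have "compact (\<beta> ` {0..1})" by (intro compact_continuous_image c) auto
  moreover have im: "\<beta> ` {0..1} \<subseteq> config_space" using assms by (simp add: motion_def)
  ultimately obtain d where d: "d > 0" "\<And>x. x \<in> \<beta> ` {0..1} \<Longrightarrow> ball x d \<subseteq> config_space"
    using ball_config_uniform by metis
  have "continuous_on ({0 :: real} \<times> {0..1}) (\<lambda>(s, t). \<beta> t)"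
    unfolding case_prod_beta by (rule continuous_on_compose2[OF c]) (auto intro!: continuous_intros)
  from ex_grid[OF _ this d(1)] obtain N0 where N0: "N0 > 0"
    "\<And>N s t t'. N0 \<le> N \<Longrightarrow> s \<in> {0 :: real} \<Longrightarrow> t \<in> {0..1} \<Longrightarrow> t' \<in> {0..1} \<Longrightarrow> \<bar>t' - t\<bar> \<le> 1 / real N \<Longrightarrow> dist (\<beta> t) (\<beta> t') < d"
    using compact_sing by blast
  show ?thesis
  proof (rule that[OF N0(1)], intro allI impI)
    fix N assume N: "N0 \<le> N"
    let ?p = "poly_path N (\<lambda>k. \<beta> (real k / real N))"
    have near: "?p t \<in> ball (\<beta> t) d" if "t \<in> {0..1}" for t
      by (rule poly_path_near[OF _ that]) (use N N0 that in auto)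
    have ball: "ball (\<beta> t) d \<subseteq> config_space" if "t \<in> {0..1}" for t using d(2) that by blast
    have pc: "?p t \<in> config_space" if "t \<in> {0..1}" for t using near[OF that] ball[OF that] by blast
    have mot: "motion b ?p"
      by (rule motion_poly_path) (use N N0(1) m(3,4) pc in \<open>auto simp: pathstart_def pathfinish_def\<close>)
    show "isotopic b \<beta> ?p"
    proof (rule isotopic_linear[OF assms mot])
      fix t :: real assume t: "t \<in> {0..1}"
      have "closed_segment (\<beta> t) (?p t) \<subseteq> ball (\<beta> t) d" using near[OF t] d(1) by (intro closed_segment_subset) auto
      then show "closed_segment (\<beta> t) (?p t) \<subseteq> config_space" using ball[OF t] by blast
    qed
  qed
qed

section \<open>The pure braid group\<close>

definition braid :: "complex ^ 'n \<Rightarrow> (real \<Rightarrow> complex ^ 'n) \<Rightarrow> (real \<Rightarrow> complex ^ 'n) set" where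
  "braid b \<beta> = {\<gamma>. isotopic b \<beta> \<gamma>}"

lemma carrier_PB: "carrier (PB b) = braid b ` {\<beta>. motion b \<beta>}"
  unfolding PB_def quotient_def Image_def braid_def by auto

lemma braid_eq: "isotopic b \<beta> \<gamma> \<Longrightarrow> braid b \<beta> = braid b \<gamma>"
  unfolding braid_def using isotopic_sym isotopic_trans by blast

lemma motion_join_poly_path:
  assumes "motion b (poly_path N v)" "motion b (poly_path N w)" "0 < N"
  shows "motion b (poly_path N v +++ poly_path N w)"
proof -
  have vw: "v 0 = b" "v N = b" "w 0 = b" "w N = b"
    using motion_path(3,4)[OF assms(1)] motion_path(3,4)[OF assms(2)]
    by (simp_all add: poly_path_0 poly_path_1 pathstart_def pathfinish_def)
  have e: "(poly_path N v +++ poly_path N w) t = poly_path (2 * N) (\<lambda>r. if r \<le> N then v r else w (r - N)) t"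
    if "t \<in> {0..1}" for t
    by (rule poly_path_join[OF assms(3) _ that]) (simp add: vw)
  have im: "path_image (poly_path N v +++ poly_path N w) \<subseteq> config_space"
    by (rule subset_path_image_join[OF motion_path(2)[OF assms(1)] motion_path(2)[OF assms(2)]])
  have "motion b (poly_path (2 * N) (\<lambda>r. if r \<le> N then v r else w (r - N)))"
    by (rule motion_poly_path) (use vw assms(3) e im in \<open>auto simp: path_image_def image_subset_iff\<close>)
  then show ?thesis using motion_cong[OF e] by simp
qed

text \<open>The product in \<open>PB\<close> ranges over members that fit together smoothly;
  polygons with a common number of edges show that there are some.\<close>

lemma ex_joinable:
  assumes "motion b \<beta>" "motion b \<gamma>"
  obtains \<beta>' \<gamma>' where "isotopic b \<beta> \<beta>'" "isotopic b \<gamma> \<gamma>'" "motion b (\<beta>' +++ \<gamma>')"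
proof -
  obtain N1 where N1: "N1 > 0" "\<forall>N\<ge>N1. isotopic b \<beta> (poly_path N (\<lambda>k. \<beta> (real k / real N)))"
    using ex_poly_path[OF assms(1)] .
  obtain N2 where N2: "N2 > 0" "\<forall>N\<ge>N2. isotopic b \<gamma> (poly_path N (\<lambda>k. \<gamma> (real k / real N)))"
    using ex_poly_path[OF assms(2)] .
  have i: "isotopic b \<beta> (poly_path (max N1 N2) (\<lambda>k. \<beta> (real k / real (max N1 N2))))"
    "isotopic b \<gamma> (poly_path (max N1 N2) (\<lambda>k. \<gamma> (real k / real (max N1 N2))))"
    using N1(2) N2(2) by simp_all
  show ?thesis
    by (rule that[OF i motion_join_poly_path[OF isotopic_motion(2)[OF i(1)] isotopic_motion(2)[OF i(2)]]])
      (use N1(1) in simp)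
qed

text \<open>The concatenation of the given motions may have a corner. Its homotopy class is enough,
  because every admissible pair of representatives has a concatenation in that class.\<close>

lemma braid_mult:
  assumes m: "motion b \<beta>" "motion b \<gamma>" "motion b \<delta>" and h: "homotopic_paths config_space (\<beta> +++ \<gamma>) \<delta>"
  shows "braid b \<beta> \<otimes>\<^bsub>PB b\<^esub> braid b \<gamma> = braid b \<delta>"
proof -
  have join: "homotopic_paths config_space (\<beta>' +++ \<gamma>') \<delta>" if "isotopic b \<beta> \<beta>'" "isotopic b \<gamma> \<gamma>'" for \<beta>' \<gamma>'
  proof -
    have "homotopic_paths config_space (\<beta>' +++ \<gamma>') (\<beta> +++ \<gamma>)"
      by (rule homotopic_paths_join)
        (use that motion_path isotopic_motion isotopic_sym isotopic_homotopic_paths in metis)+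
    then show ?thesis using h homotopic_paths_trans by blast
  qed
  obtain \<beta>' \<gamma>' where j: "isotopic b \<beta> \<beta>'" "isotopic b \<gamma> \<gamma>'" "motion b (\<beta>' +++ \<gamma>')" using ex_joinable m by metis
  have "isotopic b (\<beta>'' +++ \<gamma>'') \<epsilon> \<longleftrightarrow> isotopic b \<delta> \<epsilon>"
    if "isotopic b \<beta> \<beta>''" "isotopic b \<gamma> \<gamma>''" "motion b (\<beta>'' +++ \<gamma>'')" for \<beta>'' \<gamma>'' \<epsilon>
  proof -
    have "isotopic b (\<beta>'' +++ \<gamma>'') \<delta>" unfolding isotopic_iff using join[OF that(1,2)] that(3) m(3) by blast
    then show ?thesis using isotopic_sym isotopic_trans by blast
  qed
  then have eq: "(\<exists>\<alpha>\<in>braid b \<beta>. \<exists>\<alpha>'\<in>braid b \<gamma>. motion b (\<alpha> +++ \<alpha>') \<and> isotopic b (\<alpha> +++ \<alpha>') \<epsilon>) \<longleftrightarrow> isotopic b \<delta> \<epsilon>" for \<epsilon>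
    unfolding braid_def using j by blast
  have "braid b \<beta> \<otimes>\<^bsub>PB b\<^esub> braid b \<gamma> =
      {\<epsilon>. \<exists>\<alpha>\<in>braid b \<beta>. \<exists>\<alpha>'\<in>braid b \<gamma>. motion b (\<alpha> +++ \<alpha>') \<and> isotopic b (\<alpha> +++ \<alpha>') \<epsilon>}"
    by (simp add: PB_def)
  then show ?thesis unfolding eq by (simp add: braid_def)
qed

lemma ex_braid_mult:
  assumes "motion b \<beta>" "motion b \<gamma>"
  obtains \<delta> where "motion b \<delta>" "homotopic_paths config_space (\<beta> +++ \<gamma>) \<delta>" "braid b \<beta> \<otimes>\<^bsub>PB b\<^esub> braid b \<gamma> = braid b \<delta>"
proof -
  obtain \<beta>' \<gamma>' where j: "isotopic b \<beta> \<beta>'" "isotopic b \<gamma> \<gamma>'" "motion b (\<beta>' +++ \<gamma>')" using ex_joinable assms by metis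
  have "homotopic_paths config_space (\<beta> +++ \<gamma>) (\<beta>' +++ \<gamma>')"
    by (rule homotopic_paths_join) (use j assms motion_path isotopic_homotopic_paths in metis)+
  then show thesis using that[OF j(3)] braid_mult[OF assms j(3)] by blast
qed

lemma motion_const: "b \<in> config_space \<Longrightarrow> motion b (\<lambda>_. b)"
  unfolding motion_def smooth_path_iff by (auto simp: smooth_const)

text \<open>The reverse is taken of a polygon, because \<open>smooth_affine\<close> asks for
  smoothness on the whole line, whereas a motion is known to be smooth on \<open>{0..1}\<close>
  only.\<close>

lemma ex_reverse_motion:
  assumes "motion b \<beta>"
  obtains \<gamma> where "motion b \<gamma>" "homotopic_paths config_space (\<gamma> +++ \<beta>) (\<lambda>_. b)"
proof -
  obtain N where i: "isotopic b \<beta> (poly_path N (\<lambda>k. \<beta> (real k / real N)))"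
    using ex_poly_path[OF assms] by blast
  let ?p = "poly_path N (\<lambda>k. \<beta> (real k / real N))"
  note m = motion_path[OF isotopic_motion(2)[OF i]]
  have "smooth_on (\<lambda>t. ?p (- 1 * t + 1)) {0..1}" by (rule smooth_affine[OF smooth_poly_path])
  moreover have "- 1 * t + 1 = 1 - t" for t :: real by simp
  ultimately have "smooth_path (reversepath ?p)" unfolding smooth_path_iff reversepath_def by (simp only:)
  moreover have "reversepath ?p ` {0..1} \<subseteq> config_space"
    using m(2) path_image_reversepath[of ?p] unfolding path_image_def by simp
  ultimately have mot: "motion b (reversepath ?p)"
    using m(3,4) unfolding motion_def by (auto simp: reversepath_def pathstart_def pathfinish_def)
  have "homotopic_paths config_space (reversepath ?p +++ \<beta>) (reversepath ?p +++ ?p)"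
  proof (rule homotopic_paths_join)
    show "homotopic_paths config_space (reversepath ?p) (reversepath ?p)" by (simp add: m)
    show "homotopic_paths config_space \<beta> ?p" by (rule isotopic_homotopic_paths[OF i])
  qed (simp add: m motion_path[OF assms])
  also have "homotopic_paths config_space (reversepath ?p +++ ?p) (linepath b b)"
    using homotopic_paths_linv[OF m(1,2)] m(4) by simp
  also have "linepath b b = (\<lambda>_. b)" by (auto simp: linepath_def algebra_simps simp flip: scaleR_add_left)
  finally show ?thesis using that mot by blast
qed

lemma group_PB:
  assumes "b \<in> config_space"
  shows "group (PB b)"
proof (rule groupI)
  have one: "\<one>\<^bsub>PB b\<^esub> = braid b (\<lambda>_. b)" by (simp add: PB_def braid_def)
  have m1: "motion b (\<lambda>_. b)" by (rule motion_const[OF assms])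
  have lp: "(\<lambda>_. b) = linepath b b" by (auto simp: linepath_def algebra_simps simp flip: scaleR_add_left)
  show "\<one>\<^bsub>PB b\<^esub> \<in> carrier (PB b)" unfolding one carrier_PB using m1 by blast
  fix A B assume "A \<in> carrier (PB b)" "B \<in> carrier (PB b)"
  then obtain \<alpha> \<beta> where \<alpha>: "motion b \<alpha>" "A = braid b \<alpha>" and \<beta>: "motion b \<beta>" "B = braid b \<beta>" unfolding carrier_PB by blast
  obtain \<delta> where \<delta>: "motion b \<delta>" "homotopic_paths config_space (\<alpha> +++ \<beta>) \<delta>" "braid b \<alpha> \<otimes>\<^bsub>PB b\<^esub> braid b \<beta> = braid b \<delta>"
    using ex_braid_mult \<alpha>(1) \<beta>(1) by metis
  show "A \<otimes>\<^bsub>PB b\<^esub> B \<in> carrier (PB b)" using \<delta> \<alpha>(2) \<beta>(2) unfolding carrier_PB by blast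
  show "\<one>\<^bsub>PB b\<^esub> \<otimes>\<^bsub>PB b\<^esub> A = A"
    unfolding one \<alpha>(2)
  proof (rule braid_mult[OF m1 \<alpha>(1) \<alpha>(1)])
    show "homotopic_paths config_space ((\<lambda>_. b) +++ \<alpha>) \<alpha>"
      unfolding lp using homotopic_paths_lid[of \<alpha> config_space] motion_path[OF \<alpha>(1)] by simp
  qed
  show "\<exists>C\<in>carrier (PB b). C \<otimes>\<^bsub>PB b\<^esub> A = \<one>\<^bsub>PB b\<^esub>"
  proof -
    obtain \<gamma> where \<gamma>: "motion b \<gamma>" "homotopic_paths config_space (\<gamma> +++ \<alpha>) (\<lambda>_. b)" using ex_reverse_motion[OF \<alpha>(1)] by blast
    then have "braid b \<gamma> \<otimes>\<^bsub>PB b\<^esub> A = \<one>\<^bsub>PB b\<^esub>" unfolding one \<alpha>(2) by (intro braid_mult m1 \<alpha>(1))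
    then show ?thesis unfolding carrier_PB using \<gamma>(1) by blast
  qed
  fix C assume "C \<in> carrier (PB b)"
  then obtain \<gamma> where \<gamma>: "motion b \<gamma>" "C = braid b \<gamma>" unfolding carrier_PB by blast
  obtain \<delta>' where \<delta>': "motion b \<delta>'" "homotopic_paths config_space (\<beta> +++ \<gamma>) \<delta>'" "braid b \<beta> \<otimes>\<^bsub>PB b\<^esub> braid b \<gamma> = braid b \<delta>'"
    using ex_braid_mult \<beta>(1) \<gamma>(1) by metis
  obtain \<epsilon> where \<epsilon>: "motion b \<epsilon>" "homotopic_paths config_space (\<delta> +++ \<gamma>) \<epsilon>" "braid b \<delta> \<otimes>\<^bsub>PB b\<^esub> braid b \<gamma> = braid b \<epsilon>"
    using ex_braid_mult \<delta>(1) \<gamma>(1) by metis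
  note p = motion_path[OF \<alpha>(1)] motion_path[OF \<beta>(1)] motion_path[OF \<gamma>(1)]
  have "homotopic_paths config_space (\<alpha> +++ \<delta>') (\<alpha> +++ (\<beta> +++ \<gamma>))"
    by (rule homotopic_paths_join) (use \<delta>'(2) p in \<open>auto intro: homotopic_paths_sym simp: motion_path[OF \<delta>'(1)]\<close>)
  also have "homotopic_paths config_space (\<alpha> +++ (\<beta> +++ \<gamma>)) ((\<alpha> +++ \<beta>) +++ \<gamma>)"
    by (rule homotopic_paths_assoc) (use p in auto)
  also have "homotopic_paths config_space ((\<alpha> +++ \<beta>) +++ \<gamma>) (\<delta> +++ \<gamma>)"
    by (rule homotopic_paths_join) (use \<delta>(2) p in auto)
  also note \<epsilon>(2)
  finally have "braid b \<alpha> \<otimes>\<^bsub>PB b\<^esub> braid b \<delta>' = braid b \<epsilon>" by (rule braid_mult[OF \<alpha>(1) \<delta>'(1) \<epsilon>(1)])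
  then show "A \<otimes>\<^bsub>PB b\<^esub> B \<otimes>\<^bsub>PB b\<^esub> C = A \<otimes>\<^bsub>PB b\<^esub> (B \<otimes>\<^bsub>PB b\<^esub> C)"
    unfolding \<alpha>(2) \<beta>(2) \<gamma>(2) \<delta>(3) \<delta>'(3) \<epsilon>(3) by simp
qed

section \<open>Transverse motions\<close>

lemma card_matching:
  assumes Z: "finite Z" and ex: "\<And>t. t \<in> Z \<Longrightarrow> \<exists>s\<in>Y. R t s" "\<And>s. s \<in> Y \<Longrightarrow> \<exists>t\<in>Z. R t s"
    and uniq: "\<And>t s s'. t \<in> Z \<Longrightarrow> s \<in> Y \<Longrightarrow> s' \<in> Y \<Longrightarrow> R t s \<Longrightarrow> R t s' \<Longrightarrow> s = s'"
      "\<And>s t t'. s \<in> Y \<Longrightarrow> t \<in> Z \<Longrightarrow> t' \<in> Z \<Longrightarrow> R t s \<Longrightarrow> R t' s \<Longrightarrow> t = t'"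
  shows "finite Y \<and> card Y = card Z"
proof -
  have "\<forall>t\<in>Z. \<exists>s. s \<in> Y \<and> R t s" using ex(1) by blast
  from bchoice[OF this] obtain m where m: "\<forall>t\<in>Z. m t \<in> Y \<and> R t (m t)" ..
  have "inj_on m Z" using m uniq(2) unfolding inj_on_def by metis
  moreover have "m ` Z = Y" using m ex(2) uniq(1) by (auto simp: image_iff) metis
  ultimately have "bij_betw m Z Y" by (simp add: bij_betw_def)
  then show ?thesis using bij_betw_finite[of m Z Y] bij_betw_same_card[of m Z Y] Z by simp
qed

lemma compact_positive_bound:
  fixes f :: "'a::topological_space \<Rightarrow> real"
  assumes "compact K" "continuous_on K f" "\<And>x. x \<in> K \<Longrightarrow> f x > 0"
  shows "\<exists>e>0. \<forall>x\<in>K. e \<le> f x"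
proof (cases "K = {}")
  case True
  then show ?thesis by (auto intro: exI[of _ 1])
next
  case False
  obtain x where "x \<in> K" "\<forall>y\<in>K. f x \<le> f y" using continuous_attains_inf[OF assms(1) False assms(2)] by blast
  then show ?thesis using assms(3) by blast
qed

lemma mult_pos_close:
  fixes f g :: real
  assumes "\<bar>g - f\<bar> < e" "e \<le> \<bar>f\<bar>"
  shows "g * f > 0"
  using assms by (cases "f > 0") (auto simp: zero_less_mult_iff abs_if split: if_splits)

text \<open>Away from the ends of the unit interval the derivative within \<open>{0..1}\<close> is
  an ordinary one.\<close>

lemma DERIV_pos_strict:
  fixes f :: "real \<Rightarrow> real"
  assumes d: "\<And>t. t \<in> {a..b} \<Longrightarrow> (f has_real_derivative f' t) (at t within {0..1})" "\<And>t. t \<in> {a..b} \<Longrightarrow> f' t > 0"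
    and ab: "0 < a" "b < 1" and xy: "a \<le> x" "x < y" "y \<le> b"
  shows "f x < f y"
proof (rule DERIV_pos_imp_increasing[OF xy(2)])
  fix t assume t: "x \<le> t" "t \<le> y"
  have "at t within {0..1} = at t" by (rule at_within_interior) (use t ab xy in auto)
  then show "\<exists>D. (f has_real_derivative D) (at t) \<and> 0 < D" using d[of t] t xy by auto
qed

text \<open>Around each zero of \<open>f\<close> there is an interval of half-width \<open>r\<close>
  on which \<open>f'\<close> keeps its sign, and outside these intervals \<open>|f|\<close> is
  bounded below. A close \<open>g\<close> is monotone on each interval with opposite signs at its
  ends, hence has exactly one zero there, and none elsewhere.\<close>

lemma stable_zeros:
  fixes f f' :: "real \<Rightarrow> real"
  assumes d: "\<And>t. t \<in> {0..1} \<Longrightarrow> (f has_real_derivative f' t) (at t within {0..1})"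
    and c': "continuous_on {0..1} f'"
    and simple: "\<And>t. t \<in> {0..1} \<Longrightarrow> f t = 0 \<Longrightarrow> f' t \<noteq> 0"
    and ends: "f 0 \<noteq> 0" "f 1 \<noteq> 0"
  shows "\<exists>e>0. \<forall>g g'. (\<forall>t\<in>{0..1}. (g has_real_derivative g' t) (at t within {0..1})) \<longrightarrow>
     (\<forall>t\<in>{0..1}. \<bar>g t - f t\<bar> < e) \<longrightarrow> (\<forall>t\<in>{0..1}. \<bar>g' t - f' t\<bar> < e) \<longrightarrow>
     finite {t \<in> {0..1}. g t = 0} \<and> card {t \<in> {0..1}. g t = 0} = card {t \<in> {0..1}. f t = 0}"
proof -
  define Z where "Z = {t \<in> {0..1}. f t = 0}"
  have c: "continuous_on {0..1} f" by (rule DERIV_continuous_on[OF d])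
  have Z01: "t \<in> {0..1}" "f t = 0" "f' t \<noteq> 0" "0 < t" "t < 1" if "t \<in> Z" for t
  proof -
    show t: "t \<in> {0..1}" "f t = 0" "f' t \<noteq> 0" using that simple by (auto simp: Z_def)
    with ends show "0 < t" "t < 1" by (metis atLeastAtMost_iff less_eq_real_def)+
  qed
  have fin: "finite Z"
    unfolding Z_def
  proof (rule finite_zeros[OF c])
    fix t :: real assume t: "t \<in> {0..1}" "f t = 0"
    obtain \<epsilon> where \<epsilon>: "\<epsilon> > 0" "\<forall>s\<in>{0..1}. \<bar>s - t\<bar> < \<epsilon> \<longrightarrow> (s < t \<longrightarrow> f s * f' t < 0) \<and> (t < s \<longrightarrow> f s * f' t > 0)"
      using simple_zero_sign[OF d[OF t(1)] simple[OF t] t(2)] by blast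
    have "f s \<noteq> 0" if "s \<in> {0..1}" "\<bar>s - t\<bar> < \<epsilon>" "s \<noteq> t" for s
      using bspec[OF \<epsilon>(2) that(1)] that(2,3) by (cases "s < t") auto
    then show "\<exists>\<epsilon>>0. \<forall>s\<in>{0..1}. \<bar>s - t\<bar> < \<epsilon> \<longrightarrow> s \<noteq> t \<longrightarrow> f s \<noteq> 0" using \<epsilon>(1) by blast
  qed
  have "\<exists>q>0. q \<le> t \<and> q \<le> 1 - t \<and> (\<forall>s\<in>{0..1}. \<bar>s - t\<bar> < q \<longrightarrow> f' s * f' t > 0) \<and> (\<forall>t'\<in>Z. t' \<noteq> t \<longrightarrow> q \<le> \<bar>t' - t\<bar>)"
    if t: "t \<in> Z" for t
  proof -
    have o: "open {x. x * f' t > 0}" by (intro open_Collect_less continuous_intros)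
    have "f' t \<in> {x. x * f' t > 0}"
      by (metis CollectI Z01(3) not_real_square_gt_zero t)
    from path_stays[OF c' Z01(1)[OF t] o this]
    obtain q1 where q1: "q1 > 0" "\<forall>s\<in>{0..1}. \<bar>s - t\<bar> < q1 \<longrightarrow> f' s \<in> {x. x * f' t > 0}" by blast
    obtain q2 where q2: "q2 > 0" "\<forall>x\<in>Z. x \<noteq> t \<longrightarrow> q2 \<le> dist t x" using finite_set_avoid[OF fin] by blast
    define u where "u = min (min q1 q2) (min t (1 - t))"
    have u: "u > 0" "u \<le> t" "u \<le> 1 - t" "u \<le> q1" "u \<le> q2" using q1(1) q2(1) Z01(4,5)[OF t] by (simp_all add: u_def)
    have "f' s * f' t > 0" if "s \<in> {0..1}" "\<bar>s - t\<bar> < u" for s using bspec[OF q1(2) that(1)] that(2) u(4) by simp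
    moreover have "u \<le> \<bar>t' - t\<bar>" if "t' \<in> Z" "t' \<noteq> t" for t'
      using bspec[OF q2(2) that(1)] that(2) u(5) by (simp add: dist_real_def abs_minus_commute)
    ultimately show ?thesis using u by blast
  qed
  then have "\<forall>t\<in>Z. \<exists>q. q > 0 \<and> q \<le> t \<and> q \<le> 1 - t \<and> (\<forall>s\<in>{0..1}. \<bar>s - t\<bar> < q \<longrightarrow> f' s * f' t > 0) \<and> (\<forall>t'\<in>Z. t' \<noteq> t \<longrightarrow> q \<le> \<bar>t' - t\<bar>)"
    by blast
  from bchoice[OF this] obtain q where q: "\<forall>t\<in>Z. q t > 0 \<and> q t \<le> t \<and> q t \<le> 1 - t \<and>
    (\<forall>s\<in>{0..1}. \<bar>s - t\<bar> < q t \<longrightarrow> f' s * f' t > 0) \<and> (\<forall>t'\<in>Z. t' \<noteq> t \<longrightarrow> q t \<le> \<bar>t' - t\<bar>)" ..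
  \<comment> \<open>The 1 provides for the case without zeros; a third of the minimum keeps the
    intervals apart and inside \<open>{0..1}\<close>.\<close>
  define r where "r = Min (insert 1 (q ` Z)) / 3"
  have r: "r > 0" "3 * r \<le> q t" if "t \<in> Z" for t
    using that fin q unfolding r_def by (auto simp: Min_gr_iff)
  have r0: "r > 0" using fin q unfolding r_def by (auto simp: Min_gr_iff)
  have J01: "{t - r..t + r} \<subseteq> {0..1}" "0 < t - r" "t + r < 1" if "t \<in> Z" for t
    using r[OF that] bspec[OF q that] by auto
  have J': "f' s * f' t > 0" if "t \<in> Z" "s \<in> {t - r..t + r}" for s t
  proof -
    have "\<bar>s - t\<bar> < q t" using that(2) r[OF that(1)] by auto
    moreover have "s \<in> {0..1}" using J01(1)[OF that(1)] that(2) by blast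
    ultimately show ?thesis using bspec[OF q that(1)] by blast
  qed
  have sep: "3 * r \<le> \<bar>t' - t\<bar>" if "t \<in> Z" "t' \<in> Z" "t' \<noteq> t" for t t'
    using bspec[OF q that(1)] r(2)[OF that(1)] that(2,3) by fastforce
  define C where "C = {0..1} - (\<Union>t\<in>Z. {t - r<..<t + r})"
  have C: "compact C" "C \<subseteq> {0..1}" unfolding C_def by (intro compact_diff) auto
  have endC: "t - r \<in> C" "t + r \<in> C" if t: "t \<in> Z" for t
  proof -
    have "s \<in> C" if s: "\<bar>s - t\<bar> = r" for s
    proof -
      have "s \<notin> {t' - r<..<t' + r}" if "t' \<in> Z" for t'
        using sep[OF t that] s r0 by (cases "t' = t") (auto simp: abs_if split: if_splits)
      moreover have "s \<in> {0..1}" using J01(1)[OF t] s by (auto simp: abs_if split: if_splits)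
      ultimately show ?thesis by (auto simp: C_def)
    qed
    then show "t - r \<in> C" "t + r \<in> C" using r0 by auto
  qed
  have "\<exists>e>0. \<forall>s\<in>C. e \<le> \<bar>f s\<bar>"
  proof (rule compact_positive_bound[OF C(1)])
    show "continuous_on C (\<lambda>s. \<bar>f s\<bar>)" by (intro continuous_intros continuous_on_subset[OF c C(2)])
    fix s assume s: "s \<in> C"
    have "s \<notin> Z" using s r0 by (auto simp: C_def)
    then show "\<bar>f s\<bar> > 0" using s C(2) by (auto simp: Z_def)
  qed
  then obtain e1 where e1: "e1 > 0" "\<forall>s\<in>C. e1 \<le> \<bar>f s\<bar>" by blast
  have "\<exists>e>0. \<forall>s\<in>(\<Union>t\<in>Z. {t - r..t + r}). e \<le> \<bar>f' s\<bar>"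
  proof (rule compact_positive_bound[of "\<Union>t\<in>Z. {t - r..t + r}" "\<lambda>s. \<bar>f' s\<bar>"])
    show "compact (\<Union>t\<in>Z. {t - r..t + r})" by (intro compact_UN fin) auto
    show "continuous_on (\<Union>t\<in>Z. {t - r..t + r}) (\<lambda>s. \<bar>f' s\<bar>)"
      by (intro continuous_intros continuous_on_subset[OF c']) (use J01(1) in blast)
    fix s assume "s \<in> (\<Union>t\<in>Z. {t - r..t + r})"
    then obtain t where "t \<in> Z" "s \<in> {t - r..t + r}" by blast
    from J'[OF this] show "\<bar>f' s\<bar> > 0" by auto
  qed
  then obtain e2 where e2: "e2 > 0" "\<forall>s\<in>(\<Union>t\<in>Z. {t - r..t + r}). e2 \<le> \<bar>f' s\<bar>" by blast
  show ?thesis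
  proof (rule exI[of _ "min e1 e2"], intro conjI allI impI)
    show "min e1 e2 > 0" using e1 e2 by simp
    fix g g' :: "real \<Rightarrow> real"
    assume "\<forall>t\<in>{0..1}. (g has_real_derivative g' t) (at t within {0..1})"
      "\<forall>t\<in>{0..1}. \<bar>g t - f t\<bar> < min e1 e2" "\<forall>t\<in>{0..1}. \<bar>g' t - f' t\<bar> < min e1 e2"
    then have dg: "\<And>t. t \<in> {0..1} \<Longrightarrow> (g has_real_derivative g' t) (at t within {0..1})"
      and cl: "\<And>t. t \<in> {0..1} \<Longrightarrow> \<bar>g t - f t\<bar> < min e1 e2" "\<And>t. t \<in> {0..1} \<Longrightarrow> \<bar>g' t - f' t\<bar> < min e1 e2"
      by simp_all
    have cg: "continuous_on {0..1} g" by (rule DERIV_continuous_on[OF dg])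
    have gC: "g s * f s > 0" if "s \<in> C" for s
      by (rule mult_pos_close[of _ _ e1]) (use cl(1)[of s] bspec[OF e1(2) that] C(2) that in auto)
    have g': "g' s * f' t > 0" if "t \<in> Z" "s \<in> {t - r..t + r}" for s t
    proof -
      have "s \<in> {0..1}" using J01(1)[OF that(1)] that(2) by blast
      moreover have "s \<in> (\<Union>t\<in>Z. {t - r..t + r})" using that by blast
      ultimately have "g' s * f' s > 0" using cl(2)[of s] bspec[OF e2(2), of s] by (intro mult_pos_close[of _ _ e2]) simp_all
      with J'[OF that] show ?thesis by (auto simp: zero_less_mult_iff)
    qed
    have mono: "g x * f' t < g y * f' t" if "t \<in> Z" "t - r \<le> x" "x < y" "y \<le> t + r" for t x y
    proof (rule DERIV_pos_strict[where a = "t - r" and b = "t + r" and f = "\<lambda>x. g x * f' t" and f' = "\<lambda>x. g' x * f' t"])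
      show "((\<lambda>x. g x * f' t) has_real_derivative g' s * f' t) (at s within {0..1})" if "s \<in> {t - r..t + r}" for s
        using J01(1)[OF \<open>t \<in> Z\<close>] that by (intro DERIV_cmult_right dg) blast
    qed (use g' J01 that in auto)
    have mono': "f x * f' t < f y * f' t" if "t \<in> Z" "t - r \<le> x" "x < y" "y \<le> t + r" for t x y
    proof (rule DERIV_pos_strict[where a = "t - r" and b = "t + r" and f = "\<lambda>x. f x * f' t" and f' = "\<lambda>x. f' x * f' t"])
      show "((\<lambda>x. f x * f' t) has_real_derivative f' s * f' t) (at s within {0..1})" if "s \<in> {t - r..t + r}" for s
        using J01(1)[OF \<open>t \<in> Z\<close>] that by (intro DERIV_cmult_right d) blast
    qed (use J' J01 that in auto)
    have "finite {t \<in> {0..1}. g t = 0} \<and> card {t \<in> {0..1}. g t = 0} = card Z"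
    proof (rule card_matching[where R = "\<lambda>t s. \<bar>s - t\<bar> < r", OF fin])
      fix t assume t: "t \<in> Z"
      have "f (t - r) * f' t < 0" "f (t + r) * f' t > 0"
        using mono'[OF t, of "t - r" t] mono'[OF t, of t "t + r"] r0 Z01(2)[OF t] by auto
      then have gs: "g (t - r) * f' t < 0" "g (t + r) * f' t > 0"
        using gC[OF endC(1)[OF t]] gC[OF endC(2)[OF t]] by (auto simp: zero_less_mult_iff mult_less_0_iff)
      have "continuous_on {t - r..t + r} (\<lambda>s. g s * f' t)"
        by (intro continuous_intros continuous_on_subset[OF cg] J01(1)[OF t])
      then obtain s where s: "t - r \<le> s" "s \<le> t + r" "g s * f' t = 0"
        using IVT'[of "\<lambda>s. g s * f' t" "t - r" 0 "t + r"] gs r0 by auto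
      then have "g s = 0" "s \<noteq> t - r" "s \<noteq> t + r" using gs Z01(3)[OF t] by auto
      moreover have "s \<in> {0..1}" using J01(1)[OF t] s(1,2) by auto
      ultimately show "\<exists>s\<in>{t \<in> {0..1}. g t = 0}. \<bar>s - t\<bar> < r" using s(1,2) by (intro bexI[of _ s]) auto
    next
      fix s assume "s \<in> {t \<in> {0..1}. g t = 0}"
      then have s: "s \<in> {0..1}" "g s = 0" by simp_all
      then have "s \<notin> C" using gC[of s] by force
      then obtain t where t: "t \<in> Z" "s \<in> {t - r<..<t + r}" using s(1) unfolding C_def by blast
      have "\<bar>s - t\<bar> < r" using t(2) by (simp add: abs_less_iff)
      then show "\<exists>t\<in>Z. \<bar>s - t\<bar> < r" using t(1) by blast
    next
      fix t s s' assume t: "t \<in> Z" and s: "s \<in> {t \<in> {0..1}. g t = 0}" "s' \<in> {t \<in> {0..1}. g t = 0}" "\<bar>s - t\<bar> < r" "\<bar>s' - t\<bar> < r"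
      have no: False if "x < y" "g x = 0" "g y = 0" "\<bar>x - t\<bar> < r" "\<bar>y - t\<bar> < r" for x y
        using mono[OF t, of x y] that by (simp add: abs_less_iff)
      show "s = s'" using no[of s s'] no[of s' s] s by (cases s s' rule: linorder_cases) auto
    next
      fix s t t' assume "t \<in> Z" "t' \<in> Z" "\<bar>s - t\<bar> < r" "\<bar>s - t'\<bar> < r"
      then show "t = t'" using sep[of t t'] by fastforce
    qed
    then show "finite {t \<in> {0..1}. g t = 0}" "card {t \<in> {0..1}. g t = 0} = card {t \<in> {0..1}. f t = 0}"
      by (simp_all add: Z_def)
  qed
qed

text \<open>Uniform continuity between points of \<open>K\<close> and points merely near
  \<open>K\<close>: the compact set is first thickened within \<open>S\<close>.\<close>

lemma compact_close:
  fixes f :: "'a::euclidean_space \<Rightarrow> 'b::metric_space"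
  assumes K: "compact K" "K \<subseteq> S" "open S" and f: "continuous_on S f" and e: "e > 0"
  obtains d where "d > 0" "\<And>x y. x \<in> K \<Longrightarrow> dist x y < d \<Longrightarrow> y \<in> S \<and> dist (f x) (f y) < e"
proof -
  obtain d1 where d1: "d1 > 0" "(\<Union>x\<in>K. cball x d1) \<subseteq> S"
    using compact_subset_open_imp_cball_epsilon_subset[OF K(1,3,2)] by blast
  define K' where "K' = {x + y | x y. x \<in> K \<and> y \<in> cball 0 d1}"
  have "compact K'" unfolding K'_def by (rule compact_sums[OF K(1)]) simp
  have K'I: "y \<in> K'" if "x \<in> K" "dist x y \<le> d1" for x y
    unfolding K'_def using that by (intro CollectI exI[of _ x] exI[of _ "y - x"]) (simp add: dist_norm norm_minus_commute)
  have "K' \<subseteq> S"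
  proof
    fix z assume "z \<in> K'"
    then obtain x y where xy: "z = x + y" "x \<in> K" "y \<in> cball 0 d1" unfolding K'_def by blast
    from xy(1,3) have "z \<in> cball x d1" by (simp add: dist_norm)
    then show "z \<in> S" using d1(2) xy(2) by blast
  qed
  then have "uniformly_continuous_on K' f"
    by (intro compact_uniformly_continuous continuous_on_subset[OF f] \<open>compact K'\<close>)
  then obtain d2 where d2: "d2 > 0" "\<And>x y. x \<in> K' \<Longrightarrow> y \<in> K' \<Longrightarrow> dist y x < d2 \<Longrightarrow> dist (f y) (f x) < e"
    using e unfolding uniformly_continuous_on_def by metis
  show ?thesis
  proof (rule that[of "min d1 d2"])
    fix x y assume xy: "x \<in> K" "dist x y < min d1 d2"
    have m: "x \<in> K'" "y \<in> K'" using K'I[of x] xy d1(1) by auto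
    have "y \<in> S" using m \<open>K' \<subseteq> S\<close> by blast
    moreover have "dist (f x) (f y) < e" by (rule d2(2)[OF m(2,1)]) (use xy in simp)
    ultimately show "y \<in> S \<and> dist (f x) (f y) < e" by simp
  qed (use d1 d2 in simp)
qed

abbreviation velocity :: "(real \<Rightarrow> 'a::real_normed_vector) \<Rightarrow> real \<Rightarrow> 'a" where
  "velocity \<beta> t \<equiv> vector_derivative \<beta> (at t within {0..1})"

lemma smooth_path_velocity:
  assumes "smooth_path \<beta>"
  shows "t \<in> {0..1} \<Longrightarrow> (\<beta> has_vector_derivative velocity \<beta> t) (at t within {0..1})"
    and "continuous_on {0..1} (velocity \<beta>)"
proof -
  obtain D where D: "D 0 = \<beta>" "\<forall>k. \<forall>t\<in>{0..1}. (D k has_vector_derivative D (Suc k) t) (at t within {0..1})"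
    using assms unfolding smooth_path_def by blast
  have d: "(\<beta> has_vector_derivative D (Suc 0) t) (at t within {0..1})" if "t \<in> {0..1}" for t
    using bspec[OF spec[OF D(2), of 0] that] D(1) by simp
  have e: "velocity \<beta> t = D (Suc 0) t" if "t \<in> {0..1}" for t
    using vector_derivative_within_cbox[of 0 1 t \<beta> "D (Suc 0) t"] d[OF that] that by simp
  show "(\<beta> has_vector_derivative velocity \<beta> t) (at t within {0..1})" if "t \<in> {0..1}" for t
    using d[OF that] e[OF that] by simp
  have "continuous_on {0..1} (D (Suc 0))"
    using D(2) by (meson continuous_on_eq_continuous_within has_vector_derivative_continuous)
  then show "continuous_on {0..1} (velocity \<beta>)" by (rule continuous_on_eq) (simp add: e)
qed

definition transverse :: "(real \<Rightarrow> complex ^ 'n) \<Rightarrow> bool" where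
  "transverse \<beta> \<longleftrightarrow> (\<forall>t\<in>{0..1}. walls (\<beta> t) = 0 \<longrightarrow>
     (\<exists>D. D \<noteq> 0 \<and> ((\<lambda>s. walls (\<beta> s)) has_real_derivative D) (at t within {0..1})))"

lemma at_within_unit: "t \<in> {0..1} \<Longrightarrow> at t within {0..1 :: real} \<noteq> bot"
  using islimpt_Icc[of 0 1 t] by (simp add: trivial_limit_within)

text \<open>The derivative of \<open>walls\<close> along a motion is continuous in position and
  velocity. Hence a \<open>C1\<close>-close motion gives a \<open>C1\<close>-close function of time,
  and \<open>stable_zeros\<close> preserves the number of critical moments.\<close>

lemma transverse_good_general:
  fixes \<beta> :: "real \<Rightarrow> complex ^ 'n"
  assumes m: "motion b \<beta>" and tr: "transverse \<beta>" and b: "walls b \<noteq> 0"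
  shows "good_path \<beta>" and "general_position b \<beta>"
proof -
  have sm: "smooth_path \<beta>" and im: "\<beta> ` {0..1} \<subseteq> config_space" and e01: "\<beta> 0 = b" "\<beta> 1 = b" using m by (auto simp: motion_def)
  have cfg: "\<beta> t \<in> config_space" if "t \<in> {0..1}" for t using im that by blast
  note vel = smooth_path_velocity[OF sm]
  obtain F where F: "C1_with (walls :: complex ^ 'n \<Rightarrow> real) F" using C1_walls by (auto simp: C1_config_def)
  define f' where "f' = (\<lambda>t. F (\<beta> t) (velocity \<beta> t))"
  have d: "((\<lambda>s. walls (\<beta> s)) has_real_derivative f' t) (at t within {0..1})" if "t \<in> {0..1}" for t
    unfolding f'_def using C1_with_deriv[OF F cfg[OF that] vel(1)[OF that]] .
  have cb: "continuous_on {0..1} (\<lambda>t. (\<beta> t, velocity \<beta> t))"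
    by (intro continuous_on_Pair smooth_path_continuous[OF sm] vel(2))
  have c': "continuous_on {0..1} f'"
    using continuous_on_compose2[OF C1_with_continuous(2)[OF F] cb] cfg unfolding f'_def by (simp add: image_subset_iff)
  have simple: "f' t \<noteq> 0" if t: "t \<in> {0..1}" "walls (\<beta> t) = 0" for t
  proof -
    have "\<exists>D. D \<noteq> 0 \<and> ((\<lambda>s. walls (\<beta> s)) has_real_derivative D) (at t within {0..1})"
      using tr t unfolding transverse_def by simp
    then obtain D where D: "D \<noteq> 0" "((\<lambda>s. walls (\<beta> s)) has_real_derivative D) (at t within {0..1})" by (elim exE conjE)
    from real_derivative_unique[OF D(2) d[OF t(1)] at_within_unit[OF t(1)]] D(1) show ?thesis by simp
  qed
  have ends: "walls (\<beta> 0) \<noteq> 0" "walls (\<beta> 1) \<noteq> 0" using b e01 by auto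
  note cm = critical_moments_walls[OF im]
  have single: "\<exists>T. critical_triples (\<beta> t) \<subseteq> {T}" if t: "t \<in> critical_moments \<beta>" for t
  proof -
    have t': "t \<in> {0..1}" "walls (\<beta> t) = 0" using t by (auto simp: cm)
    show ?thesis
      by (rule simple_zero_one_wall[OF cfg[OF t'(1)] vel(1)[OF t'(1)] at_within_unit[OF t'(1)] d[OF t'(1)] simple[OF t']])
  qed
  have ss: "\<exists>\<epsilon>>0. \<forall>s\<in>{0..1}. \<bar>s - t\<bar> < \<epsilon> \<longrightarrow> (s < t \<longrightarrow> walls (\<beta> s) * f' t < 0) \<and> (t < s \<longrightarrow> walls (\<beta> s) * f' t > 0)"
    if t: "t \<in> {0..1}" "walls (\<beta> t) = 0" for t
    by (rule simple_zero_sign[OF d[OF t(1)] simple[OF t] t(2)])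
  have ex: "\<exists>e>0. \<forall>g g'. (\<forall>t\<in>{0..1}. (g has_real_derivative g' t) (at t within {0..1})) \<longrightarrow>
     (\<forall>t\<in>{0..1}. \<bar>g t - walls (\<beta> t)\<bar> < e) \<longrightarrow> (\<forall>t\<in>{0..1}. \<bar>g' t - f' t\<bar> < e) \<longrightarrow>
     finite {t \<in> {0..1}. g t = 0} \<and> card {t \<in> {0..1}. g t = 0} = card {t \<in> {0..1}. walls (\<beta> t) = 0}"
    by (rule stable_zeros[OF d c' simple ends])
  obtain e where ee: "e > 0 \<and> (\<forall>g g'. (\<forall>t\<in>{0..1}. (g has_real_derivative g' t) (at t within {0..1})) \<longrightarrow>
     (\<forall>t\<in>{0..1}. \<bar>g t - walls (\<beta> t)\<bar> < e) \<longrightarrow> (\<forall>t\<in>{0..1}. \<bar>g' t - f' t\<bar> < e) \<longrightarrow>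
     finite {t \<in> {0..1}. g t = 0} \<and> card {t \<in> {0..1}. g t = 0} = card {t \<in> {0..1}. walls (\<beta> t) = 0})"
    using ex ..
  note e = conjunct1[OF ee] conjunct2[OF ee]
  have fin: "finite (critical_moments \<beta>)" using d e(1) spec[OF spec[OF e(2), of "\<lambda>t. walls (\<beta> t)"], of f'] by (simp add: cm)
  have sc: "sign_change \<beta> t" if t: "t \<in> critical_moments \<beta>" for t
  proof -
    have t': "t \<in> {0..1}" "walls (\<beta> t) = 0" using t by (auto simp: cm)
    obtain q where q: "q > 0" "\<forall>s\<in>{0..1}. \<bar>s - t\<bar> < q \<longrightarrow> (s < t \<longrightarrow> walls (\<beta> s) * f' t < 0) \<and> (t < s \<longrightarrow> walls (\<beta> s) * f' t > 0)"
      using ss[OF t'] by blast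
    have "walls (\<beta> s) * walls (\<beta> s') < 0" if "s \<in> {0..1}" "s' \<in> {0..1}" "t - q < s" "s < t" "t < s'" "s' < t + q" for s s'
    proof -
      have "walls (\<beta> s) * f' t < 0" "walls (\<beta> s') * f' t > 0"
        using bspec[OF q(2) that(1)] bspec[OF q(2) that(2)] that(3-6) by auto
      then show ?thesis by (auto simp: zero_less_mult_iff mult_less_0_iff)
    qed
    then show ?thesis unfolding sign_change_def using q(1) by blast
  qed
  show "good_path \<beta>"
    unfolding good_path_def using smooth_path_continuous[OF sm] im ends fin single sc by blast
  have stable: "\<exists>\<epsilon>>0. \<forall>\<gamma>. motion b \<gamma> \<and> C1_close \<epsilon> \<beta> \<gamma> \<longrightarrow>
      finite (critical_moments \<gamma>) \<and> card (critical_moments \<gamma>) = card (critical_moments \<beta>)"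
  proof -
    define K where "K = (\<lambda>t. (\<beta> t, velocity \<beta> t)) ` {0..1}"
    have K: "compact K" "K \<subseteq> config_space \<times> UNIV" "open (config_space \<times> (UNIV :: (complex ^ 'n) set))"
      unfolding K_def using cfg by (auto intro!: compact_continuous_image cb open_Times open_config_space)
    have "continuous_on (config_space \<times> UNIV) (\<lambda>x. (walls (fst x :: complex ^ 'n), F (fst x) (snd x)))"
      by (intro continuous_on_Pair C1_with_continuous[OF F])
    from compact_close[OF K this e(1)] obtain q where q: "q > 0"
      "\<And>x y. x \<in> K \<Longrightarrow> dist x y < q \<Longrightarrow> y \<in> config_space \<times> UNIV \<and>
        dist (walls (fst x), F (fst x) (snd x)) (walls (fst y), F (fst y) (snd y)) < e" by metis
    show ?thesis
    proof (intro exI[of _ "q / 2"] conjI allI impI)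
      show "q / 2 > 0" using q(1) by simp
      fix \<gamma> assume \<gamma>: "motion b \<gamma> \<and> C1_close (q / 2) \<beta> \<gamma>"
      have sm\<gamma>: "smooth_path \<gamma>" and im\<gamma>: "\<gamma> ` {0..1} \<subseteq> config_space" using \<gamma> by (auto simp: motion_def)
      have near: "dist (walls (\<beta> t), f' t) (walls (\<gamma> t), F (\<gamma> t) (velocity \<gamma> t)) < e" if t: "t \<in> {0..1}" for t
      proof -
        have "norm (\<gamma> t - \<beta> t) < q / 2" "norm (velocity \<gamma> t - velocity \<beta> t) < q / 2"
          using \<gamma> t unfolding C1_close_def by auto
        then have "dist (\<beta> t) (\<gamma> t) + dist (velocity \<beta> t) (velocity \<gamma> t) < q"
          by (simp add: dist_norm norm_minus_commute)
        then have "dist (\<beta> t, velocity \<beta> t) (\<gamma> t, velocity \<gamma> t) < q"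
          using sqrt_sum_squares_le_sum[of "dist (\<beta> t) (\<gamma> t)" "dist (velocity \<beta> t) (velocity \<gamma> t)"]
          unfolding dist_Pair_Pair by simp
        from conjunct2[OF q(2)[OF _ this]] t show ?thesis by (simp add: K_def f'_def)
      qed
      have le: "\<bar>a' - a\<bar> \<le> dist (a, c) (a', c')" "\<bar>c' - c\<bar> \<le> dist (a, c) (a', c')" for a c a' c' :: real
        using dist_fst_le[of "(a, c)" "(a', c')"] dist_snd_le[of "(a, c)" "(a', c')"]
        by (simp_all add: dist_real_def abs_minus_commute)
      have "finite {t \<in> {0..1}. walls (\<gamma> t) = 0} \<and> card {t \<in> {0..1}. walls (\<gamma> t) = 0} = card {t \<in> {0..1}. walls (\<beta> t) = 0}"
      proof (rule spec[OF spec[OF e(2), of "\<lambda>t. walls (\<gamma> t)"], of "\<lambda>t. F (\<gamma> t) (velocity \<gamma> t)", rule_format])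
        fix t :: real assume t: "t \<in> {0..1}"
        have "\<gamma> t \<in> config_space" using im\<gamma> t by blast
        from C1_with_deriv[OF F this smooth_path_velocity(1)[OF sm\<gamma> t]]
        show "((\<lambda>t. walls (\<gamma> t)) has_real_derivative F (\<gamma> t) (velocity \<gamma> t)) (at t within {0..1})" .
        show "\<bar>walls (\<gamma> t) - walls (\<beta> t)\<bar> < e" "\<bar>F (\<gamma> t) (velocity \<gamma> t) - f' t\<bar> < e"
          using le(1) le(2) near[OF t] by (meson le_less_trans)+
      qed
      then show "finite (critical_moments \<gamma>)" "card (critical_moments \<gamma>) = card (critical_moments \<beta>)"
        by (simp_all add: cm critical_moments_walls[OF im\<gamma>])
    qed
  qed
  have "\<exists>!T. T \<in> critical_triples (\<beta> t)" if t: "t \<in> critical_moments \<beta>" for t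
  proof -
    obtain T where T: "critical_triples (\<beta> t) \<subseteq> {T}" using single[OF t] by blast
    moreover have "critical_triples (\<beta> t) \<noteq> {}" using t by (simp add: critical_moments_def)
    ultimately show ?thesis by blast
  qed
  then show "general_position b \<beta>" unfolding general_position_def using m fin stable by blast
qed

section \<open>Existence of transverse motions\<close>

text \<open>Vertex \<open>j\<close> of the joint chain is vertex \<open>j mod M\<close> of the chain
  number \<open>j div M\<close>; this indexing is why all chains are given the same length.\<close>

lemma ex_vertices:
  assumes "0 < M" and ch: "\<And>k. k < L \<Longrightarrow> \<exists>w. w 0 = x k \<and> w M = x (Suc k) \<and> (\<forall>i<M. R k (w i) (w (Suc i)))"
  shows "\<exists>v. v 0 = x 0 \<and> v (L * M) = x L \<and> (\<forall>j<L * M. R (j div M) (v j) (v (Suc j)))"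
proof -
  have "\<forall>k\<in>{..<L}. \<exists>w. w 0 = x k \<and> w M = x (Suc k) \<and> (\<forall>i<M. R k (w i) (w (Suc i)))" using ch by simp
  from bchoice[OF this] obtain w where w: "\<forall>k\<in>{..<L}. w k 0 = x k \<and> w k M = x (Suc k) \<and> (\<forall>i<M. R k (w k i) (w k (Suc i)))" ..
  define v where "v = (\<lambda>j. if j mod M = 0 then x (j div M) else w (j div M) (j mod M))"
  have "R (j div M) (v j) (v (Suc j))" if j: "j < L * M" for j
  proof -
    have k: "j div M < L" using j by (simp add: less_mult_imp_div_less)
    have i: "j mod M < M" using assms(1) by simp
    have wk: "w (j div M) 0 = x (j div M)" "w (j div M) M = x (Suc (j div M))"
      "R (j div M) (w (j div M) (j mod M)) (w (j div M) (Suc (j mod M)))"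
      using bspec[OF w, of "j div M"] k i by simp_all
    have "v j = w (j div M) (j mod M)" using wk(1) by (simp add: v_def)
    moreover have "v (Suc j) = w (j div M) (Suc (j mod M))"
    proof (cases "Suc (j mod M) = M")
      case True
      then have "Suc j mod M = 0" by (simp add: mod_Suc)
      moreover have "Suc j div M = Suc (j div M)" using calculation by (simp add: div_Suc)
      ultimately show ?thesis using wk(2) True by (simp add: v_def)
    next
      case False
      then have "Suc j mod M = Suc (j mod M)" by (simp add: mod_Suc)
      moreover have "Suc j div M = j div M" using calculation by (simp add: div_Suc)
      ultimately show ?thesis by (simp add: v_def)
    qed
    ultimately show ?thesis using wk(3) by simp
  qed
  moreover have "v 0 = x 0" "v (L * M) = x L" using assms(1) by (simp_all add: v_def)
  ultimately show ?thesis by blast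
qed

text \<open>A chain is lengthened by resting at its end, which is how chains of different lengths
  obtain a common one.\<close>

lemma rtranclp_padded:
  assumes "R\<^sup>*\<^sup>* x y" "R y y"
  shows "\<exists>m. \<forall>M\<ge>m. \<exists>w. w 0 = x \<and> w M = y \<and> (\<forall>i<M. R (w i) (w (Suc i)))"
proof -
  obtain m where "(R ^^ m) x y" using assms(1) rtranclp_imp_relpowp by fastforce
  then obtain w where w: "w 0 = x" "w m = y" "\<forall>i<m. R (w i) (w (Suc i))" unfolding relpowp_fun_conv by blast
  show ?thesis
  proof (intro exI[of _ m] allI impI exI conjI)
    fix M assume M: "m \<le> M"
    show "w (min 0 m) = x" "w (min M m) = y" using w M by (simp_all add: min_def)
    show "R (w (min i m)) (w (min (Suc i) m))" if "i < M" for i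
    proof (cases "i < m")
      case True
      then show ?thesis using w(3) by (simp add: min_def)
    next
      case False
      then show ?thesis using w(2) assms(2) by (simp add: min_def)
    qed
  qed
qed

lemma tame_in_refl: "x \<in> B \<Longrightarrow> B \<subseteq> config_space \<Longrightarrow> walls x \<noteq> 0 \<Longrightarrow> tame_in B x x"
  unfolding tame_in_def tame_def by auto

lemma tame_in_rtranclp_regular:
  assumes "(tame_in B)\<^sup>*\<^sup>* x y" "walls x \<noteq> 0"
  shows "walls y \<noteq> 0"
  using assms by (induction rule: rtranclp_induct) (auto simp: tame_in_def tame_def)

text \<open>Vertices are regular, so at a zero of \<open>walls\<close> the current
  \<open>step\<close> is strictly inside its range, and the chain rule multiplies the derivative
  along the segment by a positive factor.\<close>

lemma transverse_poly_path:
  fixes v :: "nat \<Rightarrow> complex ^ 'n"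
  assumes N: "0 < N" and tame: "\<And>r. r < N \<Longrightarrow> tame (v r) (v (Suc r))"
  shows "transverse (poly_path N v)"
  unfolding transverse_def
proof (intro ballI impI)
  fix t :: real assume t: "t \<in> {0..1}" and 0: "walls (poly_path N v t) = 0"
  obtain r where r: "r < N" "real r \<le> real N * t" "real N * t \<le> real r + 1" using grid_index[OF N t] by blast
  define u where "u = step (real N * t - real r)"
  note tm = tame[OF r(1), unfolded tame_def]
  have e: "poly_path N v t = v r + u *\<^sub>R (v (Suc r) - v r)" unfolding u_def by (rule poly_path_eq[OF r])
  have "u \<noteq> 0" using 0 tm unfolding e by auto
  moreover have "u \<noteq> 1" using 0 tm unfolding e by auto
  ultimately have u: "real N * t - real r > 0" "real N * t - real r < 1"
    unfolding u_def using step_0 step_1 by (meson not_le)+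
  have u01: "u \<in> {0..1}" unfolding u_def using step_range by auto
  have "\<exists>D. D \<noteq> 0 \<and> ((\<lambda>t. walls (v r + t *\<^sub>R (v (Suc r) - v r))) has_real_derivative D) (at u)"
    using tm u01 0 unfolding e by blast
  then obtain D where D: "D \<noteq> 0" "((\<lambda>t. walls (v r + t *\<^sub>R (v (Suc r) - v r))) has_real_derivative D) (at u)" by (elim exE conjE)
  obtain E where E: "E > 0" "(step has_real_derivative E) (at (real N * t - real r))" using step_deriv_pos[OF u] by blast
  have "((\<lambda>s. real N * s - real r) has_real_derivative real N) (at t)" by (auto intro!: derivative_eq_intros)
  from DERIV_chain2[OF E(2) this]
  have "((\<lambda>s. step (real N * s - real r)) has_real_derivative E * real N) (at t)" .
  from DERIV_chain2[OF D(2)[unfolded u_def] this]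
  have "((\<lambda>s. walls (v r + step (real N * s - real r) *\<^sub>R (v (Suc r) - v r))) has_real_derivative D * (E * real N)) (at t)" .
  then have "((\<lambda>s. walls (poly_path N v s)) has_real_derivative D * (E * real N)) (at t)"
  proof (rule has_field_derivative_transform_within_open)
    show "open {s. real r < real N * s \<and> real N * s < real r + 1}"
      by (intro open_Collect_conj open_Collect_less continuous_intros)
    fix s assume "s \<in> {s. real r < real N * s \<and> real N * s < real r + 1}"
    then show "walls (v r + step (real N * s - real r) *\<^sub>R (v (Suc r) - v r)) = walls (poly_path N v s)"
      using poly_path_eq[OF r(1), of s v] by simp
  qed (use u in auto)
  moreover have "D * (E * real N) \<noteq> 0" using D(1) E(1) N by simp
  ultimately show "\<exists>D. D \<noteq> 0 \<and> ((\<lambda>s. walls (poly_path N v s)) has_real_derivative D) (at t within {0..1})"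
    by (meson has_field_derivative_at_within)
qed

definition tame_polygon :: "complex ^ 'n \<Rightarrow> nat \<Rightarrow> (nat \<Rightarrow> complex ^ 'n) \<Rightarrow> bool" where
  "tame_polygon b N v \<longleftrightarrow> 0 < N \<and> v 0 = b \<and> v N = b \<and> (\<forall>r<N. tame (v r) (v (Suc r)))"

lemma tame_polygon_motion:
  assumes "tame_polygon b N v"
  shows "motion b (poly_path N v)" "transverse (poly_path N v)"
proof -
  have N: "0 < N" "v 0 = b" "v N = b" and tame: "\<And>r. r < N \<Longrightarrow> tame (v r) (v (Suc r))"
    using assms unfolding tame_polygon_def by blast+
  show "transverse (poly_path N v)" by (rule transverse_poly_path) (fact N(1), rule tame)
  show "motion b (poly_path N v)"
  proof (rule motion_poly_path[OF N(2,3)])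
    fix t :: real assume "t \<in> {0..1}"
    from grid_index[OF N(1) this] obtain r where r: "r < N" "real r \<le> real N * t" "real N * t \<le> real r + 1" .
    have "poly_path N v t \<in> closed_segment (v r) (v (Suc r))"
      unfolding poly_path_eq[OF r] closed_segment_def using step_range[of "real N * t - real r"]
      by (auto intro!: exI[of _ "step (real N * t - real r)"] simp: algebra_simps)
    then show "poly_path N v t \<in> config_space" using tame[OF r(1)] unfolding tame_def by blast
  qed
qed

lemma polydisc_mono:
  assumes "x \<in> polydisc (z :: complex ^ 'n) r" "dist y z < s"
  shows "x \<in> polydisc y (r + s)"
  unfolding polydisc_def
proof (intro CollectI allI)
  fix i
  have "dist (z $ i) (x $ i) < r" using assms(1) by (simp add: polydisc_def)
  moreover have "dist (y $ i) (z $ i) \<le> dist y z" by (rule dist_vec_nth_le)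
  ultimately show "x $ i \<in> ball (y $ i) (r + s)"
    using assms(2) dist_triangle[of "y $ i" "x $ i" "z $ i"] by simp
qed

text \<open>The order of the quantifiers lets two motions share first \<open>L\<close> and then
  \<open>M\<close>, hence the number of edges. Near time \<open>k / N\<close> the motion is replaced
  by a chain of tame segments inside the polydisc \<open>B k\<close>. All this happens in polydiscs
  of radius \<open>q\<close> about the motion, where linear isotopies stay in the configuration
  space.\<close>

lemma ex_tame_polygon:
  fixes \<beta> :: "real \<Rightarrow> complex ^ 'n"
  assumes m: "motion b \<beta>" and b: "walls b \<noteq> 0"
  shows "\<exists>L0. \<forall>L\<ge>L0. \<exists>M0. \<forall>M\<ge>M0. \<exists>v. tame_polygon b (L * M) v \<and> isotopic b \<beta> (poly_path (L * M) v)"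
proof -
  note mp = motion_path[OF m]
  have c: "continuous_on {0..1} \<beta>" using mp(1) by (simp add: path_def)
  have "compact (\<beta> ` {0..1})" by (intro compact_continuous_image c) auto
  moreover have im: "\<beta> ` {0..1} \<subseteq> config_space" using m by (simp add: motion_def)
  ultimately obtain d where d: "d > 0" "\<And>x. x \<in> \<beta> ` {0..1} \<Longrightarrow> ball x d \<subseteq> config_space"
    using ball_config_uniform by metis
  define q where "q = d / real CARD('n)"
  have q: "q > 0" using d(1) by (simp add: q_def)
  have pd: "polydisc (\<beta> t) q \<subseteq> config_space" if "t \<in> {0..1}" for t
    using polydisc_subset_ball[OF d(1), of "\<beta> t"] d(2)[of "\<beta> t"] that unfolding q_def by blast
  have "continuous_on ({0 :: real} \<times> {0..1}) (\<lambda>(s, t). \<beta> t)"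
    unfolding case_prod_beta by (rule continuous_on_compose2[OF c]) (auto intro!: continuous_intros)
  from ex_grid[OF _ this, of "q / 2"] q obtain N0 where N0: "N0 > 0"
    "\<And>N s t t'. N0 \<le> N \<Longrightarrow> s \<in> {0 :: real} \<Longrightarrow> t \<in> {0..1} \<Longrightarrow> t' \<in> {0..1} \<Longrightarrow> \<bar>t' - t\<bar> \<le> 1 / real N \<Longrightarrow> dist (\<beta> t) (\<beta> t') < q / 2"
    using compact_sing by (metis half_gt_zero)
  show ?thesis
  proof (rule exI[of _ "Suc N0"], rule allI, rule impI)
    fix L assume L: "Suc N0 \<le> L"
    \<comment> \<open>There are \<open>N + 1\<close> chains: for \<open>k < N\<close> one that leads
      inside \<open>B k\<close> to a point of \<open>B (Suc k)\<close>, and a last one inside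
      \<open>B N\<close> that returns exactly to \<open>b\<close>.\<close>
    then obtain N where N: "L = Suc N" "N0 \<le> N" "0 < N" using N0(1) by (cases L) auto
    have near: "dist (\<beta> t) (\<beta> t') < q / 2" if "t \<in> {0..1}" "t' \<in> {0..1}" "\<bar>t' - t\<bar> \<le> 1 / real N" for t t'
      using N0(2)[OF N(2) _ that] by simp
    define c where "c = (\<lambda>k. \<beta> (real k / real N))"
    define B where "B = (\<lambda>k. polydisc (c k) (q / 2))"
    have k01: "real k / real N \<in> {0..1}" if "k \<le> N" for k using that N(3) by (auto simp: field_simps)
    have cc: "dist (c k) (c (Suc k)) < q / 2" if "k < N" for k
      unfolding c_def using that N(3) by (intro near k01) (auto simp: add_divide_distrib)
    have Bq: "B k \<subseteq> polydisc (\<beta> t) q" if "k \<le> N" "t \<in> {0..1}" "\<bar>real k / real N - t\<bar> \<le> 1 / real N" for k t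
      using polydisc_mono[of _ "c k" "q / 2" "\<beta> t" "q / 2"] near[OF that(2) k01[OF that(1)] that(3)]
      unfolding B_def c_def by auto
    have Bc: "B k \<subseteq> config_space" if "k \<le> N" for k
    proof -
      have "B k \<subseteq> polydisc (\<beta> (real k / real N)) q" by (rule Bq[OF that k01[OF that]]) simp
      then show ?thesis using pd[OF k01[OF that]] by blast
    qed
    have Bb: "b \<in> B 0" "b \<in> B N"
      using mp(3,4) q N(3) by (simp_all add: B_def c_def polydisc_def pathstart_def pathfinish_def)
    have box: "B k = box_of (\<lambda>i. ball (c k $ i) (q / 2))" for k unfolding B_def by (rule polydisc_box)
    have "\<exists>y. (tame_in (B k))\<^sup>*\<^sup>* x y \<and> y \<in> B k \<and> walls y \<noteq> 0 \<and> y \<in> B (Suc k)"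
      if k: "k < N" and x: "x \<in> B k" "walls x \<noteq> 0" for k x
    proof -
      have "ball (c (Suc k) $ i) (q / 2) \<inter> ball (c k $ i) (q / 2) \<noteq> {}" for i
      proof -
        have "dist (c (Suc k) $ i) (c k $ i) \<le> dist (c (Suc k)) (c k)" by (rule dist_vec_nth_le)
        then have "c k $ i \<in> ball (c (Suc k) $ i) (q / 2) \<inter> ball (c k $ i) (q / 2)" using cc[OF k] q by (simp add: dist_commute)
        then show ?thesis by blast
      qed
      from tame_approach[OF _ _ Bc[of k, unfolded box] _ this x[unfolded box]] k
      show ?thesis unfolding box by simp
    qed
    then have "\<forall>k x. \<exists>y. k < N \<and> x \<in> B k \<and> walls x \<noteq> 0 \<longrightarrow> (tame_in (B k))\<^sup>*\<^sup>* x y \<and> walls y \<noteq> 0 \<and> y \<in> B (Suc k)" by blast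
    then obtain nx where nx: "\<forall>k x. k < N \<and> x \<in> B k \<and> walls x \<noteq> 0 \<longrightarrow>
        (tame_in (B k))\<^sup>*\<^sup>* x (nx k x) \<and> walls (nx k x) \<noteq> 0 \<and> nx k x \<in> B (Suc k)" by metis
    define x where "x = (\<lambda>k. if k = L then b else rec_nat b nx k)"
    have x0: "x 0 = b" "x L = b" using N by (simp_all add: x_def)
    have xS: "x (Suc k) = nx k (x k)" if "k < N" for k using that N(1) by (simp add: x_def)
    have xr: "x k \<in> B k \<and> walls (x k) \<noteq> 0" if "k \<le> N" for k
      using that
    proof (induction k)
      case 0
      then show ?case using x0 Bb b by simp
    next
      case (Suc k)
      then show ?case using spec[OF spec[OF nx, of k], of "x k"] xS[of k] by simp
    qed
    have chain: "(tame_in (B k))\<^sup>*\<^sup>* (x k) (x (Suc k)) \<and> x (Suc k) \<in> B k" if k: "k < L" for k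
    proof (cases "k < N")
      case True
      have r: "(tame_in (B k))\<^sup>*\<^sup>* (x k) (x (Suc k))" using spec[OF spec[OF nx, of k], of "x k"] xr[of k] xS[OF True] True by simp
      then have "x (Suc k) \<in> B k"
        by (cases rule: rtranclp.cases) (use xr[of k] True in \<open>auto simp: tame_in_def\<close>)
      with r show ?thesis by blast
    next
      case False
      then have k: "k = N" using k N(1) by simp
      have "(tame_in (B N))\<^sup>*\<^sup>* (x N) b"
        unfolding box by (rule regular_connected) (use Bc[of N] xr[of N] Bb b in \<open>simp_all add: box\<close>)
      then show ?thesis using k x0 N(1) Bb by simp
    qed
    have "\<exists>m. \<forall>M\<ge>m. \<exists>w. w 0 = x k \<and> w M = x (Suc k) \<and> (\<forall>i<M. tame_in (B k) (w i) (w (Suc i)))" if k: "k < L" for k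
    proof (rule rtranclp_padded)
      show r: "(tame_in (B k))\<^sup>*\<^sup>* (x k) (x (Suc k))" using chain[OF k] by blast
      have "k \<le> N" using k N(1) by simp
      then show "tame_in (B k) (x (Suc k)) (x (Suc k))"
        using chain[OF k] Bc tame_in_rtranclp_regular[OF r] xr by (intro tame_in_refl) auto
    qed
    then have "\<forall>k\<in>{..<L}. \<exists>m. \<forall>M\<ge>m. \<exists>w. w 0 = x k \<and> w M = x (Suc k) \<and> (\<forall>i<M. tame_in (B k) (w i) (w (Suc i)))" by simp
    from bchoice[OF this] obtain ms where ms: "\<forall>k\<in>{..<L}. \<forall>M\<ge>ms k. \<exists>w. w 0 = x k \<and> w M = x (Suc k) \<and> (\<forall>i<M. tame_in (B k) (w i) (w (Suc i)))" ..
    define M0 where "M0 = Max (insert 1 (ms ` {..<L}))"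
    have M0: "1 \<le> M0" "ms k \<le> M0" if "k < L" for k using that unfolding M0_def by auto
    show "\<exists>M0. \<forall>M\<ge>M0. \<exists>v. tame_polygon b (L * M) v \<and> isotopic b \<beta> (poly_path (L * M) v)"
    proof (intro exI[of _ M0] allI impI)
      fix M assume M: "M0 \<le> M"
      have Mpos: "0 < M" using M M0(1)[of 0] N(1) by simp
      have "\<exists>v. v 0 = x 0 \<and> v (L * M) = x L \<and> (\<forall>j<L * M. tame_in (B (j div M)) (v j) (v (Suc j)))"
      proof (rule ex_vertices[OF Mpos])
        fix k assume k: "k < L"
        have "ms k \<le> M" using M0(2)[OF k] M by simp
        with bspec[OF ms, of k] k show "\<exists>w. w 0 = x k \<and> w M = x (Suc k) \<and> (\<forall>i<M. tame_in (B k) (w i) (w (Suc i)))" by simp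
      qed
      then obtain v where v: "v 0 = b" "v (L * M) = b" "\<forall>j<L * M. tame_in (B (j div M)) (v j) (v (Suc j))" using x0 by auto
      have pos: "0 < L * M" using Mpos N(1) by simp
      have poly: "tame_polygon b (L * M) v" using v pos unfolding tame_polygon_def tame_in_def by blast
      have near_p: "poly_path (L * M) v t \<in> polydisc (\<beta> t) q" if t: "t \<in> {0..1}" for t
      proof (rule poly_path_convex[OF pos t])
        show "convex (polydisc (\<beta> t) q)" unfolding polydisc_box by (intro convex_box_of) simp
        fix r assume r: "r < L * M" "real r \<le> real (L * M) * t" "real (L * M) * t \<le> real r + 1"
        define k where "k = r div M"
        have k: "k < L" unfolding k_def using r(1) by (simp add: less_mult_imp_div_less)
        have "k * M \<le> r" unfolding k_def by simp
        then have "real k * real M \<le> real r" by (metis of_nat_le_iff of_nat_mult)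
        then have "real k * real M \<le> (real L * t) * real M" using r(2) by (simp add: algebra_simps)
        then have lo: "real k \<le> real L * t" using Mpos by simp
        have "r = k * M + r mod M" "r mod M < M" using Mpos by (simp_all add: k_def)
        then have "r + 1 \<le> (k + 1) * M" by simp
        then have "real (r + 1) \<le> real ((k + 1) * M)" by (simp only: of_nat_le_iff)
        then have "real r + 1 \<le> (real k + 1) * real M" by (simp only: of_nat_mult of_nat_add of_nat_1)
        then have "(real L * t) * real M \<le> (real k + 1) * real M" using r(3) by (simp add: algebra_simps)
        then have hi: "real L * t \<le> real k + 1" using Mpos by simp
        \<comment> \<open>The polygon runs through \<open>N + 1\<close> chains while the motion is
          sampled at multiples of \<open>1 / N\<close>; the discrepancy in time is at most
          \<open>1 / N\<close>.\<close>
        have "real k - 1 \<le> real N * t" "real N * t \<le> real k + 1" using lo hi t N(1) by (auto simp: algebra_simps)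
        then have "\<bar>real k / real N - t\<bar> \<le> 1 / real N"
          using N(3) by (simp add: abs_le_iff field_simps)
        then have "B k \<subseteq> polydisc (\<beta> t) q" using Bq[of k t] k N(1) t by simp
        moreover have "tame_in (B k) (v r) (v (Suc r))" using v(3) r(1) unfolding k_def by blast
        ultimately show "v r \<in> polydisc (\<beta> t) q \<and> v (Suc r) \<in> polydisc (\<beta> t) q" unfolding tame_in_def by blast
      qed
      have "isotopic b \<beta> (poly_path (L * M) v)"
      proof (rule isotopic_linear[OF m tame_polygon_motion(1)[OF poly]])
        fix t :: real assume t: "t \<in> {0..1}"
        have "closed_segment (\<beta> t) (poly_path (L * M) v t) \<subseteq> polydisc (\<beta> t) q"
        proof (rule closed_segment_subset[OF _ near_p[OF t]])
          show "convex (polydisc (\<beta> t) q)" unfolding polydisc_box by (intro convex_box_of) simp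
          show "\<beta> t \<in> polydisc (\<beta> t) q" using q by (simp add: polydisc_def)
        qed
        then show "closed_segment (\<beta> t) (poly_path (L * M) v t) \<subseteq> config_space" using pd[OF t] by blast
      qed
      then show "\<exists>v. tame_polygon b (L * M) v \<and> isotopic b \<beta> (poly_path (L * M) v)" using poly by blast
    qed
  qed
qed

lemma ex_tame_polygon_pair:
  fixes \<beta> \<gamma> :: "real \<Rightarrow> complex ^ 'n"
  assumes "motion b \<beta>" "motion b \<gamma>" "walls b \<noteq> 0"
  shows "\<exists>N v w. tame_polygon b N v \<and> isotopic b \<beta> (poly_path N v) \<and> tame_polygon b N w \<and> isotopic b \<gamma> (poly_path N w)"
proof -
  obtain L1 where L1: "\<forall>L\<ge>L1. \<exists>M0. \<forall>M\<ge>M0. \<exists>v. tame_polygon b (L * M) v \<and> isotopic b \<beta> (poly_path (L * M) v)"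
    using ex_tame_polygon[OF assms(1,3)] ..
  obtain L2 where L2: "\<forall>L\<ge>L2. \<exists>M0. \<forall>M\<ge>M0. \<exists>v. tame_polygon b (L * M) v \<and> isotopic b \<gamma> (poly_path (L * M) v)"
    using ex_tame_polygon[OF assms(2,3)] ..
  define L where "L = max L1 L2"
  obtain M1 where M1: "\<forall>M\<ge>M1. \<exists>v. tame_polygon b (L * M) v \<and> isotopic b \<beta> (poly_path (L * M) v)"
    using L1[rule_format, of L] unfolding L_def by auto
  obtain M2 where M2: "\<forall>M\<ge>M2. \<exists>v. tame_polygon b (L * M) v \<and> isotopic b \<gamma> (poly_path (L * M) v)"
    using L2[rule_format, of L] unfolding L_def by auto
  show ?thesis using M1[rule_format, of "max M1 M2"] M2[rule_format, of "max M1 M2"] by (meson max.cobounded1 max.cobounded2)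
qed

section \<open>Motions in general position change sides at critical moments\<close>

text \<open>\<open>d\<close> is \<open>1 + c\<close> times the vector from the centre
  \<open>p / (1 + c)\<close> of the circle to its point \<open>u\<close>; along this radius the
  polynomial changes sign at \<open>t = 0\<close>.\<close>

lemma circ_ray:
  assumes "cmod p = 1" "circ p c u = 0"
  defines "d \<equiv> of_real (1 + c) * u - p"
  shows "cmod d = \<bar>c\<bar>" "circ p c (u + t *\<^sub>R d) = c\<^sup>2 * t * (2 + (1 + c) * t)"
proof -
  obtain a b where u: "u = Complex a b" by (cases u)
  obtain x y where p: "p = Complex x y" by (cases p)
  have P: "x\<^sup>2 + y\<^sup>2 = 1" using assms(1) unfolding p by (simp add: cmod_def)
  have E: "(1 + c) * (a\<^sup>2 + b\<^sup>2) - 2 * (a * x + b * y) + (1 - c) = 0"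
    using assms(2) unfolding circ_def u p cmod_power2 by (simp add: algebra_simps)
  have d: "d = Complex ((1 + c) * a - x) ((1 + c) * b - y)" unfolding d_def u p by (simp add: complex_eq_iff)
  have "((1 + c) * a - x)\<^sup>2 + ((1 + c) * b - y)\<^sup>2 =
      c\<^sup>2 + (1 + c) * ((1 + c) * (a\<^sup>2 + b\<^sup>2) - 2 * (a * x + b * y) + (1 - c)) + (x\<^sup>2 + y\<^sup>2 - 1)"
    by (simp add: power2_eq_square algebra_simps)
  then have D: "((1 + c) * a - x)\<^sup>2 + ((1 + c) * b - y)\<^sup>2 = c\<^sup>2" using P E by simp
  then show "cmod d = \<bar>c\<bar>" unfolding d by (simp add: cmod_def)
  have "circ p c (u + t *\<^sub>R d) = ((1 + c) * (a\<^sup>2 + b\<^sup>2) - 2 * (a * x + b * y) + (1 - c)) +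
      (2 * t + (1 + c) * t\<^sup>2) * (((1 + c) * a - x)\<^sup>2 + ((1 + c) * b - y)\<^sup>2)"
    unfolding circ_def d u p cmod_power2 by (simp add: power2_eq_square algebra_simps)
  then show "circ p c (u + t *\<^sub>R d) = c\<^sup>2 * t * (2 + (1 + c) * t)"
    unfolding D E by (simp add: power2_eq_square algebra_simps)
qed

text \<open>Only the third point of the aligned triple is moved, along the radius of its circle
  inwards or outwards; \<open>side\<close> changes sign and the remaining factor \<open>H\<close>
  does not.\<close>

lemma ex_opposite_side:
  fixes w :: "complex ^ 'n"
  assumes w: "w \<in> config_space" "critical_triples w = {T}" and e: "e > 0" and \<sigma>: "\<sigma> \<noteq> 0"
  shows "\<exists>y. dist w y < e \<and> \<sigma> * walls y < 0"
proof -
  obtain a where a: "aligned w a" using critical_aligned[OF w(1), of T] w(2) by blast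
  obtain i j k where ijk: "a = (i, j, k)" by (cases a)
  note A = alignedD[OF w(1) a[unfolded ijk]]
  define p where "p = pt w i j"
  define c where "c = level (w $ i) p"
  have "side (w $ i) (w $ j) (w $ k) = 0" using A(4) by (simp add: side_def pt_def)
  then obtain H where H: "continuous_on config_space H" "H w \<noteq> 0"
    and wH: "\<And>y. y \<in> config_space \<Longrightarrow> walls y = side (y $ i) (y $ j) (y $ k) * H y"
    using walls_factor[OF w(1) _ A(1), of T] w(2) by (metis order_refl)
  have p1: "cmod p = 1" using A(2) by (simp add: p_def)
  have c0: "c > 0" unfolding c_def by (rule level_pos[OF p1 config_spaceD(1)[OF w(1)]])
  have wk: "cmod (w $ k) < 1" by (rule config_spaceD(1)[OF w(1)])
  have "level (w $ k) p - c = 0" using A(4) by (simp add: p_def c_def)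
  then have circ0: "circ p c (w $ k) = 0"
    unfolding level_circ[OF wk] using cmod_less_1[OF wk] by auto
  define d where "d = of_real (1 + c) * (w $ k) - p"
  note ray = circ_ray[OF p1 circ0, folded d_def]
  have "open {y \<in> config_space. H y * H w > 0}"
  proof -
    have "open (config_space \<inter> (\<lambda>y. H y * H w) -` {0<..})"
      by (intro continuous_open_preimage open_config_space continuous_intros H(1))
    moreover have "{y \<in> config_space. H y * H w > 0} = config_space \<inter> (\<lambda>y. H y * H w) -` {0<..}" by auto
    ultimately show ?thesis by simp
  qed
  then have op: "open (ball w e \<inter> {y \<in> config_space. H y * H w > 0})" by (rule open_Int[OF open_ball])
  have "H w * H w > 0" using H(2) by (metis not_real_square_gt_zero)
  then have "w \<in> ball w e \<inter> {y \<in> config_space. H y * H w > 0}" using e w(1) by simp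
  from open_contains_polydisc[OF op this]
  obtain r where r: "r > 0" "polydisc w r \<subseteq> ball w e \<inter> {y \<in> config_space. H y * H w > 0}" by (elim exE conjE)
  \<comment> \<open>The first bound keeps the moved point within \<open>r\<close>, as
    \<open>|d| = c\<close>; the second keeps the factor \<open>2 + (1 + c) * t\<close>
    positive.\<close>
  define t0 where "t0 = min (r / (2 * c)) (1 / (1 + c))"
  have t0: "t0 > 0" using r(1) c0 by (simp add: t0_def)
  have "\<bar>t\<bar> * c < r" "2 + (1 + c) * t > 0" if t: "\<bar>t\<bar> = t0" for t
  proof -
    have "t0 * c \<le> r / (2 * c) * c" using c0 by (intro mult_right_mono) (simp_all add: t0_def)
    then show "\<bar>t\<bar> * c < r" using t c0 r(1) by simp
    have "(1 + c) * t0 \<le> (1 + c) * (1 / (1 + c))" using c0 by (intro mult_left_mono) (simp_all add: t0_def)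
    then have "(1 + c) * t0 \<le> 1" using c0 by simp
    moreover have "(1 + c) * (- t0) \<le> (1 + c) * t" using t c0 by (intro mult_left_mono) auto
    ultimately show "2 + (1 + c) * t > 0" by linarith
  qed
  note tb = this
  have main: "walls (upd w k (w $ k + t *\<^sub>R d)) * (t * H w) > 0 \<and> upd w k (w $ k + t *\<^sub>R d) \<in> ball w e" if t: "\<bar>t\<bar> = t0" for t
  proof -
    define y where "y = upd w k (w $ k + t *\<^sub>R d)"
    have "y $ l \<in> ball (w $ l) r" for l
      using tb(1)[OF t] ray(1) c0 r(1) by (simp add: y_def dist_norm)
    then have "y \<in> polydisc w r" by (simp add: polydisc_def)
    then have y: "y \<in> ball w e" "y \<in> config_space" "H y * H w > 0" using r(2) by auto
    have yk: "y $ k = w $ k + t *\<^sub>R d" "cmod (w $ k + t *\<^sub>R d) < 1"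
      using config_spaceD(1)[OF y(2), of k] by (simp_all add: y_def)
    have "side (y $ i) (y $ j) (y $ k) = circ p c (w $ k + t *\<^sub>R d) / (1 - (cmod (w $ k + t *\<^sub>R d))\<^sup>2)"
      using side_upd[of i k j "w $ k + t *\<^sub>R d" w] yk(2) A(1) unfolding y_def p_def c_def by simp
    also have "\<dots> = c\<^sup>2 * t * (2 + (1 + c) * t) / (1 - (cmod (w $ k + t *\<^sub>R d))\<^sup>2)" by (simp add: ray(2))
    finally have s: "side (y $ i) (y $ j) (y $ k) * t = c\<^sup>2 * (t * t) * (2 + (1 + c) * t) / (1 - (cmod (w $ k + t *\<^sub>R d))\<^sup>2)"
      by (simp add: algebra_simps)
    have tt: "t * t > 0" using t t0 by (auto simp: zero_less_mult_iff abs_if split: if_splits)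
    have "side (y $ i) (y $ j) (y $ k) * t > 0"
      unfolding s using c0 tt tb(2)[OF t] cmod_less_1[OF yk(2)]
      by (intro divide_pos_pos mult_pos_pos[OF mult_pos_pos[OF _ tt]]) auto
    then have "(side (y $ i) (y $ j) (y $ k) * t) * (H y * H w) > 0" using y(3) by (rule mult_pos_pos)
    then have "walls y * (t * H w) > 0" unfolding wH[OF y(2)] by (simp add: mult_ac)
    with y(1) show ?thesis by (simp add: y_def)
  qed
  have "\<exists>t. \<bar>t\<bar> = t0 \<and> \<sigma> * (t * H w) < 0"
  proof (cases "\<sigma> * H w > 0")
    case True
    then have "\<sigma> * H w * (- t0) < 0" using t0 by (intro mult_pos_neg) auto
    then show ?thesis using t0 by (intro exI[of _ "- t0"]) (auto simp: mult_ac)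
  next
    case False
    then have "\<sigma> * H w < 0" using \<sigma> H(2) by (simp add: not_less order_less_le)
    then have "\<sigma> * H w * t0 < 0" using t0 by (rule mult_neg_pos)
    then show ?thesis using t0 by (intro exI[of _ t0]) (auto simp: mult_ac)
  qed
  then obtain t where t: "\<bar>t\<bar> = t0" "\<sigma> * (t * H w) < 0" by blast
  define y where "y = upd w k (w $ k + t *\<^sub>R d)"
  have m: "walls y * (t * H w) > 0" "dist w y < e" using main[OF t(1)] by (simp_all add: y_def)
  have "\<sigma> * walls y < 0"
  proof -
    have "(\<sigma> * (t * H w)) * (walls y * (t * H w)) < 0" using t(2) m(1) by (rule mult_neg_pos)
    then have "(\<sigma> * walls y) * ((t * H w) * (t * H w)) < 0" by (simp add: mult_ac)
    then show ?thesis by (auto simp: mult_less_0_iff)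
  qed
  with m(2) show ?thesis by blast
qed

lemma bounded_derivative:
  assumes "smooth_path \<phi>"
  shows "\<exists>C>0. \<forall>t\<in>{0..1}. norm (\<phi> t) \<le> C \<and> norm (velocity \<phi> t) \<le> C"
proof -
  have "bounded (\<phi> ` {0..1})" "bounded (velocity \<phi> ` {0..1})"
    by (intro compact_imp_bounded compact_continuous_image smooth_path_continuous smooth_path_velocity(2) assms compact_Icc)+
  then obtain C1 C2 where "\<forall>x\<in>\<phi> ` {0..1}. norm x \<le> C1" "\<forall>x\<in>velocity \<phi> ` {0..1}. norm x \<le> C2"
    unfolding bounded_iff by (elim exE)
  then have "\<forall>t\<in>{0..1}. norm (\<phi> t) \<le> max 1 (max C1 C2) \<and> norm (velocity \<phi> t) \<le> max 1 (max C1 C2)"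
    by (auto simp: le_max_iff_disj)
  then show ?thesis by (intro exI[of _ "max 1 (max C1 C2)"]) simp
qed

text \<open>The product of two copies of \<open>flat 0\<close>, rising at \<open>l\<close> and
  mirrored at \<open>r\<close>, normalised at \<open>t\<close>.\<close>

lemma ex_bump:
  assumes "0 \<le> l" "l < t" "t < r" "r \<le> (1 :: real)"
  shows "\<exists>\<phi> :: real \<Rightarrow> real. smooth_path \<phi> \<and> \<phi> t = 1 \<and> (\<forall>s. s \<notin> {l<..<r} \<longrightarrow> \<phi> s = 0)"
proof -
  define K where "K = flat 0 (t - l) * flat 0 (r - t)"
  have K: "K > 0" unfolding K_def using assms by (intro mult_pos_pos flat_pos) auto
  define \<phi> where "\<phi> = (\<lambda>s. (flat 0 (1 * s + - l) * flat 0 (- 1 * s + r)) * (1 / K))"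
  have "smooth_on (\<lambda>s. flat 0 (1 * s + - l)) {0..1}" "smooth_on (\<lambda>s. flat 0 (- 1 * s + r)) {0..1}"
    by (rule smooth_affine[OF smooth_flat])+
  from smooth_mult[OF smooth_mult[OF this] smooth_const]
  have "smooth_path \<phi>" unfolding smooth_path_iff \<phi>_def .
  moreover have "\<phi> t = 1"
  proof -
    have "flat 0 (t - l) \<noteq> 0" "flat 0 (r - t) \<noteq> 0" using assms by (simp_all add: flat_def)
    then show ?thesis by (simp add: \<phi>_def K_def)
  qed
  moreover have "\<phi> s = 0" if "s \<notin> {l<..<r}" for s
    using that by (auto simp: \<phi>_def flat_def)
  ultimately show ?thesis by blast
qed

lemma velocity_add_scaleR:
  assumes "smooth_path \<beta>" "smooth_path \<phi>" "t \<in> {0..1}"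
  shows "velocity (\<lambda>s. \<beta> s + \<phi> s *\<^sub>R v) t = velocity \<beta> t + velocity \<phi> t *\<^sub>R v"
proof -
  have "((\<lambda>s. \<phi> s *\<^sub>R v) has_vector_derivative velocity \<phi> t *\<^sub>R v) (at t within {0..1})"
    by (rule bounded_linear.has_vector_derivative[OF bounded_linear_scaleR_left smooth_path_velocity(1)[OF assms(2,3)]])
  then have "((\<lambda>s. \<beta> s + \<phi> s *\<^sub>R v) has_vector_derivative velocity \<beta> t + velocity \<phi> t *\<^sub>R v) (at t within {0..1})"
    by (intro has_vector_derivative_add smooth_path_velocity(1) assms)
  from vector_derivative_within_cbox[OF _ _ this[folded box_real(2)]] assms(3) show ?thesis by simp
qed

text \<open>
  If the motion stayed on one side at a critical moment, a small bump would push it to the other side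
  there and create an additional critical moment.
\<close>

lemma general_position_good:
  fixes \<beta> :: "real \<Rightarrow> complex ^ 'n"
  assumes gp: "general_position b \<beta>" and b: "walls b \<noteq> 0"
  shows "good_path \<beta>"
proof -
  have m: "motion b \<beta>" and fin: "finite (critical_moments \<beta>)"
    and single: "\<forall>t\<in>critical_moments \<beta>. \<exists>!T. T \<in> critical_triples (\<beta> t)"
    and st: "\<exists>\<epsilon>>0. \<forall>\<gamma>. motion b \<gamma> \<and> C1_close \<epsilon> \<beta> \<gamma> \<longrightarrow>
        finite (critical_moments \<gamma>) \<and> card (critical_moments \<gamma>) = card (critical_moments \<beta>)"
    using gp unfolding general_position_def by blast+
  have sm: "smooth_path \<beta>" and im: "\<beta> ` {0..1} \<subseteq> config_space" and e01: "\<beta> 0 = b" "\<beta> 1 = b" using m by (auto simp: motion_def)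
  note cm = critical_moments_walls[OF im]
  have ends: "walls (\<beta> 0) \<noteq> 0" "walls (\<beta> 1) \<noteq> 0" using b e01 by auto
  obtain \<epsilon> where \<epsilon>: "\<epsilon> > 0" "\<forall>\<gamma>. motion b \<gamma> \<and> C1_close \<epsilon> \<beta> \<gamma> \<longrightarrow>
      finite (critical_moments \<gamma>) \<and> card (critical_moments \<gamma>) = card (critical_moments \<beta>)" using st by blast
  have one: "\<exists>T. critical_triples (\<beta> t) = {T}" if "t \<in> critical_moments \<beta>" for t
    using bspec[OF single that] by blast
  have sc: "sign_change \<beta> t" if t: "t \<in> critical_moments \<beta>" for t
  proof (rule ccontr)
    assume ns: "\<not> sign_change \<beta> t"
    have t01: "t \<in> {0..1}" "walls (\<beta> t) = 0" using t by (auto simp: cm)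
    obtain T where T: "critical_triples (\<beta> t) = {T}" using one[OF t] by blast
    obtain \<rho> where \<rho>: "\<rho> > 0" "\<forall>x\<in>critical_moments \<beta>. x \<noteq> t \<longrightarrow> \<rho> \<le> dist t x" using finite_set_avoid[OF fin] by blast
    have "\<exists>l\<in>{0..1}. \<exists>r\<in>{0..1}. t - \<rho> < l \<and> l < t \<and> t < r \<and> r < t + \<rho> \<and> \<not> walls (\<beta> l) * walls (\<beta> r) < 0"
      using ns \<rho>(1) unfolding sign_change_def by blast
    then obtain l r where lr: "l \<in> {0..1}" "r \<in> {0..1}" "t - \<rho> < l" "l < t" "t < r" "r < t + \<rho>"
      "\<not> walls (\<beta> l) * walls (\<beta> r) < 0" by blast
    have reg: "walls (\<beta> s) \<noteq> 0" if "s \<in> {0..1}" "t - \<rho> < s" "s < t + \<rho>" "s \<noteq> t" for s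
    proof
      assume "walls (\<beta> s) = 0"
      then have "s \<in> critical_moments \<beta>" using that(1) by (simp add: cm)
      then show False using bspec[OF \<rho>(2)] that by (fastforce simp: dist_real_def)
    qed
    have l0: "walls (\<beta> l) \<noteq> 0" by (rule reg[OF lr(1,3)]) (use lr(4) \<rho>(1) in linarith)+
    have r0: "walls (\<beta> r) \<noteq> 0" by (rule reg[OF lr(2) _ lr(6)]) (use lr(5) \<rho>(1) in linarith)+
    have lrp: "walls (\<beta> l) * walls (\<beta> r) > 0" using lr(7) l0 r0 by (simp add: not_less order_less_le)
    have "\<exists>\<phi> :: real \<Rightarrow> real. smooth_path \<phi> \<and> \<phi> t = 1 \<and> (\<forall>s. s \<notin> {l<..<r} \<longrightarrow> \<phi> s = 0)"
      by (rule ex_bump) (use lr(1,2,4,5) in simp_all)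
    then obtain \<phi> :: "real \<Rightarrow> real" where "smooth_path \<phi> \<and> \<phi> t = 1 \<and> (\<forall>s. s \<notin> {l<..<r} \<longrightarrow> \<phi> s = 0)" ..
    then have \<phi>: "smooth_path \<phi>" "\<phi> t = 1" "\<And>s. s \<notin> {l<..<r} \<Longrightarrow> \<phi> s = 0" by simp_all
    obtain C where "C > 0 \<and> (\<forall>t\<in>{0..1}. norm (\<phi> t) \<le> C \<and> norm (velocity \<phi> t) \<le> C)"
      using bounded_derivative[OF \<phi>(1)] ..
    then have C: "C > 0" "\<And>t. t \<in> {0..1} \<Longrightarrow> norm (\<phi> t) \<le> C" "\<And>t. t \<in> {0..1} \<Longrightarrow> norm (velocity \<phi> t) \<le> C"
      by simp_all
    have "compact (\<beta> ` {0..1})" by (intro compact_continuous_image smooth_path_continuous[OF sm] compact_Icc)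
    then obtain d where d: "d > 0" "\<And>x. x \<in> \<beta> ` {0..1} \<Longrightarrow> ball x d \<subseteq> config_space"
      using ball_config_uniform im by metis
    \<comment> \<open>At this amplitude a bump whose values and velocity are bounded by
      \<open>C\<close> stays \<open>C1\<close>-close to the motion and inside the configuration
      space.\<close>
    have "min \<epsilon> d / C > 0" using \<epsilon>(1) d(1) C(1) by simp
    moreover have "\<beta> t \<in> config_space" using im t01(1) by blast
    ultimately obtain y where y: "dist (\<beta> t) y < min \<epsilon> d / C" "walls (\<beta> l) * walls y < 0"
      using ex_opposite_side[OF _ T _ l0] by blast
    define v where "v = y - \<beta> t"
    have v: "C * norm v < \<epsilon>" "C * norm v < d"
      using y(1) C(1) by (simp_all add: v_def dist_norm norm_minus_commute field_simps)
    have small: "norm (a *\<^sub>R v) < \<epsilon>" "norm (a *\<^sub>R v) < d" if "norm a \<le> C" for a :: real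
      using mult_right_mono[OF that, of "norm v"] v by auto
    define \<gamma> where "\<gamma> = (\<lambda>s. \<beta> s + \<phi> s *\<^sub>R v)"
    have off: "\<gamma> s = \<beta> s" if "s \<notin> {l<..<r}" for s using \<phi>(3)[OF that] by (simp add: \<gamma>_def)
    have \<gamma>t: "\<gamma> t = y" by (simp add: \<gamma>_def \<phi>(2) v_def)
    have \<gamma>c: "\<gamma> s \<in> config_space" if s: "s \<in> {0..1}" for s
    proof -
      have "dist (\<beta> s) (\<gamma> s) < d" using small(2)[OF C(2)[OF s]] by (simp add: \<gamma>_def dist_norm)
      then show ?thesis using d(2)[of "\<beta> s"] s by auto
    qed
    have sm\<gamma>: "smooth_path \<gamma>"
      using sm \<phi>(1) unfolding smooth_path_iff \<gamma>_def by (intro smooth_add smooth_scaleR smooth_const)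
    have mot: "motion b \<gamma>"
      unfolding motion_def using sm\<gamma> \<gamma>c off[of 0] off[of 1] lr(1,2) e01 by auto
    have "C1_close \<epsilon> \<beta> \<gamma>"
      unfolding C1_close_def
    proof (intro ballI conjI)
      fix s :: real assume s: "s \<in> {0..1}"
      show "norm (\<gamma> s - \<beta> s) < \<epsilon>" using small(1)[OF C(2)[OF s]] by (simp add: \<gamma>_def)
      show "norm (velocity \<gamma> s - velocity \<beta> s) < \<epsilon>"
        using small(1)[OF C(3)[OF s]] velocity_add_scaleR[OF sm \<phi>(1) s, of v] by (simp add: \<gamma>_def)
    qed
    then have cnt: "finite (critical_moments \<gamma>)" "card (critical_moments \<gamma>) = card (critical_moments \<beta>)" using \<epsilon>(2) mot by blast+
    have im\<gamma>: "\<gamma> ` {0..1} \<subseteq> config_space" using \<gamma>c by blast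
    note cm\<gamma> = critical_moments_walls[OF im\<gamma>]
    have cw: "continuous_on {0..1} (\<lambda>s. walls (\<beta> l) * walls (\<gamma> s))"
      by (intro continuous_intros continuous_on_compose2[OF continuous_walls smooth_path_continuous[OF sm\<gamma>]] im\<gamma>)
    have "walls (\<beta> l) * walls (\<beta> l) > 0" using l0 by (metis not_real_square_gt_zero)
    then have wl: "walls (\<beta> l) * walls (\<gamma> l) > 0" using off[of l] by simp
    have wr: "walls (\<beta> l) * walls (\<gamma> r) > 0" using lrp off[of r] by simp
    have wt: "walls (\<beta> l) * walls (\<gamma> t) < 0" using y(2) \<gamma>t by simp
    \<comment> \<open>The pushed motion is on the old side at \<open>l\<close> and \<open>r\<close>
      and on the other side at \<open>t\<close>. So two critical moments take the place of the one
      at \<open>t\<close>, while those outside the support of the bump remain.\<close>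
    have "continuous_on {l..t} (\<lambda>s. walls (\<beta> l) * walls (\<gamma> s))" by (rule continuous_on_subset[OF cw]) (use lr t01 in auto)
    then obtain s1 where s1: "l \<le> s1" "s1 \<le> t" "walls (\<beta> l) * walls (\<gamma> s1) = 0"
      using IVT2'[of "\<lambda>s. walls (\<beta> l) * walls (\<gamma> s)" t 0 l] wl wt lr(4) by auto
    have "continuous_on {t..r} (\<lambda>s. walls (\<beta> l) * walls (\<gamma> s))" by (rule continuous_on_subset[OF cw]) (use lr t01 in auto)
    then obtain s2 where s2: "t \<le> s2" "s2 \<le> r" "walls (\<beta> l) * walls (\<gamma> s2) = 0"
      using IVT'[of "\<lambda>s. walls (\<beta> l) * walls (\<gamma> s)" t 0 r] wr wt lr(5) by auto
    have s1': "l < s1" "s1 < t" "s1 \<in> critical_moments \<gamma>"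
    proof -
      show "l < s1" using s1 wl by (cases "s1 = l") auto
      show "s1 < t" using s1 wt by (cases "s1 = t") auto
      show "s1 \<in> critical_moments \<gamma>" using s1 l0 lr(1) t01 by (auto simp: cm\<gamma>)
    qed
    have s2': "t < s2" "s2 < r" "s2 \<in> critical_moments \<gamma>"
    proof -
      show "t < s2" using s2 wt by (cases "s2 = t") auto
      show "s2 < r" using s2 wr by (cases "s2 = r") auto
      show "s2 \<in> critical_moments \<gamma>" using s2 l0 lr(2) t01 by (auto simp: cm\<gamma>)
    qed
    have near: "x = t" if "x \<in> critical_moments \<beta>" "l \<le> x" "x \<le> r" for x
    proof (rule ccontr)
      assume "x \<noteq> t"
      moreover have "x \<in> {0..1}" "walls (\<beta> x) = 0" using that(1) by (simp_all add: cm)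
      moreover have "t - \<rho> < x" "x < t + \<rho>" using that(2,3) lr(3,6) by linarith+
      ultimately show False using reg by blast
    qed
    have "critical_moments \<beta> - {t} \<subseteq> critical_moments \<gamma>"
    proof
      fix x assume x: "x \<in> critical_moments \<beta> - {t}"
      then have "x \<notin> {l<..<r}" using near[of x] by auto
      then show "x \<in> critical_moments \<gamma>" using x off[of x] by (simp add: cm cm\<gamma>)
    qed
    then have sub: "insert s1 (insert s2 (critical_moments \<beta> - {t})) \<subseteq> critical_moments \<gamma>" using s1' s2' by blast
    have "l \<le> s1" "s1 \<le> r" "l \<le> s2" "s2 \<le> r" "s1 \<noteq> s2" using s1'(1,2) s2'(1,2) lr(4,5) by linarith+
    then have "s1 \<notin> critical_moments \<beta> - {t}" "s2 \<notin> critical_moments \<beta> - {t}" "s1 \<noteq> s2"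
      using near by blast+
    then have "card (insert s1 (insert s2 (critical_moments \<beta> - {t}))) = Suc (Suc (card (critical_moments \<beta> - {t})))"
      using fin by simp
    also have "\<dots> = Suc (card (critical_moments \<beta>))" using card_Suc_Diff1[OF fin t] by simp
    finally show False using card_mono[OF cnt(1) sub] cnt(2) by simp
  qed
  have "\<exists>T. critical_triples (\<beta> t) \<subseteq> {T}" if "t \<in> critical_moments \<beta>" for t using one[OF that] by blast
  then show ?thesis
    unfolding good_path_def using smooth_path_continuous[OF sm] im ends fin sc by blast
qed

section \<open>The homomorphism\<close>

lemma g_motion_lprod:
  "g_motion \<gamma> = lprod (map (\<lambda>t. ordered_triple (\<gamma> t)) (sorted_list_of_set (critical_moments \<gamma>)))"
  by (simp add: g_motion_def lprod_def comp_def)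

text \<open>After rescaling, the first set lies below 1/2 and the second above, so that sorting the
  union concatenates the sorted lists.\<close>

lemma sorted_list_of_set_join:
  fixes A B :: "real set"
  assumes fin: "finite A" "finite B" and ab: "A \<subseteq> {0..<1}" "B \<subseteq> {0<..1}"
  shows "sorted_list_of_set ((\<lambda>t. t / 2) ` A \<union> (\<lambda>t. (t + 1) / 2) ` B) =
    map (\<lambda>t. t / 2) (sorted_list_of_set A) @ map (\<lambda>t. (t + 1) / 2) (sorted_list_of_set B)" (is "?L = ?R")
proof (rule sorted_distinct_set_unique)
  have "sorted (map f (sorted_list_of_set X))" if "mono f" for X :: "real set" and f :: "real \<Rightarrow> real"
    by (rule sorted_map_mono) (use that in \<open>auto simp: mono_on_def mono_def\<close>)
  note s = this
  have "sorted (map (\<lambda>t. t / 2) (sorted_list_of_set A))" "sorted (map (\<lambda>t. (t + 1) / 2) (sorted_list_of_set B))"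
    by (rule s, simp add: mono_def)+
  moreover have "x / 2 \<le> (y + 1) / 2" if "x \<in> A" "y \<in> B" for x y
  proof -
    have "x < 1" "0 < y" using that ab by auto
    then show ?thesis by simp
  qed
  ultimately show "sorted ?R" by (simp add: sorted_append fin)
  have "x / 2 \<noteq> (y + 1) / 2" if "x \<in> A" "y \<in> B" for x y
  proof -
    have "x < 1" "0 < y" using that ab by auto
    then show ?thesis by simp
  qed
  then show "distinct ?R" by (auto simp: distinct_map inj_on_def fin)
qed (use fin in auto)

text \<open>The ends of good paths are regular, so no critical moment falls on the junction.\<close>

lemma g_motion_join:
  fixes \<alpha> \<beta> \<delta> :: "real \<Rightarrow> complex ^ 'n"
  assumes g: "good_path \<alpha>" "good_path \<beta>" and \<delta>: "\<And>t. t \<in> {0..1} \<Longrightarrow> \<delta> t = (\<alpha> +++ \<beta>) t"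
  shows "g_motion \<delta> = g_motion \<alpha> \<otimes>\<^bsub>G3\<^esub> g_motion \<beta>"
proof -
  have interior: "A \<subseteq> {0<..<1}" if "good_path \<gamma>" and A: "A = critical_moments \<gamma>" for A and \<gamma> :: "real \<Rightarrow> complex ^ 'n"
  proof
    fix t assume t: "t \<in> A"
    have im: "\<gamma> ` {0..1} \<subseteq> config_space" and "walls (\<gamma> 0) \<noteq> 0" "walls (\<gamma> 1) \<noteq> 0"
      using that(1) by (auto simp: good_path_def)
    moreover have "t \<in> {0..1}" "walls (\<gamma> t) = 0" using t unfolding A critical_moments_walls[OF im] by auto
    ultimately show "t \<in> {0<..<1}" by (cases "t = 0"; cases "t = 1") auto
  qed
  note int = interior[OF g(1) HOL.refl] interior[OF g(2) HOL.refl]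
  have fin: "finite (critical_moments \<alpha>)" "finite (critical_moments \<beta>)" using g by (auto simp: good_path_def)
  have d1: "\<delta> (t / 2) = \<alpha> t" if "t \<in> {0..1}" for t
    using \<delta>[of "t / 2"] that by (simp add: joinpaths_def)
  have d2: "\<delta> ((t + 1) / 2) = \<beta> t" if "t \<in> {0<..1}" for t
  proof -
    have "2 * ((t + 1) / 2) - 1 = t" by (simp add: field_simps)
    then show ?thesis using \<delta>[of "(t + 1) / 2"] that by (simp add: joinpaths_def del: times_divide_eq_right)
  qed
  have cm: "critical_moments \<delta> = (\<lambda>t. t / 2) ` critical_moments \<alpha> \<union> (\<lambda>t. (t + 1) / 2) ` critical_moments \<beta>"
  proof (rule Set.set_eqI)
    fix s
    show "s \<in> critical_moments \<delta> \<longleftrightarrow> s \<in> (\<lambda>t. t / 2) ` critical_moments \<alpha> \<union> (\<lambda>t. (t + 1) / 2) ` critical_moments \<beta>"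
    proof
      assume s: "s \<in> critical_moments \<delta>"
      then have s01: "s \<in> {0..1}" "critical_triples (\<delta> s) \<noteq> {}" by (auto simp: critical_moments_def)
      show "s \<in> (\<lambda>t. t / 2) ` critical_moments \<alpha> \<union> (\<lambda>t. (t + 1) / 2) ` critical_moments \<beta>"
      proof (cases "s \<le> 1 / 2")
        case True
        then have "2 * s \<in> critical_moments \<alpha>" using s01 d1[of "2 * s"] by (auto simp: critical_moments_def)
        then show ?thesis by (intro UnI1 image_eqI[of _ _ "2 * s"]) auto
      next
        case False
        then have "2 * s - 1 \<in> critical_moments \<beta>" using s01 d2[of "2 * s - 1"] by (auto simp: critical_moments_def)
        then show ?thesis by (intro UnI2 image_eqI[of _ _ "2 * s - 1"]) auto
      qed
    next
      assume "s \<in> (\<lambda>t. t / 2) ` critical_moments \<alpha> \<union> (\<lambda>t. (t + 1) / 2) ` critical_moments \<beta>"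
      then consider t where "t \<in> critical_moments \<alpha>" "s = t / 2" | t where "t \<in> critical_moments \<beta>" "s = (t + 1) / 2" by blast
      then show "s \<in> critical_moments \<delta>"
      proof cases
        case 1
        have "t \<in> {0<..<1}" using 1(1) int(1) by blast
        then show ?thesis using 1(1) d1[of t] unfolding 1(2) by (simp add: critical_moments_def)
      next
        case 2
        have "t \<in> {0<..<1}" using 2(1) int(2) by blast
        then show ?thesis using 2(1) d2[of t] unfolding 2(2) by (simp add: critical_moments_def)
      qed
    qed
  qed
  define as where "as = map (\<lambda>t. ordered_triple (\<alpha> t)) (sorted_list_of_set (critical_moments \<alpha>))"
  define bs where "bs = map (\<lambda>t. ordered_triple (\<beta> t)) (sorted_list_of_set (critical_moments \<beta>))"
  have "sorted_list_of_set (critical_moments \<delta>) =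
      map (\<lambda>t. t / 2) (sorted_list_of_set (critical_moments \<alpha>)) @ map (\<lambda>t. (t + 1) / 2) (sorted_list_of_set (critical_moments \<beta>))"
    unfolding cm by (rule sorted_list_of_set_join[OF fin]) (use int in auto)
  then have "map (\<lambda>t. ordered_triple (\<delta> t)) (sorted_list_of_set (critical_moments \<delta>)) =
      map (\<lambda>t. ordered_triple (\<delta> (t / 2))) (sorted_list_of_set (critical_moments \<alpha>)) @
      map (\<lambda>t. ordered_triple (\<delta> ((t + 1) / 2))) (sorted_list_of_set (critical_moments \<beta>))"
    by (simp add: comp_def)
  also have "map (\<lambda>t. ordered_triple (\<delta> (t / 2))) (sorted_list_of_set (critical_moments \<alpha>)) = as"
    unfolding as_def
  proof (rule map_cong[OF HOL.refl])
    fix t assume "t \<in> set (sorted_list_of_set (critical_moments \<alpha>))"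
    then have "t \<in> {0<..<1}" using int(1) fin by auto
    then show "ordered_triple (\<delta> (t / 2)) = ordered_triple (\<alpha> t)" using d1[of t] by simp
  qed
  also have "map (\<lambda>t. ordered_triple (\<delta> ((t + 1) / 2))) (sorted_list_of_set (critical_moments \<beta>)) = bs"
    unfolding bs_def
  proof (rule map_cong[OF HOL.refl])
    fix t assume "t \<in> set (sorted_list_of_set (critical_moments \<beta>))"
    then have "t \<in> {0<..<1}" using int(2) fin by auto
    then show "ordered_triple (\<delta> ((t + 1) / 2)) = ordered_triple (\<beta> t)" using d2[of t] by simp
  qed
  finally have "g_motion \<delta> = lprod (as @ bs)" by (simp add: g_motion_lprod)
  also have "\<dots> = lprod as \<otimes>\<^bsub>G3\<^esub> lprod bs"
    by (rule lprod_append) (use good_triples[OF g(1)] good_triples[OF g(2)] fin in \<open>auto simp: as_def bs_def\<close>)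
  finally show ?thesis by (simp add: g_motion_lprod as_def bs_def)
qed

lemma tame_polygon_join:
  assumes v: "tame_polygon b N v" and w: "tame_polygon b N w"
  shows "tame_polygon b (2 * N) (\<lambda>r. if r \<le> N then v r else w (r - N))"
proof -
  have N: "0 < N" and ends: "v 0 = b" "v N = b" "w 0 = b" "w N = b"
    and tv: "\<forall>r<N. tame (v r) (v (Suc r))" and tw: "\<forall>r<N. tame (w r) (w (Suc r))"
    using v w unfolding tame_polygon_def by blast+
  have "tame (if r \<le> N then v r else w (r - N)) (if Suc r \<le> N then v (Suc r) else w (Suc r - N))" if r: "r < 2 * N" for r
  proof (cases "r < N")
    case True
    then show ?thesis using tv by simp
  next
    case False
    then have "(if r \<le> N then v r else w (r - N)) = w (r - N)" using ends by auto
    moreover have "(if Suc r \<le> N then v (Suc r) else w (Suc r - N)) = w (Suc (r - N))"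
      using False by (simp add: Suc_diff_le)
    moreover have "tame (w (r - N)) (w (Suc (r - N)))" using tw r False by simp
    ultimately show ?thesis by simp
  qed
  then show ?thesis unfolding tame_polygon_def using N ends by simp
qed

theorem theorem3:
  fixes b :: "complex ^ 'n"
  assumes "CARD('n) \<ge> 3"
    and "b \<in> config_space"
    and "critical_triples b = {}"
  shows "(\<forall>A\<in>carrier (PB b). \<exists>\<beta>\<in>A. general_position b \<beta>) \<and>
    (\<forall>\<beta> \<gamma>. general_position b \<beta> \<and> general_position b \<gamma> \<and> isotopic b \<beta> \<gamma> \<longrightarrow> g_motion \<beta> = g_motion \<gamma>) \<and>
    group_hom (PB b) G3 (g_class b)"
proof -
  have b: "walls b \<noteq> 0" using walls_eq_0_iff[OF assms(2)] assms(3) by simp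
  have poly: "motion b (poly_path N v)" "good_path (poly_path N v)" "general_position b (poly_path N v)"
    if "tame_polygon b N v" for N v
    using transverse_good_general[OF tame_polygon_motion[OF that] b] tame_polygon_motion(1)[OF that] by blast+
  have exist: "\<exists>\<beta>\<in>A. general_position b \<beta>" if A: "A \<in> carrier (PB b)" for A
  proof -
    obtain \<beta> where \<beta>: "motion b \<beta>" "A = braid b \<beta>" using A unfolding carrier_PB by blast
    obtain N v where "tame_polygon b N v" "isotopic b \<beta> (poly_path N v)"
      using ex_tame_polygon_pair[OF \<beta>(1) \<beta>(1) b] by blast
    then show ?thesis using poly(3) \<beta>(2) unfolding braid_def by blast
  qed
  have inv: "g_motion \<beta> = g_motion \<gamma>" if "general_position b \<beta>" "general_position b \<gamma>" "isotopic b \<beta> \<gamma>" for \<beta> \<gamma>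
    by (rule g_motion_homotopic[OF general_position_good[OF that(1) b] general_position_good[OF that(2) b]
      isotopic_homotopic_paths[OF that(3)]])
  have g_class: "g_class b (braid b \<beta>) = g_motion \<beta>'" if "isotopic b \<beta> \<beta>'" "general_position b \<beta>'" for \<beta> \<beta>'
    unfolding g_class_def
  proof (rule the_equality)
    show "\<exists>\<gamma>\<in>braid b \<beta>. general_position b \<gamma> \<and> g_motion \<beta>' = g_motion \<gamma>" using that unfolding braid_def by blast
    fix x assume "\<exists>\<gamma>\<in>braid b \<beta>. general_position b \<gamma> \<and> x = g_motion \<gamma>"
    then obtain \<gamma> where \<gamma>: "isotopic b \<beta> \<gamma>" "general_position b \<gamma>" "x = g_motion \<gamma>" unfolding braid_def by blast
    have "isotopic b \<gamma> \<beta>'" by (rule isotopic_trans[OF isotopic_sym[OF \<gamma>(1)] that(1)])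
    from inv[OF \<gamma>(2) that(2) this] \<gamma>(3) show "x = g_motion \<beta>'" by simp
  qed
  have "g_class b \<in> hom (PB b) G3"
  proof (rule homI)
    fix A assume "A \<in> carrier (PB b)"
    then obtain \<beta> where \<beta>: "motion b \<beta>" "A = braid b \<beta>" unfolding carrier_PB by blast
    obtain N v where v: "tame_polygon b N v" "isotopic b \<beta> (poly_path N v)"
      using ex_tame_polygon_pair[OF \<beta>(1) \<beta>(1) b] by blast
    have "g_motion (poly_path N v) \<in> carrier G3"
      using word_upto_closed[OF poly(2)[OF v(1)], of 1] word_upto_1[OF poly(2)[OF v(1)]] by simp
    then show "g_class b A \<in> carrier G3" using g_class[OF v(2) poly(3)[OF v(1)]] \<beta>(2) by simp
    fix B assume "B \<in> carrier (PB b)"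
    then obtain \<gamma> where \<gamma>: "motion b \<gamma>" "B = braid b \<gamma>" unfolding carrier_PB by blast
    \<comment> \<open>Both classes are represented by transverse polygons with the same number of
      edges, so that the concatenation is again such a polygon and represents the product of the
      classes.\<close>
    obtain M p q where p: "tame_polygon b M p" "isotopic b \<beta> (poly_path M p)"
      and q: "tame_polygon b M q" "isotopic b \<gamma> (poly_path M q)"
      using ex_tame_polygon_pair[OF \<beta>(1) \<gamma>(1) b] by blast
    define \<delta> where "\<delta> = poly_path (2 * M) (\<lambda>r. if r \<le> M then p r else q (r - M))"
    note pq = tame_polygon_join[OF p(1) q(1)]
    have M: "0 < M" "p M = q 0" using p(1) q(1) by (simp_all add: tame_polygon_def)
    have join: "(poly_path M p +++ poly_path M q) t = \<delta> t" if "t \<in> {0..1}" for t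
      unfolding \<delta>_def by (rule poly_path_join[where v = p and w = q, OF M that])
    note mp = motion_path[OF poly(1)[OF p(1)]] and mq = motion_path[OF poly(1)[OF q(1)]]
    have "homotopic_paths config_space (poly_path M p +++ poly_path M q) \<delta>"
    proof (rule homotopic_paths_eq[OF _ _ join])
      show "path (poly_path M p +++ poly_path M q)" by (rule path_join_imp) (simp_all add: mp mq)
      show "path_image (poly_path M p +++ poly_path M q) \<subseteq> config_space" by (rule subset_path_image_join[OF mp(2) mq(2)])
    qed
    from braid_mult[OF poly(1)[OF p(1)] poly(1)[OF q(1)] poly(1)[OF pq, folded \<delta>_def] this]
    have "A \<otimes>\<^bsub>PB b\<^esub> B = braid b \<delta>"
      unfolding \<beta>(2) \<gamma>(2) braid_eq[OF p(2)] braid_eq[OF q(2)] .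
    then have "g_class b (A \<otimes>\<^bsub>PB b\<^esub> B) = g_motion \<delta>"
      using g_class[OF isotopic_refl[OF poly(1)[OF pq]] poly(3)[OF pq]] by (simp add: \<delta>_def)
    also have "\<dots> = g_motion (poly_path M p) \<otimes>\<^bsub>G3\<^esub> g_motion (poly_path M q)"
      by (rule g_motion_join[OF poly(2)[OF p(1)] poly(2)[OF q(1)] join[THEN HOL.sym]])
    also have "\<dots> = g_class b A \<otimes>\<^bsub>G3\<^esub> g_class b B"
      unfolding \<beta>(2) \<gamma>(2) g_class[OF p(2) poly(3)[OF p(1)]] g_class[OF q(2) poly(3)[OF q(1)]] ..
    finally show "g_class b (A \<otimes>\<^bsub>PB b\<^esub> B) = g_class b A \<otimes>\<^bsub>G3\<^esub> g_class b B" .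
  qed
  then have "group_hom (PB b) G3 (g_class b)"
    by (intro group_hom.intro group_hom_axioms.intro group_PB[OF assms(2)] G3.is_group)
  then show ?thesis using exist inv by blast
qed

end
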